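(* Let $n\ge 1$ and $N\ge 1$ be integers and let $B^n\subset\mathbb{R}^n$ be the closed unit ball. Let $U_1,\dots,U_N$ be pairwise nonintersecting compact connected domains in $B^n$ with nonempty interiors, let $\mu_j=m_n(U_j)$ be the $n$-dimensional Lebesgue measure of $U_j$, and assume $\mu_1\ge\mu_2\ge\dots\ge\mu_N$. Let $Z_j=\partial U_j$ be the boundary of $U_j$ and $Z=\bigcup_{j=1}^N Z_j$. Define the natural number $\bar d\ge 1$ by $(\bar d-1)^n+1\le N<\bar d^{\,n}+1$, and for each natural number $d$ with $1\le d\le\bar d$ put $j_d=(d-1)^n+1$. Then for each natural number $d$ with $1\le d\le\bar d$, $$\mathcal{RG}_d(Z)\ge\frac{(d+1)!}{2}\left(\frac{\mu_{j_d}}{4n}\right)^d .$$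
   Context: For a $C^{d+1}$ function $f:B^n\to\mathbb{R}$ and $l=0,1,\dots,d+1$, put $M_l(f)=\max_{z\in B^n}\|f^{(l)}(z)\|$, where the norm of the $l$-th derivative $f^{(l)}(z)$ is the sum of the absolute values of all the partial derivatives of $f$ of order $l$ at $z$ (so $M_0(f)=\max_{B^n}|f|$). For $Z\subset B^n$, let $W_d(Z)$ be the set of $C^{d+1}$-smooth functions $f$ on $B^n$ vanishing on $Z$ with $M_0(f)=1$. The $d$-th rigidity constant of $Z$ is $\mathcal{RG}_d(Z)=\inf_{f\in W_d(Z)}M_{d+1}(f)$. *)

theory Defs
  imports "HOL-Analysis.Analysis" "HOL-Library.Multiset"
begin

text \<open>
  Derivatives on the closed ball are taken within the ball. As the ball is convex with
  nonempty interior, the Frechet derivative within it is unique at each of its points, the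
  boundary included (in contrast to one-dimensional difference quotients in a direction
  tangent to the sphere, which are void), and it depends only on the values in the ball.
  Values at points outside \<open>S\<close> are irrelevant throughout.
\<close>

definition partial_deriv ::
    "(real ^ 'n) set \<Rightarrow> 'n \<Rightarrow> (real ^ 'n \<Rightarrow> real) \<Rightarrow> real ^ 'n \<Rightarrow> real" where
  "partial_deriv S i f = (\<lambda>z. frechet_derivative f (at z within S) (axis i 1))"

primrec iter_partial_deriv ::
    "(real ^ 'n) set \<Rightarrow> 'n list \<Rightarrow> (real ^ 'n \<Rightarrow> real) \<Rightarrow> real ^ 'n \<Rightarrow> real" where
  "iter_partial_deriv S [] f = f"
| "iter_partial_deriv S (i # is) f = partial_deriv S i (iter_partial_deriv S is f)"

primrec Ck_on :: "nat \<Rightarrow> (real ^ 'n) set \<Rightarrow> (real ^ 'n \<Rightarrow> real) \<Rightarrow> bool" where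
  "Ck_on 0 S f \<longleftrightarrow> continuous_on S f"
| "Ck_on (Suc k) S f \<longleftrightarrow> f differentiable_on S \<and> (\<forall>i. Ck_on k S (partial_deriv S i f))"

text \<open>
  Multi-indices are multisets of coordinates: \<open>count A i\<close> is the order of differentiation in
  the \<open>i\<close>-th variable and \<open>size A\<close> the total order. The order in which the coordinates are
  listed is immaterial for a function of class \<open>C\<^sup>l\<close> with \<open>l = size A\<close>, since mixed partial
  derivatives commute.
\<close>

definition multi_deriv ::
    "(real ^ 'n) set \<Rightarrow> 'n multiset \<Rightarrow> (real ^ 'n \<Rightarrow> real) \<Rightarrow> real ^ 'n \<Rightarrow> real" where
  "multi_deriv S A f = iter_partial_deriv S (SOME is. mset is = A) f"

lemma finite_multisets_of_size: "finite {A :: 'n::finite multiset. size A = l}"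
proof (rule finite_subset)
  show "{A :: 'n multiset. size A = l} \<subseteq> mset ` {xs. set xs \<subseteq> UNIV \<and> length xs = l}"
  proof
    fix A :: "'n multiset" assume "A \<in> {A. size A = l}"
    moreover obtain xs where "mset xs = A" using ex_mset by blast
    ultimately show "A \<in> mset ` {xs. set xs \<subseteq> UNIV \<and> length xs = l}" by force
  qed
  show "finite (mset ` {xs :: 'n list. set xs \<subseteq> UNIV \<and> length xs = l})"
    by (intro finite_imageI finite_lists_length_eq) simp
qed

text \<open>Each partial derivative of order \<open>l\<close> is counted once.\<close>

definition deriv_norm :: "nat \<Rightarrow> (real ^ 'n \<Rightarrow> real) \<Rightarrow> real ^ 'n \<Rightarrow> real" where
  "deriv_norm l f z = (\<Sum>A | size A = l. \<bar>multi_deriv (cball 0 1) A f z\<bar>)"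

text \<open>The supremum is a maximum when \<open>f\<close> is of class \<open>C\<^sup>l\<close> on the ball.\<close>

definition M :: "nat \<Rightarrow> (real ^ 'n \<Rightarrow> real) \<Rightarrow> real" where
  "M l f = (SUP z\<in>cball 0 1. deriv_norm l f z)"

definition W :: "nat \<Rightarrow> (real ^ 'n) set \<Rightarrow> (real ^ 'n \<Rightarrow> real) set" where
  "W d Z = {f. Ck_on (d + 1) (cball 0 1) f \<and> (\<forall>z\<in>Z. f z = 0) \<and> M 0 f = 1}"

text \<open>
  The infimum is taken in the extended reals, so that it is \<open>\<infinity>\<close> (and not an unspecified
  real) for a set \<open>Z\<close>, such as the whole ball, for which \<open>W d Z\<close> is empty.
\<close>

definition RG :: "nat \<Rightarrow> (real ^ 'n) set \<Rightarrow> ereal" where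
  "RG d Z = (INF f\<in>W d Z. ereal (M (d + 1) f))"

end

theory Submission
  imports Defs
begin

text \<open>
  Let \<open>\<bar>f x0\<bar> = 1\<close>. On a line through \<open>x0\<close>, Lagrange interpolation bounds \<open>\<bar>f x0\<bar>\<close> by the values of \<open>f\<close>
  at \<open>d + 1\<close> nodes and by the derivative of order \<open>d + 1\<close>. If \<open>f\<close> is small on a set \<open>E\<close> of large
  measure, some ray from \<open>x0\<close> meets \<open>E\<close> in a set that contains \<open>d + 1\<close> well separated nodes, and
  \<open>M (d + 1) f\<close> must be large. For \<open>d \<le> 3\<close> the set \<open>E\<close> is the union of the pieces: a line from a point
  of a piece to another piece carries four zeros of \<open>f\<close>, so that \<open>f\<close> is small on the pieces.

  For \<open>d \<ge> 4\<close> let \<open>P\<close> be the Taylor polynomial of degree \<open>d\<close>, \<open>\<delta>\<close> a bound of \<open>\<bar>f - P\<bar>\<close> and \<open>m = d - 1\<close>.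
  In a piece where \<open>\<bar>P\<bar>\<close> exceeds \<open>\<delta>\<close>, a generic perturbation of \<open>P\<close> has a nondegenerate extremum.
  By Bezout there are at most \<open>m ^ n\<close> critical points. Polynomials of low degree form an isotropic
  subspace of the quotient ring with its residue form, which improves the bound for extrema to
  \<open>m ^ n\<close> minus the dimension of this subspace (the argument of Petrovskii and Oleinik). Thus among
  the \<open>m ^ n + 1\<close> pieces there are enough with \<open>\<bar>P\<bar> \<le> \<delta>\<close>, and \<open>E\<close> is the union of those.
\<close>

section \<open>Generic nonsingularity of matrices\<close>

text \<open>Write omega for the volume of the unit ball in dimension \<open>n\<close>. For
  \<open>d \<ge> 4\<close>, if \<open>E\<close> consists of \<open>g\<close> pieces of measure
  \<open>m0\<close>, the node estimate multiplied by the target \<open>(m0 / (4 * n)) ^ d\<close>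
  becomes \<open>sqrt n ^ (d - 1) * (d * omega / (2 * g)) ^ d / d!\<close>: the measure cancels. The
  root is the price for comparing directional derivatives with the sum of the partial ones. A single
  good piece is not enough: with \<open>g = 1\<close> and \<open>n = 2\<close> this is unbounded in
  \<open>d\<close>. Quadratic polynomials as isotropic subspace give \<open>g\<close> about
  \<open>n ^ 2 / 2\<close>, which pays for everything; their degree condition is too restrictive for
  low \<open>d\<close>, hence the separate elementary arguments there. The algebra avoids complex
  zeros, multiplicities and residues. The system \<open>x $ i ^ m + t * q i\<close> is monomial at
  \<open>t = 0\<close>, where all claims on bases and ideals are evident. Each claim is the
  nonsingularity of a matrix that is polynomial in \<open>t\<close> and the identity at 0, so it
  holds for all but finitely many \<open>t\<close>. Large \<open>t\<close> remain available, and for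
  these the system divided by \<open>t\<close> is a small perturbation of \<open>q\<close>.\<close>

lemma nontrivial_relation:
  fixes a :: "'s \<Rightarrow> 't \<Rightarrow> real"
  assumes "finite T" "finite S" "card T < card S"
  shows "\<exists>c. (\<exists>s\<in>S. c s \<noteq> 0) \<and> (\<forall>t\<in>T. (\<Sum>s\<in>S. c s * a s t) = 0)"
  using assms
proof (induction T arbitrary: S a rule: finite_induct)
  case empty
  then have "S \<noteq> {}" by auto
  then show ?case by (intro exI[of _ "\<lambda>_. 1"]) auto
next
  case (insert t T)
  show ?case
  proof (cases "\<forall>s\<in>S. a s t = 0")
    case True
    have "card T < card S" using insert by simp
    then obtain c where "\<exists>s\<in>S. c s \<noteq> 0" "\<forall>t\<in>T. (\<Sum>s\<in>S. c s * a s t) = 0"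
      using insert.IH[OF insert.prems(1)] by blast
    with True show ?thesis by (intro exI[of _ c]) auto
  next
    case False
    then obtain s0 where s0: "s0 \<in> S" "a s0 t \<noteq> 0" by blast
    define S' where "S' = S - {s0}"
    have S': "finite S'" "card T < card S'" "s0 \<notin> S'" "S = insert s0 S'"
      using insert s0 by (auto simp: S'_def)
    \<comment> \<open>Gaussian elimination with pivot \<open>a s0 t\<close>: all \<open>b s\<close>
      vanish in column \<open>t\<close>, so the induction hypothesis has to deal with
      \<open>T\<close> only. The coefficient of the pivot row in \<open>e\<close> is chosen so that
      the combination of the \<open>a s\<close> equals that of the \<open>b s\<close>.\<close>
    define b where "b s u = a s u - a s t / a s0 t * a s0 u" for s u
    obtain c where c: "\<exists>s\<in>S'. c s \<noteq> 0" "\<forall>u\<in>T. (\<Sum>s\<in>S'. c s * b s u) = 0"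
      using insert.IH[OF S'(1,2)] by blast
    define e where "e = c(s0 := - (\<Sum>s\<in>S'. c s * (a s t / a s0 t)))"
    have e0: "e s0 * a s0 u = - (\<Sum>s\<in>S'. c s * (a s t / a s0 t) * a s0 u)" for u
      by (simp add: e_def sum_distrib_right)
    have sum_e: "(\<Sum>s\<in>S. e s * a s u) = (\<Sum>s\<in>S'. c s * b s u)" for u
    proof -
      have "(\<Sum>s\<in>S. e s * a s u) = e s0 * a s0 u + (\<Sum>s\<in>S'. e s * a s u)"
        using S' by simp
      also have "(\<Sum>s\<in>S'. e s * a s u) = (\<Sum>s\<in>S'. c s * a s u)"
        by (rule sum.cong) (use S' in \<open>auto simp: e_def\<close>)
      finally show ?thesis
        by (simp add: e0 b_def right_diff_distrib sum_subtractf mult.assoc)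
    qed
    have "b s t = 0" for s using s0 by (simp add: b_def)
    moreover have "\<exists>s\<in>S. e s \<noteq> 0" using c(1) S' by (auto simp: e_def)
    ultimately show ?thesis
      using c(2) by (intro exI[of _ e]) (auto simp: sum_e)
  qed
qed

text \<open>The vector \<open>e\<close> is adjoined as a further row, indexed by
  \<open>None\<close>. A relation among \<open>card S + 1\<close> rows with \<open>card S\<close>
  columns must involve it, because the old rows are independent.\<close>

lemma nonsingular_spans:
  fixes a :: "'s \<Rightarrow> 's \<Rightarrow> real"
  assumes "finite S"
    and nons: "\<And>c. \<forall>j\<in>S. (\<Sum>i\<in>S. c i * a i j) = 0 \<Longrightarrow> \<forall>i\<in>S. c i = 0"
  shows "\<exists>c. \<forall>j\<in>S. (\<Sum>i\<in>S. c i * a i j) = e j"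
proof -
  define b where "b s j = (case s of None \<Rightarrow> e j | Some i \<Rightarrow> a i j)" for s j
  define S' where "S' = insert None (Some ` S)"
  have S': "finite S'" "card S < card S'"
    using assms(1) by (auto simp: S'_def card_image card_insert_if)
  obtain c where c: "\<exists>s\<in>S'. c s \<noteq> 0" "\<forall>j\<in>S. (\<Sum>s\<in>S'. c s * b s j) = 0"
    using nontrivial_relation[OF assms(1) S', of b] by blast
  have sum_c: "(\<Sum>s\<in>S'. c s * b s j) = c None * e j + (\<Sum>i\<in>S. c (Some i) * a i j)" for j
    using assms(1) by (simp add: S'_def sum.reindex b_def)
  have "c None \<noteq> 0"
  proof
    assume "c None = 0"
    then have "\<forall>i\<in>S. c (Some i) = 0"
      using c(2) sum_c by (intro nons[of "\<lambda>i. c (Some i)"]) simp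
    then have "c s = 0" if "s \<in> S'" for s
      using that \<open>c None = 0\<close> by (cases s) (auto simp: S'_def)
    with c(1) show False by blast
  qed
  have "(\<Sum>i\<in>S. (- c (Some i) / c None) * a i j) = e j" if "j \<in> S" for j
  proof -
    have "(\<Sum>i\<in>S. (- c (Some i) / c None) * a i j) = - (\<Sum>i\<in>S. c (Some i) * a i j) / c None"
      by (simp add: sum_divide_distrib sum_negf)
    also have "\<dots> = e j"
    proof -
      have "- (\<Sum>i\<in>S. c (Some i) * a i j) = c None * e j"
        using bspec[OF c(2) that] unfolding sum_c by linarith
      then show ?thesis using \<open>c None \<noteq> 0\<close> by (metis nonzero_mult_div_cancel_left)
    qed
    finally show ?thesis .
  qed
  then show ?thesis by (intro exI[of _ "\<lambda>i. - c (Some i) / c None"]) simp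
qed

text \<open>The determinant would be a polynomial in \<open>t\<close> with value 1 at 0. Instead of
  determinants over arbitrary index sets, one index is eliminated at a time, and the exceptional
  \<open>t\<close> are roots of the successive pivots.\<close>

lemma generic_nonsingular:
  fixes A :: "'s \<Rightarrow> 's \<Rightarrow> real poly"
  assumes "finite S" "\<And>i j. i \<in> S \<Longrightarrow> j \<in> S \<Longrightarrow> poly (A i j) 0 = (if i = j then 1 else 0)"
  shows "finite {t. \<exists>c. (\<forall>j\<in>S. (\<Sum>i\<in>S. c i * poly (A i j) t) = 0) \<and> (\<exists>i\<in>S. c i \<noteq> 0)}"
  using assms
proof (induction S arbitrary: A rule: finite_induct)
  case empty
  then show ?case by simp
next
  case (insert s S)
  \<comment> \<open>Elimination without division: the entries stay polynomials in \<open>t\<close>,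
    and \<open>B\<close> is again the identity matrix at \<open>t = 0\<close>.\<close>
  define B where "B j k = A s s * A j k - A j s * A s k" for j k
  have "poly (B i j) 0 = (if i = j then 1 else 0)" if "i \<in> S" "j \<in> S" for i j
    using insert.prems[of s s] insert.prems[of i j] insert.prems[of i s] insert.prems[of s j] that insert.hyps
    by (auto simp: B_def split: if_splits)
  then have fin: "finite {t. \<exists>c. (\<forall>j\<in>S. (\<Sum>i\<in>S. c i * poly (B i j) t) = 0) \<and> (\<exists>i\<in>S. c i \<noteq> 0)}"
    by (rule insert.IH)
  have "A s s \<noteq> 0" using insert.prems[of s s] by auto
  then have "finite {t. poly (A s s) t = 0}" by (rule poly_roots_finite)
  moreover have "{t. \<exists>c. (\<forall>j\<in>insert s S. (\<Sum>i\<in>insert s S. c i * poly (A i j) t) = 0) \<and> (\<exists>i\<in>insert s S. c i \<noteq> 0)}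
    \<subseteq> {t. poly (A s s) t = 0} \<union> {t. \<exists>c. (\<forall>j\<in>S. (\<Sum>i\<in>S. c i * poly (B i j) t) = 0) \<and> (\<exists>i\<in>S. c i \<noteq> 0)}"
  proof (rule subsetI, rule UnCI)
    fix t
    assume "t \<in> {t. \<exists>c. (\<forall>j\<in>insert s S. (\<Sum>i\<in>insert s S. c i * poly (A i j) t) = 0) \<and> (\<exists>i\<in>insert s S. c i \<noteq> 0)}"
    then obtain c i0 where c: "\<forall>j\<in>insert s S. (\<Sum>i\<in>insert s S. c i * poly (A i j) t) = 0"
      and i0: "i0 \<in> insert s S" "c i0 \<noteq> 0" by blast
    assume "t \<notin> {t. \<exists>c. (\<forall>j\<in>S. (\<Sum>i\<in>S. c i * poly (B i j) t) = 0) \<and> (\<exists>i\<in>S. c i \<noteq> 0)}"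
    then have nB: "(\<forall>j\<in>S. (\<Sum>i\<in>S. c i * poly (B i j) t) = 0) \<longrightarrow> (\<forall>i\<in>S. c i = 0)"
      unfolding mem_Collect_eq not_ex by (elim allE[of _ c]) auto
    show "t \<in> {t. poly (A s s) t = 0}"
    proof (rule ccontr)
    assume "t \<notin> {t. poly (A s s) t = 0}"
    then have nz: "poly (A s s) t \<noteq> 0" by simp
    have eq: "c s * poly (A s j) t + (\<Sum>i\<in>S. c i * poly (A i j) t) = 0" if "j \<in> insert s S" for j
      using bspec[OF c that] insert.hyps by simp
    have "(\<Sum>i\<in>S. c i * poly (B i j) t) = 0" if "j \<in> S" for j
    proof -
      have "(\<Sum>i\<in>S. c i * poly (B i j) t)
        = poly (A s s) t * (\<Sum>i\<in>S. c i * poly (A i j) t) - poly (A s j) t * (\<Sum>i\<in>S. c i * poly (A i s) t)"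
        by (simp add: B_def algebra_simps sum_distrib_left sum_subtractf)
      also have "\<dots> = 0"
      proof -
        have "(\<Sum>i\<in>S. c i * poly (A i j) t) = - c s * poly (A s j) t"
          "(\<Sum>i\<in>S. c i * poly (A i s) t) = - c s * poly (A s s) t"
          using eq[of j] eq[of s] that by simp_all
        then show ?thesis by simp
      qed
      finally show ?thesis .
    qed
    then have cS: "\<forall>i\<in>S. c i = 0" using nB by simp
    with eq[of s] nz have "c s = 0" by simp
    with i0 cS show False by auto
    qed
  qed
  ultimately show ?case using fin by (meson finite_UnI finite_subset)
qed

section \<open>Polynomial functions of bounded degree\<close>

definition mon :: "'n::finite multiset \<Rightarrow> real ^ 'n \<Rightarrow> real" where
  "mon A x = (\<Prod>i\<in>#A. x $ i)"

lemma mon_empty [simp]: "mon {#} x = 1"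
  and mon_add_mset [simp]: "mon (add_mset i A) x = x $ i * mon A x"
  and mon_union: "mon (A + B) x = mon A x * mon B x"
  by (simp_all add: mon_def)

lemma mon_replicate: "mon (replicate_mset k i) x = x $ i ^ k"
  by (induction k) auto

lemma finite_multisets_upto: "finite {A :: 'n::finite multiset. size A \<le> D}"
proof -
  have "{A :: 'n multiset. size A \<le> D} = (\<Union>l\<le>D. {A. size A = l})" by auto
  then show ?thesis by (simp add: finite_multisets_of_size)
qed

text \<open>The coefficients are polynomials in a parameter \<open>t\<close> of unrestricted degree,
  since matrices of such coefficients are the subject of \<open>generic_nonsingular\<close>. The
  closure properties of \<open>Pol\<close> are read off from those of \<open>TPol\<close>.\<close>

definition TPol :: "nat \<Rightarrow> (real \<Rightarrow> real ^ 'n::finite \<Rightarrow> real) set" where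
  "TPol D = {F. \<exists>c :: 'n multiset \<Rightarrow> real poly. \<forall>t x. F t x = (\<Sum>A | size A \<le> D. poly (c A) t * mon A x)}"

definition Pol :: "nat \<Rightarrow> (real ^ 'n::finite \<Rightarrow> real) set" where
  "Pol D = {f. \<exists>c. \<forall>x. f x = (\<Sum>A | size A \<le> D. c A * mon A x)}"

lemma Pol_TPol: "f \<in> Pol D \<longleftrightarrow> (\<lambda>t. f) \<in> TPol D"
proof
  assume "f \<in> Pol D"
  then obtain c where "\<forall>x. f x = (\<Sum>A | size A \<le> D. c A * mon A x)" by (auto simp: Pol_def)
  then show "(\<lambda>t. f) \<in> TPol D" unfolding TPol_def by (auto intro!: exI[of _ "\<lambda>A. [:c A:]"])
next
  assume "(\<lambda>t. f) \<in> TPol D"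
  then obtain c where "\<forall>t x. f x = (\<Sum>A | size A \<le> D. poly (c A) t * mon A x)" by (auto simp: TPol_def)
  then show "f \<in> Pol D" unfolding Pol_def by (auto intro!: exI[of _ "\<lambda>A. poly (c A) 0"])
qed

lemma TPol_mon: "size A \<le> D \<Longrightarrow> (\<lambda>t x. poly p t * mon A x) \<in> TPol D"
  unfolding TPol_def
  by (auto intro!: exI[of _ "\<lambda>B. if B = A then p else 0"] simp: if_distrib if_distribR sum.If_cases finite_multisets_upto
      cong: if_cong)

lemma TPol_add: "F \<in> TPol D \<Longrightarrow> G \<in> TPol D \<Longrightarrow> (\<lambda>t x. F t x + G t x) \<in> TPol D"
proof -
  assume "F \<in> TPol D" "G \<in> TPol D"
  then obtain c d where "\<forall>t x. F t x = (\<Sum>A | size A \<le> D. poly (c A) t * mon A x)"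
    "\<forall>t x. G t x = (\<Sum>A | size A \<le> D. poly (d A) t * mon A x)" by (auto simp: TPol_def)
  then show ?thesis unfolding TPol_def
    by (auto intro!: exI[of _ "\<lambda>A. c A + d A"] simp: algebra_simps sum.distrib)
qed

lemma TPol_0: "(\<lambda>t x. 0) \<in> TPol D"
  unfolding TPol_def by (auto intro!: exI[of _ "\<lambda>A. 0"])

lemma TPol_sum: "(\<And>i. i \<in> I \<Longrightarrow> F i \<in> TPol D) \<Longrightarrow> (\<lambda>t x. \<Sum>i\<in>I. F i t x) \<in> TPol D"
  by (induction I rule: infinite_finite_induct) (auto intro: TPol_add TPol_0)

lemma TPol_mult:
  assumes "F \<in> TPol D" "G \<in> TPol E"
  shows "(\<lambda>t x. F t x * G t x) \<in> TPol (D + E)"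
proof -
  obtain c d where c: "F = (\<lambda>t x. \<Sum>A | size A \<le> D. poly (c A) t * mon A x)"
    and d: "G = (\<lambda>t x. \<Sum>A | size A \<le> E. poly (d A) t * mon A x)"
    using assms by (fastforce simp: TPol_def)
  have "(\<lambda>t x. F t x * G t x) = (\<lambda>t x. \<Sum>A | size A \<le> D. \<Sum>B | size B \<le> E. poly (c A * d B) t * mon (A + B) x)"
    by (auto simp: c d sum_product mon_union algebra_simps fun_eq_iff intro!: sum.cong)
  moreover have "\<dots> \<in> TPol (D + E)"
    by (intro TPol_sum TPol_mon) auto
  ultimately show ?thesis by simp
qed

lemma TPol_mono: "F \<in> TPol D \<Longrightarrow> D \<le> E \<Longrightarrow> F \<in> TPol E"
proof -
  assume "F \<in> TPol D" "D \<le> E"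
  then obtain c where c: "F = (\<lambda>t x. \<Sum>A | size A \<le> D. poly (c A) t * mon A x)"
    by (fastforce simp: TPol_def)
  show ?thesis unfolding c by (intro TPol_sum TPol_mon) (use \<open>D \<le> E\<close> in auto)
qed

lemma Pol_mon: "size A \<le> D \<Longrightarrow> mon A \<in> Pol D"
  using TPol_mon[of A D 1] by (simp add: Pol_TPol)

lemma Pol_add: "f \<in> Pol D \<Longrightarrow> g \<in> Pol D \<Longrightarrow> (\<lambda>x. f x + g x) \<in> Pol D"
  by (simp add: Pol_TPol TPol_add)

lemma Pol_0: "(\<lambda>x. 0) \<in> Pol D"
  by (simp add: Pol_TPol TPol_0)

lemma Pol_sum: "(\<And>i. i \<in> I \<Longrightarrow> f i \<in> Pol D) \<Longrightarrow> (\<lambda>x. \<Sum>i\<in>I. f i x) \<in> Pol D"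
  by (simp add: Pol_TPol TPol_sum)

lemma Pol_mult: "f \<in> Pol D \<Longrightarrow> g \<in> Pol E \<Longrightarrow> (\<lambda>x. f x * g x) \<in> Pol (D + E)"
  using TPol_mult[of "\<lambda>t. f" D "\<lambda>t. g" E] by (simp add: Pol_TPol)

lemma Pol_mono: "f \<in> Pol D \<Longrightarrow> D \<le> E \<Longrightarrow> f \<in> Pol E"
  by (simp add: Pol_TPol TPol_mono)

lemma Pol_const: "(\<lambda>x. c) \<in> Pol D"
  using TPol_mon[of "{#}" D "[:c:]"] by (simp add: Pol_TPol)

lemma Pol_cmult: "f \<in> Pol D \<Longrightarrow> (\<lambda>x. c * f x) \<in> Pol D"
  using Pol_mult[OF Pol_const[of c 0], of f D] by simp

lemma Pol_uminus: "f \<in> Pol D \<Longrightarrow> (\<lambda>x. - f x) \<in> Pol D"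
  using Pol_cmult[of f D "-1"] by simp

lemma Pol_diff: "f \<in> Pol D \<Longrightarrow> g \<in> Pol D \<Longrightarrow> (\<lambda>x. f x - g x) \<in> Pol D"
  using Pol_add[OF _ Pol_uminus, of f D g] by simp

lemma Pol_coord: "1 \<le> D \<Longrightarrow> (\<lambda>x. x $ i) \<in> Pol D"
proof -
  assume "1 \<le> D"
  then have "mon {#i#} \<in> Pol D" by (intro Pol_mon) simp
  moreover have "mon {#i#} = (\<lambda>x. x $ i)" by (simp add: fun_eq_iff)
  ultimately show ?thesis by simp
qed

lemma Pol_prod: "finite I \<Longrightarrow> (\<And>i. i \<in> I \<Longrightarrow> f i \<in> Pol D) \<Longrightarrow> (\<lambda>x. \<Prod>i\<in>I. f i x) \<in> Pol (card I * D)"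
  by (induction I rule: finite_induct) (auto intro: Pol_const Pol_mult)

lemma TPol_prod: "finite I \<Longrightarrow> (\<And>i. i \<in> I \<Longrightarrow> F i \<in> TPol D) \<Longrightarrow> (\<lambda>t x. \<Prod>i\<in>I. F i t x) \<in> TPol (card I * D)"
proof (induction I rule: finite_induct)
  case empty
  show ?case using TPol_mon[of "{#}" 0 1] by simp
qed (auto intro: TPol_mult)

lemma Pol_induct [consumes 1, case_names mon add cmult]:
  assumes "f \<in> Pol D"
    and "\<And>A. size A \<le> D \<Longrightarrow> P (mon A)"
    and "\<And>f g. P f \<Longrightarrow> P g \<Longrightarrow> P (\<lambda>x. f x + g x)"
    and "\<And>c f. P f \<Longrightarrow> P (\<lambda>x. c * f x)"
  shows "P f"
proof -
  obtain c where c: "f = (\<lambda>x. \<Sum>A | size A \<le> D. c A * mon A x)"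
    using assms(1) by (auto simp: Pol_def)
  have P0: "P (\<lambda>x. 0)" using assms(4)[OF assms(2)[of "{#}"], of 0] by simp
  have "(\<forall>A\<in>I. size A \<le> D) \<Longrightarrow> P (\<lambda>x. \<Sum>A\<in>I. c A * mon A x)" if "finite I" for I
    using that
  proof (induction I rule: finite_induct)
    case (insert A I)
    then show ?case using assms(3)[OF assms(4)[OF assms(2)[of A], of "c A"]] by simp
  qed (simp add: P0)
  from this[OF finite_multisets_upto] show ?thesis unfolding c by auto
qed

text \<open>Induction on the set of variables. For fixed values of the others, the sum is a
  polynomial in \<open>x $ i\<close>, whose coefficients vanish; deleting \<open>i\<close> is
  injective on the multisets with a given count of \<open>i\<close>, so each coefficient is again a
  sum of distinct monomials.\<close>

lemma mon_independent:
  fixes c :: "'n::finite multiset \<Rightarrow> real"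
  assumes "finite S" "\<And>x. (\<Sum>A\<in>S. c A * mon A x) = 0" "A \<in> S"
  shows "c A = 0"
proof -
  have "c A = 0" if "finite F" "finite S" "\<forall>A\<in>S. set_mset A \<subseteq> F" "\<forall>x. (\<Sum>A\<in>S. c A * mon A x) = 0" "A \<in> S"
    for F :: "'n set" and S A and c :: "'n multiset \<Rightarrow> real"
    using that
  proof (induction F arbitrary: S A c rule: finite_induct)
    case empty
    then have "S = {{#}}" by auto
    with empty show ?case by auto
  next
    case (insert i F)
    define N where "N = Max ((\<lambda>A. count A i) ` S)"
    have N: "count A i \<le> N" if "A \<in> S" for A
      unfolding N_def using insert.prems(1) that by (intro Max_ge) auto
    define rest where "rest A = filter_mset (\<lambda>j. j \<noteq> i) A" for A :: "'n multiset"
    have mon_split: "mon A x = x $ i ^ count A i * mon (rest A) x" for A x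
    proof -
      have "A = replicate_mset (count A i) i + rest A"
        by (auto simp: rest_def multiset_eq_iff)
      then show ?thesis by (metis mon_union mon_replicate)
    qed
    have mon_rest: "mon (rest A) (\<chi> j. if j = i then y else x $ j) = mon (rest A) x" for A x y
      unfolding rest_def by (induction A) auto
    define k where "k = count A i"
    define Sk where "Sk = {B\<in>S. count B i = k}"
    have inj: "inj_on rest Sk"
    proof (rule inj_onI)
      fix B C assume "B \<in> Sk" "C \<in> Sk" "rest B = rest C"
      then show "B = C"
        by (auto simp: Sk_def rest_def multiset_eq_iff) metis
    qed
    have "(\<Sum>B\<in>Sk. c B * mon (rest B) x) = 0" for x
    proof -
      have "(\<Sum>l\<le>N. (\<Sum>B\<in>{B\<in>S. count B i = l}. c B * mon (rest B) x) * y ^ l) = 0" for y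
      proof -
        have "(\<Sum>l\<le>N. (\<Sum>B\<in>{B\<in>S. count B i = l}. c B * mon (rest B) x) * y ^ l)
          = (\<Sum>l\<le>N. \<Sum>B\<in>{B\<in>S. count B i = l}. c B * mon B (\<chi> j. if j = i then y else x $ j))"
          unfolding sum_distrib_right
          by (intro sum.cong refl, subst (2) mon_split) (auto simp: mon_rest)
        also have "\<dots> = (\<Sum>B\<in>S. c B * mon B (\<chi> j. if j = i then y else x $ j))"
          by (rule sum.group) (use insert.prems(1) N in auto)
        also have "\<dots> = 0" using insert.prems by simp
        finally show ?thesis .
      qed
      then have "\<forall>l\<le>N. (\<Sum>B\<in>{B\<in>S. count B i = l}. c B * mon (rest B) x) = 0"
        using polyfun_eq_0[of "\<lambda>l. \<Sum>B\<in>{B\<in>S. count B i = l}. c B * mon (rest B) x" N] by blast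
      then show ?thesis using N[OF insert.prems(4)] by (auto simp: Sk_def k_def)
    qed
    moreover have "(\<Sum>B\<in>Sk. c B * mon (rest B) x) = (\<Sum>C\<in>rest ` Sk. c (the_inv_into Sk rest C) * mon C x)" for x
      by (subst sum.reindex[OF inj]) (auto simp: the_inv_into_f_f[OF inj])
    ultimately have "c (the_inv_into Sk rest (rest A)) = 0"
      using insert.prems
      by (intro insert.IH[of "rest ` Sk" "\<lambda>C. c (the_inv_into Sk rest C)"]) (auto simp: Sk_def rest_def k_def)
    then show ?case
      using insert.prems(4) by (subst (asm) the_inv_into_f_f[OF inj]) (auto simp: Sk_def k_def)
  qed
  from this[of UNIV S] assms show ?thesis by auto
qed

section \<open>Generic complete intersections\<close>

text \<open>A deformation of the monomial basis remains a basis generically: its coefficient matrix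
  with respect to the monomials is polynomial in \<open>t\<close> and, by independence of the
  monomials, the identity at \<open>t = 0\<close>.\<close>

lemma generic_basis:
  fixes F :: "'n::finite multiset \<Rightarrow> real \<Rightarrow> real ^ 'n \<Rightarrow> real"
  assumes F: "\<And>A. size A \<le> D \<Longrightarrow> F A \<in> TPol D" and F0: "\<And>A. size A \<le> D \<Longrightarrow> F A 0 = mon A"
  shows "finite {t. \<not> ((\<forall>c. (\<forall>x. (\<Sum>A | size A \<le> D. c A * F A t x) = 0) \<longrightarrow> (\<forall>A. size A \<le> D \<longrightarrow> c A = 0)) \<and>
    (\<forall>f\<in>Pol D. \<exists>c. \<forall>x. f x = (\<Sum>A | size A \<le> D. c A * F A t x)))}"
proof -
  define S where "S = {A :: 'n multiset. size A \<le> D}"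
  have fin: "finite S" unfolding S_def by (rule finite_multisets_upto)
  have "\<forall>A\<in>S. \<exists>c. \<forall>t x. F A t x = (\<Sum>B\<in>S. poly (c B) t * mon B x)"
    using F by (force simp: S_def TPol_def)
  then obtain a where a: "\<And>A t x. A \<in> S \<Longrightarrow> F A t x = (\<Sum>B\<in>S. poly (a A B) t * mon B x)"
    by metis
  have a0: "poly (a A B) 0 = (if A = B then 1 else 0)" if "A \<in> S" "B \<in> S" for A B
  proof -
    have "(\<Sum>B\<in>S. (poly (a A B) 0 - (if A = B then 1 else 0)) * mon B x) = 0" for x
    proof -
      have "(\<Sum>B\<in>S. (if A = B then 1 else 0) * mon B x) = (\<Sum>B\<in>S. if A = B then mon B x else 0)"
        by (intro sum.cong) auto
      also have "\<dots> = mon A x" using fin that(1) by simp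
      finally show ?thesis
        using a[OF that(1), of 0 x] F0[of A] that by (simp add: S_def left_diff_distrib sum_subtractf)
    qed
    from mon_independent[OF fin this that(2)] show ?thesis by simp
  qed
  have comb: "(\<Sum>A\<in>S. c A * F A t x) = (\<Sum>B\<in>S. (\<Sum>A\<in>S. c A * poly (a A B) t) * mon B x)" for c t x
  proof -
    have "(\<Sum>A\<in>S. c A * F A t x) = (\<Sum>A\<in>S. \<Sum>B\<in>S. c A * poly (a A B) t * mon B x)"
      by (intro sum.cong refl) (simp add: a sum_distrib_left mult.assoc)
    also have "\<dots> = (\<Sum>B\<in>S. \<Sum>A\<in>S. c A * poly (a A B) t * mon B x)" by (rule sum.swap)
    finally show ?thesis by (simp add: sum_distrib_right)
  qed
  have "finite {t. \<exists>c. (\<forall>j\<in>S. (\<Sum>i\<in>S. c i * poly (a i j) t) = 0) \<and> (\<exists>i\<in>S. c i \<noteq> 0)}"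
    by (rule generic_nonsingular[OF fin a0])
  then show ?thesis
  proof (rule rev_finite_subset, intro subsetI, goal_cases)
    case (1 t)
    show ?case
    proof (rule ccontr)
      assume nt: "t \<notin> {t. \<exists>c. (\<forall>j\<in>S. (\<Sum>i\<in>S. c i * poly (a i j) t) = 0) \<and> (\<exists>i\<in>S. c i \<noteq> 0)}"
      have nons: "\<forall>i\<in>S. c i = 0" if "\<forall>j\<in>S. (\<Sum>i\<in>S. c i * poly (a i j) t) = 0" for c
        using nt that unfolding mem_Collect_eq not_ex by (elim allE[of _ c]) auto
      have "\<forall>A. size A \<le> D \<longrightarrow> c A = 0" if c: "\<forall>x. (\<Sum>A | size A \<le> D. c A * F A t x) = 0" for c
      proof -
        have "(\<Sum>B\<in>S. (\<Sum>A\<in>S. c A * poly (a A B) t) * mon B x) = 0" for x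
          using c unfolding S_def[symmetric] comb by blast
        then have "\<forall>B\<in>S. (\<Sum>A\<in>S. c A * poly (a A B) t) = 0"
          using mon_independent[OF fin, of "\<lambda>B. \<Sum>A\<in>S. c A * poly (a A B) t"] by blast
        from nons[OF this] show ?thesis by (auto simp: S_def)
      qed
      moreover have "\<exists>c. \<forall>x. f x = (\<Sum>A | size A \<le> D. c A * F A t x)" if f: "f \<in> Pol D" for f
      proof -
        obtain e where e: "\<And>x. f x = (\<Sum>B\<in>S. e B * mon B x)" using f by (auto simp: Pol_def S_def)
        obtain c where "\<forall>j\<in>S. (\<Sum>i\<in>S. c i * poly (a i j) t) = e j"
          using nonsingular_spans[OF fin, of "\<lambda>i j. poly (a i j) t" e] nons by auto
        then have "\<forall>x. f x = (\<Sum>A\<in>S. c A * F A t x)" unfolding comb e by auto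
        then show ?thesis unfolding S_def by (intro exI[of _ c])
      qed
      ultimately show False using 1 unfolding mem_Collect_eq by blast
    qed
  qed
qed

text \<open>At \<open>t = 0\<close> the system reads \<open>x $ i ^ m = 0\<close>, and its quotient
  ring has the box monomials as basis. For \<open>t > 0\<close>, division by \<open>t\<close>
  exhibits it as \<open>q\<close> with the perturbation \<open>x $ i ^ m / t\<close>.\<close>

definition gsys :: "nat \<Rightarrow> ('n \<Rightarrow> real ^ 'n \<Rightarrow> real) \<Rightarrow> real \<Rightarrow> 'n::finite \<Rightarrow> real ^ 'n \<Rightarrow> real" where
  "gsys m q t i x = x $ i ^ m + t * q i x"

definition in_box :: "nat \<Rightarrow> 'n::finite multiset \<Rightarrow> bool" where
  "in_box m A \<longleftrightarrow> (\<forall>i. count A i < m)"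

text \<open>The fixed choice assigns to each monomial outside the box one multiple of a generator,
  namely one which equals this monomial at \<open>t = 0\<close>.\<close>

definition pick :: "nat \<Rightarrow> 'n::finite multiset \<Rightarrow> 'n" where
  "pick m A = (SOME i. m \<le> count A i)"

lemma pick: "\<not> in_box m A \<Longrightarrow> m \<le> count A (pick m A)"
  unfolding pick_def in_box_def by (rule someI_ex) (auto simp: not_less)

definition lowered :: "nat \<Rightarrow> 'n::finite multiset \<Rightarrow> 'n multiset" where
  "lowered m A = A - replicate_mset m (pick m A)"

lemma lowered: "\<not> in_box m A \<Longrightarrow> lowered m A + replicate_mset m (pick m A) = A"
  unfolding lowered_def using pick by (metis count_le_replicate_mset_subset_eq subset_mset.diff_add)

text \<open>The members of the ideal of the system that are visibly of degree at most \<open>D\<close>.\<close>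

definition ideal_upto :: "nat \<Rightarrow> ('n \<Rightarrow> real ^ 'n \<Rightarrow> real) \<Rightarrow> real \<Rightarrow> nat \<Rightarrow> (real ^ 'n::finite \<Rightarrow> real) set" where
  "ideal_upto m q t D = {f. \<exists>c. \<forall>x. f x = (\<Sum>i\<in>UNIV. \<Sum>B | size B + m \<le> D. c i B * (mon B x * gsys m q t i x))}"

lemma finite_shifted: "finite {B :: 'n::finite multiset. size B + m \<le> D}"
  by (rule finite_subset[OF _ finite_multisets_upto[of D]]) auto

lemma ideal_upto_add: "f \<in> ideal_upto m q t D \<Longrightarrow> g \<in> ideal_upto m q t D \<Longrightarrow> (\<lambda>x. f x + g x) \<in> ideal_upto m q t D"
proof -
  assume "f \<in> ideal_upto m q t D" "g \<in> ideal_upto m q t D"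
  then obtain c d where "\<forall>x. f x = (\<Sum>i\<in>UNIV. \<Sum>B | size B + m \<le> D. c i B * (mon B x * gsys m q t i x))"
    "\<forall>x. g x = (\<Sum>i\<in>UNIV. \<Sum>B | size B + m \<le> D. d i B * (mon B x * gsys m q t i x))"
    by (auto simp: ideal_upto_def)
  then show ?thesis unfolding ideal_upto_def
    by (auto intro!: exI[of _ "\<lambda>i B. c i B + d i B"] simp: distrib_right sum.distrib)
qed

lemma ideal_upto_0: "(\<lambda>x. 0) \<in> ideal_upto m q t D"
  unfolding ideal_upto_def by (auto intro!: exI[of _ "\<lambda>i B. 0"])

lemma ideal_upto_sum: "(\<And>i. i \<in> I \<Longrightarrow> f i \<in> ideal_upto m q t D) \<Longrightarrow> (\<lambda>x. \<Sum>i\<in>I. f i x) \<in> ideal_upto m q t D"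
  by (induction I rule: infinite_finite_induct) (auto intro: ideal_upto_add ideal_upto_0)

lemma ideal_upto_cmult: "f \<in> ideal_upto m q t D \<Longrightarrow> (\<lambda>x. a * f x) \<in> ideal_upto m q t D"
proof -
  assume "f \<in> ideal_upto m q t D"
  then obtain c where "\<forall>x. f x = (\<Sum>i\<in>UNIV. \<Sum>B | size B + m \<le> D. c i B * (mon B x * gsys m q t i x))"
    by (auto simp: ideal_upto_def)
  then show ?thesis unfolding ideal_upto_def
    by (auto intro!: exI[of _ "\<lambda>i B. a * c i B"] simp: sum_distrib_left mult.assoc)
qed

lemma ideal_upto_gen: "size B + m \<le> D \<Longrightarrow> (\<lambda>x. mon B x * gsys m q t i x) \<in> ideal_upto m q t D"
proof -
  assume B: "size B + m \<le> D"
  have "(\<Sum>j\<in>UNIV. \<Sum>C | size C + m \<le> D. (if j = i \<and> C = B then 1 else 0) * (mon C x * gsys m q t j x))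
    = mon B x * gsys m q t i x" for x
  proof -
    have "(\<Sum>j\<in>UNIV. \<Sum>C | size C + m \<le> D. (if j = i \<and> C = B then 1 else 0) * (mon C x * gsys m q t j x))
      = (\<Sum>j\<in>UNIV. if j = i then mon B x * gsys m q t i x else 0)"
    proof (rule sum.cong, rule refl)
      fix j
      have "(\<Sum>C | size C + m \<le> D. (if j = i \<and> C = B then 1 else 0) * (mon C x * gsys m q t j x))
        = (\<Sum>C | size C + m \<le> D. if C = B then (if j = i then mon B x * gsys m q t i x else 0) else 0)"
        by (intro sum.cong) auto
      also have "\<dots> = (if j = i then mon B x * gsys m q t i x else 0)"
        using B by (subst sum.delta) (auto simp: finite_shifted)
      finally show "(\<Sum>C | size C + m \<le> D. (if j = i \<and> C = B then 1 else 0) * (mon C x * gsys m q t j x))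
        = (if j = i then mon B x * gsys m q t i x else 0)" .
    qed
    then show ?thesis by simp
  qed
  then show ?thesis unfolding ideal_upto_def mem_Collect_eq
    by (intro exI[of _ "\<lambda>j C. if j = i \<and> C = B then 1 else 0"]) simp
qed

lemma ideal_upto_induct [consumes 1, case_names gen add cmult zero]:
  assumes "f \<in> ideal_upto m q t D"
    and "\<And>B i. size B + m \<le> D \<Longrightarrow> P (\<lambda>x. mon B x * gsys m q t i x)"
    and "\<And>f g. P f \<Longrightarrow> P g \<Longrightarrow> P (\<lambda>x. f x + g x)"
    and "\<And>c f. P f \<Longrightarrow> P (\<lambda>x. c * f x)"
    and P0: "P (\<lambda>x. 0)"
  shows "P f"
proof -
  obtain c where f: "f = (\<lambda>x. \<Sum>i\<in>UNIV. \<Sum>B | size B + m \<le> D. c i B * (mon B x * gsys m q t i x))"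
    using assms(1) by (auto simp: ideal_upto_def)
  have sum: "P (\<lambda>x. \<Sum>i\<in>I. F i x)" if "finite I" "\<And>i. i \<in> I \<Longrightarrow> P (F i)" for I and F :: "'z \<Rightarrow> real ^ 'a \<Rightarrow> real"
    using that by (induction I rule: finite_induct) (auto intro: assms(3) P0)
  show ?thesis unfolding f by (intro sum finite_shifted assms(4) assms(2)) auto
qed

lemma ideal_upto_mult:
  assumes "p \<in> Pol e" "f \<in> ideal_upto m q t D"
  shows "(\<lambda>x. p x * f x) \<in> ideal_upto m q t (D + e)"
  using assms(1)
proof (induction p rule: Pol_induct)
  case (mon A)
  show ?case using assms(2)
  proof (induction f rule: ideal_upto_induct)
    case (gen B i)
    then have "(\<lambda>x. mon (A + B) x * gsys m q t i x) \<in> ideal_upto m q t (D + e)"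
      using mon by (intro ideal_upto_gen) simp
    then show ?case by (simp add: mon_union mult.assoc)
  next
    case (add f g)
    then show ?case using ideal_upto_add by (fastforce simp: distrib_left)
  next
    case (cmult c f)
    then show ?case using ideal_upto_cmult[of _ m q t _ c] by (simp add: mult.left_commute)
  qed (simp add: ideal_upto_0)
next
  case (add f g)
  then show ?case using ideal_upto_add by (fastforce simp: distrib_right)
next
  case (cmult c f)
  then show ?case using ideal_upto_cmult[of _ m q t _ c] by (simp add: mult.assoc)
qed

lemma ideal_upto_Pol_gen:
  assumes "p \<in> Pol e" "e + m \<le> D"
  shows "(\<lambda>x. p x * gsys m q t i x) \<in> ideal_upto m q t D"
  using assms(1)
proof (induction p rule: Pol_induct)
  case (mon A)
  then show ?case using assms(2) by (intro ideal_upto_gen) simp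
next
  case (add f g)
  then show ?case using ideal_upto_add by (fastforce simp: distrib_right)
next
  case (cmult c f)
  then show ?case using ideal_upto_cmult[of _ m q t _ c] by (simp add: mult.assoc)
qed

lemma ideal_upto_mono:
  assumes "f \<in> ideal_upto m q t D" "D \<le> E"
  shows "f \<in> ideal_upto m q t E"
  using ideal_upto_mult[OF Pol_const[of 1 "E - D"] assms(1)] assms(2) by simp

lemma ideal_upto_zero:
  assumes "f \<in> ideal_upto m q t D" "\<And>i. gsys m q t i z = 0"
  shows "f z = 0"
  using assms(1) by (induction f rule: ideal_upto_induct) (simp_all add: assms(2))

lemma gsys_TPol: "q i \<in> Pol m \<Longrightarrow> (\<lambda>t. gsys m q t i) \<in> TPol m"
proof -
  assume q: "q i \<in> Pol m"
  have "(\<lambda>t x. poly 1 t * mon (replicate_mset m i) x) \<in> TPol m" by (rule TPol_mon) simp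
  moreover have "(\<lambda>t x. (poly [:0,1:] t * mon {#} x) * q i x) \<in> TPol (0 + m)"
    using q by (intro TPol_mult TPol_mon) (simp_all add: Pol_TPol)
  ultimately have "(\<lambda>t x. poly 1 t * mon (replicate_mset m i) x + (poly [:0,1:] t * mon {#} x) * q i x) \<in> TPol m"
    by (intro TPol_add) simp_all
  then show ?thesis by (simp add: gsys_def[abs_def] mon_replicate)
qed

text \<open>Modulo \<open>gsys m q t k * gsys m q t i\<close>, the two ways of eliminating a monomial divisible by
  \<open>x $ i ^ m\<close> and by \<open>x $ k ^ m\<close> differ by \<open>t\<close> times elements of the same kind, so that for
  generic \<open>t\<close> one way per monomial spans the ideal.\<close>

lemma generic_koszul:
  fixes q :: "'n::finite \<Rightarrow> real ^ 'n \<Rightarrow> real"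
  assumes q: "\<And>i. q i \<in> Pol m"
  shows "finite {t. \<not> (\<forall>f\<in>ideal_upto m q t D. \<exists>c. \<forall>x. f x =
    (\<Sum>A | size A \<le> D \<and> \<not> in_box m A. c A * (mon (lowered m A) x * gsys m q t (pick m A) x)))}"
proof -
  \<comment> \<open>The span of the canonical multiples, one per monomial outside the box. The goal
    is that it contains all of \<open>ideal_upto m q t D\<close>.\<close>
  define C where "C t = {f. \<exists>c. \<forall>x. f x =
    (\<Sum>A | size A \<le> D \<and> \<not> in_box m A. c A * (mon (lowered m A) x * gsys m q t (pick m A) x))}" for t
  define R where "R i = replicate_mset m i" for i :: 'n
  have finC: "finite {A :: 'n multiset. size A \<le> D \<and> \<not> in_box m A}"
    by (rule finite_subset[OF _ finite_multisets_upto[of D]]) auto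
  have C_add: "(\<lambda>x. f x + g x) \<in> C t" if "f \<in> C t" "g \<in> C t" for f g t
  proof -
    obtain c d where "\<forall>x. f x = (\<Sum>A | size A \<le> D \<and> \<not> in_box m A. c A * (mon (lowered m A) x * gsys m q t (pick m A) x))"
      "\<forall>x. g x = (\<Sum>A | size A \<le> D \<and> \<not> in_box m A. d A * (mon (lowered m A) x * gsys m q t (pick m A) x))"
      using \<open>f \<in> C t\<close> \<open>g \<in> C t\<close> by (auto simp: C_def)
    then show ?thesis unfolding C_def
      by (auto intro!: exI[of _ "\<lambda>A. c A + d A"] simp: distrib_right sum.distrib)
  qed
  have C_cmult: "(\<lambda>x. a * f x) \<in> C t" if "f \<in> C t" for f a t
  proof -
    obtain c where "\<forall>x. f x = (\<Sum>A | size A \<le> D \<and> \<not> in_box m A. c A * (mon (lowered m A) x * gsys m q t (pick m A) x))"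
      using \<open>f \<in> C t\<close> by (auto simp: C_def)
    then show ?thesis unfolding C_def
      by (auto intro!: exI[of _ "\<lambda>A. a * c A"] simp: sum_distrib_left mult.assoc)
  qed
  have C_0: "(\<lambda>x. 0) \<in> C t" for t
    unfolding C_def by (auto intro!: exI[of _ "\<lambda>A. 0"])
  have C_sum: "(\<lambda>x. \<Sum>i\<in>I. f i x) \<in> C t" if "\<And>i. i \<in> I \<Longrightarrow> f i \<in> C t" for I t and f :: "'z \<Rightarrow> real ^ 'n \<Rightarrow> real"
    using that by (induction I rule: infinite_finite_induct) (auto intro: C_add C_0)
  have C_gen: "(\<lambda>x. mon (lowered m A) x * gsys m q t (pick m A) x) \<in> C t" if "size A \<le> D" "\<not> in_box m A" for A t
    unfolding C_def mem_Collect_eq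
    by (rule exI[of _ "\<lambda>B. if B = A then 1 else 0"])
      (use that finC in \<open>simp add: if_distrib if_distribR cong: if_cong\<close>)
  have canon: "(\<lambda>x. mon B x * gsys m q t i x) \<in> C t" if "size B + m \<le> D" "pick m (B + R i) = i" for B i t
  proof -
    have "m \<le> count (B + R i) i" by (simp add: R_def)
    then have "\<not> in_box m (B + R i)" by (auto simp: in_box_def not_less)
    moreover have "lowered m (B + R i) = B" using that(2) unfolding lowered_def R_def by simp
    ultimately show ?thesis using C_gen[of "B + R i" t] that by (simp add: R_def)
  qed
  define P where "P = {(i :: 'n, B :: 'n multiset). size B + m \<le> D}"
  have finP: "finite P"
    by (rule finite_subset[of _ "UNIV \<times> {B. size B + m \<le> D}"]) (auto simp: P_def intro!: finite_cartesian_product finite_shifted)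
  \<comment> \<open>The multiples whose generator is not the one preferred by \<open>pick\<close>;
    these are to be expressed by the canonical ones.\<close>
  define NC where "NC = {(i, B). (i, B) \<in> P \<and> pick m (B + R i) \<noteq> i}"
  have finNC: "finite NC" by (rule finite_subset[OF _ finP]) (auto simp: NC_def)
  define u where "u t b x = mon (snd b) x * gsys m q t (fst b) x" for t b x
  have u_canon: "u t b \<in> C t" if "b \<in> P - NC" for b t
    using that canon[of "snd b" "fst b" t] by (cases b) (auto simp: P_def NC_def u_def[abs_def])
  have rel: "\<exists>K. \<forall>t. (\<lambda>x. u t b x - t * (\<Sum>b'\<in>P. K b' * u t b' x)) \<in> C t" if b: "b \<in> NC" for b
  proof -
    obtain i B where iB: "b = (i, B)" "size B + m \<le> D" "pick m (B + R i) \<noteq> i"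
      using b by (cases b) (auto simp: NC_def P_def)
    define k where "k = pick m (B + R i)"
    have nb: "\<not> in_box m (B + R i)" by (auto simp: in_box_def not_less R_def intro!: exI[of _ i])
    have "m \<le> count B k" using pick[OF nb] iB(3) unfolding k_def by (simp add: R_def)
    define \<gamma> where "\<gamma> = B - R k"
    have B: "B = \<gamma> + R k" unfolding \<gamma>_def R_def
      using \<open>m \<le> count B k\<close> by (metis count_le_replicate_mset_subset_eq subset_mset.diff_add)
    then have sz: "size B = size \<gamma> + m" by (simp add: R_def)
    have "(\<lambda>x. mon \<gamma> x * q j x) \<in> Pol (D - m)" for j
      using Pol_mono[OF Pol_mult[OF Pol_mon[of \<gamma> "size \<gamma>"] q[of j]], of "D - m"] iB(2) sz by simp
    then have "\<exists>c. \<forall>x. mon \<gamma> x * q j x = (\<Sum>B | size B + m \<le> D. c B * mon B x)" for j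
      using iB(2) unfolding Pol_def mem_Collect_eq by (simp add: le_diff_conv2)
    then obtain c where c: "\<And>j x. mon \<gamma> x * q j x = (\<Sum>B | size B + m \<le> D. c j B * mon B x)"
      by metis
    \<comment> \<open>Writing \<open>g i\<close> for \<open>gsys m q t i\<close>: from
      \<open>x $ k ^ m = g k - t * q k\<close> and the symmetry of \<open>g k * g i\<close> one gets
      \<open>x $ k ^ m * g i = x $ i ^ m * g k + t * (q i * g k - q k * g i)\<close>. Multiplied by
      \<open>mon \<gamma>\<close>, the first summand is canonical, and \<open>K\<close> holds the
      coefficients of the bracket.\<close>
    define K where "K b' = (if fst b' = k then c i (snd b') else 0) - (if fst b' = i then c k (snd b') else 0)" for b'
    have sumK: "(\<Sum>b'\<in>P. K b' * u t b' x) = mon \<gamma> x * q i x * gsys m q t k x - mon \<gamma> x * q k x * gsys m q t i x" for t x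
    proof -
      have P_eq: "P = UNIV \<times> {B. size B + m \<le> D}" by (auto simp: P_def)
      have "(\<Sum>b'\<in>P. K b' * u t b' x) = (\<Sum>j\<in>UNIV. \<Sum>B | size B + m \<le> D. K (j, B) * u t (j, B) x)"
        unfolding P_eq by (simp add: sum.cartesian_product)
      also have "\<dots> = (\<Sum>j\<in>UNIV. (if j = k then \<Sum>B | size B + m \<le> D. c i B * mon B x * gsys m q t k x else 0)
          - (if j = i then \<Sum>B | size B + m \<le> D. c k B * mon B x * gsys m q t i x else 0))"
        by (intro sum.cong refl) (auto simp: K_def u_def algebra_simps sum_subtractf sum_negf)
      also have "\<dots> = mon \<gamma> x * q i x * gsys m q t k x - mon \<gamma> x * q k x * gsys m q t i x"
        by (simp add: sum_subtractf c sum_distrib_right)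
      finally show ?thesis .
    qed
    have e1: "u t b x - t * (\<Sum>b'\<in>P. K b' * u t b' x) = mon (\<gamma> + R i) x * gsys m q t k x" for t x
      unfolding sumK unfolding u_def iB(1) fst_conv snd_conv B mon_union R_def mon_replicate
      by (simp add: gsys_def algebra_simps)
    have e2: "(\<lambda>x. mon (\<gamma> + R i) x * gsys m q t k x) \<in> C t" for t
    proof -
      have "\<gamma> + R i + R k = B + R i" unfolding B by (simp only: ac_simps)
      then have "pick m (\<gamma> + R i + R k) = k" unfolding k_def by (rule arg_cong)
      moreover have "size (\<gamma> + R i) + m \<le> D" using iB(2) sz by (simp add: R_def)
      ultimately show ?thesis using canon[of "\<gamma> + R i" k t] by simp
    qed
    have "(\<lambda>x. u t b x - t * (\<Sum>b'\<in>P. K b' * u t b' x)) \<in> C t" for t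
      unfolding e1 by (rule e2)
    then show ?thesis by (intro exI[of _ K] allI)
  qed
  then have "\<forall>b\<in>NC. \<exists>K. \<forall>t. (\<lambda>x. u t b x - t * (\<Sum>b'\<in>P. K b' * u t b' x)) \<in> C t"
    by (rule ballI)
  from bchoice[OF this] obtain K where
    K': "\<forall>b\<in>NC. \<forall>t. (\<lambda>x. u t b x - t * (\<Sum>b'\<in>P. K b b' * u t b' x)) \<in> C t"
    by (rule exE)
  have K: "(\<lambda>x. u t b x - t * (\<Sum>b'\<in>P. K b b' * u t b' x)) \<in> C t" if "b \<in> NC" for b t
    using spec[OF bspec[OF K' that]] .
  \<comment> \<open>Modulo \<open>C t\<close> the noncanonical multiples are annihilated by the
    matrix of \<open>1 - t * K\<close>, which is the identity at \<open>t = 0\<close>. Where it is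
    nonsingular, they all lie in \<open>C t\<close>.\<close>
  define a where "a b b' = [:if b = b' then 1 else 0, - K b b':]" for b b'
  have Ka: "(\<lambda>x. \<Sum>b'\<in>NC. poly (a b b') t * u t b' x) \<in> C t" if "b \<in> NC" for b t
  proof -
    have split: "(\<Sum>b'\<in>P. K b b' * u t b' x) = (\<Sum>b'\<in>NC. K b b' * u t b' x) + (\<Sum>b'\<in>P - NC. K b b' * u t b' x)" for x
      using finP by (subst sum.subset_diff[of NC P]) (auto simp: NC_def)
    have eq: "(\<Sum>b'\<in>NC. poly (a b b') t * u t b' x) = (u t b x - t * (\<Sum>b'\<in>P. K b b' * u t b' x))
      + t * (\<Sum>b'\<in>P - NC. K b b' * u t b' x)" for x
    proof -
      have "(\<Sum>b'\<in>NC. poly (a b b') t * u t b' x)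
        = (\<Sum>b'\<in>NC. (if b = b' then u t b' x else 0) - t * (K b b' * u t b' x))"
        by (intro sum.cong) (auto simp: a_def algebra_simps)
      also have "\<dots> = u t b x - t * (\<Sum>b'\<in>NC. K b b' * u t b' x)"
        using that finNC by (simp add: sum_subtractf sum_distrib_left)
      finally show ?thesis using split[of x] by (simp add: algebra_simps)
    qed
    show ?thesis unfolding eq by (intro C_add K that C_cmult C_sum u_canon)
  qed
  have "finite {t. \<exists>c. (\<forall>j\<in>NC. (\<Sum>i\<in>NC. c i * poly (a i j) t) = 0) \<and> (\<exists>i\<in>NC. c i \<noteq> 0)}"
    by (rule generic_nonsingular[OF finNC]) (auto simp: a_def)
  then have "finite {t. \<not> (\<forall>f\<in>ideal_upto m q t D. f \<in> C t)}"
  proof (rule rev_finite_subset, intro subsetI, goal_cases)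
    case (1 t)
    show ?case
    proof (rule ccontr)
      assume nt: "t \<notin> {t. \<exists>c. (\<forall>j\<in>NC. (\<Sum>i\<in>NC. c i * poly (a i j) t) = 0) \<and> (\<exists>i\<in>NC. c i \<noteq> 0)}"
      have nons: "\<forall>i\<in>NC. c i = 0" if "\<forall>j\<in>NC. (\<Sum>i\<in>NC. c i * poly (a i j) t) = 0" for c
        using nt that unfolding mem_Collect_eq not_ex by (elim allE[of _ c]) auto
      have u_NC: "u t b \<in> C t" if b: "b \<in> NC" for b
      proof -
        obtain c where c: "\<forall>j\<in>NC. (\<Sum>i\<in>NC. c i * poly (a i j) t) = (if b = j then 1 else 0)"
          using nonsingular_spans[OF finNC, of "\<lambda>i j. poly (a i j) t" "\<lambda>j. if b = j then 1 else 0"] nons by auto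
        have "u t b x = (\<Sum>b''\<in>NC. c b'' * (\<Sum>b'\<in>NC. poly (a b'' b') t * u t b' x))" for x
        proof -
          have "(\<Sum>b''\<in>NC. c b'' * (\<Sum>b'\<in>NC. poly (a b'' b') t * u t b' x))
            = (\<Sum>b''\<in>NC. \<Sum>b'\<in>NC. c b'' * poly (a b'' b') t * u t b' x)"
            by (simp add: sum_distrib_left mult.assoc)
          also have "\<dots> = (\<Sum>b'\<in>NC. \<Sum>b''\<in>NC. c b'' * poly (a b'' b') t * u t b' x)" by (rule sum.swap)
          also have "\<dots> = (\<Sum>b'\<in>NC. (\<Sum>b''\<in>NC. c b'' * poly (a b'' b') t) * u t b' x)"
            by (simp add: sum_distrib_right)
          also have "\<dots> = (\<Sum>b'\<in>NC. if b = b' then u t b' x else 0)"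
            using c by (intro sum.cong) auto
          also have "\<dots> = u t b x" using finNC b by simp
          finally show ?thesis by simp
        qed
        then have "u t b = (\<lambda>x. \<Sum>b''\<in>NC. c b'' * (\<Sum>b'\<in>NC. poly (a b'' b') t * u t b' x))" by auto
        then show ?thesis by (simp only:) (intro C_sum C_cmult Ka)
      qed
      have "f \<in> C t" if "f \<in> ideal_upto m q t D" for f
        using that
      proof (induction f rule: ideal_upto_induct)
        case (gen B i)
        then have "(i, B) \<in> P" by (simp add: P_def)
        then have "u t (i, B) \<in> C t" using u_canon u_NC by blast
        then show ?case by (simp add: u_def[abs_def])
      qed (auto intro: C_add C_cmult C_0)
      then show False using 1 by simp
    qed
  qed
  then show ?thesis unfolding C_def mem_Collect_eq .
qed

section \<open>Difference quotients and the Bezoutian\<close>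

text \<open>The members \<open>T k\<close> are the leading parts of difference quotients of \<open>f\<close>; they do not
  depend on the base point \<open>z\<close>.\<close>

definition has_dq :: "nat \<Rightarrow> (real ^ 'n::finite \<Rightarrow> real) \<Rightarrow> ('n \<Rightarrow> real ^ 'n \<Rightarrow> real) \<Rightarrow> bool" where
  "has_dq D f T \<longleftrightarrow> (\<forall>k. T k \<in> Pol (D - 1)) \<and>
    (\<forall>z. \<exists>a. (\<forall>k. (\<lambda>x. a k x - T k x) \<in> Pol (D - 2)) \<and>
      (\<forall>x. f x - f z = (\<Sum>k\<in>UNIV. a k x * (x $ k - z $ k))))"

lemma has_dqD:
  assumes "has_dq D f T"
  shows "T k \<in> Pol (D - 1)"
    and "\<exists>a. (\<forall>k. a k \<in> Pol (D - 1)) \<and> (\<forall>k. (\<lambda>x. a k x - T k x) \<in> Pol (D - 2)) \<and>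
      (\<forall>x. f x - f z = (\<Sum>k\<in>UNIV. a k x * (x $ k - z $ k)))"
proof -
  show T: "T k \<in> Pol (D - 1)" for k using assms by (simp add: has_dq_def)
  obtain a where a: "\<And>k. (\<lambda>x. a k x - T k x) \<in> Pol (D - 2)"
    "\<forall>x. f x - f z = (\<Sum>k\<in>UNIV. a k x * (x $ k - z $ k))"
    using assms unfolding has_dq_def by blast
  have "a k \<in> Pol (D - 1)" for k
    using Pol_add[OF Pol_mono[OF a(1)[of k], of "D - 1"] T[of k]] by simp
  with a show "\<exists>a. (\<forall>k. a k \<in> Pol (D - 1)) \<and> (\<forall>k. (\<lambda>x. a k x - T k x) \<in> Pol (D - 2)) \<and>
      (\<forall>x. f x - f z = (\<Sum>k\<in>UNIV. a k x * (x $ k - z $ k)))" by blast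
qed

text \<open>The product rule for differences:
  \<open>mon B x * (x $ i - z $ i) + z $ i * (mon B x - mon B z)\<close>. The second summand has
  quotients of one degree less, so the leading part comes from the first alone and does not involve
  \<open>T\<close>.\<close>

lemma has_dq_step:
  assumes "has_dq (size B) (mon B) T"
  shows "has_dq (Suc (size B)) (mon (add_mset i B)) (\<lambda>k. if k = i then mon B else (\<lambda>x. 0))"
  unfolding has_dq_def
proof (intro conjI allI)
  fix k
  show "(if k = i then mon B else (\<lambda>x. 0)) \<in> Pol (Suc (size B) - 1)"
    by (simp add: Pol_mon Pol_0)
next
  fix z
  obtain a where a: "\<And>k. a k \<in> Pol (size B - 1)"
    "\<And>x. mon B x - mon B z = (\<Sum>k\<in>UNIV. a k x * (x $ k - z $ k))"
    using has_dqD(2)[OF assms] by metis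
  define b where "b k x = (if k = i then mon B x else 0) + z $ i * a k x" for k x
  have "(\<lambda>x. b k x - (if k = i then mon B else (\<lambda>x. 0)) x) \<in> Pol (Suc (size B) - 2)" for k
    using Pol_cmult[OF a(1)[of k], of "z $ i"] by (auto simp: b_def)
  moreover have "mon (add_mset i B) x - mon (add_mset i B) z = (\<Sum>k\<in>UNIV. b k x * (x $ k - z $ k))" for x
  proof -
    have "(\<Sum>k\<in>UNIV. b k x * (x $ k - z $ k))
      = (\<Sum>k\<in>UNIV. (if k = i then mon B x * (x $ k - z $ k) else 0) + z $ i * (a k x * (x $ k - z $ k)))"
      by (intro sum.cong) (auto simp: b_def algebra_simps)
    also have "\<dots> = mon B x * (x $ i - z $ i) + z $ i * (mon B x - mon B z)"
      by (simp add: sum.distrib sum_distrib_left[symmetric] a(2))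
    finally show ?thesis by (simp add: algebra_simps)
  qed
  ultimately show "\<exists>a. (\<forall>k. (\<lambda>x. a k x - (if k = i then mon B else (\<lambda>x. 0)) x) \<in> Pol (Suc (size B) - 2)) \<and>
      (\<forall>x. mon (add_mset i B) x - mon (add_mset i B) z = (\<Sum>k\<in>UNIV. a k x * (x $ k - z $ k)))"
    by (intro exI[of _ b]) simp
qed

lemma has_dq_mon: "\<exists>T. has_dq (size A) (mon A) T"
proof (induction A)
  case empty
  show ?case
    by (intro exI[of _ "\<lambda>k x. 0"]) (auto simp: has_dq_def Pol_0 intro!: exI[of _ "\<lambda>k x. 0"])
next
  case (add i A)
  then obtain T where T: "has_dq (size A) (mon A) T" by blast
  show ?case unfolding size_add_mset by (intro exI) (rule has_dq_step[OF T])
qed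

lemma has_dq_mono: "has_dq D f T \<Longrightarrow> D \<le> E \<Longrightarrow> has_dq E f T"
  unfolding has_dq_def by (meson Pol_mono diff_le_mono)

lemma has_dq_add:
  assumes "has_dq D f T" "has_dq D g S"
  shows "has_dq D (\<lambda>x. f x + g x) (\<lambda>k x. T k x + S k x)"
  unfolding has_dq_def
proof (intro conjI allI)
  fix k show "(\<lambda>x. T k x + S k x) \<in> Pol (D - 1)"
    using assms by (intro Pol_add has_dqD(1))
next
  fix z
  obtain a where a: "\<And>k. (\<lambda>x. a k x - T k x) \<in> Pol (D - 2)"
    "\<And>x. f x - f z = (\<Sum>k\<in>UNIV. a k x * (x $ k - z $ k))"
    using has_dqD(2)[OF assms(1)] by metis
  obtain b where b: "\<And>k. (\<lambda>x. b k x - S k x) \<in> Pol (D - 2)"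
    "\<And>x. g x - g z = (\<Sum>k\<in>UNIV. b k x * (x $ k - z $ k))"
    using has_dqD(2)[OF assms(2)] by metis
  have "(\<lambda>x. a k x + b k x - (T k x + S k x)) \<in> Pol (D - 2)" for k
    using Pol_add[OF a(1)[of k] b(1)[of k]] by (simp add: algebra_simps)
  moreover have "f x + g x - (f z + g z) = (\<Sum>k\<in>UNIV. (a k x + b k x) * (x $ k - z $ k))" for x
    using a(2)[of x] b(2)[of x] by (simp add: distrib_right sum.distrib)
  ultimately show "\<exists>a. (\<forall>k. (\<lambda>x. a k x - (T k x + S k x)) \<in> Pol (D - 2)) \<and>
      (\<forall>x. f x + g x - (f z + g z) = (\<Sum>k\<in>UNIV. a k x * (x $ k - z $ k)))"
    by (intro exI[of _ "\<lambda>k x. a k x + b k x"]) simp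
qed

lemma has_dq_cmult:
  assumes "has_dq D f T"
  shows "has_dq D (\<lambda>x. c * f x) (\<lambda>k x. c * T k x)"
  unfolding has_dq_def
proof (intro conjI allI)
  fix k show "(\<lambda>x. c * T k x) \<in> Pol (D - 1)"
    using assms by (intro Pol_cmult has_dqD(1))
next
  fix z
  obtain a where a: "\<And>k. (\<lambda>x. a k x - T k x) \<in> Pol (D - 2)"
    "\<And>x. f x - f z = (\<Sum>k\<in>UNIV. a k x * (x $ k - z $ k))"
    using has_dqD(2)[OF assms(1)] by metis
  have "(\<lambda>x. c * a k x - c * T k x) \<in> Pol (D - 2)" for k
    using Pol_cmult[OF a(1)[of k], of c] by (simp add: algebra_simps)
  moreover have "c * f x - c * f z = (\<Sum>k\<in>UNIV. c * a k x * (x $ k - z $ k))" for x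
    using a(2)[of x] by (simp add: right_diff_distrib[symmetric] mult.assoc sum_distrib_left)
  ultimately show "\<exists>a. (\<forall>k. (\<lambda>x. a k x - c * T k x) \<in> Pol (D - 2)) \<and>
      (\<forall>x. c * f x - c * f z = (\<Sum>k\<in>UNIV. a k x * (x $ k - z $ k)))"
    by (intro exI[of _ "\<lambda>k x. c * a k x"]) simp
qed

lemma has_dq_Pol: "f \<in> Pol D \<Longrightarrow> \<exists>T. has_dq D f T"
proof (induction f rule: Pol_induct)
  case (mon A)
  then show ?case using has_dq_mon has_dq_mono by blast
qed (blast intro: has_dq_add has_dq_cmult)+

text \<open>With these explicit leading parts the matrix for the system is diagonal at
  \<open>t = 0\<close>, and its determinant there is the top monomial of the box.\<close>

lemma has_dq_power:
  assumes "m \<ge> 1"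
  shows "has_dq m (\<lambda>x. x $ i ^ m) (\<lambda>k x. if k = i then x $ i ^ (m - 1) else 0)"
proof -
  obtain T where "has_dq (size (replicate_mset (m - 1) i)) (mon (replicate_mset (m - 1) i)) T"
    using has_dq_mon by blast
  from has_dq_step[OF this, of i]
  have "has_dq m (mon (replicate_mset m i)) (\<lambda>k. if k = i then mon (replicate_mset (m - 1) i) else (\<lambda>x. 0))"
    using assms by (simp add: replicate_mset_Suc[symmetric])
  moreover have "mon (replicate_mset m i) = (\<lambda>x. x $ i ^ m)" by (simp add: fun_eq_iff mon_replicate)
  moreover have "(\<lambda>k. if k = i then mon (replicate_mset (m - 1) i) else (\<lambda>x. 0))
      = (\<lambda>k x. if k = i then x $ i ^ (m - 1) else 0)"
    by (auto simp: fun_eq_iff mon_replicate)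
  ultimately show ?thesis by simp
qed

text \<open>The top-degree part of a product depends only on those of its factors: the factors are
  exchanged one at a time, and each exchange loses a degree.\<close>

lemma Pol_prod_diff:
  assumes "finite I" "\<And>i. i \<in> I \<Longrightarrow> f i \<in> Pol (Suc d)" "\<And>i. i \<in> I \<Longrightarrow> g i \<in> Pol (Suc d)"
    "\<And>i. i \<in> I \<Longrightarrow> (\<lambda>x. f i x - g i x) \<in> Pol d"
  shows "(\<lambda>x. (\<Prod>i\<in>I. f i x) - (\<Prod>i\<in>I. g i x)) \<in> Pol (card I * Suc d - 1)"
  using assms
proof (induction I rule: finite_induct)
  case empty
  show ?case by (simp add: Pol_0)
next
  case (insert i I)
  have "(\<lambda>x. (f i x - g i x) * (\<Prod>i\<in>I. f i x)) \<in> Pol (d + card I * Suc d)"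
    using insert by (intro Pol_mult Pol_prod) auto
  moreover have "(\<lambda>x. g i x * ((\<Prod>i\<in>I. f i x) - (\<Prod>i\<in>I. g i x))) \<in> Pol (d + card I * Suc d)"
  \<comment> \<open>Here truncated subtraction would spoil the degree count, as
    \<open>0 - 1 = 0\<close>; but the two empty products cancel.\<close>
  proof (cases "I = {}")
    case True
    then show ?thesis by (simp add: Pol_0)
  next
    case False
    then have "Suc d + (card I * Suc d - 1) = d + card I * Suc d"
      using insert.hyps by (cases "card I") auto
    have "(\<lambda>x. g i x * ((\<Prod>i\<in>I. f i x) - (\<Prod>i\<in>I. g i x))) \<in> Pol (Suc d + (card I * Suc d - 1))"
      by (intro Pol_mult insert.IH) (auto intro: insert.prems)
    then show ?thesis unfolding \<open>Suc d + (card I * Suc d - 1) = d + card I * Suc d\<close> .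
  qed
  ultimately have "(\<lambda>x. (f i x - g i x) * (\<Prod>i\<in>I. f i x) + g i x * ((\<Prod>i\<in>I. f i x) - (\<Prod>i\<in>I. g i x)))
      \<in> Pol (d + card I * Suc d)" by (rule Pol_add)
  then show ?case using insert.hyps by (simp add: algebra_simps)
qed

lemma Pol_det_diff:
  fixes E F :: "'n::finite \<Rightarrow> 'n \<Rightarrow> real ^ 'n \<Rightarrow> real"
  assumes "\<And>i k. E i k \<in> Pol (Suc d)" "\<And>i k. F i k \<in> Pol (Suc d)" "\<And>i k. (\<lambda>x. E i k x - F i k x) \<in> Pol d"
  shows "(\<lambda>x. det (\<chi> i k. E i k x) - det (\<chi> i k. F i k x)) \<in> Pol (CARD('n) * Suc d - 1)"
proof -
  have "(\<lambda>x. of_int (sign p) * ((\<Prod>i\<in>UNIV. E i (p i) x) - (\<Prod>i\<in>UNIV. F i (p i) x)))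
      \<in> Pol (CARD('n) * Suc d - 1)" for p :: "'n \<Rightarrow> 'n"
    by (intro Pol_cmult Pol_prod_diff assms) auto
  then have "(\<lambda>x. \<Sum>p | p permutes (UNIV :: 'n set). of_int (sign p) * ((\<Prod>i\<in>UNIV. E i (p i) x) - (\<Prod>i\<in>UNIV. F i (p i) x)))
      \<in> Pol (CARD('n) * Suc d - 1)"
    by (intro Pol_sum)
  then show ?thesis by (simp add: det_def sum_subtractf right_diff_distrib)
qed

lemma TPol_cmult: "F \<in> TPol D \<Longrightarrow> (\<lambda>t x. c * F t x) \<in> TPol D"
  using TPol_mult[OF TPol_mon[of "{#}" 0 "[:c:]"], of F D] by simp

lemma TPol_det:
  fixes E :: "'n::finite \<Rightarrow> 'n \<Rightarrow> real \<Rightarrow> real ^ 'n \<Rightarrow> real"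
  assumes "\<And>i k. E i k \<in> TPol d"
  shows "(\<lambda>t x. det (\<chi> i k. E i k t x)) \<in> TPol (CARD('n) * d)"
  unfolding det_def using assms
  by (auto intro!: TPol_sum TPol_cmult TPol_prod)

lemma Pol_det:
  fixes E :: "'n::finite \<Rightarrow> 'n \<Rightarrow> real ^ 'n \<Rightarrow> real"
  assumes "\<And>i k. E i k \<in> Pol d"
  shows "(\<lambda>x. det (\<chi> i k. E i k x)) \<in> Pol (CARD('n) * d)"
  using TPol_det[of "\<lambda>i k t. E i k" d] assms by (simp add: Pol_TPol)

text \<open>Cramer's rule: multiplying the determinant by \<open>x $ k - z $ k\<close> replaces
  column \<open>k\<close> by the generators. Each term of the Leibniz expansion then contains
  exactly one generator and \<open>n - 1\<close> entries of degree \<open>m - 1\<close>, which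
  accounts for the degree bound.\<close>

lemma bezout_ideal:
  fixes E :: "'n::finite \<Rightarrow> 'n \<Rightarrow> real ^ 'n \<Rightarrow> real"
  assumes m: "m \<ge> 1" and E: "\<And>i k. E i k \<in> Pol (m - 1)"
    and g: "\<And>i x. gsys m q t i x = (\<Sum>k\<in>UNIV. E i k x * (x $ k - z $ k))"
  shows "(\<lambda>x. (x $ k - z $ k) * det (\<chi> i k. E i k x)) \<in> ideal_upto m q t (CARD('n) * (m - 1) + 1)"
proof -
  have "(x $ k - z $ k) * det (\<chi> i k. E i k x)
      = det (\<chi> i j. if j = k then gsys m q t i x else E i j x)" for x
  proof -
    have "det (\<chi> i j. if j = k then ((\<chi> i k. E i k x) *v (x - z)) $ i else (\<chi> i k. E i k x) $ i $ j)
        = (x - z) $ k * det (\<chi> i k. E i k x)" by (rule cramer_lemma)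
    moreover have "((\<chi> i k. E i k x) *v (x - z)) $ i = gsys m q t i x" for i
      by (simp add: matrix_vector_mult_def g)
    then have "(\<chi> i j. if j = k then ((\<chi> i k. E i k x) *v (x - z)) $ i else (\<chi> i k. E i k x) $ i $ j)
        = (\<chi> i j. if j = k then gsys m q t i x else E i j x)"
      by (simp add: vec_eq_iff)
    ultimately show ?thesis by simp
  qed
  moreover have "(\<lambda>x. det (\<chi> i j. if j = k then gsys m q t i x else E i j x)) \<in> ideal_upto m q t (CARD('n) * (m - 1) + 1)"
    unfolding det_def
  proof (intro ideal_upto_sum ideal_upto_cmult)
    fix p :: "'n \<Rightarrow> 'n" assume "p \<in> {p. p permutes UNIV}"
    then have p: "p permutes UNIV" by simp
    define i0 where "i0 = inv p k"
    have i0: "p i = k \<longleftrightarrow> i = i0" for i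
      unfolding i0_def using p by (metis permutes_inv_eq)
    have "(\<Prod>i\<in>UNIV. (\<chi> i j. if j = k then gsys m q t i x else E i j x) $ i $ p i)
      = (\<Prod>i\<in>UNIV - {i0}. E i (p i) x) * gsys m q t i0 x" for x
    proof -
      have "(\<Prod>i\<in>UNIV. (\<chi> i j. if j = k then gsys m q t i x else E i j x) $ i $ p i)
        = (\<Prod>i\<in>UNIV. if i = i0 then gsys m q t i x else E i (p i) x)" by (simp add: i0)
      also have "\<dots> = gsys m q t i0 x * (\<Prod>i\<in>UNIV - {i0}. if i = i0 then gsys m q t i x else E i (p i) x)"
        by (subst prod.remove[of _ i0]) auto
      also have "(\<Prod>i\<in>UNIV - {i0}. if i = i0 then gsys m q t i x else E i (p i) x) = (\<Prod>i\<in>UNIV - {i0}. E i (p i) x)"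
        by (intro prod.cong) auto
      finally show ?thesis by simp
    qed
    moreover have "(\<lambda>x. (\<Prod>i\<in>UNIV - {i0}. E i (p i) x) * gsys m q t i0 x) \<in> ideal_upto m q t (CARD('n) * (m - 1) + 1)"
    proof (rule ideal_upto_Pol_gen)
      show "(\<lambda>x. \<Prod>i\<in>UNIV - {i0}. E i (p i) x) \<in> Pol (card (UNIV - {i0}) * (m - 1))"
        by (intro Pol_prod E) auto
      have "CARD('n) \<ge> 1" by (simp add: Suc_leI)
      then have "(CARD('n) - 1) * (m - 1) + (m - 1) = CARD('n) * (m - 1)"
        by (metis le_add_diff_inverse2 mult.commute mult_Suc_right add.commute plus_1_eq_Suc)
      then show "card (UNIV - {i0}) * (m - 1) + m \<le> CARD('n) * (m - 1) + 1"
        using m by simp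
    qed
    ultimately show "(\<lambda>x. \<Prod>i\<in>UNIV. (\<chi> i j. if j = k then gsys m q t i x else E i j x) $ i $ p i)
      \<in> ideal_upto m q t (CARD('n) * (m - 1) + 1)" by simp
  qed
  ultimately show ?thesis by simp
qed

section \<open>Box monomials and derivatives of polynomial functions\<close>

lemma card_box: "card {A :: 'n::finite multiset. in_box m A} = m ^ CARD('n)"
proof -
  have "bij_betw count {A :: 'n multiset. in_box m A} (PiE UNIV (\<lambda>_. {..<m}))"
  proof (rule bij_betwI')
    fix A B :: "'n multiset" show "(count A = count B) = (A = B)" by (simp add: multiset_eq_iff fun_eq_iff)
  next
    fix A :: "'n multiset" assume "A \<in> {A. in_box m A}"
    then show "count A \<in> PiE UNIV (\<lambda>_. {..<m})" by (auto simp: in_box_def)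
  next
    fix f assume f: "f \<in> PiE (UNIV :: 'n set) (\<lambda>_. {..<m})"
    have "count (Abs_multiset f) = f" by (rule Abs_multiset_inverse) simp
    then show "\<exists>A\<in>{A. in_box m A}. f = count A" using f by (intro bexI[of _ "Abs_multiset f"]) (auto simp: in_box_def)
  qed
  then have "card {A :: 'n multiset. in_box m A} = card (PiE (UNIV :: 'n set) (\<lambda>_. {..<m}))"
    by (rule bij_betw_same_card)
  then show ?thesis by (simp add: card_PiE)
qed

lemma size_le_card_box:
  fixes A :: "'n::finite multiset"
  assumes "in_box m A"
  shows "size A \<le> CARD('n) * (m - 1)"
proof -
  have c: "count A i \<le> m - 1" for i
  proof -
    have "count A i < m" using assms by (simp add: in_box_def)
    then show ?thesis by linarith
  qed
  have "size A = (\<Sum>i\<in>set_mset A. count A i)" by (rule size_multiset_overloaded_eq)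
  also have "\<dots> \<le> (\<Sum>i\<in>UNIV. count A i)" by (rule sum_mono2) auto
  also have "\<dots> \<le> (\<Sum>i\<in>(UNIV :: 'n set). m - 1)" by (rule sum_mono) (rule c)
  finally show ?thesis by simp
qed

lemma Pol_has_derivative:
  assumes "f \<in> Pol D"
  shows "\<exists>f'. (\<forall>k. f' k \<in> Pol (D - 1)) \<and> (\<forall>x. (f has_derivative (\<lambda>v. \<Sum>k\<in>UNIV. f' k x * v $ k)) (at x))"
  using assms
proof (induction f rule: Pol_induct)
  case (mon A)
  \<comment> \<open>The clause for \<open>{#}\<close> makes up for truncated subtraction: the bound
    \<open>size A - 1\<close> alone would allow constants as derivatives of a constant, and
    \<open>x $ i * f' k\<close> would exceed the degree in the next step.\<close>
  have "\<exists>f'. (\<forall>k. f' k \<in> Pol (size A - 1)) \<and> (A = {#} \<longrightarrow> f' = (\<lambda>k x. 0)) \<and> (\<forall>x. (mon A has_derivative (\<lambda>v. \<Sum>k\<in>UNIV. f' k x * v $ k)) (at x))"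
  proof (induction A)
    case empty
    show ?case by (intro exI[of _ "\<lambda>k x. 0"]) (auto simp: Pol_0 mon_def[abs_def])
  next
    case (add i A)
    then obtain f' where f': "\<And>k. f' k \<in> Pol (size A - 1)"
      "\<And>x. (mon A has_derivative (\<lambda>v. \<Sum>k\<in>UNIV. f' k x * v $ k)) (at x)"
      "A = {#} \<longrightarrow> f' = (\<lambda>k x. 0)" by auto
    define g where "g k x = (if k = i then mon A x else 0) + x $ i * f' k x" for k x
    have "g k \<in> Pol (size (add_mset i A) - 1)" for k
    proof -
      have "(\<lambda>x. x $ i * f' k x) \<in> Pol (size A)"
      proof (cases "size A = 0")
        case True
        then have "A = {#}" by simp
        then have "f' k = (\<lambda>x. 0)" using f'(3) by (simp add: fun_eq_iff)
        then show ?thesis by (simp add: Pol_0)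
      next
        case False
        then have "1 + (size A - 1) = size A" by linarith
        then show ?thesis using Pol_mult[OF Pol_coord[of 1 i, OF order_refl] f'(1)[of k]] by (simp only:)
      qed
      then show ?thesis unfolding g_def[abs_def]
        by (cases "k = i") (simp_all add: Pol_add Pol_mon)
    qed
    moreover have "(mon (add_mset i A) has_derivative (\<lambda>v. \<Sum>k\<in>UNIV. g k x * v $ k)) (at x)" for x
    proof -
      have "((\<lambda>x. x $ i * mon A x) has_derivative (\<lambda>v. x $ i * (\<Sum>k\<in>UNIV. f' k x * v $ k) + v $ i * mon A x)) (at x)"
        by (intro has_derivative_mult f' bounded_linear_imp_has_derivative bounded_linear_vec_nth)
      moreover have "x $ i * (\<Sum>k\<in>UNIV. f' k x * v $ k) + v $ i * mon A x = (\<Sum>k\<in>UNIV. g k x * v $ k)" for v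
      proof -
        have "(\<Sum>k\<in>UNIV. g k x * v $ k) = (\<Sum>k\<in>UNIV. (if k = i then mon A x * v $ k else 0) + x $ i * (f' k x * v $ k))"
          by (intro sum.cong) (auto simp: g_def algebra_simps)
        then show ?thesis by (simp add: sum.distrib sum_distrib_left)
      qed
      ultimately show ?thesis by (simp add: mon_add_mset[abs_def])
    qed
    ultimately show ?case by (intro exI[of _ g]) (simp del: mon_add_mset)
  qed
  then obtain f' where f': "\<And>k. f' k \<in> Pol (size A - 1)"
    "\<And>x. (mon A has_derivative (\<lambda>v. \<Sum>k\<in>UNIV. f' k x * v $ k)) (at x)" by auto
  have "f' k \<in> Pol (D - 1)" for k by (rule Pol_mono[OF f'(1)]) (use mon in simp)
  then show ?case using f'(2) by (intro exI[of _ f']) simp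
next
  case (add f g)
  then obtain f' g' where f': "\<And>k. f' k \<in> Pol (D - 1)" "\<And>x. (f has_derivative (\<lambda>v. \<Sum>k\<in>UNIV. f' k x * v $ k)) (at x)"
    and g': "\<And>k. g' k \<in> Pol (D - 1)" "\<And>x. (g has_derivative (\<lambda>v. \<Sum>k\<in>UNIV. g' k x * v $ k)) (at x)"
    by blast
  have "((\<lambda>x. f x + g x) has_derivative (\<lambda>v. \<Sum>k\<in>UNIV. (f' k x + g' k x) * v $ k)) (at x)" for x
    using has_derivative_add[OF f'(2)[of x] g'(2)[of x]] by (simp add: distrib_right sum.distrib)
  moreover have "(\<lambda>x. f' k x + g' k x) \<in> Pol (D - 1)" for k by (rule Pol_add[OF f'(1) g'(1)])
  ultimately show ?case by (intro exI[of _ "\<lambda>k x. f' k x + g' k x"]) simp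
next
  case (cmult c f)
  then obtain f' where f': "\<And>k. f' k \<in> Pol (D - 1)" "\<And>x. (f has_derivative (\<lambda>v. \<Sum>k\<in>UNIV. f' k x * v $ k)) (at x)"
    by blast
  have "((\<lambda>x. c * f x) has_derivative (\<lambda>v. \<Sum>k\<in>UNIV. (c * f' k x) * v $ k)) (at x)" for x
    using has_derivative_mult_right[OF f'(2)[of x], of c] by (simp add: sum_distrib_left mult.assoc)
  moreover have "(\<lambda>x. c * f' k x) \<in> Pol (D - 1)" for k by (rule Pol_cmult[OF f'(1)])
  ultimately show ?case by (intro exI[of _ "\<lambda>k x. c * f' k x"]) simp
qed

text \<open>The largest monomial of the box. Its coefficient takes over the role of the Euler-Jacobi
  residue.\<close>

definition corner :: "nat \<Rightarrow> 'n::finite multiset" where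
  "corner m = (\<Sum>i\<in>UNIV. replicate_mset (m - 1) i)"

lemma count_corner [simp]: "count (corner m) i = m - 1"
  by (simp add: corner_def count_sum)

lemma size_corner: "size (corner m :: 'n::finite multiset) = CARD('n) * (m - 1)"
  by (simp add: corner_def size_multiset_sum)

lemma mon_corner: "mon (corner m) x = (\<Prod>i\<in>UNIV. x $ i ^ (m - 1))"
proof -
  have "mon (\<Sum>i\<in>I. replicate_mset (m - 1) i) x = (\<Prod>i\<in>I. x $ i ^ (m - 1))" if "finite I" for I :: "'a set"
    using that by (induction I rule: finite_induct) (auto simp: mon_union mon_replicate)
  then show ?thesis by (simp add: corner_def)
qed

text \<open>The monomials in the box represent a basis of the quotient by the ideal; the top one is
  replaced by the leading part \<open>\<Theta>\<close> of the Bezoutian.\<close>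

definition quot_basis :: "nat \<Rightarrow> ('n \<Rightarrow> real ^ 'n \<Rightarrow> real) \<Rightarrow> (real \<Rightarrow> real ^ 'n \<Rightarrow> real) \<Rightarrow>
    'n::finite multiset \<Rightarrow> real \<Rightarrow> real ^ 'n \<Rightarrow> real" where
  "quot_basis m q \<Theta> A t x = (if \<not> in_box m A then mon (lowered m A) x * gsys m q t (pick m A) x
    else if A = corner m then \<Theta> t x else mon A x)"

text \<open>At \<open>t = 0\<close> every member is the monomial that indexes it: a multiple of a
  generator becomes \<open>mon A\<close> by the choice of \<open>lowered\<close>, and
  \<open>\<Theta>\<close> becomes the top box monomial by assumption.\<close>

lemma generic_quot_basis:
  fixes q :: "'n::finite \<Rightarrow> real ^ 'n \<Rightarrow> real"
  assumes q: "\<And>i. q i \<in> Pol m" and \<Theta>: "\<Theta> \<in> TPol (CARD('n) * (m - 1))" and \<Theta>0: "\<Theta> 0 = mon (corner m)"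
  shows "finite {t. \<not> ((\<forall>c. (\<forall>x. (\<Sum>A | size A \<le> D. c A * quot_basis m q \<Theta> A t x) = 0) \<longrightarrow> (\<forall>A. size A \<le> D \<longrightarrow> c A = 0)) \<and>
    (\<forall>f\<in>Pol D. \<exists>c. \<forall>x. f x = (\<Sum>A | size A \<le> D. c A * quot_basis m q \<Theta> A t x)))}"
proof (rule generic_basis)
  fix A :: "'n multiset" assume A: "size A \<le> D"
  show "quot_basis m q \<Theta> A \<in> TPol D"
  proof (cases "in_box m A")
    case False
    have "(\<lambda>t x. (poly 1 t * mon (lowered m A) x) * gsys m q t (pick m A) x) \<in> TPol (size (lowered m A) + m)"
      by (intro TPol_mult TPol_mon gsys_TPol q) simp
    moreover have "size (lowered m A) + m = size A"
      by (subst (2) lowered[OF False, symmetric]) simp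
    ultimately show ?thesis
      using False A by (auto simp: quot_basis_def[abs_def] intro: TPol_mono)
  next
    case True
    show ?thesis
    proof (cases "A = corner m")
      case c: True
      have "quot_basis m q \<Theta> A = \<Theta>" using True c by (simp add: quot_basis_def[abs_def])
      then show ?thesis using TPol_mono[OF \<Theta>] A c size_corner[of m, where 'n = 'n] by simp
    next
      case False
      have "quot_basis m q \<Theta> A = (\<lambda>t x. poly 1 t * mon A x)"
        using True False by (simp add: quot_basis_def[abs_def])
      then show ?thesis using TPol_mon[OF A, of 1] by simp
    qed
  qed
  show "quot_basis m q \<Theta> A 0 = mon A"
  proof (cases "in_box m A")
    case False
    have "mon A x = mon (lowered m A) x * x $ (pick m A) ^ m" for x
      by (subst lowered[OF False, symmetric]) (simp add: mon_union mon_replicate)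
    then show ?thesis using False by (simp add: quot_basis_def[abs_def] gsys_def fun_eq_iff)
  next
    case True
    then show ?thesis by (auto simp: quot_basis_def[abs_def] \<Theta>0)
  qed
qed

text \<open>The evaluation argument of Petrovskii and Oleinik: since the Euler-Jacobi functional kills
  polynomials of low degree, those of degree at most \<open>r\<close> span an isotropic subspace of the
  quotient ring, while the Bezoutians at the points of \<open>Z\<close> span a definite one.\<close>

lemma count_solutions:
  fixes q :: "'n::finite \<Rightarrow> real ^ 'n \<Rightarrow> real"
  assumes q: "\<And>i. q i \<in> Pol m" and m: "m \<ge> 2" and r: "1 \<le> r" "r \<le> m - 1" "2 * r + a < CARD('n) * (m - 1)"
  shows "finite {t. \<not> (\<forall>Z h G. finite Z \<longrightarrow> (\<forall>z\<in>Z. \<forall>i. gsys m q t i z = 0) \<longrightarrow> h \<in> Pol a \<longrightarrow>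
    (\<forall>z\<in>Z. \<forall>i. (gsys m q t i has_derivative (\<lambda>v. \<Sum>k\<in>UNIV. G z i k * v $ k)) (at z)) \<longrightarrow>
    (\<forall>z\<in>Z. h z * det (\<chi> i k. G z i k) > 0) \<longrightarrow>
    card Z + card {A :: 'n multiset. size A \<le> r} \<le> m ^ CARD('n))}"
proof -
  define \<sigma> where "\<sigma> = CARD('n) * (m - 1)"
  \<comment> \<open>Room for the product of an element of the ideal of degree
    \<open>\<sigma>\<close> with the multiplier \<open>p\<close> below, whose degree is at most
    \<open>a + r\<close>.\<close>
  define D where "D = \<sigma> + (a + r)"
  obtain T where T: "\<And>i. has_dq m (q i) (T i)" using has_dq_Pol[OF q] by metis
  define Tt where "Tt i k t x = (if k = i then x $ i ^ (m - 1) else 0) + t * T i k x" for i k :: 'n and t x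
  have Tt_dq: "has_dq m (gsys m q t i) (\<lambda>k. Tt i k t)" for i t
    using has_dq_add[OF has_dq_power[of m i] has_dq_cmult[OF T[of i], of t]] m
    by (simp add: gsys_def[abs_def] Tt_def[abs_def])
  define \<Theta> where "\<Theta> t x = det (\<chi> i k. Tt i k t x)" for t x
  have "Tt i k \<in> TPol (m - 1)" for i k
  proof -
    have "(\<lambda>t x. (poly [:0,1:] t * mon {#} x) * T i k x) \<in> TPol (0 + (m - 1))"
      by (intro TPol_mult TPol_mon) (use has_dqD(1)[OF T] in \<open>simp_all add: Pol_TPol\<close>)
    moreover have "(\<lambda>t x. if k = i then x $ i ^ (m - 1) else 0) \<in> TPol (m - 1)"
    proof (cases "k = i")
      case True
      then show ?thesis using TPol_mon[of "replicate_mset (m - 1) i" "m - 1" 1] by (simp add: mon_replicate)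
    qed (simp add: TPol_0)
    ultimately have "(\<lambda>t x. (if k = i then x $ i ^ (m - 1) else 0) + (poly [:0,1:] t * mon {#} x) * T i k x) \<in> TPol (m - 1)"
      by (intro TPol_add) simp_all
    then show ?thesis by (simp add: Tt_def[abs_def])
  qed
  then have \<Theta>: "\<Theta> \<in> TPol \<sigma>" unfolding \<Theta>_def[abs_def] \<sigma>_def by (rule TPol_det)
  have \<Theta>0: "\<Theta> 0 = mon (corner m)"
  proof
    fix x :: "real ^ 'n"
    have "\<Theta> 0 x = (\<Prod>i\<in>UNIV. (\<chi> i k. Tt i k 0 x) $ i $ i)"
      unfolding \<Theta>_def by (rule det_diagonal) (simp add: Tt_def)
    then show "\<Theta> 0 x = mon (corner m) x" by (simp add: mon_corner Tt_def)
  qed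
  define F where "F = quot_basis m q \<Theta>"
  define ind where "ind E t \<longleftrightarrow> (\<forall>c. (\<forall>x. (\<Sum>A | size A \<le> E. c A * F A t x) = 0) \<longrightarrow> (\<forall>A. size A \<le> E \<longrightarrow> c A = 0))" for E t
  define spn where "spn E t \<longleftrightarrow> (\<forall>f\<in>Pol E. \<exists>c. \<forall>x. f x = (\<Sum>A | size A \<le> E. c A * F A t x))" for E t
  define kosz where "kosz t \<longleftrightarrow> (\<forall>f\<in>ideal_upto m q t D. \<exists>c. \<forall>x. f x =
    (\<Sum>A | size A \<le> D \<and> \<not> in_box m A. c A * (mon (lowered m A) x * gsys m q t (pick m A) x)))" for t
  have fin1: "finite {t. \<not> (ind E t \<and> spn E t)}" for E
    unfolding ind_def spn_def F_def using q \<Theta> \<Theta>0 unfolding \<sigma>_def by (rule generic_quot_basis)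
  have fin2: "finite {t. \<not> kosz t}" unfolding kosz_def by (rule generic_koszul[OF q])
  \<comment> \<open>Three degrees occur: \<open>D\<close> for the uniqueness of coefficients,
    \<open>\<sigma>\<close> for the expansion of the Bezoutians and \<open>\<sigma> - 1\<close> for
    polynomials on which the residue vanishes.\<close>
  have "finite ({t. \<not> (ind D t \<and> spn D t)} \<union> {t. \<not> (ind \<sigma> t \<and> spn \<sigma> t)} \<union> {t. \<not> (ind (\<sigma> - 1) t \<and> spn (\<sigma> - 1) t)} \<union> {t. \<not> kosz t})"
    using fin1 fin2 by blast
  then show ?thesis
  proof (rule rev_finite_subset, intro subsetI, goal_cases)
    case (1 t)
    show ?case
    proof (rule ccontr)
      assume "t \<notin> {t. \<not> (ind D t \<and> spn D t)} \<union> {t. \<not> (ind \<sigma> t \<and> spn \<sigma> t)} \<union> {t. \<not> (ind (\<sigma> - 1) t \<and> spn (\<sigma> - 1) t)} \<union> {t. \<not> kosz t}"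
      then have ind: "ind D t" and spn: "spn \<sigma> t" "spn (\<sigma> - 1) t" and kosz: "kosz t" by auto
      have ind': "c A = 0" if "\<And>x. (\<Sum>A | size A \<le> D. c A * F A t x) = 0" "size A \<le> D" for c A
        by (rule ind[unfolded ind_def, rule_format]) (fact that)+
      have finD: "finite {A :: 'n multiset. size A \<le> E}" for E by (rule finite_multisets_upto)
      have extend: "(\<Sum>A | size A \<le> E \<and> P A. c A * f A) = (\<Sum>A | size A \<le> D. (if size A \<le> E \<and> P A then c A else 0) * f A)"
        if "E \<le> D" for E P c and f :: "'n multiset \<Rightarrow> real"
      proof -
        have "(\<Sum>A | size A \<le> E \<and> P A. c A * f A) = (\<Sum>A | size A \<le> E \<and> P A. (if size A \<le> E \<and> P A then c A else 0) * f A)"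
          by (intro sum.cong) auto
        also have "\<dots> = (\<Sum>A | size A \<le> D. (if size A \<le> E \<and> P A then c A else 0) * f A)"
          using that by (intro sum.mono_neutral_left finD) auto
        finally show ?thesis .
      qed
      have koszF: "\<exists>c. (\<forall>A. in_box m A \<longrightarrow> c A = 0) \<and> (\<forall>x. f x = (\<Sum>A | size A \<le> D. c A * F A t x))"
        if fI: "f \<in> ideal_upto m q t D" for f
      proof -
        obtain c where c: "\<forall>x. f x = (\<Sum>A | size A \<le> D \<and> \<not> in_box m A. c A * (mon (lowered m A) x * gsys m q t (pick m A) x))"
          by (rule exE[OF bspec[OF kosz[unfolded kosz_def] fI]])
        have "f x = (\<Sum>A | size A \<le> D \<and> \<not> in_box m A. c A * F A t x)" for x
          unfolding c[rule_format] by (intro sum.cong) (auto simp: F_def quot_basis_def)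
        then have "f x = (\<Sum>A | size A \<le> D. (if size A \<le> D \<and> \<not> in_box m A then c A else 0) * F A t x)" for x
          using extend[where E = D and P = "\<lambda>A. \<not> in_box m A" and c = c and f = "\<lambda>A. F A t x"] by simp
        then show ?thesis by (intro exI[of _ "\<lambda>A. if size A \<le> D \<and> \<not> in_box m A then c A else 0"]) auto
      qed
      have \<sigma>1: "1 \<le> \<sigma>" using r unfolding \<sigma>_def by linarith
      have boxc: "in_box m (corner m :: 'n multiset)" using m by (simp add: in_box_def)
      have szc: "size (corner m :: 'n multiset) = \<sigma>" by (simp add: size_corner \<sigma>_def)
      have \<Theta>F: "F (corner m) t = \<Theta> t" using boxc by (simp add: F_def quot_basis_def[abs_def])
      \<comment> \<open>The Euler-Jacobi theorem in coordinates: the coefficient at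
        \<open>corner m\<close> vanishes on the ideal, whose members involve no index in the box,
        and on polynomials of degree below \<open>\<sigma>\<close>, the size of the corner; for
        \<open>\<Theta> t\<close> it is 1.\<close>
      have top: "s = 0" if s: "(\<lambda>x. s * \<Theta> t x - \<rho> x) \<in> ideal_upto m q t D" "\<rho> \<in> Pol (\<sigma> - 1)" for s \<rho>
      proof -
        obtain c where c0: "(\<forall>A. in_box m A \<longrightarrow> c A = 0) \<and> (\<forall>x. s * \<Theta> t x - \<rho> x = (\<Sum>A | size A \<le> D. c A * F A t x))"
          by (rule exE[OF koszF[OF s(1)]])
        have c: "\<And>A. in_box m A \<Longrightarrow> c A = 0" "\<And>x. s * \<Theta> t x - \<rho> x = (\<Sum>A | size A \<le> D. c A * F A t x)"
          using c0 by auto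
        obtain d where d: "\<forall>x. \<rho> x = (\<Sum>A | size A \<le> \<sigma> - 1. d A * F A t x)"
          by (rule exE[OF bspec[OF spn(2)[unfolded spn_def] s(2)]])
        have d': "\<rho> x = (\<Sum>A | size A \<le> D. (if size A \<le> \<sigma> - 1 \<and> True then d A else 0) * F A t x)" for x
          using extend[where E = "\<sigma> - 1" and P = "\<lambda>_. True" and c = d and f = "\<lambda>A. F A t x"] d[rule_format, of x] by (simp add: D_def)
        have "(\<Sum>A | size A \<le> D. (if A = corner m then s else 0) * F A t x) = s * \<Theta> t x" for x
        proof -
          have "(\<Sum>A | size A \<le> D. (if A = corner m then s else 0) * F A t x)
            = (\<Sum>A :: 'n multiset | size A \<le> D. if A = corner m then s * \<Theta> t x else 0)"
            by (intro sum.cong) (auto simp: \<Theta>F)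
          also have "\<dots> = s * \<Theta> t x" using szc by (subst sum.delta) (auto simp: D_def finD)
          finally show ?thesis .
        qed
        then have "(\<Sum>A | size A \<le> D. ((if A = corner m then s else 0) - (if size A \<le> \<sigma> - 1 \<and> True then d A else 0) - c A) * F A t x) = 0" for x
          using c(2)[of x] d'[of x] by (simp add: left_diff_distrib sum_subtractf)
        from ind'[OF this, of "corner m"] show ?thesis
          using szc \<sigma>1 c(1)[OF boxc] by (simp add: D_def)
      qed
      have main: "card Z + card {A :: 'n multiset. size A \<le> r} \<le> m ^ CARD('n)"
        if Z: "finite Z" "\<And>z i. z \<in> Z \<Longrightarrow> gsys m q t i z = 0" and h: "h \<in> Pol a"
          and G: "\<And>z i. z \<in> Z \<Longrightarrow> (gsys m q t i has_derivative (\<lambda>v. \<Sum>k\<in>UNIV. G z i k * v $ k)) (at z)"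
          and pos: "\<And>z. z \<in> Z \<Longrightarrow> h z * det (\<chi> i k. G z i k) > 0" for Z h G
      proof (rule ccontr)
        assume "\<not> card Z + card {A :: 'n multiset. size A \<le> r} \<le> m ^ CARD('n)"
        then have big: "m ^ CARD('n) < card Z + card {A :: 'n multiset. size A \<le> r}" by simp
        define dq where "dq i z e \<longleftrightarrow> (\<forall>k. e k \<in> Pol (m - 1)) \<and> (\<forall>k. (\<lambda>x. e k x - Tt i k t x) \<in> Pol (m - 2)) \<and>
          (\<forall>x. gsys m q t i x - gsys m q t i z = (\<Sum>k\<in>UNIV. e k x * (x $ k - z $ k)))" for i z e
        define e where "e i z = (SOME e. dq i z e)" for i z
        have "dq i z (e i z)" for i z
        proof -
          have "\<exists>e. dq i z e" unfolding dq_def by (rule has_dqD(2)[OF Tt_dq])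
          then show ?thesis unfolding e_def by (rule someI_ex)
        qed
        then have e: "\<And>i z k. e i z k \<in> Pol (m - 1)" "\<And>i z k. (\<lambda>x. e i z k x - Tt i k t x) \<in> Pol (m - 2)"
          "\<And>i z x. gsys m q t i x - gsys m q t i z = (\<Sum>k\<in>UNIV. e i z k x * (x $ k - z $ k))"
          by (simp_all add: dq_def)
        define \<Phi> where "\<Phi> z x = det (\<chi> i k. e i z k x)" for z x
        have \<Phi>_pol: "\<Phi> z \<in> Pol \<sigma>" for z unfolding \<Phi>_def[abs_def] \<sigma>_def by (intro Pol_det e)
        \<comment> \<open>The base point affects difference quotients only below the top degree, so
          all Bezoutians have the same residue as \<open>\<Theta> t\<close>.\<close>
        have \<Phi>_top: "(\<lambda>x. \<Phi> z x - \<Theta> t x) \<in> Pol (\<sigma> - 1)" for z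
        proof -
          have mm: "m - 1 = Suc (m - 2)" using m by simp
          show ?thesis unfolding \<Phi>_def \<Theta>_def \<sigma>_def mm
            by (rule Pol_det_diff) (use e has_dqD(1)[OF Tt_dq] in \<open>simp_all add: mm[symmetric]\<close>)
        qed
        have \<Phi>_coord: "(\<lambda>x. (x $ k - z $ k) * \<Phi> z x) \<in> ideal_upto m q t (\<sigma> + 1)" if "z \<in> Z" for z k
          unfolding \<Phi>_def \<sigma>_def
          by (rule bezout_ideal) (use m e(1) e(3)[of _ _ z] Z(2)[OF that] in auto)
        \<comment> \<open>Among the solutions, the Bezoutian at \<open>z\<close> is supported at
          \<open>z\<close>: at any other solution some coordinate factor in
          \<open>\<Phi>_coord\<close> is nonzero.\<close>
        have \<Phi>_zero: "\<Phi> z z' = 0" if "z \<in> Z" "z' \<in> Z" "z \<noteq> z'" for z z'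
        proof -
          obtain k where k: "z $ k \<noteq> z' $ k" using \<open>z \<noteq> z'\<close> by (auto simp: vec_eq_iff)
          have "(z' $ k - z $ k) * \<Phi> z z' = 0"
            using ideal_upto_zero[OF \<Phi>_coord[OF \<open>z \<in> Z\<close>, of k], of z'] Z(2)[OF \<open>z' \<in> Z\<close>] by blast
          with k show ?thesis by auto
        qed
        \<comment> \<open>Modulo the ideal, multiplication of the Bezoutian at \<open>z\<close> by
          \<open>w\<close> amounts to multiplication by the number \<open>w z\<close>.\<close>
        have \<Phi>_mult: "(\<lambda>x. (w x - w z) * \<Phi> z x) \<in> ideal_upto m q t D" if "z \<in> Z" "w \<in> Pol (a + r)" for z w
        proof -
          obtain S where "has_dq (a + r) w S" using has_dq_Pol[OF \<open>w \<in> _\<close>] by blast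
          from has_dqD(2)[OF this, of z] obtain b where b: "\<And>k. b k \<in> Pol (a + r - 1)"
            "\<And>x. w x - w z = (\<Sum>k\<in>UNIV. b k x * (x $ k - z $ k))" by blast
          have "(\<lambda>x. \<Sum>k\<in>UNIV. b k x * ((x $ k - z $ k) * \<Phi> z x)) \<in> ideal_upto m q t (\<sigma> + 1 + (a + r - 1))"
            by (intro ideal_upto_sum ideal_upto_mult b \<Phi>_coord \<open>z \<in> Z\<close>)
          moreover have "\<sigma> + 1 + (a + r - 1) = D" using r by (simp add: D_def)
          ultimately show ?thesis by (simp add: b(2) sum_distrib_right mult.assoc)
        qed
        define J where "J z = det (\<chi> i k. G z i k)" for z
        \<comment> \<open>On the diagonal the difference quotients are the partial derivatives, so
          the Bezoutian there is the Jacobian determinant.\<close>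
        have e_diag: "e i z k z = G z i k" if z: "z \<in> Z" for i z k
        proof -
          have "((\<lambda>x. e i z k x * (x $ k - z $ k)) has_derivative (\<lambda>v. e i z k z * v $ k)) (at z)" for k
          proof -
            obtain f' where "(e i z k has_derivative f') (at z)"
              using Pol_has_derivative[OF e(1)[of i z k]] by blast
            then have "((\<lambda>x. e i z k x * (x $ k - z $ k)) has_derivative
                (\<lambda>v. e i z k z * (v $ k - 0) + f' v * (z $ k - z $ k))) (at z)"
              by (intro has_derivative_mult has_derivative_diff has_derivative_const
                  bounded_linear_imp_has_derivative bounded_linear_vec_nth)
            then show ?thesis by simp
          qed
          then have "((\<lambda>x. \<Sum>k\<in>UNIV. e i z k x * (x $ k - z $ k)) has_derivative (\<lambda>v. \<Sum>k\<in>UNIV. e i z k z * v $ k)) (at z)"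
            by (intro has_derivative_sum)
          moreover have "(\<lambda>x. \<Sum>k\<in>UNIV. e i z k x * (x $ k - z $ k)) = gsys m q t i"
            using e(3)[of i _ z] Z(2)[OF z, of i] by (simp add: fun_eq_iff)
          ultimately have "(gsys m q t i has_derivative (\<lambda>v. \<Sum>k\<in>UNIV. e i z k z * v $ k)) (at z)" by simp
          from has_derivative_unique[OF this G[OF z]]
          have "(\<Sum>j\<in>UNIV. e i z j z * (axis k 1 :: real ^ 'n) $ j) = (\<Sum>j\<in>UNIV. G z i j * (axis k 1 :: real ^ 'n) $ j)"
            by (rule fun_cong)
          then show ?thesis by (simp add: axis_def if_distrib cong: if_cong)
        qed
        have \<Phi>_J: "\<Phi> z z = J z" if "z \<in> Z" for z
          unfolding \<Phi>_def J_def using e_diag[OF that] by simp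
        define BX where "BX = {A :: 'n multiset. in_box m A}"
        have BX_sub: "BX \<subseteq> {A. size A \<le> \<sigma>}" using size_le_card_box by (auto simp: BX_def \<sigma>_def)
        have finBX: "finite BX" by (rule finite_subset[OF BX_sub finD])
        define V where "V = {A :: 'n multiset. size A \<le> r}"
        have finV: "finite V" unfolding V_def by (rule finD)
        \<comment> \<open>Suppose there are more vectors than the dimension \<open>m ^ n\<close> of
          the quotient. The disjoint sum as index type counts Bezoutians and monomials separately
          whether or not some of the functions coincide.\<close>
        define \<phi> where "\<phi> s = (case s of Inl z \<Rightarrow> \<Phi> z | Inr A \<Rightarrow> mon A)" for s :: "(real ^ 'n) + 'n multiset"
        define S where "S = Inl ` Z \<union> Inr ` V"
        have finS: "finite S" using Z(1) finV by (simp add: S_def)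
        have "card S = card Z + card V"
          unfolding S_def using Z(1) finV by (subst card_Un_disjoint) (auto simp: card_image)
        then have cardS: "card BX < card S" using big by (simp add: BX_def card_box V_def)
        have r\<sigma>: "r < \<sigma>" using r by (simp add: \<sigma>_def)
        have "\<phi> s \<in> Pol \<sigma>" if "s \<in> S" for s
          using that \<Phi>_pol r\<sigma> by (auto simp: S_def \<phi>_def V_def intro!: Pol_mon)
        then have "\<forall>s\<in>S. \<exists>c. \<forall>x. \<phi> s x = (\<Sum>A | size A \<le> \<sigma>. c A * F A t x)"
          by (intro ballI bspec[OF spn(1)[unfolded spn_def]])
        from bchoice[OF this] obtain co where co': "\<forall>s\<in>S. \<forall>x. \<phi> s x = (\<Sum>A | size A \<le> \<sigma>. co s A * F A t x)"
          by (rule exE)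
        have co: "\<phi> s x = (\<Sum>A | size A \<le> \<sigma>. co s A * F A t x)" if "s \<in> S" for s x
          using spec[OF bspec[OF co' that]] .
        obtain \<kappa> where \<kappa>0: "(\<exists>s\<in>S. \<kappa> s \<noteq> 0) \<and> (\<forall>A\<in>BX. (\<Sum>s\<in>S. \<kappa> s * co s A) = 0)"
          by (rule exE[OF nontrivial_relation[OF finBX finS cardS, of co]])
        have \<kappa>: "\<exists>s\<in>S. \<kappa> s \<noteq> 0" "\<And>A. A \<in> BX \<Longrightarrow> (\<Sum>s\<in>S. \<kappa> s * co s A) = 0"
          using \<kappa>0 by auto
        have rel: "(\<lambda>x. \<Sum>s\<in>S. \<kappa> s * \<phi> s x) \<in> ideal_upto m q t \<sigma>"
        proof -
          have "(\<Sum>s\<in>S. \<kappa> s * \<phi> s x) = (\<Sum>A | size A \<le> \<sigma> \<and> \<not> in_box m A. (\<Sum>s\<in>S. \<kappa> s * co s A) * (mon (lowered m A) x * gsys m q t (pick m A) x))" for x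
          proof -
            have "(\<Sum>s\<in>S. \<kappa> s * \<phi> s x) = (\<Sum>s\<in>S. \<Sum>A | size A \<le> \<sigma>. \<kappa> s * co s A * F A t x)"
              by (intro sum.cong refl) (simp add: co sum_distrib_left mult.assoc)
            also have "\<dots> = (\<Sum>A | size A \<le> \<sigma>. (\<Sum>s\<in>S. \<kappa> s * co s A) * F A t x)"
              by (subst sum.swap) (simp add: sum_distrib_right)
            also have "\<dots> = (\<Sum>A | size A \<le> \<sigma> \<and> \<not> in_box m A. (\<Sum>s\<in>S. \<kappa> s * co s A) * F A t x)"
              using \<kappa>(2) by (intro sum.mono_neutral_right finD) (auto simp: BX_def)
            also have "\<dots> = (\<Sum>A | size A \<le> \<sigma> \<and> \<not> in_box m A. (\<Sum>s\<in>S. \<kappa> s * co s A) * (mon (lowered m A) x * gsys m q t (pick m A) x))"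
              by (intro sum.cong) (auto simp: F_def quot_basis_def)
            finally show ?thesis .
          qed
          moreover have "(\<lambda>x. \<Sum>A | size A \<le> \<sigma> \<and> \<not> in_box m A. (\<Sum>s\<in>S. \<kappa> s * co s A) * (mon (lowered m A) x * gsys m q t (pick m A) x)) \<in> ideal_upto m q t \<sigma>"
          proof (intro ideal_upto_sum ideal_upto_cmult ideal_upto_gen)
            fix A assume A: "A \<in> {A. size A \<le> \<sigma> \<and> \<not> in_box m A}"
            then have "size (lowered m A) + m = size A" using lowered[of m A] by (metis mem_Collect_eq size_replicate_mset size_union)
            then show "size (lowered m A) + m \<le> \<sigma>" using A by simp
          qed
          ultimately show ?thesis by simp
        qed
        \<comment> \<open>The relation says that a combination \<open>w\<close> of Bezoutians agrees
          modulo the ideal with a polynomial \<open>v\<close> of degree at most \<open>r\<close>.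
          Evaluation at a solution gives \<open>\<kappa> (Inl z) * J z = v z\<close>.\<close>
        define w where "w x = (\<Sum>z\<in>Z. \<kappa> (Inl z) * \<Phi> z x)" for x
        define v where "v x = - (\<Sum>A\<in>V. \<kappa> (Inr A) * mon A x)" for x
        have wv: "(\<lambda>x. w x - v x) \<in> ideal_upto m q t \<sigma>"
        proof -
          have "(\<Sum>s\<in>S. \<kappa> s * \<phi> s x) = w x - v x" for x
            unfolding S_def w_def v_def using Z(1) finV
            by (subst sum.union_disjoint) (auto simp: sum.reindex \<phi>_def)
          then show ?thesis using rel by simp
        qed
        have v_pol: "v \<in> Pol r"
          unfolding v_def[abs_def] by (intro Pol_uminus Pol_sum Pol_cmult Pol_mon) (simp add: V_def)
        have wz: "\<kappa> (Inl z) * J z = v z" if z: "z \<in> Z" for z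
        proof -
          have "w z - v z = 0" using ideal_upto_zero[OF wv, of z] Z(2)[OF z] by blast
          moreover have "w z = (\<Sum>z'\<in>Z. if z' = z then \<kappa> (Inl z) * J z else 0)"
            unfolding w_def using \<Phi>_zero z \<Phi>_J[OF z] by (intro sum.cong) auto
          ultimately show ?thesis using Z(1) z by simp
        qed
        \<comment> \<open>The residues of \<open>p * w\<close> and \<open>p * v\<close> agree. The
          first is \<open>s\<close>, because \<open>p\<close> acts on each Bezoutian by its value;
          the second is 0, because the degree is at most
          \<open>a + 2 * r < \<sigma>\<close>.\<close>
        define p where "p x = h x * v x" for x
        have p_pol: "p \<in> Pol (a + r)" unfolding p_def[abs_def] by (intro Pol_mult h v_pol)
        define s where "s = (\<Sum>z\<in>Z. \<kappa> (Inl z) * p z)"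
        define \<rho> where "\<rho> x = p x * v x - (\<Sum>z\<in>Z. \<kappa> (Inl z) * p z * (\<Phi> z x - \<Theta> t x))" for x
        have \<rho>_pol: "\<rho> \<in> Pol (\<sigma> - 1)"
        proof -
          have "(\<lambda>x. p x * v x) \<in> Pol (\<sigma> - 1)"
            by (rule Pol_mono[OF Pol_mult[OF p_pol v_pol]]) (use r in \<open>simp add: \<sigma>_def\<close>)
          then show ?thesis unfolding \<rho>_def[abs_def] by (intro Pol_diff Pol_sum Pol_cmult \<Phi>_top)
        qed
        have "s = 0"
        proof (rule top[OF _ \<rho>_pol])
          have 1: "(\<lambda>x. p x * (w x - v x)) \<in> ideal_upto m q t D"
            unfolding D_def by (rule ideal_upto_mult[OF p_pol wv])
          have 2: "(\<lambda>x. \<Sum>z\<in>Z. - \<kappa> (Inl z) * ((p x - p z) * \<Phi> z x)) \<in> ideal_upto m q t D"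
            by (intro ideal_upto_sum ideal_upto_cmult \<Phi>_mult p_pol)
          have "p x * (w x - v x) + (\<Sum>z\<in>Z. - \<kappa> (Inl z) * ((p x - p z) * \<Phi> z x)) = s * \<Theta> t x - \<rho> x" for x
            unfolding w_def s_def \<rho>_def
            by (simp add: algebra_simps sum_distrib_left sum_distrib_right sum_subtractf sum.distrib sum_negf)
          with ideal_upto_add[OF 1 2] show "(\<lambda>x. s * \<Theta> t x - \<rho> x) \<in> ideal_upto m q t D" by simp
        qed
        have J0: "J z \<noteq> 0" if "z \<in> Z" for z using pos[OF that] by (auto simp: J_def)
        \<comment> \<open>By the sign condition on \<open>h * J\<close> all terms of
          \<open>s\<close> are nonnegative: the form is definite on the Bezoutians but vanishes on
          \<open>v\<close>.\<close>
        have trm: "\<kappa> (Inl z) * p z = h z * J z * (v z / J z)\<^sup>2" if "z \<in> Z" for z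
        proof -
          have "\<kappa> (Inl z) = v z / J z" using wz[OF that] J0[OF that] by (simp add: field_simps)
          then show ?thesis using J0[OF that] by (simp add: p_def field_simps power2_eq_square)
        qed
        have nonneg: "\<kappa> (Inl z) * p z \<ge> 0" if "z \<in> Z" for z
          using trm[OF that] pos[OF that] by (simp add: J_def)
        have \<kappa>p: "\<kappa> (Inl z) * p z = 0" if "z \<in> Z" for z
          using \<open>s = 0\<close> sum_nonneg_eq_0_iff[OF Z(1), of "\<lambda>z. \<kappa> (Inl z) * p z"] nonneg that by (auto simp: s_def)
        have \<kappa>Z: "\<kappa> (Inl z) = 0" if "z \<in> Z" for z
        proof -
          have "h z \<noteq> 0" using pos[OF that] by auto
          then have "\<kappa> (Inl z) = 0 \<or> v z = 0" using \<kappa>p[OF that] by (simp add: p_def)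
          then show ?thesis using wz[OF that] J0[OF that] by auto
        qed
        then have w0: "w x = 0" for x by (simp add: w_def)
        \<comment> \<open>What remains is a combination of low-degree monomials in the ideal.
          Because of \<open>r \<le> m - 1\<close> and \<open>r < \<sigma>\<close> these lie in the
          box and differ from the corner, so they are basis members, and members of the ideal have
          coefficient 0 there.\<close>
        have "(\<lambda>x. - v x) \<in> ideal_upto m q t D"
          using ideal_upto_mono[OF wv, of D] by (simp add: w0 D_def)
        from koszF[OF this] obtain c where c0: "(\<forall>A. in_box m A \<longrightarrow> c A = 0) \<and> (\<forall>x. - v x = (\<Sum>A | size A \<le> D. c A * F A t x))"
          by (rule exE)
        have c: "\<And>A. in_box m A \<Longrightarrow> c A = 0" "\<And>x. - v x = (\<Sum>A | size A \<le> D. c A * F A t x)"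
          using c0 by auto
        have V_box: "in_box m A" "A \<noteq> corner m" if "A \<in> V" for A
        proof -
          have "count A i < m" for i
          proof -
            have "count A i \<le> size A" by (rule count_le_size)
            then show ?thesis using that r m by (simp add: V_def)
          qed
          then show "in_box m A" by (simp add: in_box_def)
          show "A \<noteq> corner m" using that szc r\<sigma> by (auto simp: V_def)
        qed
        have "- v x = (\<Sum>A | size A \<le> r \<and> True. \<kappa> (Inr A) * F A t x)" for x
          unfolding v_def using V_box by (auto simp: V_def F_def quot_basis_def intro!: sum.cong)
        then have v_exp: "- v x = (\<Sum>A | size A \<le> D. (if size A \<le> r \<and> True then \<kappa> (Inr A) else 0) * F A t x)" for x
          using extend[where E = r and P = "\<lambda>_. True" and c = "\<lambda>A. \<kappa> (Inr A)" and f = "\<lambda>A. F A t x"] r\<sigma> by (simp add: D_def)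
        have "(\<Sum>A | size A \<le> D. (c A - (if size A \<le> r \<and> True then \<kappa> (Inr A) else 0)) * F A t x) = 0" for x
          using c(2)[of x] v_exp[of x] by (simp add: left_diff_distrib sum_subtractf)
        from ind'[OF this] have "\<kappa> (Inr A) = 0" if "A \<in> V" for A
          using c(1)[OF V_box(1)[OF that]] that r\<sigma> by (force simp: V_def D_def)
        with \<kappa>Z \<kappa>(1) show False by (auto simp: S_def)
      qed
      from 1 obtain Z h G where *: "finite Z" "\<forall>z\<in>Z. \<forall>i. gsys m q t i z = 0" "h \<in> Pol a"
        "\<forall>z\<in>Z. \<forall>i. (gsys m q t i has_derivative (\<lambda>v. \<Sum>k\<in>UNIV. G z i k * v $ k)) (at z)"
        "\<forall>z\<in>Z. h z * det (\<chi> i k. G z i k) > 0"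
        "\<not> card Z + card {A :: 'n multiset. size A \<le> r} \<le> m ^ CARD('n)"
        unfolding mem_Collect_eq not_all not_imp by (elim exE conjE)
      have "card Z + card {A :: 'n multiset. size A \<le> r} \<le> m ^ CARD('n)"
        using *(2,4,5) by (intro main[OF *(1) _ *(3), of G]) simp_all
      with *(6) show False by simp
    qed
  qed
qed

section \<open>Regular values\<close>

text \<open>The library states Sard's theorem for well-ordered index types only; \<open>'a wo\<close> is a copy of
  the finite type \<open>'a\<close> with an arbitrary well-ordering.\<close>

typedef 'a wo = "UNIV :: 'a set" ..

instance wo :: (finite) finite
proof
  have "(UNIV :: 'a wo set) = range Abs_wo" by (metis Abs_wo_cases surj_def)
  then show "finite (UNIV :: 'a wo set)" by (metis finite finite_imageI)
qed

definition wo_index :: "'a::finite wo \<Rightarrow> nat" where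
  "wo_index = (SOME f. inj f)"

lemma inj_wo_index: "inj (wo_index :: 'a::finite wo \<Rightarrow> nat)"
proof -
  have "\<exists>f :: 'a wo \<Rightarrow> nat. inj f"
    using finite_imp_inj_to_nat_seg[OF finite[of "UNIV :: 'a wo set"]] by blast
  then show ?thesis unfolding wo_index_def by (rule someI_ex)
qed

instantiation wo :: (finite) wellorder
begin
definition less_eq_wo :: "'a wo \<Rightarrow> 'a wo \<Rightarrow> bool" where "less_eq_wo x y \<longleftrightarrow> wo_index x \<le> wo_index y"
definition less_wo :: "'a wo \<Rightarrow> 'a wo \<Rightarrow> bool" where "less_wo x y \<longleftrightarrow> wo_index x < wo_index y"
instance
proof
  fix P :: "'a wo \<Rightarrow> bool" and a
  assume IH: "\<And>x. (\<And>y. y < x \<Longrightarrow> P y) \<Longrightarrow> P x"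
  show "P a"
  proof (induction a rule: measure_induct_rule[of wo_index])
    case (less x)
    show ?case by (rule IH) (rule less, simp add: less_wo_def)
  qed
qed (auto simp: less_eq_wo_def less_wo_def dest: injD[OF inj_wo_index])
end

section \<open>Critical values and second-order conditions at an extremum\<close>

lemma has_derivative_vec_lambda:
  assumes "\<And>i. ((\<lambda>x. f i x) has_derivative f' i) (at a within S)"
  shows "((\<lambda>x. (\<chi> i. f i x) :: real ^ 'n) has_derivative (\<lambda>v. \<chi> i. f' i v)) (at a within S)"
  by (subst has_derivative_componentwise_within) (auto simp: Basis_vec_def inner_axis assms)

text \<open>The maps \<open>\<phi>\<close> and \<open>\<psi>\<close> only rename coordinates.
  Singularity is passed on as failure of injectivity, which survives the renaming and yields the
  rank condition of \<open>baby_Sard\<close>.\<close>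

lemma sard_negligible:
  fixes g :: "real ^ 'n::finite \<Rightarrow> real ^ 'n" and A :: "real ^ 'n \<Rightarrow> real ^ 'n ^ 'n"
  assumes der: "\<And>x. (g has_derivative (\<lambda>v. A x *v v)) (at x)"
  shows "negligible (g ` {x. det (A x) = 0})"
proof -
  define \<phi> :: "real ^ 'n \<Rightarrow> real ^ 'n wo" where "\<phi> x = (\<chi> i. x $ Rep_wo i)" for x
  define \<psi> :: "real ^ 'n wo \<Rightarrow> real ^ 'n" where "\<psi> x = (\<chi> i. x $ Abs_wo i)" for x
  have \<psi>\<phi>: "\<psi> (\<phi> x) = x" for x by (simp add: \<phi>_def \<psi>_def Abs_wo_inverse vec_eq_iff)
  have \<phi>\<psi>: "\<phi> (\<psi> x) = x" for x by (simp add: \<phi>_def \<psi>_def Rep_wo_inverse vec_eq_iff)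
  have lin: "linear \<phi>" "linear \<psi>"
    by (auto intro!: linearI simp: \<phi>_def \<psi>_def vec_eq_iff)
  then have bl: "bounded_linear \<phi>" "bounded_linear \<psi>" by (simp_all add: linear_conv_bounded_linear)
  define S where "S = {x. det (A x) = 0}"
  define F where "F y = \<phi> (g (\<psi> y))" for y
  define F' where "F' y v = \<phi> (A (\<psi> y) *v \<psi> v)" for y v
  have "negligible (F ` (\<phi> ` S))"
  proof (rule baby_Sard)
    show "CARD('n wo) \<le> CARD('n wo)" by simp
    fix y assume "y \<in> \<phi> ` S"
    have "(\<psi> has_derivative \<psi>) (at y)" by (rule bounded_linear_imp_has_derivative[OF bl(2)])
    from has_derivative_compose[OF this der[of "\<psi> y"]]
    have "((\<lambda>y. g (\<psi> y)) has_derivative (\<lambda>v. A (\<psi> y) *v \<psi> v)) (at y)" .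
    from bounded_linear.has_derivative[OF bl(1) this]
    have F': "(F has_derivative F' y) (at y)" unfolding F_def[abs_def] F'_def[abs_def] .
    then show "(F has_derivative F' y) (at y within \<phi> ` S)" by (rule has_derivative_at_withinI)
    have "det (A (\<psi> y)) = 0" using \<open>y \<in> \<phi> ` S\<close> by (auto simp: S_def \<psi>\<phi>)
    then have "rank (A (\<psi> y)) < CARD('n)" using det_eq_0_rank by blast
    then have "\<not> inj ((*v) (A (\<psi> y)))" by (simp add: less_rank_noninjective)
    then obtain u w where uw: "u \<noteq> w" "A (\<psi> y) *v u = A (\<psi> y) *v w" by (auto simp: inj_def)
    have "matrix (F' y) *v \<phi> u = matrix (F' y) *v \<phi> w"
    proof -
      have "(\<lambda>x. matrix (F' y) *v x) = F' y"
        by (rule matrix_vector_mul) (rule has_derivative_bounded_linear[OF F'])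
      then show ?thesis using uw by (simp add: fun_eq_iff F'_def \<psi>\<phi>)
    qed
    moreover have "\<phi> u \<noteq> \<phi> w" using uw(1) \<psi>\<phi> by metis
    ultimately have "\<not> inj ((*v) (matrix (F' y)))" by (auto simp: inj_def)
    then show "rank (matrix (F' y)) < CARD('n wo)" by (simp add: less_rank_noninjective)
  qed
  then have "negligible (\<psi> ` F ` \<phi> ` S)"
  proof (rule negligible_differentiable_image_negligible[rotated])
    have "range (Rep_wo :: 'n wo \<Rightarrow> 'n) = UNIV" by (metis Abs_wo_inverse UNIV_I surj_def)
    then have "card (range (Rep_wo :: 'n wo \<Rightarrow> 'n)) = CARD('n)" by simp
    moreover have "inj (Rep_wo :: 'n wo \<Rightarrow> 'n)" by (meson Rep_wo_inject injI)
    ultimately have "CARD('n wo) = CARD('n)" by (metis card_image)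
    then show "DIM(real ^ 'n wo) \<le> DIM(real ^ 'n)" by simp
    show "\<psi> differentiable_on F ` \<phi> ` S" by (rule linear_imp_differentiable_on[OF lin(2)])
  qed
  moreover have "\<psi> ` F ` \<phi> ` S = g ` S" by (auto simp: F_def \<psi>\<phi> image_iff)
  ultimately show ?thesis by (simp add: S_def)
qed

text \<open>On the segment from the identity matrix to \<open>A\<close> the quadratic form is
  positive definite except possibly at \<open>A\<close> itself, so the determinant never vanishes
  and keeps the sign that it has at the identity. Symmetry of \<open>A\<close> is not
  involved.\<close>

lemma det_pos_if_nonneg_definite:
  fixes A :: "real ^ 'n ^ 'n"
  assumes nonneg: "\<And>v. 0 \<le> v \<bullet> (A *v v)" and nz: "det A \<noteq> 0"
  shows "det A > 0"
proof (rule ccontr)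
  assume "\<not> det A > 0"
  define B where "B \<tau> = (\<chi> i j. (1 - \<tau>) * mat 1 $ i $ j + \<tau> * A $ i $ j)" for \<tau> :: real
  have B_mult: "B \<tau> *v v = (1 - \<tau>) *\<^sub>R v + \<tau> *\<^sub>R (A *v v)" for \<tau> v
  proof -
    have "B \<tau> = (1 - \<tau>) *\<^sub>R mat 1 + \<tau> *\<^sub>R A" by (simp add: B_def vec_eq_iff)
    then show ?thesis
      by (simp add: matrix_vector_mult_add_rdistrib scaleR_matrix_vector_assoc[symmetric])
  qed
  have nz: "det (B \<tau>) \<noteq> 0" if "0 \<le> \<tau>" "\<tau> \<le> 1" for \<tau>
  proof (cases "\<tau> = 1")
    case True
    have "B 1 = A" by (simp add: B_def vec_eq_iff)
    with True nz show ?thesis by simp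
  next
    case False
    have "inj ((*v) (B \<tau>))"
    proof (rule injI)
      fix x y assume "B \<tau> *v x = B \<tau> *v y"
      then have "B \<tau> *v (x - y) = 0" by (simp add: matrix_vector_mult_diff_distrib)
      then have "(x - y) \<bullet> (B \<tau> *v (x - y)) = 0" by simp
      then have "(1 - \<tau>) * ((x - y) \<bullet> (x - y)) + \<tau> * ((x - y) \<bullet> (A *v (x - y))) = 0"
        unfolding B_mult by (simp add: inner_add_right)
      moreover have "\<tau> * ((x - y) \<bullet> (A *v (x - y))) \<ge> 0" using nonneg that by simp
      moreover have "(1 - \<tau>) * ((x - y) \<bullet> (x - y)) \<ge> 0" using that by simp
      ultimately have "(1 - \<tau>) * ((x - y) \<bullet> (x - y)) = 0" by linarith
      then show "x = y" using False by simp
    qed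
    then show ?thesis
      by (metis det_eq_0_rank less_rank_noninjective)
  qed
  have "continuous_on {0..1} (\<lambda>\<tau>. det (B \<tau>))"
    unfolding det_def B_def by (intro continuous_intros)
  moreover have "B 0 = mat 1" "B 1 = A" by (simp_all add: B_def vec_eq_iff)
  ultimately obtain \<tau> where "0 \<le> \<tau>" "\<tau> \<le> 1" "det (B \<tau>) = 0"
    using IVT2'[of "\<lambda>\<tau>. det (B \<tau>)" 1 0 0] \<open>\<not> det A > 0\<close> by auto
  with nz show False by blast
qed

lemma has_real_derivative_line:
  fixes a :: "'n::finite \<Rightarrow> real" and v :: "real ^ 'n"
  assumes "(\<phi> has_derivative (\<lambda>h. \<Sum>k\<in>UNIV. a k * (h *\<^sub>R v) $ k)) (at \<tau>)"
  shows "(\<phi> has_real_derivative (\<Sum>k\<in>UNIV. a k * v $ k)) (at \<tau>)"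
proof -
  have "(\<lambda>h. \<Sum>k\<in>UNIV. a k * (h *\<^sub>R v) $ k) = (*) (\<Sum>k\<in>UNIV. a k * v $ k)"
    by (auto simp: fun_eq_iff sum_distrib_right intro!: sum.cong)
  then show ?thesis using assms by (simp add: has_field_derivative_def)
qed

text \<open>Were the second derivative along \<open>v\<close> positive, the first derivative, which
  is 0 at \<open>z\<close>, would be positive just after it, and the mean value theorem would give
  larger values of \<open>Q\<close> on the line.\<close>

lemma second_order_max:
  fixes Q :: "real ^ 'n \<Rightarrow> real"
  assumes S: "open S" "z \<in> S" and max: "\<And>y. y \<in> S \<Longrightarrow> Q y \<le> Q z"
    and dQ: "\<And>x. (Q has_derivative (\<lambda>v. \<Sum>k\<in>UNIV. d k x * v $ k)) (at x)"
    and dd: "\<And>k. (d k has_derivative (\<lambda>v. \<Sum>i\<in>UNIV. H k i * v $ i)) (at z)"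
  shows "(\<Sum>k\<in>UNIV. (\<Sum>i\<in>UNIV. H k i * v $ i) * v $ k) \<le> 0"
proof (rule ccontr)
  assume neg: "\<not> ?thesis"
  have "(\<lambda>v. \<Sum>k\<in>UNIV. d k z * v $ k) = (\<lambda>v. 0)"
    by (rule differential_zero_maxmin[OF S(2,1) dQ]) (use max in auto)
  then have d0: "(\<Sum>k\<in>UNIV. d k z * v $ k) = 0" by meson
  define \<phi> where "\<phi> \<tau> = Q (z + \<tau> *\<^sub>R v)" for \<tau>
  define \<phi>' where "\<phi>' \<tau> = (\<Sum>k\<in>UNIV. d k (z + \<tau> *\<^sub>R v) * v $ k)" for \<tau>
  have line: "((\<lambda>\<tau>. z + \<tau> *\<^sub>R v) has_derivative (\<lambda>h. h *\<^sub>R v)) (at \<tau>)" for \<tau> :: real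
    by (auto intro!: derivative_eq_intros)
  have d\<phi>: "(\<phi> has_real_derivative \<phi>' \<tau>) (at \<tau>)" for \<tau>
  proof -
    from has_derivative_compose[OF line dQ]
    have "(\<phi> has_derivative (\<lambda>h. \<Sum>k\<in>UNIV. d k (z + \<tau> *\<^sub>R v) * (h *\<^sub>R v) $ k)) (at \<tau>)"
      unfolding \<phi>_def[abs_def] .
    then show ?thesis unfolding \<phi>'_def by (rule has_real_derivative_line)
  qed
  have dd\<phi>: "(\<phi>' has_real_derivative (\<Sum>k\<in>UNIV. (\<Sum>i\<in>UNIV. H k i * v $ i) * v $ k)) (at 0)"
  proof -
    have "((\<lambda>\<tau>. d k (z + \<tau> *\<^sub>R v)) has_real_derivative (\<Sum>i\<in>UNIV. H k i * v $ i)) (at 0)" for k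
    proof -
      have "(d k has_derivative (\<lambda>v. \<Sum>i\<in>UNIV. H k i * v $ i)) (at (z + 0 *\<^sub>R v))" using dd by simp
      from has_derivative_compose[OF line this]
      show ?thesis by (rule has_real_derivative_line)
    qed
    then show ?thesis unfolding \<phi>'_def[abs_def]
      by (intro DERIV_sum DERIV_cmult_right)
  qed
  obtain \<delta> where \<delta>: "\<delta> > 0" "\<And>h. 0 < h \<Longrightarrow> h < \<delta> \<Longrightarrow> \<phi>' 0 < \<phi>' (0 + h)"
    using DERIV_pos_inc_right[OF dd\<phi>] neg by auto
  have "\<phi>' 0 = 0" by (simp add: \<phi>'_def d0)
  have "((\<lambda>\<tau>. z + \<tau> *\<^sub>R v) \<longlongrightarrow> z) (at 0)" by (auto intro!: tendsto_eq_intros)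
  from topological_tendstoD[OF this S]
  have "eventually (\<lambda>\<tau>. z + \<tau> *\<^sub>R v \<in> S) (at 0)" .
  then obtain e where e: "e > 0" "\<And>\<tau>. \<tau> \<noteq> 0 \<Longrightarrow> \<bar>\<tau>\<bar> < e \<Longrightarrow> z + \<tau> *\<^sub>R v \<in> S"
    by (auto simp: eventually_at dist_real_def)
  define h where "h = min (\<delta> / 2) (e / 2)"
  have h: "0 < h" "h < \<delta>" "h < e" using \<delta> e by (auto simp: h_def)
  obtain \<xi> where \<xi>: "0 < \<xi>" "\<xi> < h" "\<phi> h - \<phi> 0 = (h - 0) * \<phi>' \<xi>"
    using MVT2[of 0 h \<phi> \<phi>'] d\<phi> h by blast
  have "\<phi>' \<xi> > 0" using \<delta>(2)[of \<xi>] \<xi> h \<open>\<phi>' 0 = 0\<close> by simp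
  then have "\<phi> h > \<phi> 0" using \<xi> h by (smt (verit) mult_pos_pos)
  moreover have "\<phi> h \<le> \<phi> 0" using max[OF e(2)[of h]] h by (simp add: \<phi>_def)
  ultimately show False by simp
qed

lemma Pol_scaled_mon: "mon A (c *\<^sub>R x) = c ^ size A * mon A x"
  by (induction A) auto

text \<open>The operator multiplies the homogeneous part of degree \<open>l\<close> by
  \<open>D - l\<close> and hence removes the part of degree \<open>D\<close>.\<close>

lemma Pol_euler:
  assumes f: "f \<in> Pol D" and df: "\<And>x. (f has_derivative (\<lambda>v. \<Sum>k\<in>UNIV. f' k x * v $ k)) (at x)"
  shows "(\<lambda>x. real D * f x - (\<Sum>k\<in>UNIV. f' k x * x $ k)) \<in> Pol (D - 1)"
proof -
  obtain c where c: "\<And>x. f x = (\<Sum>A | size A \<le> D. c A * mon A x)" using f by (auto simp: Pol_def)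
  have eul: "(\<Sum>k\<in>UNIV. f' k x * x $ k) = (\<Sum>A | size A \<le> D. c A * (real (size A) * mon A x))" for x
  proof -
    have "((\<lambda>\<tau>. \<tau> *\<^sub>R x) has_derivative (\<lambda>h. h *\<^sub>R x)) (at 1)" by (auto intro!: derivative_eq_intros)
    moreover have "(f has_derivative (\<lambda>v. \<Sum>k\<in>UNIV. f' k x * v $ k)) (at (1 *\<^sub>R x))" using df by simp
    ultimately have "((\<lambda>\<tau>. f (\<tau> *\<^sub>R x)) has_derivative (\<lambda>h. \<Sum>k\<in>UNIV. f' k x * (h *\<^sub>R x) $ k)) (at 1)"
      by (rule has_derivative_compose)
    then have "((\<lambda>\<tau>. f (\<tau> *\<^sub>R x)) has_real_derivative (\<Sum>k\<in>UNIV. f' k x * x $ k)) (at 1)"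
      by (rule has_real_derivative_line)
    moreover have "((\<lambda>\<tau>. f (\<tau> *\<^sub>R x)) has_real_derivative (\<Sum>A | size A \<le> D. c A * (real (size A) * mon A x))) (at 1)"
      unfolding c Pol_scaled_mon
      by (auto intro!: derivative_eq_intros sum.cong)
    ultimately show ?thesis by (rule DERIV_unique)
  qed
  have "(\<lambda>x. (c A * real (D - size A)) * mon A x) \<in> Pol (D - 1)" if "size A \<le> D" for A
  proof (cases "size A = D")
    case False
    with that have "size A \<le> D - 1" by simp
    then show ?thesis by (intro Pol_cmult Pol_mon)
  qed (simp add: Pol_0)
  then have "(\<lambda>x. \<Sum>A | size A \<le> D. (c A * real (D - size A)) * mon A x) \<in> Pol (D - 1)"
    by (intro Pol_sum) simp
  moreover have "(\<Sum>A | size A \<le> D. (c A * real (D - size A)) * mon A x) = real D * f x - (\<Sum>k\<in>UNIV. f' k x * x $ k)" for x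
    unfolding eul c sum_distrib_left sum_subtractf[symmetric]
    by (intro sum.cong) (auto simp: of_nat_diff algebra_simps)
  ultimately show ?thesis by simp
qed

lemma Pol_continuous_on: "f \<in> Pol D \<Longrightarrow> continuous_on S f"
proof -
  assume "f \<in> Pol D"
  from exE[OF Pol_has_derivative[OF this]]
  obtain f' where "(\<forall>k. f' k \<in> Pol (D - 1)) \<and> (\<forall>x. (f has_derivative (\<lambda>v. \<Sum>k\<in>UNIV. f' k x * v $ k)) (at x))"
    by blast
  then show ?thesis
    by (meson continuous_at_imp_continuous_on has_derivative_continuous)
qed

lemma sum_power_bound:
  assumes "norm (x :: real ^ 'n) \<le> 1"
  shows "\<bar>\<Sum>i\<in>UNIV. x $ i ^ k\<bar> \<le> CARD('n)"
proof -
  have "\<bar>\<Sum>i\<in>UNIV. x $ i ^ k\<bar> \<le> (\<Sum>i\<in>UNIV. \<bar>x $ i ^ k\<bar>)" by (rule sum_abs)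
  also have "\<dots> \<le> (\<Sum>i\<in>(UNIV :: 'n set). 1)"
  proof (rule sum_mono)
    fix i
    have "\<bar>x $ i\<bar> \<le> 1" using component_le_norm_cart[of x i] assms by linarith
    then show "\<bar>x $ i ^ k\<bar> \<le> 1" by (simp add: power_abs power_le_one)
  qed
  finally show ?thesis by simp
qed

text \<open>If every \<open>U j\<close> contains a point where \<open>\<bar>P\<bar>\<close> exceeds its bound on the boundary, then so does a
  small generic perturbation of \<open>P\<close>, which therefore has a nondegenerate extremum in each \<open>U j\<close>.
  In even dimension the Hessian determinant is positive at both kinds of extrema; in odd dimension
  the signs are corrected by a polynomial which agrees with \<open>- P\<close> at the critical points and has
  degree \<open>m\<close> by Euler's identity.\<close>

lemma bad_pieces_bound:
  fixes P :: "real ^ 'n::finite \<Rightarrow> real" and U :: "'i \<Rightarrow> (real ^ 'n) set"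
  assumes P: "P \<in> Pol (m + 1)" and m: "m \<ge> 2" and I: "finite I"
    and U: "\<And>j. j \<in> I \<Longrightarrow> compact (U j)" "\<And>j. j \<in> I \<Longrightarrow> U j \<subseteq> cball 0 1" "disjoint_family_on U I"
    and fr: "\<And>j x. j \<in> I \<Longrightarrow> x \<in> frontier (U j) \<Longrightarrow> \<bar>P x\<bar> \<le> \<delta>"
    and bad: "\<And>j. j \<in> I \<Longrightarrow> \<exists>x\<in>U j. \<bar>P x\<bar> > \<delta>" and \<delta>: "\<delta> \<ge> 0"
    and r: "1 \<le> r" "r \<le> m - 1" "2 * r + a < CARD('n) * (m - 1)" and a: "even CARD('n) \<or> a = m"
  shows "card I + card {A :: 'n multiset. size A \<le> r} \<le> m ^ CARD('n)"
proof -
  have "\<forall>j\<in>I. \<exists>x. x \<in> U j \<and> \<bar>P x\<bar> > \<delta>" using bad by blast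
  from bchoice[OF this] obtain p where p: "\<And>j. j \<in> I \<Longrightarrow> p j \<in> U j" "\<And>j. j \<in> I \<Longrightarrow> \<bar>P (p j)\<bar> > \<delta>"
    by blast
  define \<epsilon> where "\<epsilon> j = (if P (p j) > 0 then 1 else - 1 :: real)" for j
  have \<epsilon>: "\<epsilon> j * P (p j) > \<delta>" if "j \<in> I" for j
    using p(2)[OF that] by (auto simp: \<epsilon>_def)
  have \<epsilon>1: "\<epsilon> j = 1 \<or> \<epsilon> j = - 1" for j by (auto simp: \<epsilon>_def)
  \<comment> \<open>The least excess over \<open>\<delta>\<close>; the element 1 keeps the minimum
    defined for empty \<open>I\<close>.\<close>
  define \<gamma> where "\<gamma> = Min (insert 1 ((\<lambda>j. \<epsilon> j * P (p j) - \<delta>) ` I))"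
  have "\<gamma> > 0" unfolding \<gamma>_def using I \<epsilon> by (subst Min_gr_iff) auto
  have \<gamma>: "\<epsilon> j * P (p j) \<ge> \<delta> + \<gamma>" if "j \<in> I" for j
  proof -
    have "\<gamma> \<le> \<epsilon> j * P (p j) - \<delta>" unfolding \<gamma>_def using I that by (intro Min_le) auto
    then show ?thesis by simp
  qed
  \<comment> \<open>Passing from \<open>P\<close> to \<open>Q\<close> costs at most
    \<open>2 * \<eta>\<close> both at the large value and on the boundary, so
    \<open>4 * \<eta> < \<gamma>\<close> forces the maximum into the interior.\<close>
  define \<eta> where "\<eta> = \<gamma> / 5"
  have "\<eta> > 0" using \<open>\<gamma> > 0\<close> by (simp add: \<eta>_def)
  obtain p1 where p1: "(\<forall>k. p1 k \<in> Pol m) \<and> (\<forall>x. (P has_derivative (\<lambda>v. \<Sum>k\<in>UNIV. p1 k x * v $ k)) (at x))"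
    using exE[OF Pol_has_derivative[OF P]] by auto
  have "\<forall>k. \<exists>h. (\<forall>i. h i \<in> Pol (m - 1)) \<and> (\<forall>x. (p1 k has_derivative (\<lambda>v. \<Sum>i\<in>UNIV. h i x * v $ i)) (at x))"
    using p1 Pol_has_derivative by blast
  from choice[OF this] obtain p2 where
    p2: "\<forall>k. (\<forall>i. p2 k i \<in> Pol (m - 1)) \<and> (\<forall>x. (p1 k has_derivative (\<lambda>v. \<Sum>i\<in>UNIV. p2 k i x * v $ i)) (at x))"
    by (rule exE)
  define H where "H t k i x = t * p2 k i x + (if i = k then real m * x $ k ^ (m - 1) else 0)" for t k i x
  have dg: "((\<lambda>x. t * (p1 k x + b) + x $ k ^ m) has_derivative (\<lambda>v. \<Sum>i\<in>UNIV. H t k i x * v $ i)) (at x)" for t b k x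
  proof -
    have 1: "((\<lambda>x. t * (p1 k x + b)) has_derivative (\<lambda>v. t * (\<Sum>i\<in>UNIV. p2 k i x * v $ i))) (at x)"
      using p2 by (auto intro!: derivative_eq_intros)
    have 2: "((\<lambda>x. x $ k ^ m) has_derivative (\<lambda>v. real m * x $ k ^ (m - 1) * v $ k)) (at x)"
      by (auto intro!: derivative_eq_intros bounded_linear_imp_has_derivative bounded_linear_vec_nth)
    have "t * (\<Sum>i\<in>UNIV. p2 k i x * v $ i) + real m * x $ k ^ (m - 1) * v $ k = (\<Sum>i\<in>UNIV. H t k i x * v $ i)" for v
    proof -
      have "(\<Sum>i\<in>UNIV. H t k i x * v $ i)
        = (\<Sum>i\<in>UNIV. t * (p2 k i x * v $ i) + (if i = k then real m * x $ k ^ (m - 1) * v $ k else 0))"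
        by (intro sum.cong) (auto simp: H_def algebra_simps)
      then show ?thesis by (simp add: sum.distrib sum_distrib_left)
    qed
    then show ?thesis using has_derivative_add[OF 1 2] by simp
  qed
  define g where "g t b x = (\<chi> k. t * (p1 k x + b) + x $ k ^ m)" for t b x
  \<comment> \<open>Countably many parameters, so that one shift can avoid the critical values for
    all of them; they are unbounded, so that arbitrarily large ones escape the finite exceptional
    set of \<open>count_solutions\<close>.\<close>
  define t where "t N = real (Suc N)" for N
  have t: "t N > 0" for N by (simp add: t_def)
  \<comment> \<open>The critical values of the gradient of \<open>P\<close> perturbed by
    \<open>x $ k ^ m / t N\<close>. A solution of the final system with singular derivative would
    make \<open>b'\<close> one of them.\<close>
  define S where "S N = (\<lambda>x. (1 / t N) *\<^sub>R (\<chi> k. t N * (p1 k x + 0) + x $ k ^ m)) ` {x. det ((1 / t N) *\<^sub>R (\<chi> k i. H (t N) k i x)) = 0}" for N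
  have "negligible (S N)" for N
    unfolding S_def
  proof (rule sard_negligible)
    fix x
    have "((\<lambda>x. (\<chi> k. t N * (p1 k x + 0) + x $ k ^ m) :: real ^ 'n) has_derivative (\<lambda>v. \<chi> k. \<Sum>i\<in>UNIV. H (t N) k i x * v $ i)) (at x)"
      by (intro has_derivative_vec_lambda dg)
    note has_derivative_scaleR_right[OF this, of "1 / t N"]
    moreover have "(\<lambda>v. (1 / t N) *\<^sub>R (\<chi> k. \<Sum>i\<in>UNIV. H (t N) k i x * v $ i))
        = (*v) ((1 / t N) *\<^sub>R (\<chi> k i. H (t N) k i x))"
      by (rule ext) (simp add: matrix_vector_mult_def vec_eq_iff sum_divide_distrib)
    ultimately show "((\<lambda>x. (1 / t N) *\<^sub>R (\<chi> k. t N * (p1 k x + 0) + x $ k ^ m) :: real ^ 'n) has_derivative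
        (*v) ((1 / t N) *\<^sub>R (\<chi> k i. H (t N) k i x))) (at x)"
      by (simp only:)
  qed
  then have "negligible (\<Union>N. S N)" by (intro negligible_countable_Union) auto
  moreover have "\<not> negligible (ball 0 \<eta> :: (real ^ 'n) set)"
    using \<open>\<eta> > 0\<close> by (intro open_not_negligible) auto
  ultimately have "\<not> ball 0 \<eta> \<subseteq> (\<Union>N. S N)" using negligible_subset by blast
  then obtain b' where "b' \<in> ball 0 \<eta>" "b' \<notin> (\<Union>N. S N)" by blast
  then have b': "norm b' < \<eta>" "\<And>N. b' \<notin> S N" by auto
  define b where "b = - b'"
  define q where "q k x = p1 k x + b $ k" for k x
  have q: "q k \<in> Pol m" for k unfolding q_def[abs_def] using p1 by (intro Pol_add Pol_const) auto
  have g_eq: "gsys m q t k x = t * (p1 k x + b $ k) + x $ k ^ m" for t k x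
    by (simp add: gsys_def q_def)
  have dgs: "(gsys m q t k has_derivative (\<lambda>v. \<Sum>i\<in>UNIV. H t k i x * v $ i)) (at x)" for t k x
    unfolding g_eq[abs_def] by (rule dg)
  have nondeg: "det (\<chi> k i. H (t N) k i x) \<noteq> 0" if z: "\<And>k. gsys m q (t N) k x = 0" for x N
  proof
    assume d0: "det (\<chi> k i. H (t N) k i x) = 0"
    have "(1 / t N) *\<^sub>R (\<chi> k i. H (t N) k i x) = (\<chi> k. (1 / t N) *s (\<chi> k i. H (t N) k i x) $ k)"
      by (simp add: vec_eq_iff)
    then have "det ((1 / t N) *\<^sub>R (\<chi> k i. H (t N) k i x)) = 0"
      using d0 by (simp add: det_rows_mul)
    moreover have "b' = (1 / t N) *\<^sub>R (\<chi> k. t N * (p1 k x + 0) + x $ k ^ m)"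
      using z t[of N] by (simp add: vec_eq_iff g_eq b_def field_simps)
    ultimately have "b' \<in> S N" unfolding S_def by blast
    with b'(2) show False by blast
  qed
  define good where "good t \<longleftrightarrow> (\<forall>Z h G. finite Z \<longrightarrow> (\<forall>z\<in>Z. \<forall>i. gsys m q t i z = 0) \<longrightarrow> h \<in> Pol a \<longrightarrow>
    (\<forall>z\<in>Z. \<forall>i. (gsys m q t i has_derivative (\<lambda>v. \<Sum>k\<in>UNIV. G z i k * v $ k)) (at z)) \<longrightarrow>
    (\<forall>z\<in>Z. h z * det (\<chi> i k. G z i k) > 0) \<longrightarrow>
    card Z + card {A :: 'n multiset. size A \<le> r} \<le> m ^ CARD('n))" for t
  have "finite {t. \<not> good t}" unfolding good_def by (rule count_solutions[OF q m r])
  moreover have "inj t" by (auto simp: inj_def t_def)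
  ultimately have "finite (t -` {t. \<not> good t})" by (intro finite_vimageI)
  then obtain N0 where N0: "\<And>N. N \<ge> N0 \<Longrightarrow> good (t N)"
    unfolding finite_nat_set_iff_bounded by (metis (mono_tags, lifting) mem_Collect_eq not_le vimage_eq)
  obtain N1 :: nat where N1: "CARD('n) / \<eta> < N1" using reals_Archimedean2 by blast
  define N where "N = max N0 N1"
  define T where "T = t N"
  have T: "T > 0" "good T" unfolding T_def using t N0[of N] by (auto simp: N_def)
  have "CARD('n) / \<eta> < T" using N1 unfolding T_def t_def N_def by linarith
  then have CT: "CARD('n) / T < \<eta>" using \<open>T > 0\<close> \<open>\<eta> > 0\<close> by (simp add: field_simps)
  \<comment> \<open>A function with gradient \<open>gsys m q T / T\<close>: the linear term is the
    generic shift, the last term the deformation of the system, which is small since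
    \<open>T\<close> is large.\<close>
  define Q where "Q x = P x + (\<Sum>k\<in>UNIV. b $ k * x $ k) + (\<Sum>k\<in>UNIV. x $ k ^ (m + 1)) / (real (m + 1) * T)" for x
  have QP: "\<bar>Q x - P x\<bar> \<le> 2 * \<eta>" if "norm x \<le> 1" for x
  proof -
    have "\<bar>b \<bullet> x\<bar> \<le> norm b * norm x" by (rule Cauchy_Schwarz_ineq2)
    also have "\<dots> \<le> \<eta> * 1" using that b'(1) \<open>\<eta> > 0\<close> by (intro mult_mono) (auto simp: b_def)
    finally have 1: "\<bar>\<Sum>k\<in>UNIV. b $ k * x $ k\<bar> \<le> \<eta>" by (simp add: inner_vec_def)
    have "\<bar>(\<Sum>k\<in>UNIV. x $ k ^ (m + 1)) / (real (m + 1) * T)\<bar> \<le> CARD('n) / (real (m + 1) * T)"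
      using sum_power_bound[OF that, of "m + 1"] \<open>T > 0\<close> by (simp add: abs_mult divide_right_mono)
    also have "\<dots> \<le> CARD('n) / T" using \<open>T > 0\<close> by (intro divide_left_mono) auto
    finally show ?thesis using 1 CT unfolding Q_def by linarith
  qed
  define D where "D k x = gsys m q T k x / T" for k x
  have dQ: "(Q has_derivative (\<lambda>v. \<Sum>k\<in>UNIV. D k x * v $ k)) (at x)" for x
  proof -
    have 1: "((\<lambda>x. x $ k ^ (m + 1)) has_derivative (\<lambda>v. real (m + 1) * x $ k ^ m * v $ k)) (at x)" for k
      using has_derivative_power[OF bounded_linear_imp_has_derivative[OF bounded_linear_vec_nth[of k]], where n = "m + 1"]
      by (simp add: mult_ac del: power_Suc)
    have 2: "((\<lambda>x. b $ k * x $ k) has_derivative (\<lambda>v. b $ k * v $ k)) (at x)" for k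
      by (intro has_derivative_mult_right bounded_linear_imp_has_derivative bounded_linear_vec_nth)
    have "(Q has_derivative (\<lambda>v. (\<Sum>k\<in>UNIV. p1 k x * v $ k) + (\<Sum>k\<in>UNIV. b $ k * v $ k)
        + (\<Sum>k\<in>UNIV. real (m + 1) * x $ k ^ m * v $ k) / (real (m + 1) * T))) (at x)"
      unfolding Q_def[abs_def]
    proof (intro has_derivative_add)
      show "(P has_derivative (\<lambda>v. \<Sum>k\<in>UNIV. p1 k x * v $ k)) (at x)" using p1 by blast
      show "((\<lambda>x. \<Sum>k\<in>UNIV. b $ k * x $ k) has_derivative (\<lambda>v. \<Sum>k\<in>UNIV. b $ k * v $ k)) (at x)"
        by (rule has_derivative_sum) (rule 2)
      show "((\<lambda>x. (\<Sum>k\<in>UNIV. x $ k ^ (m + 1)) / (real (m + 1) * T)) has_derivative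
          (\<lambda>v. (\<Sum>k\<in>UNIV. real (m + 1) * x $ k ^ m * v $ k) / (real (m + 1) * T))) (at x)"
        by (rule bounded_linear.has_derivative[OF bounded_linear_divide has_derivative_sum[OF 1]])
    qed
    moreover have "(\<Sum>k\<in>UNIV. p1 k x * v $ k) + (\<Sum>k\<in>UNIV. b $ k * v $ k)
        + (\<Sum>k\<in>UNIV. real (m + 1) * x $ k ^ m * v $ k) / (real (m + 1) * T) = (\<Sum>k\<in>UNIV. D k x * v $ k)" for v
    proof -
      have "real (m + 1) * c / (real (m + 1) * T) = c / T" for c
        by (rule mult_divide_mult_cancel_left) simp
      then have "real (m + 1) * x $ k ^ m * v $ k / (real (m + 1) * T) = x $ k ^ m * v $ k / T" for k
        unfolding mult.assoc[of "real (m + 1)" "x $ k ^ m"] by blast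
      then show ?thesis
        unfolding sum_divide_distrib sum.distrib[symmetric]
        by (intro sum.cong refl) (use \<open>T > 0\<close> in \<open>simp add: D_def g_eq field_simps del: of_nat_add of_nat_Suc\<close>)
    qed
    ultimately show ?thesis by simp
  qed
  have dD: "(D k has_derivative (\<lambda>v. \<Sum>i\<in>UNIV. H T k i x / T * v $ i)) (at x)" for k x
    using bounded_linear.has_derivative[OF bounded_linear_divide[of T] dgs[of T k x]] unfolding D_def[abs_def]
    by (simp add: sum_divide_distrib)
  have Q_pol: "Q \<in> Pol (m + 1)"
  proof -
    have "(\<lambda>x. x $ k ^ (m + 1)) \<in> Pol (m + 1)" for k :: 'n
    proof -
      have "mon (replicate_mset (m + 1) k) = (\<lambda>x. x $ k ^ (m + 1))" by (rule ext) (rule mon_replicate)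
      moreover have "mon (replicate_mset (m + 1) k) \<in> Pol (m + 1)" by (rule Pol_mon) simp
      ultimately show ?thesis by (simp only:)
    qed
    then have "(\<lambda>x :: real ^ 'n. (1 / (real (m + 1) * T)) * (\<Sum>k\<in>UNIV. x $ k ^ (m + 1))) \<in> Pol (m + 1)"
      by (intro Pol_cmult Pol_sum)
    moreover have "(\<lambda>x :: real ^ 'n. \<Sum>k\<in>UNIV. b $ k * x $ k) \<in> Pol (m + 1)" by (intro Pol_sum Pol_cmult Pol_coord) simp
    ultimately have "(\<lambda>x. P x + (\<Sum>k\<in>UNIV. b $ k * x $ k) + (1 / (real (m + 1) * T)) * (\<Sum>k\<in>UNIV. x $ k ^ (m + 1))) \<in> Pol (m + 1)"
      by (intro Pol_add P)
    then show ?thesis by (simp add: Q_def[abs_def])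
  qed
  have "\<forall>j\<in>I. \<exists>z. z \<in> interior (U j) \<and> (\<forall>y\<in>U j. \<epsilon> j * Q y \<le> \<epsilon> j * Q z) \<and> \<epsilon> j * Q z > 0"
  proof
    fix j assume j: "j \<in> I"
    have "continuous_on (U j) (\<lambda>x. \<epsilon> j * Q x)" by (intro continuous_intros Pol_continuous_on[OF Q_pol])
    then obtain z where z: "z \<in> U j" "\<And>y. y \<in> U j \<Longrightarrow> \<epsilon> j * Q y \<le> \<epsilon> j * Q z"
      using continuous_attains_sup[OF U(1)[OF j]] p(1)[OF j] by blast
    have eQ: "\<bar>\<epsilon> j * Q x - \<epsilon> j * P x\<bar> \<le> 2 * \<eta>" if "x \<in> U j" for x
      using QP[of x] U(2)[OF j] that \<epsilon>1[of j] by auto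
    have big: "\<epsilon> j * Q z \<ge> \<delta> + \<gamma> - 2 * \<eta>"
      using z(2)[OF p(1)[OF j]] eQ[OF p(1)[OF j]] \<gamma>[OF j] by linarith
    have "z \<notin> frontier (U j)"
    proof
      assume "z \<in> frontier (U j)"
      from fr[OF j this] have "\<epsilon> j * P z \<le> \<delta>" using \<epsilon>1[of j] by auto
      with eQ[OF z(1)] big \<open>\<gamma> > 0\<close> show False by (simp add: \<eta>_def)
    qed
    then have "z \<in> interior (U j)" using z(1) by (simp add: frontier_def closure_subset[THEN subsetD])
    moreover have "\<epsilon> j * Q z > 0" using big \<delta> \<open>\<gamma> > 0\<close> by (simp add: \<eta>_def)
    ultimately show "\<exists>z. z \<in> interior (U j) \<and> (\<forall>y\<in>U j. \<epsilon> j * Q y \<le> \<epsilon> j * Q z) \<and> \<epsilon> j * Q z > 0"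
      using z(2) by blast
  qed
  from bchoice[OF this] obtain z where z: "\<And>j. j \<in> I \<Longrightarrow> z j \<in> interior (U j)"
    "\<And>j y. j \<in> I \<Longrightarrow> y \<in> U j \<Longrightarrow> \<epsilon> j * Q y \<le> \<epsilon> j * Q (z j)" "\<And>j. j \<in> I \<Longrightarrow> \<epsilon> j * Q (z j) > 0"
    by blast
  have deQ: "((\<lambda>x. \<epsilon> j * Q x) has_derivative (\<lambda>v. \<Sum>k\<in>UNIV. (\<epsilon> j * D k x) * v $ k)) (at x)" for j x
    using has_derivative_mult_right[OF dQ[of x], of "\<epsilon> j"] by (simp add: sum_distrib_left mult.assoc)
  have crit: "gsys m q T k (z j) = 0" if j: "j \<in> I" for j k
  proof -
    have "(\<lambda>v. \<Sum>k\<in>UNIV. (\<epsilon> j * D k (z j)) * v $ k) = (\<lambda>v. 0)"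
      by (rule differential_zero_maxmin[OF z(1)[OF j] open_interior deQ])
        (use z(2)[OF j] interior_subset in blast)
    then have "(\<Sum>i\<in>UNIV. (\<epsilon> j * D i (z j)) * axis k 1 $ i) = 0" by (rule fun_cong)
    then have "\<epsilon> j * D k (z j) = 0" by (simp add: axis_def if_distrib cong: if_cong)
    then show ?thesis using \<epsilon>1[of j] \<open>T > 0\<close> by (auto simp: D_def)
  qed
  define J where "J x = det (\<chi> k i. H T k i x)" for x
  have J: "(- \<epsilon> j) ^ CARD('n) * J (z j) > 0" if j: "j \<in> I" for j
  proof -
    \<comment> \<open>This is \<open>T\<close> times the Hessian of
      \<open>- \<epsilon> j * Q\<close>, which is nonnegative definite at a maximum of
      \<open>\<epsilon> j * Q\<close>.\<close>
    define A where "A = (\<chi> k. (- \<epsilon> j) *s (\<chi> k i. H T k i (z j)) $ k)"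
    have detA: "det A = (- \<epsilon> j) ^ CARD('n) * J (z j)"
      unfolding A_def by (subst det_rows_mul) (simp add: J_def)
    have "det A > 0"
    proof (rule det_pos_if_nonneg_definite)
      show "det A \<noteq> 0"
        unfolding detA J_def T_def using nondeg[of N "z j"] crit[OF j] \<epsilon>1[of j] by (auto simp: T_def)
      fix v
      have "((\<lambda>x. \<epsilon> j * D k x) has_derivative (\<lambda>v. \<Sum>i\<in>UNIV. (\<epsilon> j * (H T k i (z j) / T)) * v $ i)) (at (z j))" for k
        using has_derivative_mult_right[OF dD[of k "z j"], of "\<epsilon> j"] by (simp add: sum_distrib_left mult.assoc)
      from second_order_max[OF open_interior z(1)[OF j] _ deQ this, of v]
      have "(\<Sum>k\<in>UNIV. (\<Sum>i\<in>UNIV. \<epsilon> j * (H T k i (z j) / T) * v $ i) * v $ k) \<le> 0"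
        using z(2)[OF j] interior_subset by blast
      moreover have "v \<bullet> (A *v v) = - T * (\<Sum>k\<in>UNIV. (\<Sum>i\<in>UNIV. \<epsilon> j * (H T k i (z j) / T) * v $ i) * v $ k)"
        using \<open>T > 0\<close>
        by (simp add: A_def inner_vec_def matrix_vector_mult_def sum_distrib_left sum_distrib_right sum_negf algebra_simps cong: sum.cong)
      ultimately show "0 \<le> v \<bullet> (A *v v)" using \<open>T > 0\<close> by (simp add: mult_nonneg_nonpos)
    qed
    then show ?thesis by (simp add: detA)
  qed
  have inj: "inj_on z I"
  proof (rule inj_onI)
    fix i j assume "i \<in> I" "j \<in> I" "z i = z j"
    then have "z i \<in> U i \<inter> U j" using z(1) interior_subset by (metis IntI subsetD)
    then show "i = j" using U(3) \<open>i \<in> I\<close> \<open>j \<in> I\<close> by (auto simp: disjoint_family_on_def)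
  qed
  have "\<exists>h\<in>Pol a. \<forall>j\<in>I. h (z j) * J (z j) > 0"
  proof (cases "even CARD('n)")
    case True
    have "(- \<epsilon> j) ^ CARD('n) = 1" for j using \<epsilon>1[of j] True by auto
    then show ?thesis using J by (intro bexI[of _ "\<lambda>x. 1"]) (simp_all add: Pol_const)
  next
    case False
    with assms(13) have "a = m" by simp
    \<comment> \<open>At a critical point only \<open>(m + 1) * Q\<close> is left, and
      \<open>\<epsilon> j * Q > 0\<close> there. So \<open>- h\<close> has the sign of
      \<open>- \<epsilon> j\<close>, which in odd dimension is that of \<open>J\<close>.\<close>
    define h where "h x = real (m + 1) * Q x - (\<Sum>k\<in>UNIV. D k x * x $ k)" for x
    have "h \<in> Pol m" using Pol_euler[OF Q_pol dQ] by (simp add: h_def[abs_def])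
    then have "(\<lambda>x. - h x) \<in> Pol a" unfolding \<open>a = m\<close> by (rule Pol_uminus)
    moreover have "- h (z j) * J (z j) > 0" if j: "j \<in> I" for j
    proof -
      have "h (z j) = real (m + 1) * Q (z j)" using crit[OF j] by (simp add: h_def D_def)
      moreover have "(- \<epsilon> j) ^ CARD('n) = - \<epsilon> j" using \<epsilon>1[of j] False by auto
      ultimately have b: "0 < - \<epsilon> j * J (z j)" using J[OF j] by simp
      have "- (real (m + 1) * Q (z j)) * J (z j) = real (m + 1) * ((\<epsilon> j * Q (z j)) * (- \<epsilon> j * J (z j)))"
        using \<epsilon>1[of j] by auto
      moreover have "0 < real (m + 1) * ((\<epsilon> j * Q (z j)) * (- \<epsilon> j * J (z j)))"
        by (rule mult_pos_pos[OF _ mult_pos_pos[OF z(3)[OF j] b]]) simp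
      ultimately show ?thesis unfolding \<open>h (z j) = real (m + 1) * Q (z j)\<close> by linarith
    qed
    ultimately show ?thesis by (intro bexI[of _ "\<lambda>x. - h x"]) auto
  qed
  then obtain h where h: "h \<in> Pol a" "\<And>j. j \<in> I \<Longrightarrow> h (z j) * J (z j) > 0" by blast
  have "card (z ` I) + card {A :: 'n multiset. size A \<le> r} \<le> m ^ CARD('n)"
    by (rule T(2)[unfolded good_def, rule_format, of "z ` I" h "\<lambda>x k i. H T k i x"])
      (use I crit h dgs in \<open>auto simp: J_def\<close>)
  then show ?thesis by (simp add: card_image[OF inj])
qed

section \<open>Interpolation on an interval\<close>

text \<open>The clause \<open>\<tau> < Max Z\<close> serves the induction: the zero found between
  the two largest elements of \<open>Z\<close> is thereby new.\<close>

lemma rolle_step: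
  fixes \<phi> \<phi>' :: "real \<Rightarrow> real"
  assumes "finite Z" "Z \<noteq> {}"
    and der: "\<And>\<tau>. \<tau> \<in> {\<alpha>..\<beta>} \<Longrightarrow> (\<phi> has_real_derivative \<phi>' \<tau>) (at \<tau> within {\<alpha>..\<beta>})"
    and "Z \<subseteq> {\<alpha>..\<beta>}" "\<And>\<tau>. \<tau> \<in> Z \<Longrightarrow> \<phi> \<tau> = 0"
  shows "\<exists>Y. finite Y \<and> card Y = card Z - 1 \<and> Y \<subseteq> {\<alpha>..\<beta>} \<and> (\<forall>\<tau>\<in>Y. \<tau> < Max Z \<and> \<phi>' \<tau> = 0)"
  using assms(1,2,4,5)
proof (induction Z rule: finite_linorder_max_induct)
  case (insert b A)
  show ?case
  proof (cases "A = {}")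
    case True
    then show ?thesis by (intro exI[of _ "{}"]) simp
  next
    case False
    then obtain Y where Y: "finite Y" "card Y = card A - 1" "Y \<subseteq> {\<alpha>..\<beta>}" "\<forall>\<tau>\<in>Y. \<tau> < Max A \<and> \<phi>' \<tau> = 0"
      using insert by auto
    define c where "c = Max A"
    have c: "c \<in> A" "c < b" using False insert by (auto simp: c_def)
    have sub: "{c..b} \<subseteq> {\<alpha>..\<beta>}" using c insert.prems by auto
    have "\<exists>z. c < z \<and> z < b \<and> DERIV \<phi> z :> 0"
    proof (rule Rolle)
      show "\<phi> c = \<phi> b" using c insert.prems by simp
      show "continuous_on {c..b} \<phi>"
        by (rule continuous_on_subset[OF _ sub])
          (meson DERIV_continuous continuous_on_eq_continuous_within der)
      fix x assume x: "c < x" "x < b"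
      then have "x \<in> {\<alpha><..<\<beta>}" using c insert.prems by force
      then have "at x within {\<alpha>..\<beta>} = at x" by (intro at_within_interior) (simp add: interior_atLeastAtMost_real)
      then show "\<phi> differentiable at x"
        using der[of x] x sub real_differentiable_def by force
    qed (use c in simp)
    then obtain z where z: "c < z" "z < b" "DERIV \<phi> z :> 0" by blast
    have "z \<in> {\<alpha><..<\<beta>}" using z c insert.prems by force
    then have "at z within {\<alpha>..\<beta>} = at z" by (intro at_within_interior) (simp add: interior_atLeastAtMost_real)
    then have "\<phi>' z = 0" using der[of z] z sub DERIV_unique by fastforce
    have "Max (insert b A) = b" using insert.hyps by (intro Max_eqI) auto
    moreover have "z \<notin> Y" using Y(4) z by (auto simp: c_def)
    moreover have "card A \<ge> 1" using False insert.hyps by (simp add: Suc_le_eq card_gt_0_iff)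
    moreover have "b \<notin> A" using insert.hyps by auto
    ultimately show ?thesis
      using Y z \<open>\<phi>' z = 0\<close> sub c insert.hyps
      by (intro exI[of _ "insert z Y"]) (auto simp: c_def)
  qed
qed simp

lemma rolle_iterated:
  fixes \<phi> :: "nat \<Rightarrow> real \<Rightarrow> real"
  assumes der: "\<And>j \<tau>. j < k \<Longrightarrow> \<tau> \<in> {\<alpha>..\<beta>} \<Longrightarrow> (\<phi> j has_real_derivative \<phi> (Suc j) \<tau>) (at \<tau> within {\<alpha>..\<beta>})"
    and "finite Z" "card Z = Suc k" "Z \<subseteq> {\<alpha>..\<beta>}" "\<And>\<tau>. \<tau> \<in> Z \<Longrightarrow> \<phi> 0 \<tau> = 0"
  shows "\<exists>\<eta>\<in>{\<alpha>..\<beta>}. \<phi> k \<eta> = 0"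
proof -
  have "\<exists>Y. finite Y \<and> card Y = Suc k - i \<and> Y \<subseteq> {\<alpha>..\<beta>} \<and> (\<forall>\<tau>\<in>Y. \<phi> i \<tau> = 0)" if "i \<le> k" for i
    using that
  proof (induction i)
    case 0
    then show ?case using assms(2-5) by (intro exI[of _ Z]) auto
  next
    case (Suc i)
    then obtain Y where Y: "finite Y" "card Y = Suc k - i" "Y \<subseteq> {\<alpha>..\<beta>}" "\<forall>\<tau>\<in>Y. \<phi> i \<tau> = 0" by auto
    have "Y \<noteq> {}" using Y(2) Suc.prems by auto
    obtain X where "finite X" "card X = card Y - 1" "X \<subseteq> {\<alpha>..\<beta>}" "\<forall>\<tau>\<in>X. \<tau> < Max Y \<and> \<phi> (Suc i) \<tau> = 0"
      using rolle_step[OF Y(1) \<open>Y \<noteq> {}\<close> der[of i]] Y Suc.prems by auto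
    then show ?case using Y(2) by (intro exI[of _ X]) auto
  qed
  from this[of k] obtain Y where "card Y = 1" "Y \<subseteq> {\<alpha>..\<beta>}" "\<forall>\<tau>\<in>Y. \<phi> k \<tau> = 0" by auto
  then show ?thesis by (auto simp: card_1_singleton_iff)
qed

lemma higher_pderiv_small_degree: "degree (p :: real poly) < k \<Longrightarrow> (pderiv ^^ k) p = 0"
  by (rule poly_eqI) (simp add: coeff_higher_pderiv coeff_eq_0)

text \<open>Lagrange interpolation with Cauchy's remainder. The derivatives are given as a sequence
  of functions, one-sided at the ends of the interval, because the lines concerned may end on the
  sphere. The point \<open>\<xi>\<close> may lie outside the hull of the nodes.\<close>

lemma interpolation_bound:
  fixes \<phi> :: "nat \<Rightarrow> real \<Rightarrow> real"
  assumes der: "\<And>j \<tau>. j < Suc d \<Longrightarrow> \<tau> \<in> {\<alpha>..\<beta>} \<Longrightarrow> (\<phi> j has_real_derivative \<phi> (Suc j) \<tau>) (at \<tau> within {\<alpha>..\<beta>})"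
    and bound: "\<And>\<tau>. \<tau> \<in> {\<alpha>..\<beta>} \<Longrightarrow> \<bar>\<phi> (Suc d) \<tau>\<bar> \<le> C"
    and X: "finite X" "card X = Suc d" "X \<subseteq> {\<alpha>..\<beta>}" and \<xi>: "\<xi> \<in> {\<alpha>..\<beta>}"
  shows "\<bar>\<phi> 0 \<xi>\<bar> \<le> (\<Sum>x\<in>X. \<bar>\<phi> 0 x\<bar> * (\<Prod>y\<in>X - {x}. \<bar>\<xi> - y\<bar> / \<bar>x - y\<bar>)) + C / fact (Suc d) * (\<Prod>x\<in>X. \<bar>\<xi> - x\<bar>)"
proof -
  define l where "l x = (\<Prod>y\<in>X - {x}. smult (1 / (x - y)) [:- y, 1:])" for x
  define L where "L = (\<Sum>x\<in>X. smult (\<phi> 0 x) (l x))"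
  define V where "V = (\<Prod>x\<in>X. [:- x, 1:])"
  have l: "poly (l x) \<tau> = (\<Prod>y\<in>X - {x}. (\<tau> - y) / (x - y))" for x \<tau>
    by (simp add: l_def poly_prod diff_divide_distrib)
  have lX: "poly (l x) x' = (if x' = x then 1 else 0)" if "x \<in> X" "x' \<in> X" for x x'
  proof (cases "x' = x")
    case True
    have "(\<Prod>y\<in>X - {x}. (x - y) / (x - y)) = (\<Prod>y\<in>X - {x}. 1)" by (intro prod.cong) auto
    with True show ?thesis by (simp add: l)
  next
    case False
    then show ?thesis using that X(1) by (auto simp: l prod_zero_iff)
  qed
  have LX: "poly L x = \<phi> 0 x" if "x \<in> X" for x
  proof -
    have "poly L x = (\<Sum>x'\<in>X. if x = x' then \<phi> 0 x' else 0)"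
      unfolding L_def poly_sum poly_smult using lX that by (intro sum.cong) auto
    then show ?thesis using that X(1) by simp
  qed
  have degL: "degree L < Suc d"
  proof -
    have "degree (l x) \<le> d" if "x \<in> X" for x
    proof -
      have "degree (l x) \<le> (\<Sum>y\<in>X - {x}. degree (smult (1 / (x - y)) [:- y, 1:]))"
        unfolding l_def using degree_prod_sum_le[of "X - {x}" "\<lambda>y. smult (1 / (x - y)) [:- y, 1:]"] X(1)
        by (simp only: finite_Diff o_def)
      also have "\<dots> \<le> (\<Sum>y\<in>X - {x}. 1)" by (intro sum_mono) (simp add: degree_smult_le[THEN order_trans])
      also have "\<dots> = d" using X that by simp
      finally show ?thesis .
    qed
    then have "degree L \<le> d" unfolding L_def
      by (intro degree_sum_le X(1)) (meson degree_smult_le order_trans)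
    then show ?thesis by simp
  qed
  have V_lead: "lead_coeff V = 1" "degree V = Suc d"
  proof -
    show "lead_coeff V = 1" unfolding V_def by (simp add: lead_coeff_prod)
    have "degree V = (\<Sum>x\<in>X. degree [:- x, 1:])" unfolding V_def by (rule degree_prod_eq_sum_degree) auto
    then show "degree V = Suc d" using X(2) by simp
  qed
  have V: "poly V \<tau> = (\<Prod>x\<in>X. \<tau> - x)" for \<tau> by (simp add: V_def poly_prod)
  have DV: "poly ((pderiv ^^ Suc d) V) \<tau> = fact (Suc d)" for \<tau>
  proof -
    have "(pderiv ^^ Suc d) V = [:fact (Suc d):]"
    proof (rule poly_eqI)
      fix n
      show "coeff ((pderiv ^^ Suc d) V) n = coeff [:fact (Suc d):] n"
        using V_lead by (cases n)
          (auto simp del: funpow.simps simp: coeff_higher_pderiv coeff_eq_0 pochhammer_fact[symmetric])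
    qed
    then show ?thesis by (simp del: funpow.simps)
  qed
  have rhs: "(\<Sum>x\<in>X. \<bar>\<phi> 0 x\<bar> * (\<Prod>y\<in>X - {x}. \<bar>\<xi> - y\<bar> / \<bar>x - y\<bar>)) \<ge> \<bar>poly L \<xi>\<bar>"
    unfolding L_def poly_sum poly_smult
    by (rule order_trans[OF sum_abs]) (simp add: abs_mult l abs_prod abs_divide)
  have C0: "C \<ge> 0" using bound[OF \<xi>] by linarith
  show ?thesis
  proof (cases "\<xi> \<in> X")
    case True
    then have "\<phi> 0 \<xi> = poly L \<xi>" by (simp add: LX)
    moreover have "C / fact (Suc d) * (\<Prod>x\<in>X. \<bar>\<xi> - x\<bar>) \<ge> 0" using C0 by (intro mult_nonneg_nonneg prod_nonneg) auto
    ultimately show ?thesis using rhs by linarith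
  next
    case False
    then have V\<xi>: "poly V \<xi> \<noteq> 0" using X(1) by (auto simp: V)
    \<comment> \<open>This makes \<open>\<psi> 0\<close> vanish at \<open>\<xi>\<close> in addition
      to the \<open>d + 1\<close> nodes. Iterated Rolle gives a zero of the derivative of order
      \<open>d + 1\<close>, where \<open>L\<close> has disappeared and \<open>V\<close> contributes
      \<open>(d + 1)!\<close>.\<close>
    define c where "c = (\<phi> 0 \<xi> - poly L \<xi>) / poly V \<xi>"
    define \<psi> where "\<psi> j \<tau> = \<phi> j \<tau> - poly ((pderiv ^^ j) L) \<tau> - c * poly ((pderiv ^^ j) V) \<tau>" for j \<tau>
    have "\<exists>\<eta>\<in>{\<alpha>..\<beta>}. \<psi> (Suc d) \<eta> = 0"
    proof (rule rolle_iterated)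
      show "finite (insert \<xi> X)" "card (insert \<xi> X) = Suc (Suc d)" "insert \<xi> X \<subseteq> {\<alpha>..\<beta>}"
        using X \<xi> False by auto
      show "\<psi> 0 \<tau> = 0" if "\<tau> \<in> insert \<xi> X" for \<tau>
      proof (cases "\<tau> = \<xi>")
        case True
        then show ?thesis using V\<xi> by (simp add: \<psi>_def c_def)
      next
        case False
        then have "\<tau> \<in> X" using that by simp
        then have "poly V \<tau> = 0" using X(1) by (auto simp: V)
        then show ?thesis using LX[OF \<open>\<tau> \<in> X\<close>] by (simp add: \<psi>_def)
      qed
      fix j \<tau> assume j: "j < Suc d" and \<tau>: "\<tau> \<in> {\<alpha>..\<beta>}"
      show "(\<psi> j has_real_derivative \<psi> (Suc j) \<tau>) (at \<tau> within {\<alpha>..\<beta>})"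
        unfolding \<psi>_def[abs_def] funpow.simps o_def
        by (intro DERIV_diff DERIV_cmult der[OF j \<tau>]) (rule has_field_derivative_at_within[OF poly_DERIV])+
    qed
    then obtain \<eta> where \<eta>: "\<eta> \<in> {\<alpha>..\<beta>}" "\<psi> (Suc d) \<eta> = 0" by blast
    have "\<phi> (Suc d) \<eta> = c * fact (Suc d)"
      using \<eta>(2) unfolding \<psi>_def DV higher_pderiv_small_degree[OF degL] by simp
    then have "c = \<phi> (Suc d) \<eta> / fact (Suc d)" by (simp del: fact_Suc)
    then have "\<bar>c\<bar> \<le> C / fact (Suc d)" using bound[OF \<eta>(1)] by (simp add: divide_right_mono del: fact_Suc)
    then have "\<bar>c * poly V \<xi>\<bar> \<le> C / fact (Suc d) * (\<Prod>x\<in>X. \<bar>\<xi> - x\<bar>)"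
      unfolding V abs_mult abs_prod by (intro mult_right_mono prod_nonneg) auto
    moreover have "\<phi> 0 \<xi> = poly L \<xi> + c * poly V \<xi>" using V\<xi> by (simp add: c_def)
    ultimately show ?thesis using rhs by linarith
  qed
qed

section \<open>Partial derivatives on the closed ball\<close>

abbreviation B1 :: "(real ^ 'n) set" where "B1 \<equiv> cball 0 1"

lemma iter_partial_deriv_append:
  "iter_partial_deriv S (xs @ ys) f = iter_partial_deriv S xs (iter_partial_deriv S ys f)"
  by (induction xs) auto

lemma Ck_on_iter: "Ck_on k S f \<Longrightarrow> length xs \<le> k \<Longrightarrow> Ck_on (k - length xs) S (iter_partial_deriv S xs f)"
proof (induction xs arbitrary: f k rule: rev_induct)
  case (snoc i xs)
  then obtain k' where k: "k = Suc k'" by (cases k) auto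
  then have "Ck_on k' S (partial_deriv S i f)" using snoc.prems by simp
  from snoc.IH[OF this] show ?case using snoc.prems k by (simp add: iter_partial_deriv_append)
qed simp

lemma Ck_on_continuous: "Ck_on k S f \<Longrightarrow> continuous_on S f"
  by (cases k) (auto intro: differentiable_imp_continuous_on)

lemma Ck_on_differentiable: "Ck_on k S f \<Longrightarrow> k > 0 \<Longrightarrow> f differentiable_on S"
  by (cases k) auto

lemma has_derivative_partial_deriv:
  fixes g :: "real ^ 'n::finite \<Rightarrow> real"
  assumes "g differentiable_on S" "z \<in> S"
  shows "(g has_derivative (\<lambda>v. \<Sum>i\<in>UNIV. partial_deriv S i g z * v $ i)) (at z within S)"
proof -
  have D: "(g has_derivative frechet_derivative g (at z within S)) (at z within S)"
    using assms by (auto simp: differentiable_on_def frechet_derivative_works)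
  then have lin: "linear (frechet_derivative g (at z within S))" by (rule has_derivative_linear)
  have "frechet_derivative g (at z within S) v = (\<Sum>i\<in>UNIV. partial_deriv S i g z * v $ i)" for v
  proof -
    have "v = (\<Sum>i\<in>UNIV. v $ i *\<^sub>R axis i 1)"
      by (simp add: vec_eq_iff axis_def if_distrib cong: if_cong)
    then have "frechet_derivative g (at z within S) v = frechet_derivative g (at z within S) (\<Sum>i\<in>UNIV. v $ i *\<^sub>R axis i 1)"
      by (rule arg_cong)
    also have "\<dots> = (\<Sum>i\<in>UNIV. v $ i *\<^sub>R frechet_derivative g (at z within S) (axis i 1))"
      by (simp add: linear_sum[OF lin] linear_scale[OF lin])
    finally show ?thesis by (simp add: partial_deriv_def mult.commute)
  qed
  then have "frechet_derivative g (at z within S) = (\<lambda>v. \<Sum>i\<in>UNIV. partial_deriv S i g z * v $ i)" by (rule ext)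
  with D show ?thesis by (simp only:)
qed

lemma partial_deriv_cong:
  assumes "\<And>x. x \<in> S \<Longrightarrow> g x = h x" "z \<in> S"
  shows "partial_deriv S i g z = partial_deriv S i h z"
proof -
  have "(g has_derivative f') (at z within S) \<longleftrightarrow> (h has_derivative f') (at z within S)" for f'
    using has_derivative_transform[OF assms(2), of h g] has_derivative_transform[OF assms(2), of g h] assms(1) by metis
  then show ?thesis by (simp add: partial_deriv_def frechet_derivative_def)
qed

section \<open>Derivatives along lines and symmetry of mixed partial derivatives\<close>

lemma line_derivative:
  fixes g :: "real ^ 'n::finite \<Rightarrow> real"
  assumes g: "g differentiable_on S" and T: "\<And>\<sigma>. \<sigma> \<in> T \<Longrightarrow> x + \<sigma> *\<^sub>R v \<in> S" and \<tau>: "\<tau> \<in> T"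
  shows "((\<lambda>\<sigma>. g (x + \<sigma> *\<^sub>R v)) has_real_derivative (\<Sum>i\<in>UNIV. v $ i * partial_deriv S i g (x + \<tau> *\<^sub>R v))) (at \<tau> within T)"
proof -
  have "((\<lambda>\<sigma>. x + \<sigma> *\<^sub>R v) has_derivative (\<lambda>h. h *\<^sub>R v)) (at \<tau> within T)"
    by (auto intro!: derivative_eq_intros)
  moreover have "(g has_derivative (\<lambda>w. \<Sum>i\<in>UNIV. partial_deriv S i g (x + \<tau> *\<^sub>R v) * w $ i)) (at (x + \<tau> *\<^sub>R v) within (\<lambda>\<sigma>. x + \<sigma> *\<^sub>R v) ` T)"
    by (rule has_derivative_subset[OF has_derivative_partial_deriv[OF g T[OF \<tau>]]]) (use T in auto)
  ultimately have "((\<lambda>\<sigma>. g (x + \<sigma> *\<^sub>R v)) has_derivative (\<lambda>h. \<Sum>i\<in>UNIV. partial_deriv S i g (x + \<tau> *\<^sub>R v) * (h *\<^sub>R v) $ i)) (at \<tau> within T)"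
    by (rule has_derivative_in_compose)
  moreover have "(\<lambda>h. \<Sum>i\<in>UNIV. partial_deriv S i g (x + \<tau> *\<^sub>R v) * (h *\<^sub>R v) $ i)
      = (*) (\<Sum>i\<in>UNIV. v $ i * partial_deriv S i g (x + \<tau> *\<^sub>R v))"
    by (rule ext) (simp add: sum_distrib_left mult_ac)
  ultimately show ?thesis by (simp add: has_field_derivative_def)
qed

text \<open>The mean value theorem, first in direction \<open>i\<close> for the difference in
  direction \<open>j\<close>, then in direction \<open>j\<close>. The left side is symmetric in
  \<open>i\<close> and \<open>j\<close>, which is the core of Schwarz's theorem.\<close>

lemma mixed_difference:
  fixes g :: "real ^ 'n::finite \<Rightarrow> real"
  assumes g: "Ck_on 2 B1 g" and h: "h > 0"
    and sub: "\<And>s t. 0 \<le> s \<Longrightarrow> s \<le> h \<Longrightarrow> 0 \<le> t \<Longrightarrow> t \<le> h \<Longrightarrow> z + s *\<^sub>R axis i 1 + t *\<^sub>R axis j 1 \<in> B1"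
  shows "\<exists>s t. 0 \<le> s \<and> s \<le> h \<and> 0 \<le> t \<and> t \<le> h \<and>
    g (z + h *\<^sub>R axis i 1 + h *\<^sub>R axis j 1) - g (z + h *\<^sub>R axis i 1) - g (z + h *\<^sub>R axis j 1) + g z
      = h\<^sup>2 * partial_deriv B1 j (partial_deriv B1 i g) (z + s *\<^sub>R axis i 1 + t *\<^sub>R axis j 1)"
proof -
  have sum1: "(\<Sum>k\<in>UNIV. (axis l 1 :: real ^ 'n) $ k * c k) = c l" for l c
    by (simp add: axis_def if_distrib if_distribR cong: if_cong)
  have dg: "g differentiable_on B1" "\<And>k. partial_deriv B1 k g differentiable_on B1"
    using g by (auto simp: numeral_2_eq_2)
  define \<psi> where "\<psi> s = g ((z + h *\<^sub>R axis j 1) + s *\<^sub>R axis i 1) - g (z + s *\<^sub>R axis i 1)" for s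
  have sub1: "z + t *\<^sub>R axis j 1 + s *\<^sub>R axis i 1 \<in> B1" if "s \<in> {0..h}" "t \<in> {0..h}" for s t
    using sub[of s t] that by (simp add: algebra_simps)
  have d\<psi>: "(\<psi> has_real_derivative (partial_deriv B1 i g ((z + h *\<^sub>R axis j 1) + s *\<^sub>R axis i 1) - partial_deriv B1 i g (z + s *\<^sub>R axis i 1))) (at s within {0..h})"
    if "s \<in> {0..h}" for s
    unfolding \<psi>_def[abs_def]
    using line_derivative[OF dg(1), of "{0..h}" "z + h *\<^sub>R axis j 1" "axis i 1" s] line_derivative[OF dg(1), of "{0..h}" z "axis i 1" s]
      sub1[of _ h] sub1[of _ 0] that h
    by (intro DERIV_diff) (auto simp: sum1)
  obtain s where s: "s \<in> {0<..<h}" "\<psi> h - \<psi> 0 = h * (partial_deriv B1 i g ((z + h *\<^sub>R axis j 1) + s *\<^sub>R axis i 1) - partial_deriv B1 i g (z + s *\<^sub>R axis i 1))"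
  proof -
    have "\<exists>s\<in>{0<..<h}. \<psi> h - \<psi> 0 = (\<lambda>v. v * (partial_deriv B1 i g ((z + h *\<^sub>R axis j 1) + s *\<^sub>R axis i 1) - partial_deriv B1 i g (z + s *\<^sub>R axis i 1))) (h - 0)"
      by (rule mvt_simple[OF h]) (use d\<psi> in \<open>auto simp: has_field_derivative_def mult_commute_abs\<close>)
    then show ?thesis using that by auto
  qed
  define ch where "ch t = partial_deriv B1 i g ((z + s *\<^sub>R axis i 1) + t *\<^sub>R axis j 1)" for t
  have dch: "(ch has_real_derivative (partial_deriv B1 j (partial_deriv B1 i g) ((z + s *\<^sub>R axis i 1) + t *\<^sub>R axis j 1))) (at t within {0..h})"
    if "t \<in> {0..h}" for t
    unfolding ch_def[abs_def]
    using line_derivative[OF dg(2)[of i], of "{0..h}" "z + s *\<^sub>R axis i 1" "axis j 1" t] sub[of s] s(1) that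
    by (auto simp: sum1)
  obtain t where t: "t \<in> {0<..<h}" "ch h - ch 0 = h * partial_deriv B1 j (partial_deriv B1 i g) ((z + s *\<^sub>R axis i 1) + t *\<^sub>R axis j 1)"
  proof -
    have "\<exists>t\<in>{0<..<h}. ch h - ch 0 = (\<lambda>v. v * partial_deriv B1 j (partial_deriv B1 i g) ((z + s *\<^sub>R axis i 1) + t *\<^sub>R axis j 1)) (h - 0)"
      by (rule mvt_simple[OF h]) (use dch in \<open>auto simp: has_field_derivative_def mult_commute_abs\<close>)
    then show ?thesis using that by auto
  qed
  have "\<psi> h - \<psi> 0 = h * (ch h - ch 0)"
    unfolding s(2) ch_def by (simp add: algebra_simps)
  then have "\<psi> h - \<psi> 0 = h\<^sup>2 * partial_deriv B1 j (partial_deriv B1 i g) ((z + s *\<^sub>R axis i 1) + t *\<^sub>R axis j 1)"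
    unfolding t(2) by (simp add: power2_eq_square)
  then show ?thesis
    using s(1) t(1) by (intro exI[of _ s] exI[of _ t]) (auto simp: \<psi>_def algebra_simps)
qed

text \<open>At interior points small squares fit into the ball, and both mixed derivatives are
  limits of the same second differences. On the sphere such squares may leave the ball, and equality
  follows by continuity.\<close>

lemma partial_deriv_commute:
  fixes g :: "real ^ 'n::finite \<Rightarrow> real"
  assumes g: "Ck_on 2 B1 g" and z: "z \<in> B1"
  shows "partial_deriv B1 j (partial_deriv B1 i g) z = partial_deriv B1 i (partial_deriv B1 j g) z"
proof -
  define a b where "a = partial_deriv B1 j (partial_deriv B1 i g)" and "b = partial_deriv B1 i (partial_deriv B1 j g)"
  have cont: "continuous_on B1 a" "continuous_on B1 b"
    using g by (auto simp: numeral_2_eq_2 a_def b_def)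
  have ball: "a x - b x = 0" if x: "x \<in> ball 0 1" for x
  proof (rule ccontr)
    assume "a x - b x \<noteq> 0"
    define e where "e = \<bar>a x - b x\<bar> / 2"
    have e: "e > 0" using \<open>a x - b x \<noteq> 0\<close> by (simp add: e_def)
    have xB: "x \<in> B1" using x by auto
    obtain d1 where d1: "d1 > 0" "\<And>y. y \<in> B1 \<Longrightarrow> dist y x < d1 \<Longrightarrow> dist (a y) (a x) < e"
      using cont(1) xB e unfolding continuous_on_iff by blast
    obtain d2 where d2: "d2 > 0" "\<And>y. y \<in> B1 \<Longrightarrow> dist y x < d2 \<Longrightarrow> dist (b y) (b x) < e"
      using cont(2) xB e unfolding continuous_on_iff by blast
    define h where "h = min (min d1 d2) (1 - norm x) / 3"
    have h: "h > 0" "2 * h < d1" "2 * h < d2" "2 * h < 1 - norm x"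
      using d1(1) d2(1) x by (auto simp: h_def min_def)
    have near: "norm (s *\<^sub>R axis i 1 + t *\<^sub>R (axis j 1 :: real ^ 'n)) \<le> 2 * h"
      if "0 \<le> s" "s \<le> h" "0 \<le> t" "t \<le> h" for s t i j
      using norm_triangle_ineq[of "s *\<^sub>R axis i 1" "t *\<^sub>R (axis j 1 :: real ^ 'n)"] that by simp
    have sub: "x + s *\<^sub>R axis i 1 + t *\<^sub>R axis j 1 \<in> B1"
      if "0 \<le> s" "s \<le> h" "0 \<le> t" "t \<le> h" for s t i j
      using near[OF that, of i j] norm_triangle_ineq[of x "s *\<^sub>R axis i 1 + t *\<^sub>R axis j 1"] h(4)
      by (simp add: add.assoc)
    have dist: "dist (x + s *\<^sub>R axis i 1 + t *\<^sub>R axis j 1) x \<le> 2 * h"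
      if "0 \<le> s" "s \<le> h" "0 \<le> t" "t \<le> h" for s t i j
      using near[OF that, of i j] by (simp add: dist_norm add.assoc)
    obtain s t where st: "0 \<le> s" "s \<le> h" "0 \<le> t" "t \<le> h"
      "g (x + h *\<^sub>R axis i 1 + h *\<^sub>R axis j 1) - g (x + h *\<^sub>R axis i 1) - g (x + h *\<^sub>R axis j 1) + g x
        = h\<^sup>2 * a (x + s *\<^sub>R axis i 1 + t *\<^sub>R axis j 1)"
      using mixed_difference[OF g h(1) sub, of i j] unfolding a_def by blast
    obtain s' t' where st': "0 \<le> s'" "s' \<le> h" "0 \<le> t'" "t' \<le> h"
      "g (x + h *\<^sub>R axis j 1 + h *\<^sub>R axis i 1) - g (x + h *\<^sub>R axis j 1) - g (x + h *\<^sub>R axis i 1) + g x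
        = h\<^sup>2 * b (x + s' *\<^sub>R axis j 1 + t' *\<^sub>R axis i 1)"
      using mixed_difference[OF g h(1) sub, of j i] unfolding b_def by blast
    have "h\<^sup>2 * a (x + s *\<^sub>R axis i 1 + t *\<^sub>R axis j 1) = h\<^sup>2 * b (x + s' *\<^sub>R axis j 1 + t' *\<^sub>R axis i 1)"
      using st(5) st'(5) by (simp add: algebra_simps)
    then have "a (x + s *\<^sub>R axis i 1 + t *\<^sub>R axis j 1) = b (x + s' *\<^sub>R axis j 1 + t' *\<^sub>R axis i 1)"
      using h(1) by simp
    moreover have "dist (a (x + s *\<^sub>R axis i 1 + t *\<^sub>R axis j 1)) (a x) < e"
      by (rule d1(2)[OF sub[OF st(1-4)]]) (use dist[OF st(1-4), of i j] h in linarith)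
    moreover have "dist (b (x + s' *\<^sub>R axis j 1 + t' *\<^sub>R axis i 1)) (b x) < e"
      by (rule d2(2)[OF sub[OF st'(1-4)]]) (use dist[OF st'(1-4), of j i] h in linarith)
    ultimately have "\<bar>a x - b x\<bar> < 2 * e" unfolding dist_real_def by linarith
    then show False by (simp add: e_def)
  qed
  have "a z - b z = 0"
    by (rule continuous_constant_on_closure[of "ball 0 1" "\<lambda>x. a x - b x" 0 z])
      (use cont ball z in \<open>auto intro!: continuous_intros\<close>)
  then show ?thesis by (simp add: a_def b_def)
qed

text \<open>The coordinate \<open>a\<close> passes one neighbour at a time. The length bound
  guarantees that the function on which the two neighbours act is still twice continuously
  differentiable.\<close>

lemma iter_partial_deriv_move:
  fixes f :: "real ^ 'n::finite \<Rightarrow> real"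
  assumes "Ck_on k B1 f" "length (ps @ a # qs) \<le> k" "z \<in> B1"
  shows "iter_partial_deriv B1 (ps @ a # qs) f z = iter_partial_deriv B1 (a # ps @ qs) f z"
  using assms(2,3)
proof (induction ps arbitrary: z)
  case (Cons p ps)
  have "Ck_on (k - length (ps @ qs)) B1 (iter_partial_deriv B1 (ps @ qs) f)"
    by (rule Ck_on_iter[OF assms(1)]) (use Cons in simp)
  moreover have "k - length (ps @ qs) = 2 + (k - length (ps @ qs) - 2)" using Cons.prems by simp
  ultimately have "Ck_on (2 + (k - length (ps @ qs) - 2)) B1 (iter_partial_deriv B1 (ps @ qs) f)" by (simp only:)
  moreover have weaken: "Ck_on (j + l) S g \<Longrightarrow> Ck_on j S g" for j l S and g :: "real ^ 'n \<Rightarrow> real"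
    by (induction j arbitrary: g) (auto intro: Ck_on_continuous)
  ultimately have C2: "Ck_on 2 B1 (iter_partial_deriv B1 (ps @ qs) f)" by blast
  have "iter_partial_deriv B1 ((p # ps) @ a # qs) f z
    = partial_deriv B1 p (iter_partial_deriv B1 (ps @ a # qs) f) z" by simp
  also have "\<dots> = partial_deriv B1 p (iter_partial_deriv B1 (a # ps @ qs) f) z"
    by (rule partial_deriv_cong) (use Cons in auto)
  also have "\<dots> = partial_deriv B1 a (partial_deriv B1 p (iter_partial_deriv B1 (ps @ qs) f)) z"
    unfolding iter_partial_deriv.simps by (rule partial_deriv_commute[OF C2 Cons.prems(2)])
  finally show ?case by simp
qed simp

lemma iter_partial_deriv_perm:
  fixes f :: "real ^ 'n::finite \<Rightarrow> real"
  assumes "Ck_on k B1 f" "length xs \<le> k" "mset xs = mset ys" "z \<in> B1"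
  shows "iter_partial_deriv B1 xs f z = iter_partial_deriv B1 ys f z"
  using assms(2-4)
proof (induction xs arbitrary: ys z)
  case (Cons a xs)
  then have "a \<in> set ys" by (metis list.set_intros(1) set_mset_mset)
  then obtain ps qs where ys: "ys = ps @ a # qs" by (meson split_list)
  then have ms: "mset xs = mset (ps @ qs)" using Cons.prems(2) by simp
  have len: "length ys \<le> k" using Cons.prems by (metis size_mset)
  have "iter_partial_deriv B1 ys f z = partial_deriv B1 a (iter_partial_deriv B1 (ps @ qs) f) z"
    unfolding ys using iter_partial_deriv_move[OF assms(1) len[unfolded ys] Cons.prems(3)] by simp
  also have "\<dots> = partial_deriv B1 a (iter_partial_deriv B1 xs f) z"
    by (rule partial_deriv_cong) (use Cons.IH[OF _ ms] Cons.prems in auto)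
  finally show ?case by simp
qed simp

lemma multi_deriv_eq:
  fixes f :: "real ^ 'n::finite \<Rightarrow> real"
  assumes "Ck_on k B1 f" "length xs \<le> k" "z \<in> B1"
  shows "multi_deriv B1 (mset xs) f z = iter_partial_deriv B1 xs f z"
proof -
  have "mset (SOME is. mset is = mset xs) = mset xs" by (rule someI_ex) auto
  then show ?thesis unfolding multi_deriv_def
    using iter_partial_deriv_perm[OF assms(1,2) _ assms(3)] by metis
qed

lemma finite_lists_length: "finite {xs :: 'n::finite list. length xs = k}"
  using finite_lists_length_eq[of "UNIV :: 'n set" k] by simp

lemma deriv_norm_continuous:
  fixes f :: "real ^ 'n::finite \<Rightarrow> real"
  assumes "Ck_on k B1 f"
  shows "continuous_on B1 (deriv_norm k f)"
proof -
  have "continuous_on B1 (multi_deriv B1 A f)" if "size A = k" for A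
  proof -
    obtain xs where xs: "mset xs = A" using ex_mset by blast
    then have len: "length xs \<le> k" using that by (metis order_refl size_mset)
    have "continuous_on B1 (iter_partial_deriv B1 xs f)"
      by (rule Ck_on_continuous[OF Ck_on_iter[OF assms len]])
    then show ?thesis
      by (rule continuous_on_eq) (use multi_deriv_eq[OF assms len] xs in auto)
  qed
  then show ?thesis unfolding deriv_norm_def[abs_def] by (intro continuous_intros) auto
qed

text \<open>The supremum in \<open>M\<close> is informative only for bounded sets; continuity on the
  compact ball provides the bound.\<close>

lemma deriv_norm_le_M:
  fixes f :: "real ^ 'n::finite \<Rightarrow> real"
  assumes "Ck_on k B1 f" "z \<in> B1"
  shows "deriv_norm k f z \<le> M k f"
proof -
  have "compact (deriv_norm k f ` B1)"
    by (rule compact_continuous_image[OF deriv_norm_continuous[OF assms(1)] compact_cball])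
  then have "bdd_above (deriv_norm k f ` B1)" by (intro bounded_imp_bdd_above compact_imp_bounded)
  then show ?thesis unfolding M_def by (rule cSUP_upper[OF assms(2)])
qed

lemma deriv_norm_0: "deriv_norm 0 f z = \<bar>f z\<bar>"
  by (simp add: deriv_norm_def multi_deriv_def)

lemma W_attained:
  fixes f :: "real ^ 'n::finite \<Rightarrow> real"
  assumes "f \<in> W d Z"
  shows "\<exists>x\<in>B1. \<bar>f x\<bar> = 1"
proof -
  have f: "Ck_on (d + 1) B1 f" "M 0 f = 1" using assms by (auto simp: W_def)
  have cont: "continuous_on B1 (\<lambda>x. \<bar>f x\<bar>)" by (intro continuous_intros Ck_on_continuous[OF f(1)])
  have "B1 \<noteq> ({} :: (real ^ 'n) set)" by auto
  from continuous_attains_sup[OF compact_cball this cont]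
  obtain x where x: "x \<in> B1" "\<And>y. y \<in> B1 \<Longrightarrow> \<bar>f y\<bar> \<le> \<bar>f x\<bar>" by blast
  have "M 0 f = \<bar>f x\<bar>" unfolding M_def deriv_norm_0
    by (rule cSup_eq_maximum) (use x in auto)
  with f x show ?thesis by auto
qed

section \<open>Directional derivatives\<close>

text \<open>The derivative of order \<open>k\<close> along \<open>v\<close>, expanded over words of
  coordinates: a further differentiation just prepends a letter, which would be less convenient with
  multi-indices.\<close>

definition dirder :: "nat \<Rightarrow> real ^ 'n::finite \<Rightarrow> (real ^ 'n \<Rightarrow> real) \<Rightarrow> real ^ 'n \<Rightarrow> real" where
  "dirder k v f z = (\<Sum>xs | length xs = k. (\<Prod>i\<leftarrow>xs. v $ i) * iter_partial_deriv B1 xs f z)"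

lemma sum_lists_Suc:
  "(\<Sum>xs | length xs = Suc k. F xs) = (\<Sum>xs | length xs = k. \<Sum>i\<in>(UNIV :: 'n::finite set). F (i # xs))"
proof -
  have "bij_betw (\<lambda>(xs, i). i # xs) ({xs. length xs = k} \<times> (UNIV :: 'n set)) {xs. length xs = Suc k}"
    by (rule bij_betwI[of _ _ _ "\<lambda>ys. (tl ys, hd ys)"]) (auto simp: length_Suc_conv)
  from sum.reindex_bij_betw[OF this, of F]
  show ?thesis by (simp add: sum.cartesian_product case_prod_unfold)
qed

lemma dirder_0: "dirder 0 v f z = f z"
  by (simp add: dirder_def)

lemma dirder_derivative:
  fixes f :: "real ^ 'n::finite \<Rightarrow> real"
  assumes f: "Ck_on n B1 f" and k: "k < n" and T: "\<And>\<sigma>. \<sigma> \<in> T \<Longrightarrow> x + \<sigma> *\<^sub>R v \<in> B1" and \<tau>: "\<tau> \<in> T"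
  shows "((\<lambda>\<sigma>. dirder k v f (x + \<sigma> *\<^sub>R v)) has_real_derivative dirder (Suc k) v f (x + \<tau> *\<^sub>R v)) (at \<tau> within T)"
proof -
  have "((\<lambda>\<sigma>. dirder k v f (x + \<sigma> *\<^sub>R v)) has_real_derivative
    (\<Sum>xs | length xs = k. (\<Prod>i\<leftarrow>xs. v $ i) * (\<Sum>i\<in>UNIV. v $ i * partial_deriv B1 i (iter_partial_deriv B1 xs f) (x + \<tau> *\<^sub>R v)))) (at \<tau> within T)"
    unfolding dirder_def
  proof (intro DERIV_sum DERIV_cmult line_derivative T \<tau>)
    fix xs :: "'n list" assume "xs \<in> {xs. length xs = k}"
    then show "iter_partial_deriv B1 xs f differentiable_on B1"
      using Ck_on_iter[OF f, of xs] k by (intro Ck_on_differentiable) auto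
  qed
  moreover have "dirder (Suc k) v f (x + \<tau> *\<^sub>R v)
    = (\<Sum>xs | length xs = k. (\<Prod>i\<leftarrow>xs. v $ i) * (\<Sum>i\<in>UNIV. v $ i * partial_deriv B1 i (iter_partial_deriv B1 xs f) (x + \<tau> *\<^sub>R v)))"
    unfolding dirder_def sum_lists_Suc by (simp add: sum_distrib_left mult_ac)
  ultimately show ?thesis by simp
qed

text \<open>The largest weight with which a single partial derivative of order \<open>size A\<close> enters a directional
  derivative is the multinomial coefficient times \<open>mon A\<close>.\<close>

definition weight :: "'n::finite multiset \<Rightarrow> real ^ 'n \<Rightarrow> real" where
  "weight A v = (\<Sum>xs | mset xs = A. \<Prod>i\<leftarrow>xs. \<bar>v $ i\<bar>)"

definition weight_bound :: "'n::finite itself \<Rightarrow> nat \<Rightarrow> real \<Rightarrow> bool" where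
  "weight_bound TYPE('n) k \<kappa> \<longleftrightarrow> (\<forall>(A :: 'n multiset) v. size A = k \<longrightarrow> norm v \<le> 1 \<longrightarrow> weight A v \<le> \<kappa>)"

lemma finite_lists_mset: "finite {xs :: 'n::finite list. mset xs = A}"
  by (rule finite_subset[OF _ finite_lists_length[of "size A"]]) auto

text \<open>Rearrangements of a word give the same partial derivative. Collecting them leaves one
  weight per multi-index, and \<open>deriv_norm\<close> counts each multi-index once.\<close>

lemma dirder_bound:
  fixes f :: "real ^ 'n::finite \<Rightarrow> real"
  assumes f: "Ck_on k B1 f" and z: "z \<in> B1" and v: "norm v \<le> 1" and \<kappa>: "weight_bound TYPE('n) k \<kappa>"
  shows "\<bar>dirder k v f z\<bar> \<le> \<kappa> * M k f"
proof -
  have "\<bar>dirder k v f z\<bar> \<le> (\<Sum>xs | length xs = k. (\<Prod>i\<leftarrow>xs. \<bar>v $ i\<bar>) * \<bar>multi_deriv B1 (mset xs) f z\<bar>)"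
    unfolding dirder_def
  proof (rule order_trans[OF sum_abs], rule sum_mono)
    fix xs :: "'n list" assume "xs \<in> {xs. length xs = k}"
    then have "multi_deriv B1 (mset xs) f z = iter_partial_deriv B1 xs f z"
      by (intro multi_deriv_eq[OF f _ z]) simp
    moreover have "\<bar>\<Prod>i\<leftarrow>xs. v $ i\<bar> = (\<Prod>i\<leftarrow>xs. \<bar>v $ i\<bar>)" by (induction xs) (auto simp: abs_mult)
    ultimately show "\<bar>(\<Prod>i\<leftarrow>xs. v $ i) * iter_partial_deriv B1 xs f z\<bar> \<le> (\<Prod>i\<leftarrow>xs. \<bar>v $ i\<bar>) * \<bar>multi_deriv B1 (mset xs) f z\<bar>"
      by (simp add: abs_mult)
  qed
  also have "\<dots> = (\<Sum>A | size A = k. \<Sum>xs\<in>{xs. xs \<in> {xs. length xs = k} \<and> mset xs = A}. (\<Prod>i\<leftarrow>xs. \<bar>v $ i\<bar>) * \<bar>multi_deriv B1 (mset xs) f z\<bar>)"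
    by (rule sum.group[symmetric]) (auto simp: finite_lists_length finite_multisets_of_size)
  also have "\<dots> = (\<Sum>A | size A = k. weight A v * \<bar>multi_deriv B1 A f z\<bar>)"
  proof (rule sum.cong)
    fix A :: "'n multiset" assume "A \<in> {A. size A = k}"
    then have "{xs. xs \<in> {xs. length xs = k} \<and> mset xs = A} = {xs. mset xs = A}" by auto
    then show "(\<Sum>xs\<in>{xs. xs \<in> {xs. length xs = k} \<and> mset xs = A}. (\<Prod>i\<leftarrow>xs. \<bar>v $ i\<bar>) * \<bar>multi_deriv B1 (mset xs) f z\<bar>)
      = weight A v * \<bar>multi_deriv B1 A f z\<bar>"
      by (simp add: weight_def sum_distrib_right)
  qed simp
  also have "\<dots> \<le> (\<Sum>A | size A = k. \<kappa> * \<bar>multi_deriv B1 A f z\<bar>)"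
    using \<kappa> v by (intro sum_mono mult_right_mono) (auto simp: weight_bound_def)
  also have "\<dots> = \<kappa> * deriv_norm k f z" by (simp add: deriv_norm_def sum_distrib_left)
  also have "\<dots> \<le> \<kappa> * M k f"
  proof (rule mult_left_mono[OF deriv_norm_le_M[OF f z]])
    obtain A :: "'n multiset" where "size A = k" by (meson size_replicate_mset)
    moreover have "weight A 0 \<ge> 0" unfolding weight_def by (intro sum_nonneg) (auto intro!: prod_list_nonneg)
    ultimately show "0 \<le> \<kappa>" using \<kappa>[unfolded weight_bound_def, rule_format, of A 0] by simp
  qed
  finally show ?thesis .
qed

section \<open>Bounds for the weights\<close>

lemma weight_rec:
  assumes "A \<noteq> {#}"
  shows "weight A v = (\<Sum>i\<in>set_mset A. \<bar>v $ i\<bar> * weight (A - {#i#}) v)"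
proof -
  have "weight A v = (\<Sum>i\<in>set_mset A. \<Sum>xs\<in>{xs. xs \<in> {xs. mset xs = A} \<and> hd xs = i}. \<Prod>i\<leftarrow>xs. \<bar>v $ i\<bar>)"
    unfolding weight_def
    by (rule sum.group[symmetric]) (use assms in \<open>auto simp: finite_lists_mset\<close>)
  also have "\<dots> = (\<Sum>i\<in>set_mset A. \<bar>v $ i\<bar> * weight (A - {#i#}) v)"
  proof (rule sum.cong[OF refl])
    fix i assume i: "i \<in># A"
    have "bij_betw (\<lambda>ys. i # ys) {ys. mset ys = A - {#i#}} {xs. xs \<in> {xs. mset xs = A} \<and> hd xs = i}"
    proof (rule bij_betwI[of _ _ _ tl])
      show "(\<lambda>ys. i # ys) \<in> {ys. mset ys = A - {#i#}} \<rightarrow> {xs. xs \<in> {xs. mset xs = A} \<and> hd xs = i}"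
        using i by auto
      show "tl \<in> {xs. xs \<in> {xs. mset xs = A} \<and> hd xs = i} \<rightarrow> {ys. mset ys = A - {#i#}}"
        using assms by (auto simp: neq_Nil_conv)
      show "i # tl y = y" if "y \<in> {xs. xs \<in> {xs. mset xs = A} \<and> hd xs = i}" for y
        using that assms by (cases y) auto
    qed simp
    from sum.reindex_bij_betw[OF this, of "\<lambda>xs. \<Prod>i\<leftarrow>xs. \<bar>v $ i\<bar>"]
    show "(\<Sum>xs\<in>{xs. xs \<in> {xs. mset xs = A} \<and> hd xs = i}. \<Prod>i\<leftarrow>xs. \<bar>v $ i\<bar>) = \<bar>v $ i\<bar> * weight (A - {#i#}) v"
      by (simp add: weight_def sum_distrib_left)
  qed
  finally show ?thesis .
qed

lemma sum_abs_components:
  fixes v :: "real ^ 'n::finite"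
  assumes "norm v \<le> 1"
  shows "(\<Sum>i\<in>I. \<bar>v $ i\<bar>) \<le> sqrt (card I)"
proof -
  have "(\<Sum>i\<in>I. \<bar>v $ i\<bar>)\<^sup>2 \<le> (\<Sum>i\<in>I. \<bar>v $ i\<bar>\<^sup>2) * real (card I)"
    using Cauchy_Schwarz_ineq_sum[of "\<lambda>i. \<bar>v $ i\<bar>" "\<lambda>_. 1" I] by simp
  also have "\<dots> \<le> 1 * real (card I)"
  proof (rule mult_right_mono)
    have "(\<Sum>i\<in>I. \<bar>v $ i\<bar>\<^sup>2) \<le> (\<Sum>i\<in>UNIV. \<bar>v $ i\<bar>\<^sup>2)" by (rule sum_mono2) auto
    also have "\<dots> = (norm v)\<^sup>2" by (simp add: norm_vec_def L2_set_def sum_nonneg)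
    also have "\<dots> \<le> 1" using assms by (simp add: power_le_one)
    finally show "(\<Sum>i\<in>I. \<bar>v $ i\<bar>\<^sup>2) \<le> 1" .
  qed simp
  finally show ?thesis by (intro real_le_rsqrt) simp
qed

text \<open>Splitting off the first letter costs the sum of \<open>\<bar>v $ i\<bar>\<close> over
  the letters that occur, by Cauchy-Schwarz at most the root of their number; there are at most
  \<open>Suc k\<close> letters and at most one per coordinate.\<close>

lemma weight_bound_Suc:
  assumes "weight_bound TYPE('n::finite) k \<kappa>" "\<kappa> \<ge> 0"
  shows "weight_bound TYPE('n) (Suc k) (\<kappa> * sqrt (min (Suc k) CARD('n)))"
  unfolding weight_bound_def
proof (intro allI impI)
  fix A :: "'n multiset" and v :: "real ^ 'n"
  assume A: "size A = Suc k" and v: "norm v \<le> 1"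
  then have "A \<noteq> {#}" by auto
  then have "weight A v = (\<Sum>i\<in>set_mset A. \<bar>v $ i\<bar> * weight (A - {#i#}) v)" by (rule weight_rec)
  also have "\<dots> \<le> (\<Sum>i\<in>set_mset A. \<bar>v $ i\<bar> * \<kappa>)"
    using assms A v by (intro sum_mono mult_left_mono) (auto simp: weight_bound_def size_Diff_singleton)
  also have "\<dots> = \<kappa> * (\<Sum>i\<in>set_mset A. \<bar>v $ i\<bar>)" by (simp add: sum_distrib_left mult.commute)
  also have "\<dots> \<le> \<kappa> * sqrt (card (set_mset A))"
    by (intro mult_left_mono sum_abs_components v assms)
  also have "\<dots> \<le> \<kappa> * sqrt (min (Suc k) CARD('n))"
  proof -
    have "card (set_mset A) \<le> Suc k"
      using A by (metis card_length ex_mset set_mset_mset size_mset)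
    moreover have "card (set_mset A) \<le> CARD('n)" by (rule card_mono) auto
    ultimately show ?thesis using assms(2) by (intro mult_left_mono) auto
  qed
  finally show "weight A v \<le> \<kappa> * sqrt (min (Suc k) CARD('n))" .
qed

text \<open>From \<open>2 * \<bar>v $ i\<bar> * \<bar>v $ j\<bar> \<le> (v $ i)\<^sup>2 + (v $
  j)\<^sup>2\<close>. Starting the recursion at order 2 with the constant 1 saves a factor
  \<open>sqrt 2\<close> against \<open>weight_bound_Suc\<close> from order 1 in dimension at least
  2.\<close>

lemma weight_bound_2: "weight_bound TYPE('n::finite) 2 1"
  unfolding weight_bound_def
proof (intro allI impI)
  fix A :: "'n multiset" and v :: "real ^ 'n"
  assume A: "size A = 2" and v: "norm v \<le> 1"
  obtain xs where xs: "mset xs = A" using ex_mset by blast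
  then have "length xs = Suc (Suc 0)" using A by auto
  then obtain i j where "xs = [i, j]" by (auto simp: length_Suc_conv)
  with xs have ij: "A = {#i, j#}" by auto
  have w1: "weight {#l#} v = \<bar>v $ l\<bar>" for l
    by (subst weight_rec) (auto simp: weight_def)
  have sq: "(\<Sum>l\<in>UNIV. (v $ l)\<^sup>2) \<le> 1"
  proof -
    have "(\<Sum>l\<in>UNIV. (v $ l)\<^sup>2) = (norm v)\<^sup>2" by (simp add: norm_vec_def L2_set_def sum_nonneg)
    then show ?thesis using v by (simp add: power_le_one)
  qed
  show "weight A v \<le> 1"
  proof (cases "i = j")
    case True
    have "weight A v = \<bar>v $ i\<bar> * \<bar>v $ i\<bar>" unfolding ij by (subst weight_rec) (auto simp: True w1)
    also have "\<dots> = (v $ i)\<^sup>2" by (simp add: power2_eq_square)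
    also have "\<dots> \<le> (\<Sum>l\<in>UNIV. (v $ l)\<^sup>2)" by (rule member_le_sum) auto
    finally show ?thesis using sq by linarith
  next
    case False
    have "weight A v = 2 * (\<bar>v $ i\<bar> * \<bar>v $ j\<bar>)" unfolding ij by (subst weight_rec) (use False in \<open>auto simp: w1\<close>)
    also have "\<dots> \<le> (v $ i)\<^sup>2 + (v $ j)\<^sup>2"
      using sum_squares_bound[of "\<bar>v $ i\<bar>" "\<bar>v $ j\<bar>"] by simp
    also have "\<dots> = (\<Sum>l\<in>{i, j}. (v $ l)\<^sup>2)" using False by simp
    also have "\<dots> \<le> (\<Sum>l\<in>UNIV. (v $ l)\<^sup>2)" by (rule sum_mono2) auto
    finally show ?thesis using sq by linarith
  qed
qed

lemma weight_bound_mono: "weight_bound TYPE('n::finite) k \<kappa> \<Longrightarrow> \<kappa> \<le> \<kappa>' \<Longrightarrow> weight_bound TYPE('n) k \<kappa>'"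
  unfolding weight_bound_def by force

lemma weight_bound_general: "weight_bound TYPE('n::finite) (k + 2) (sqrt CARD('n) ^ k)"
proof (induction k)
  case 0
  show ?case unfolding add_0 power_0 by (rule weight_bound_2)
next
  case (Suc k)
  from weight_bound_Suc[OF Suc] show ?case
    by (auto elim!: weight_bound_mono intro!: mult_right_mono simp: mult.commute)
qed

text \<open>Independent of the dimension, and better than \<open>weight_bound_general\<close> as
  soon as there are more than three coordinates.\<close>

lemma weight_bound_3: "weight_bound TYPE('n::finite) 3 (sqrt 3)"
proof -
  have "weight_bound TYPE('n) (Suc 2) (1 * sqrt (min (Suc 2) CARD('n)))"
    by (rule weight_bound_Suc[OF weight_bound_2]) simp
  moreover have "Suc 2 = (3 :: nat)" by simp
  ultimately have "weight_bound TYPE('n) 3 (1 * sqrt (min 3 CARD('n)))" by (simp only:)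
  then show ?thesis by (rule weight_bound_mono) simp
qed

section \<open>Interpolation and approximation on the ball\<close>

text \<open>The restriction to the line has \<open>x\<close> at parameter 0. The hull of 0 and the
  nodes is mapped into the ball by convexity, and \<open>norm u \<le> 1\<close> allows the uniform
  bound for directional derivatives.\<close>

lemma ball_interpolation:
  fixes f :: "real ^ 'n::finite \<Rightarrow> real"
  assumes f: "Ck_on (d + 1) B1 f" and \<kappa>: "weight_bound TYPE('n) (d + 1) \<kappa>"
    and x: "x \<in> B1" and u: "norm u \<le> 1"
    and T: "finite T" "card T = d + 1" "\<And>\<tau>. \<tau> \<in> T \<Longrightarrow> x + \<tau> *\<^sub>R u \<in> B1"
  shows "\<bar>f x\<bar> \<le> (\<Sum>\<tau>\<in>T. \<bar>f (x + \<tau> *\<^sub>R u)\<bar> * (\<Prod>\<sigma>\<in>T - {\<tau>}. \<bar>\<sigma>\<bar> / \<bar>\<tau> - \<sigma>\<bar>))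
    + \<kappa> * M (d + 1) f / fact (d + 1) * (\<Prod>\<tau>\<in>T. \<bar>\<tau>\<bar>)"
proof -
  define \<alpha> \<beta> where "\<alpha> = Min (insert 0 T)" and "\<beta> = Max (insert 0 T)"
  have ab: "\<alpha> \<in> insert 0 T" "\<beta> \<in> insert 0 T" unfolding \<alpha>_def \<beta>_def
    using Min_in[of "insert 0 T"] Max_in[of "insert 0 T"] T(1) by blast+
  have sub: "T \<subseteq> {\<alpha>..\<beta>}" "0 \<in> {\<alpha>..\<beta>}" using T(1) by (auto simp: \<alpha>_def \<beta>_def)
  have seg: "x + \<tau> *\<^sub>R u \<in> B1" if "\<tau> \<in> {\<alpha>..\<beta>}" for \<tau>
  proof -
    have "x + \<alpha> *\<^sub>R u \<in> B1" "x + \<beta> *\<^sub>R u \<in> B1" using ab x T(3) by auto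
    moreover have "\<tau> \<in> closed_segment \<alpha> \<beta>" using that by (auto simp: closed_segment_eq_real_ivl)
    then obtain s where s: "0 \<le> s" "s \<le> 1" "\<tau> = (1 - s) * \<alpha> + s * \<beta>" by (auto simp: in_segment)
    have "x + \<tau> *\<^sub>R u = (1 - s) *\<^sub>R (x + \<alpha> *\<^sub>R u) + s *\<^sub>R (x + \<beta> *\<^sub>R u)"
      unfolding s(3) by (simp add: algebra_simps)
    ultimately show ?thesis using s(1,2) convexD_alt[OF convex_cball, of "x + \<alpha> *\<^sub>R u" 0 1 "x + \<beta> *\<^sub>R u" s] by simp
  qed
  have "\<bar>dirder 0 u f (x + 0 *\<^sub>R u)\<bar> \<le> (\<Sum>\<tau>\<in>T. \<bar>dirder 0 u f (x + \<tau> *\<^sub>R u)\<bar> * (\<Prod>\<sigma>\<in>T - {\<tau>}. \<bar>0 - \<sigma>\<bar> / \<bar>\<tau> - \<sigma>\<bar>))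
    + \<kappa> * M (d + 1) f / fact (Suc d) * (\<Prod>\<tau>\<in>T. \<bar>0 - \<tau>\<bar>)"
  proof (rule interpolation_bound[where \<phi> = "\<lambda>j \<tau>. dirder j u f (x + \<tau> *\<^sub>R u)" and \<alpha> = \<alpha> and \<beta> = \<beta>])
    show "((\<lambda>\<tau>. dirder j u f (x + \<tau> *\<^sub>R u)) has_real_derivative dirder (Suc j) u f (x + \<tau> *\<^sub>R u)) (at \<tau> within {\<alpha>..\<beta>})"
      if "j < Suc d" "\<tau> \<in> {\<alpha>..\<beta>}" for j \<tau>
      by (rule dirder_derivative[OF f _ seg]) (use that in auto)
    show "\<bar>dirder (Suc d) u f (x + \<tau> *\<^sub>R u)\<bar> \<le> \<kappa> * M (d + 1) f" if "\<tau> \<in> {\<alpha>..\<beta>}" for \<tau>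
      using dirder_bound[OF f seg[OF that] u \<kappa>] by simp
  qed (use T sub in auto)
  then show ?thesis by (simp add: dirder_0)
qed

lemma taylor_ball:
  fixes f :: "real ^ 'n::finite \<Rightarrow> real"
  assumes f: "Ck_on (d + 1) B1 f" and \<kappa>: "weight_bound TYPE('n) (d + 1) \<kappa>"
  shows "\<exists>P\<in>Pol d. \<forall>z\<in>B1. \<bar>f z - P z\<bar> \<le> \<kappa> * M (d + 1) f / fact (d + 1)"
proof -
  define P where "P z = (\<Sum>k<d + 1. dirder k z f 0 / fact k)" for z
  have "(\<lambda>z. (iter_partial_deriv B1 xs f 0 / fact k) * mon (mset xs) z) \<in> Pol d" if "length xs = k" "k < d + 1" for xs k
    using that by (intro Pol_cmult Pol_mon) simp
  then have "(\<lambda>z. \<Sum>k<d + 1. \<Sum>xs | length xs = k. (iter_partial_deriv B1 xs f 0 / fact k) * mon (mset xs) z) \<in> Pol d"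
    by (intro Pol_sum) auto
  moreover have "mon (mset xs) z = (\<Prod>i\<leftarrow>xs. z $ i)" for xs and z :: "real ^ 'n"
    by (induction xs) auto
  ultimately have P: "P \<in> Pol d"
    by (simp add: P_def[abs_def] dirder_def sum_divide_distrib mult.commute)
  have ball: "\<bar>f z - P z\<bar> \<le> \<kappa> * M (d + 1) f / fact (d + 1)" if z: "z \<in> ball 0 1" for z
  proof -
    \<comment> \<open>\<open>Maclaurin\<close> asks for two-sided derivatives up to the parameter 1,
      so the segment is prolonged beyond \<open>z\<close>. This is possible for \<open>z\<close> in
      the open ball; the sphere is reached by continuity at the end.\<close>
    define \<rho> where "\<rho> = (if z = 0 then 2 else 1 / norm z)"
    have \<rho>: "\<rho> > 1" using z by (auto simp: \<rho>_def field_simps)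
    have seg: "0 + \<tau> *\<^sub>R z \<in> B1" if "\<tau> \<in> {- \<rho>..\<rho>}" for \<tau>
    proof (cases "z = 0")
      case False
      then have "\<bar>\<tau>\<bar> * norm z \<le> \<rho> * norm z" using that by (intro mult_right_mono) auto
      then show ?thesis using False by (simp add: \<rho>_def)
    qed simp
    define \<phi> where "\<phi> k \<tau> = dirder k z f (0 + \<tau> *\<^sub>R z)" for k \<tau>
    have "\<exists>t>0. t < 1 \<and> \<phi> 0 1 = (\<Sum>m<d + 1. \<phi> m 0 / fact m * 1 ^ m) + \<phi> (d + 1) t / fact (d + 1) * 1 ^ (d + 1)"
    proof (rule Maclaurin)
      show "\<forall>m t. m < d + 1 \<and> 0 \<le> t \<and> t \<le> 1 \<longrightarrow> (\<phi> m has_real_derivative \<phi> (Suc m) t) (at t)"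
      proof (intro allI impI)
        fix m t assume mt: "m < d + 1 \<and> 0 \<le> t \<and> t \<le> (1 :: real)"
        then have t: "t \<in> {- \<rho><..<\<rho>}" using \<rho> by auto
        have "(\<phi> m has_real_derivative \<phi> (Suc m) t) (at t within {- \<rho>..\<rho>})"
          unfolding \<phi>_def by (rule dirder_derivative[OF f _ seg]) (use mt t in auto)
        moreover have "at t within {- \<rho>..\<rho>} = at t"
          by (rule at_within_interior) (use t in \<open>simp add: interior_atLeastAtMost_real\<close>)
        ultimately show "(\<phi> m has_real_derivative \<phi> (Suc m) t) (at t)" by simp
      qed
    qed auto
    then obtain t where t: "0 < t" "t < 1" "\<phi> 0 1 = (\<Sum>m<d + 1. \<phi> m 0 / fact m) + \<phi> (d + 1) t / fact (d + 1)"
      by auto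
    then have "f z - P z = \<phi> (d + 1) t / fact (d + 1)" by (simp add: \<phi>_def P_def dirder_0)
    moreover have "\<bar>\<phi> (d + 1) t\<bar> \<le> \<kappa> * M (d + 1) f"
      unfolding \<phi>_def using t \<rho> z by (intro dirder_bound[OF f seg _ \<kappa>]) auto
    ultimately show ?thesis by (simp add: divide_right_mono del: fact_Suc)
  qed
  have cont: "continuous_on B1 P"
  proof -
    have "continuous_on B1 (mon A)" for A :: "'n multiset"
      by (induction A) (auto simp: mon_def[abs_def] intro!: continuous_intros)
    moreover obtain c where "P = (\<lambda>x. \<Sum>A | size A \<le> d. c A * mon A x)" using P by (auto simp: Pol_def)
    ultimately show ?thesis
      by (simp only:) (intro continuous_on_sum continuous_on_mult continuous_on_const)
  qed
  have "\<bar>f z - P z\<bar> \<le> \<kappa> * M (d + 1) f / fact (d + 1)" if "z \<in> B1" for z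
    by (rule continuous_le_on_closure[of "ball 0 1" "\<lambda>z. \<bar>f z - P z\<bar>"])
      (use cont Ck_on_continuous[OF f] ball that in \<open>auto intro!: continuous_intros\<close>)
  with P show ?thesis by blast
qed

section \<open>Rays through a set of positive measure\<close>

lemma emeasure_cball1:
  "emeasure lebesgue (cball 0 1 :: (real ^ 'n::finite) set) = ennreal (unit_ball_vol CARD('n))"
  using emeasure_cball[of 1 "0 :: real ^ 'n"] by simp

text \<open>The ball is cut into the images of the shell between the ball and its homothetic copy
  of ratio \<open>q\<close> with centre \<open>x0\<close> under the powers of this homothety. Moving all parts of \<open>E\<close> to the
  outermost shell and averaging there yields a ray on which \<open>E\<close> is large; this replaces
  integration in polar coordinates. The set in the conclusion records, in the coordinate
  \<open>s = r ^ n\<close>, the layers which the ray meets in \<open>E\<close>.\<close>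

lemma shell_ray:
  fixes E :: "(real ^ 'n::finite) set"
  assumes E: "compact E" "E \<subseteq> cball 0 1" and x0: "x0 \<in> cball 0 1" and q: "0 < q" "q < 1"
    and \<theta>: "0 \<le> \<theta>" "\<theta> * unit_ball_vol CARD('n) < measure lebesgue E"
  shows "\<exists>y\<in>cball 0 1. x0 + (1 / q) *\<^sub>R (y - x0) \<notin> cball 0 1 \<and>
    ennreal \<theta> < emeasure lborel (\<Union>i\<in>{i. x0 + q ^ i *\<^sub>R (y - x0) \<in> E}. {q ^ (CARD('n) * Suc i)<..q ^ (CARD('n) * i)})"
proof (rule ccontr)
  assume neg: "\<not> ?thesis"
  define B where "B = (cball 0 1 :: (real ^ 'n) set)"
  define n where "n = CARD('n)"
  define \<omega> where "\<omega> = unit_ball_vol (real n)"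
  have n: "n \<ge> 1" by (simp add: n_def Suc_leI)
  define pt where "pt i y = x0 + q ^ i *\<^sub>R (y - x0)" for i y
  have pt_eq: "pt i y = (q ^ i) *\<^sub>R y + (x0 - (q ^ i) *\<^sub>R x0)" for i y by (simp add: pt_def algebra_simps)
  define S where "S = B - pt 1 ` B"
  have x0B: "x0 \<in> B" using x0 by (simp add: B_def)
  have ptB: "pt i y \<in> B" if "y \<in> B" for i y
  proof -
    have "q ^ i \<le> 1" using q by (simp add: power_le_one)
    then have "(1 - q ^ i) *\<^sub>R x0 + (q ^ i) *\<^sub>R y \<in> B"
      using q x0B that unfolding B_def by (intro convexD_alt[OF convex_cball]) auto
    then show ?thesis by (simp add: pt_eq algebra_simps)
  qed
  have S_iff: "y \<in> S \<longleftrightarrow> y \<in> B \<and> x0 + (1 / q) *\<^sub>R (y - x0) \<notin> B" for y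
  proof -
    have "y \<in> pt 1 ` B \<longleftrightarrow> x0 + (1 / q) *\<^sub>R (y - x0) \<in> B"
    proof
      assume "y \<in> pt 1 ` B"
      then obtain w where "w \<in> B" "y = pt 1 w" by blast
      then show "x0 + (1 / q) *\<^sub>R (y - x0) \<in> B" using q by (simp add: pt_def)
    next
      assume "x0 + (1 / q) *\<^sub>R (y - x0) \<in> B"
      moreover have "y = pt 1 (x0 + (1 / q) *\<^sub>R (y - x0))" using q by (simp add: pt_def)
      ultimately show "y \<in> pt 1 ` B" by blast
    qed
    then show ?thesis by (auto simp: S_def)
  qed
  have pt_cont: "continuous_on A (pt i)" for A i unfolding pt_def[abs_def] by (intro continuous_intros)
  have cB: "compact B" "compact (pt 1 ` B)"
    unfolding B_def by (auto intro: compact_continuous_image pt_cont)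
  have S_meas: "S \<in> sets borel" unfolding S_def using cB by (intro sets.Diff borel_compact)
  define Ei where "Ei i = {y \<in> S. pt i y \<in> E}" for i
  have Ei_meas: "Ei i \<in> sets borel" for i
  proof -
    have "closed (pt i -` E)" by (intro closed_vimage compact_imp_closed E(1) continuous_intros) (auto simp: pt_def intro!: continuous_intros)
    then have "S \<inter> pt i -` E \<in> sets borel" by (intro sets.Int S_meas borel_closed)
    moreover have "Ei i = S \<inter> pt i -` E" by (auto simp: Ei_def)
    ultimately show ?thesis by simp
  qed
  have emS: "emeasure lebesgue S = ennreal (\<omega> * (1 - q ^ n))"
  proof -
    have "emeasure lebesgue (pt 1 ` B) = ennreal (q ^ n) * ennreal \<omega>"
      using emeasure_lebesgue_affine[of q "x0 - q *\<^sub>R x0" B] emeasure_cball1[where 'n = 'n] q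
      by (simp add: pt_eq[abs_def] B_def n_def \<omega>_def ennreal_power)
    then have 1: "emeasure lebesgue (pt 1 ` B) = ennreal (q ^ n * \<omega>)"
      using q by (simp add: ennreal_mult' \<omega>_def)
    have "B \<in> sets lebesgue" "pt 1 ` B \<in> sets lebesgue"
      using borel_compact[OF cB(1)] borel_compact[OF cB(2)] by (auto intro!: sets_completionI_sets)
    then have "emeasure lebesgue S = emeasure lebesgue B - emeasure lebesgue (pt 1 ` B)"
      unfolding S_def
    proof (intro emeasure_Diff)
      show "emeasure lebesgue (pt 1 ` B) \<noteq> \<infinity>" unfolding 1 by simp
      show "pt 1 ` B \<subseteq> B" using ptB by blast
    qed
    also have "\<dots> = ennreal \<omega> - ennreal (q ^ n * \<omega>)" unfolding 1 by (simp add: B_def emeasure_cball1 \<omega>_def n_def)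
    also have "\<dots> = ennreal (\<omega> - q ^ n * \<omega>)" using q by (intro ennreal_minus) (simp add: \<omega>_def)
    finally show ?thesis by (simp add: algebra_simps)
  qed
  \<comment> \<open>Any point other than the centre is moved outwards by the inverse homothety until
    the next step would leave the ball.\<close>
  have cover: "E \<subseteq> {x0} \<union> (\<Union>i. pt i ` Ei i)"
  proof
    fix x assume x: "x \<in> E"
    show "x \<in> {x0} \<union> (\<Union>i. pt i ` Ei i)"
    proof (cases "x = x0")
      case False
      define e where "e i = x0 + (1 / q ^ i) *\<^sub>R (x - x0)" for i
      have "\<exists>i. e i \<notin> B"
      proof -
        have "norm (x - x0) / 3 > 0" using False by simp
        then obtain i where i: "q ^ i < norm (x - x0) / 3" using q real_arch_pow_inv by blast
        have "norm (e i) \<ge> norm ((1 / q ^ i) *\<^sub>R (x - x0)) - norm x0"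
          unfolding e_def by (metis add.commute norm_diff_ineq)
        moreover have "norm ((1 / q ^ i) *\<^sub>R (x - x0)) = norm (x - x0) / q ^ i" using q by (simp add: divide_inverse)
        moreover have "norm (x - x0) / q ^ i > 3" using i q by (simp add: field_simps)
        moreover have "norm x0 \<le> 1" using x0 by simp
        ultimately have "norm (e i) > 1" by linarith
        then show ?thesis by (intro exI[of _ i]) (simp add: B_def)
      qed
      define k where "k = (LEAST i. e i \<notin> B)"
      have k: "e k \<notin> B" unfolding k_def by (rule LeastI_ex) (fact \<open>\<exists>i. e i \<notin> B\<close>)
      have "e 0 \<in> B" using x E(2) by (auto simp: e_def B_def)
      with k have "k \<noteq> 0" by metis
      then obtain j where j: "k = Suc j" by (cases k) auto
      have "e j \<in> B" using not_less_Least[of j "\<lambda>i. e i \<notin> B"] j by (auto simp: k_def)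
      moreover have "x0 + (1 / q) *\<^sub>R (e j - x0) = e k" by (simp add: e_def j)
      ultimately have "e j \<in> S" using k by (simp add: S_iff)
      moreover have "pt j (e j) = x" using q by (simp add: pt_def e_def)
      ultimately have "x \<in> pt j ` Ei j" using x by (force simp: Ei_def)
      then show ?thesis by blast
    qed simp
  qed
  have emE: "emeasure lebesgue E \<le> (\<Sum>i. ennreal (q ^ (n * i)) * emeasure lebesgue (Ei i))"
  proof -
    have pt_meas: "pt i ` Ei i \<in> sets lebesgue" for i
    proof (cases "q ^ i = 0")
      case True
      then show ?thesis using q by simp
    next
      case False
      have "pt i ` Ei i = (\<lambda>x. x0 + (1 / q ^ i) *\<^sub>R (x - x0)) -` Ei i"
      proof (intro equalityI subsetI)
        fix x assume "x \<in> (\<lambda>x. x0 + (1 / q ^ i) *\<^sub>R (x - x0)) -` Ei i"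
        moreover have "x = pt i (x0 + (1 / q ^ i) *\<^sub>R (x - x0))" using q by (simp add: pt_def)
        ultimately show "x \<in> pt i ` Ei i" by blast
      qed (use q in \<open>auto simp: pt_def\<close>)
      moreover have "(\<lambda>x. x0 + (1 / q ^ i) *\<^sub>R (x - x0)) \<in> borel_measurable borel"
        by (intro borel_measurable_continuous_onI continuous_intros)
      ultimately have "pt i ` Ei i \<in> sets borel"
        using measurable_sets[OF _ Ei_meas[of i], of "\<lambda>x. x0 + (1 / q ^ i) *\<^sub>R (x - x0)" borel] by simp
      then show ?thesis by simp
    qed
    have un_meas: "(\<Union>i. pt i ` Ei i) \<in> sets lebesgue" using pt_meas by (intro sets.countable_UN) auto
    then have x0_meas: "{x0} \<union> (\<Union>i. pt i ` Ei i) \<in> sets lebesgue" by (intro sets.Un) auto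
    have "emeasure lebesgue E \<le> emeasure lebesgue ({x0} \<union> (\<Union>i. pt i ` Ei i))"
      by (rule emeasure_mono[OF cover x0_meas])
    also have "\<dots> \<le> emeasure lebesgue {x0} + emeasure lebesgue (\<Union>i. pt i ` Ei i)"
      by (rule emeasure_subadditive) (use un_meas in auto)
    also have "\<dots> = emeasure lebesgue (\<Union>i. pt i ` Ei i)" by simp
    also have "\<dots> \<le> (\<Sum>i. emeasure lebesgue (pt i ` Ei i))"
      by (rule emeasure_subadditive_countably) (use pt_meas in auto)
    also have "\<dots> = (\<Sum>i. ennreal (q ^ (n * i)) * emeasure lebesgue (Ei i))"
    proof (rule suminf_cong)
      fix i
      have "emeasure lebesgue (pt i ` Ei i) = ennreal (\<bar>q ^ i\<bar> ^ n) * emeasure lebesgue (Ei i)"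
        using emeasure_lebesgue_affine[of "q ^ i" "x0 - (q ^ i) *\<^sub>R x0" "Ei i"]
        by (simp add: pt_eq[abs_def] n_def)
      also have "\<bar>q ^ i\<bar> ^ n = q ^ (n * i)"
        using q by (simp add: power_mult[symmetric] mult.commute)
      finally show "emeasure lebesgue (pt i ` Ei i) = ennreal (q ^ (n * i)) * emeasure lebesgue (Ei i)" .
    qed
    finally show ?thesis .
  qed
  \<comment> \<open>The length of \<open>J i\<close> is the share of the ball taken by its
    \<open>i\<close>-th shell. So the total length of the layers met by a ray counts
    \<open>E\<close> with the proper volume weights.\<close>
  define J where "J i = {q ^ (n * Suc i)<..q ^ (n * i)}" for i
  have emJ: "emeasure lborel (J i) = ennreal (q ^ (n * i)) * ennreal (1 - q ^ n)" for i
  proof -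
    have "q ^ n \<le> 1" using q by (simp add: power_le_one)
    then have le: "q ^ (n * Suc i) \<le> q ^ (n * i)" using q by (intro power_decreasing) auto
    have "emeasure lborel (J i) = ennreal (q ^ (n * i) - q ^ (n * Suc i))" unfolding J_def using le by simp
    also have "q ^ (n * i) - q ^ (n * Suc i) = q ^ (n * i) * (1 - q ^ n)" by (simp add: algebra_simps power_add)
    finally show ?thesis using q \<open>q ^ n \<le> 1\<close> by (simp add: ennreal_mult)
  qed
  have disjJ: "disjoint_family J"
  proof -
    have "J i \<inter> J j = {}" if "i < j" for i j
    proof -
      have "q ^ (n * j) \<le> q ^ (n * Suc i)" using q that by (intro power_decreasing mult_le_mono2) auto
      then show ?thesis by (auto simp: J_def)
    qed
    then show ?thesis unfolding disjoint_family_on_def by (metis inf_commute linorder_neqE_nat)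
  qed
  have ray: "(\<Sum>i. ennreal (q ^ (n * i)) * ennreal (1 - q ^ n) * indicator (Ei i) y) \<le> ennreal \<theta> * indicator S y" for y
  proof (cases "y \<in> S")
    case True
    have "(\<Sum>i. ennreal (q ^ (n * i)) * ennreal (1 - q ^ n) * indicator (Ei i) y) = (\<Sum>i. emeasure lborel (if pt i y \<in> E then J i else {}))"
      by (rule suminf_cong) (auto simp: emJ Ei_def True)
    also have "\<dots> = emeasure lborel (\<Union>i. if pt i y \<in> E then J i else {})"
      by (rule suminf_emeasure) (use disjJ in \<open>auto simp: J_def disjoint_family_on_def\<close>)
    also have "(\<Union>i. if pt i y \<in> E then J i else {}) = (\<Union>i\<in>{i. pt i y \<in> E}. J i)" by (auto split: if_splits)
    also have "emeasure lborel \<dots> \<le> ennreal \<theta>"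
      using neg True unfolding S_iff B_def pt_def J_def n_def by (auto simp: not_less)
    finally show ?thesis using True by simp
  next
    case False
    then show ?thesis by (simp add: Ei_def)
  qed
  \<comment> \<open>Integration over the outermost shell: if no ray exceeded
    \<open>\<theta>\<close>, the weighted volume of \<open>E\<close> would be at most
    \<open>\<theta>\<close> times that of the shell, and the common factor \<open>1 - q ^ n\<close>
    cancels.\<close>
  have "ennreal (1 - q ^ n) * emeasure lebesgue E \<le> ennreal (1 - q ^ n) * (\<Sum>i. ennreal (q ^ (n * i)) * emeasure lebesgue (Ei i))"
    by (rule mult_left_mono[OF emE]) simp
  also have "\<dots> = (\<Sum>i. ennreal (q ^ (n * i)) * ennreal (1 - q ^ n) * emeasure lebesgue (Ei i))"
    by (simp add: ennreal_suminf_cmult[symmetric] mult_ac)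
  also have "\<dots> = (\<Sum>i. \<integral>\<^sup>+ y. ennreal (q ^ (n * i)) * ennreal (1 - q ^ n) * indicator (Ei i) y \<partial>lebesgue)"
    using Ei_meas by (intro suminf_cong nn_integral_cmult_indicator[symmetric]) simp
  also have "\<dots> = (\<integral>\<^sup>+ y. (\<Sum>i. ennreal (q ^ (n * i)) * ennreal (1 - q ^ n) * indicator (Ei i) y) \<partial>lebesgue)"
    using Ei_meas by (intro nn_integral_suminf[symmetric] borel_measurable_times_ennreal borel_measurable_const borel_measurable_indicator) simp
  also have "\<dots> \<le> (\<integral>\<^sup>+ y. ennreal \<theta> * indicator S y \<partial>lebesgue)" by (intro nn_integral_mono ray)
  also have "\<dots> = ennreal \<theta> * ennreal (\<omega> * (1 - q ^ n))" using S_meas by (subst nn_integral_cmult_indicator) (simp_all add: emS)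
  finally have 1: "ennreal (1 - q ^ n) * emeasure lebesgue E \<le> ennreal \<theta> * ennreal (\<omega> * (1 - q ^ n))" .
  have q1: "q ^ n < 1" using q n by (simp add: power_less_one_iff)
  have "emeasure lebesgue E = ennreal (measure lebesgue E)"
    by (rule emeasure_eq_ennreal_measure) (use emeasure_compact_finite[OF E(1)] borel_compact[OF E(1)] in simp)
  with 1 have "ennreal ((1 - q ^ n) * measure lebesgue E) \<le> ennreal (\<theta> * (\<omega> * (1 - q ^ n)))"
    using q1 \<theta>(1) by (simp add: ennreal_mult \<omega>_def)
  then have "(1 - q ^ n) * measure lebesgue E \<le> \<theta> * (\<omega> * (1 - q ^ n))"
    using q1 \<theta>(1) by (subst (asm) ennreal_le_iff) (auto simp: \<omega>_def)
  then have "measure lebesgue E \<le> \<theta> * \<omega>" using q1 by (simp add: mult_ac)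
  with \<theta>(2) show False by (simp add: \<omega>_def n_def)
qed

text \<open>Greedy choice from above: a point \<open>s0\<close> within \<open>\<epsilon>\<close> of
  the supremum is taken, and everything above \<open>s0 - \<eta>\<close> is discarded. This loses
  measure at most \<open>\<eta> + \<epsilon>\<close>, and the strict inequality leaves room for
  \<open>\<epsilon>\<close>.\<close>

lemma separated_points:
  assumes "F \<in> sets lborel" "bdd_above F" "\<eta> > 0" "ennreal (real d * \<eta>) < emeasure lborel F"
  shows "\<exists>s :: nat \<Rightarrow> real. (\<forall>j\<le>d. s j \<in> F) \<and> (\<forall>j<d. s (Suc j) \<le> s j - \<eta>)"
  using assms(1,2,4)
proof (induction d arbitrary: F)
  case 0
  then have "F \<noteq> {}" by auto
  then obtain x where "x \<in> F" by blast
  then show ?case by (intro exI[of _ "\<lambda>_. x"]) auto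
next
  case (Suc d)
  from dense[OF Suc.prems(3)] obtain c0 where c0: "ennreal (real (Suc d) * \<eta>) < c0" "c0 < emeasure lborel F"
    by blast
  then have "c0 \<noteq> top" by auto
  then obtain c where "c0 = ennreal c" "c \<ge> 0" by (cases c0) auto
  with c0 have c: "ennreal (real (Suc d) * \<eta>) < ennreal c" "ennreal c < emeasure lborel F" "c \<ge> 0" by auto
  define \<epsilon> where "\<epsilon> = c - real (Suc d) * \<eta>"
  have \<epsilon>: "\<epsilon> > 0" using c \<open>\<eta> > 0\<close> by (simp add: \<epsilon>_def ennreal_less_iff)
  have "F \<noteq> {}" using Suc.prems(3) by auto
  define \<sigma> where "\<sigma> = Sup F"
  obtain s0 where s0: "s0 \<in> F" "\<sigma> - \<epsilon> < s0"
    using less_cSupD[OF \<open>F \<noteq> {}\<close>, of "\<sigma> - \<epsilon>"] \<epsilon> by (auto simp: \<sigma>_def)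
  have le: "x \<le> \<sigma>" if "x \<in> F" for x unfolding \<sigma>_def by (rule cSup_upper[OF that Suc.prems(2)])
  define F' where "F' = F \<inter> {..s0 - \<eta>}"
  have "ennreal c < emeasure lborel F" by (fact c(2))
  also have "emeasure lborel F \<le> emeasure lborel (F' \<union> {s0 - \<eta><..\<sigma>})"
    by (rule emeasure_mono) (use Suc.prems(1) le in \<open>auto simp: F'_def\<close>)
  also have "\<dots> \<le> emeasure lborel F' + emeasure lborel {s0 - \<eta><..\<sigma>}"
    by (rule emeasure_subadditive) (use Suc.prems(1) in \<open>auto simp: F'_def\<close>)
  also have "emeasure lborel {s0 - \<eta><..\<sigma>} = ennreal (\<sigma> - (s0 - \<eta>))"
    using le[OF s0(1)] \<open>\<eta> > 0\<close> by (subst emeasure_lborel_Ioc) auto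
  also have "\<dots> \<le> ennreal (\<eta> + \<epsilon>)" using s0(2) by (intro ennreal_leI) linarith
  finally have "ennreal (real d * \<eta>) + ennreal (\<eta> + \<epsilon>) < emeasure lborel F' + ennreal (\<eta> + \<epsilon>)"
    using \<epsilon> \<open>\<eta> > 0\<close>
    by (subst ennreal_plus[symmetric]) (auto simp: \<epsilon>_def algebra_simps elim!: order.strict_trans1[rotated] add_left_mono)
  then have "ennreal (real d * \<eta>) < emeasure lborel F'"
    by (metis add_right_mono leD leI)
  then obtain s where s: "\<forall>j\<le>d. s j \<in> F'" "\<forall>j<d. s (Suc j) \<le> s j - \<eta>"
    using Suc.IH[of F'] Suc.prems(1,2) by (auto simp: F'_def)
  show ?case
  proof (intro exI[of _ "\<lambda>j. case j of 0 \<Rightarrow> s0 | Suc j \<Rightarrow> s j"] conjI allI impI)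
    fix j assume "j \<le> Suc d"
    then show "(case j of 0 \<Rightarrow> s0 | Suc j \<Rightarrow> s j) \<in> F"
      using s(1) s0(1) by (auto simp: F'_def split: nat.split)
  next
    fix j assume "j < Suc d"
    then show "(case Suc j of 0 \<Rightarrow> s0 | Suc j \<Rightarrow> s j) \<le> (case j of 0 \<Rightarrow> s0 | Suc j \<Rightarrow> s j) - \<eta>"
      using s by (auto simp: F'_def split: nat.split)
  qed
qed

lemma power_diff_le_mult:
  fixes a b :: real
  assumes "0 \<le> b" "b \<le> a" "a \<le> 1"
  shows "a ^ n - b ^ n \<le> real n * (a - b)"
proof (induction n)
  case (Suc n)
  have "a ^ Suc n - b ^ Suc n = a * (a ^ n - b ^ n) + b ^ n * (a - b)" by (simp add: algebra_simps)
  also have "\<dots> \<le> 1 * (a ^ n - b ^ n) + 1 * (a - b)"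
    using assms by (intro add_mono mult_right_mono) (auto simp: power_mono power_le_one)
  finally show ?case using Suc by (simp add: algebra_simps)
qed simp

text \<open>Layers separated in the coordinate \<open>s = r ^ n\<close> give separated radii,
  because the slope of \<open>r ^ n\<close> on the unit interval is at most \<open>n\<close>; hence
  the factor \<open>CARD('n)\<close> in the hypothesis.\<close>

lemma ray_nodes:
  fixes E :: "(real ^ 'n::finite) set"
    and d :: nat
  assumes E: "compact E" "E \<subseteq> cball 0 1" and x0: "x0 \<in> cball 0 1" and d: "d \<ge> 1"
    and \<rho>: "0 < \<rho>" "\<rho> * (CARD('n) * unit_ball_vol CARD('n)) < measure lebesgue E"
  shows "\<exists>y\<in>cball 0 1. \<exists>r :: nat \<Rightarrow> real. (\<forall>j\<le>d. 0 < r j \<and> r j \<le> 1 \<and> x0 + r j *\<^sub>R (y - x0) \<in> E) \<and>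
    (\<forall>j<d. r (Suc j) \<le> r j - \<rho> / d)"
proof -
  define n where "n = CARD('n)"
  define \<omega> where "\<omega> = unit_ball_vol (real n)"
  have n: "n \<ge> 1" by (simp add: n_def Suc_leI)
  have \<omega>: "\<omega> > 0" by (simp add: \<omega>_def)
  have "\<rho> * n < measure lebesgue E / \<omega>" using \<rho>(2) \<omega> by (simp add: n_def \<omega>_def field_simps)
  then obtain \<theta> where \<theta>: "\<rho> * n < \<theta>" "\<theta> < measure lebesgue E / \<omega>" using dense by blast
  have "0 < \<rho> * n" using \<rho>(1) n by simp
  then have \<theta>0: "0 < \<theta>" using \<theta>(1) by linarith
  \<comment> \<open>The excess of \<open>\<theta>\<close> over \<open>\<rho> * n\<close> pays for
    rounding a point of a layer to the radius \<open>q ^ i\<close>: \<open>q\<close> is chosen so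
    that the ends of a layer differ by the factor \<open>1 + \<epsilon>\<close>.\<close>
  define \<epsilon> where "\<epsilon> = (\<theta> - \<rho> * n) / d"
  have \<epsilon>: "\<epsilon> > 0" using \<theta> d by (simp add: \<epsilon>_def)
  define q where "q = (1 / (1 + \<epsilon>)) powr (1 / n)"
  have q: "0 < q" "q < 1" "1 / q ^ n \<le> 1 + \<epsilon>"
  proof -
    show "0 < q" using \<epsilon> by (simp add: q_def)
    have qn: "q ^ n = 1 / (1 + \<epsilon>)" using \<epsilon> n
      by (simp add: q_def powr_realpow[symmetric] powr_powr)
    then show "1 / q ^ n \<le> 1 + \<epsilon>" by simp
    have "q ^ n < 1" unfolding qn using \<epsilon> by simp
    then show "q < 1" by (metis leI less_le_not_le one_le_power)
  qed
  have "\<theta> * unit_ball_vol CARD('n) < measure lebesgue E" using \<theta>(2) \<omega> by (simp add: \<omega>_def n_def field_simps)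
  from shell_ray[OF E x0 q(1,2) order.strict_implies_order[OF \<theta>0] this]
  obtain y where y: "y \<in> cball 0 1" and big: "ennreal \<theta> < emeasure lborel (\<Union>i\<in>{i. x0 + q ^ i *\<^sub>R (y - x0) \<in> E}. {q ^ (n * Suc i)<..q ^ (n * i)})"
    unfolding n_def by blast
  define F where "F = (\<Union>i\<in>{i. x0 + q ^ i *\<^sub>R (y - x0) \<in> E}. {q ^ (n * Suc i)<..q ^ (n * i)})"
  have F_le: "s \<le> 1" if "s \<in> F" for s
  proof -
    obtain i where "s \<le> q ^ (n * i)" using \<open>s \<in> F\<close> by (auto simp: F_def)
    also have "\<dots> \<le> 1" using q by (simp add: power_le_one)
    finally show ?thesis .
  qed
  obtain s where s: "\<forall>j\<le>d. s j \<in> F" "\<forall>j<d. s (Suc j) \<le> s j - \<theta> / d"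
  proof -
    have "\<exists>s :: nat \<Rightarrow> real. (\<forall>j\<le>d. s j \<in> F) \<and> (\<forall>j<d. s (Suc j) \<le> s j - \<theta> / d)"
    proof (rule separated_points)
      show "F \<in> sets lborel" unfolding F_def by (intro sets.countable_UN') auto
      show "bdd_above F" using F_le by (intro bdd_aboveI[of _ 1])
      show "\<theta> / d > 0" using \<theta>0 d by simp
      show "ennreal (real d * (\<theta> / d)) < emeasure lborel F" using big d by (simp add: F_def)
    qed
    then show ?thesis using that by blast
  qed
  have "\<forall>j\<in>{..d}. \<exists>i. x0 + q ^ i *\<^sub>R (y - x0) \<in> E \<and> q ^ (n * Suc i) < s j \<and> s j \<le> q ^ (n * i)"
    using s(1) unfolding F_def by auto
  from bchoice[OF this] obtain i where i: "\<forall>j\<in>{..d}. x0 + q ^ i j *\<^sub>R (y - x0) \<in> E \<and> q ^ (n * Suc (i j)) < s j \<and> s j \<le> q ^ (n * i j)"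
    by blast
  define r where "r j = q ^ i j" for j
  have rn: "q ^ (n * i j) = r j ^ n" "q ^ (n * Suc (i j)) = q ^ n * r j ^ n" for j
    by (simp_all add: r_def power_mult[symmetric] mult.commute power_add)
  have r: "0 < r j" "r j \<le> 1" for j using q by (simp_all add: r_def power_le_one)
  have "r (Suc j) \<le> r j - \<rho> / d" if j: "j < d" for j
  proof -
    have 1: "s j \<le> r j ^ n" using i j by (simp add: rn)
    have "q ^ (n * Suc (i (Suc j))) < s (Suc j)" using bspec[OF i, of "Suc j"] j by simp
    then have 2: "q ^ n * r (Suc j) ^ n < s (Suc j)" unfolding rn(2) .
    have "r (Suc j) ^ n \<le> s (Suc j) * (1 / q ^ n)" using 2 q(1) by (simp add: field_simps)
    also have "\<dots> \<le> s (Suc j) * (1 + \<epsilon>)"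
    proof (rule mult_left_mono[OF q(3)])
      show "0 \<le> s (Suc j)" using 2 r[of "Suc j"] q(1) by (smt (verit) mult_nonneg_nonneg zero_le_power)
    qed
    also have "\<dots> \<le> s (Suc j) + \<epsilon>"
    proof -
      have "s (Suc j) \<le> 1" using F_le s(1) j by auto
      then show ?thesis using \<epsilon> by (simp add: distrib_left mult_left_le_one_le)
    qed
    finally have "r j ^ n - r (Suc j) ^ n \<ge> \<theta> / d - \<epsilon>" using 1 s(2) j by fastforce
    moreover have "\<theta> / d - \<epsilon> = n * (\<rho> / d)" using d by (simp add: \<epsilon>_def field_simps)
    ultimately have 3: "r j ^ n - r (Suc j) ^ n \<ge> n * (\<rho> / d)" by linarith
    have pos: "n * (\<rho> / d) > 0" using \<rho>(1) n d by simp
    have "r (Suc j) \<le> r j"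
    proof (rule ccontr)
      assume "\<not> r (Suc j) \<le> r j"
      then have "r j ^ n \<le> r (Suc j) ^ n" using r[of j] by (intro power_mono) auto
      with 3 pos show False by linarith
    qed
    then have "r j ^ n - r (Suc j) ^ n \<le> n * (r j - r (Suc j))"
      using r by (intro power_diff_le_mult) (auto intro: less_imp_le)
    with 3 have "n * (\<rho> / d) \<le> n * (r j - r (Suc j))" by linarith
    then show ?thesis by (subst (asm) mult_le_cancel_left_pos) (use n in auto)
  qed
  then show ?thesis
    using y r i by (intro bexI[of _ y] exI[of _ r]) (auto simp: r_def)
qed

text \<open>For equally spaced nodes the terms are \<open>1 / (h ^ d * j! * (d - j)!)\<close>.\<close>

lemma spaced_nodes_sum:
  fixes r :: "nat \<Rightarrow> real"
  assumes r: "\<And>j. j \<le> d \<Longrightarrow> 0 < r j \<and> r j \<le> 1" and gap: "\<And>j. j < d \<Longrightarrow> r (Suc j) \<le> r j - h" and h: "h > 0"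
  shows "inj_on r {..d}"
    and "(\<Sum>\<tau>\<in>r ` {..d}. \<Prod>\<sigma>\<in>r ` {..d} - {\<tau>}. \<bar>\<sigma>\<bar> / \<bar>\<tau> - \<sigma>\<bar>) \<le> (2 / h) ^ d / fact d"
proof -
  have sep: "r i - r j \<ge> real (j - i) * h" if "i \<le> j" "j \<le> d" for i j
    using that
  proof (induction j rule: dec_induct)
    case (step j)
    then have "r (Suc j) \<le> r j - h" using gap by simp
    with step show ?case by (simp add: Suc_diff_le algebra_simps)
  qed simp
  show inj: "inj_on r {..d}"
  proof (rule linorder_inj_onI)
    fix i j :: nat assume "i < j" "j \<in> {..d}"
    then have "real (j - i) * h > 0" using h by simp
    then show "r i \<noteq> r j" using sep[of i j] \<open>i < j\<close> \<open>j \<in> {..d}\<close> by auto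
  qed auto
  have bound: "(\<Prod>i\<in>{..d} - {j}. \<bar>r i\<bar> / \<bar>r j - r i\<bar>) \<le> 1 / (h ^ d * (fact j * fact (d - j)))" if j: "j \<le> d" for j
  proof -
    have "(\<Prod>i\<in>{..d} - {j}. \<bar>r i\<bar> / \<bar>r j - r i\<bar>) \<le> (\<Prod>i\<in>{..d} - {j}. 1 / (\<bar>real i - real j\<bar> * h))"
    proof (rule prod_mono, intro conjI)
      fix i assume i: "i \<in> {..d} - {j}"
      have "\<bar>real i - real j\<bar> * h \<le> \<bar>r j - r i\<bar>"
        using sep[of i j] sep[of j i] i j by (cases "i \<le> j") (auto simp: of_nat_diff abs_if)
      moreover have "\<bar>real i - real j\<bar> * h > 0" using i h by auto
      ultimately show "\<bar>r i\<bar> / \<bar>r j - r i\<bar> \<le> 1 / (\<bar>real i - real j\<bar> * h)"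
        using r[of i] i by (intro frac_le) auto
    qed simp
    also have "\<dots> = 1 / ((\<Prod>i\<in>{..d} - {j}. \<bar>real i - real j\<bar>) * h ^ d)"
      using j by (simp add: prod_dividef prod.distrib)
    also have "(\<Prod>i\<in>{..d} - {j}. \<bar>real i - real j\<bar>) = fact j * fact (d - j)"
    proof -
      have eq: "{..d} - {j} = {..<j} \<union> {j<..d}" using j by auto
      have "(\<Prod>i\<in>{..d} - {j}. \<bar>real i - real j\<bar>) = (\<Prod>i\<in>{..<j}. \<bar>real i - real j\<bar>) * (\<Prod>i\<in>{j<..d}. \<bar>real i - real j\<bar>)"
        unfolding eq by (rule prod.union_disjoint) auto
      also have "(\<Prod>i\<in>{..<j}. \<bar>real i - real j\<bar>) = (\<Prod>k\<in>{1..j}. real k)"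
      proof (rule prod.reindex_bij_witness[of _ "\<lambda>k. j - k" "\<lambda>i. j - i"], goal_cases)
        case (5 i)
        then have "real (j - i) = real j - real i" by (intro of_nat_diff) simp
        with 5 show ?case by simp
      qed auto
      also have "(\<Prod>i\<in>{j<..d}. \<bar>real i - real j\<bar>) = (\<Prod>k\<in>{1..d - j}. real k)"
      proof (rule prod.reindex_bij_witness[of _ "\<lambda>k. j + k" "\<lambda>i. i - j"], goal_cases)
        case (5 i)
        then have "real (i - j) = real i - real j" by (intro of_nat_diff) simp
        with 5 show ?case by simp
      qed auto
      finally show ?thesis by (simp add: fact_prod)
    qed
    finally show ?thesis by (simp add: mult_ac)
  qed
  have "(\<Sum>\<tau>\<in>r ` {..d}. \<Prod>\<sigma>\<in>r ` {..d} - {\<tau>}. \<bar>\<sigma>\<bar> / \<bar>\<tau> - \<sigma>\<bar>) = (\<Sum>j\<le>d. \<Prod>i\<in>{..d} - {j}. \<bar>r i\<bar> / \<bar>r j - r i\<bar>)"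
  proof (subst sum.reindex[OF inj], rule sum.cong[OF refl])
    fix j assume j: "j \<in> {..d}"
    have "r ` {..d} - {r j} = r ` ({..d} - {j})" using inj j by (auto simp: inj_on_def)
    moreover have "inj_on r ({..d} - {j})" using inj by (rule inj_on_subset) auto
    ultimately show "((\<lambda>\<tau>. \<Prod>\<sigma>\<in>r ` {..d} - {\<tau>}. \<bar>\<sigma>\<bar> / \<bar>\<tau> - \<sigma>\<bar>) \<circ> r) j = (\<Prod>i\<in>{..d} - {j}. \<bar>r i\<bar> / \<bar>r j - r i\<bar>)"
      by (simp add: prod.reindex)
  qed
  also have "\<dots> \<le> (\<Sum>j\<le>d. 1 / (h ^ d * (fact j * fact (d - j))))" by (intro sum_mono bound) simp
  also have "\<dots> = (\<Sum>j\<le>d. real (d choose j)) / (h ^ d * fact d)"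
    unfolding sum_divide_distrib
    by (intro sum.cong refl) (auto simp: binomial_fact field_simps)
  also have "\<dots> = (2 / h) ^ d / fact d"
  proof -
    have "(\<Sum>j\<le>d. real (d choose j)) = 2 ^ d"
      using choose_row_sum[of d] by (metis of_nat_numeral of_nat_power of_nat_sum)
    then show ?thesis by (simp add: power_divide)
  qed
  finally show "(\<Sum>\<tau>\<in>r ` {..d}. \<Prod>\<sigma>\<in>r ` {..d} - {\<tau>}. \<bar>\<sigma>\<bar> / \<bar>\<tau> - \<sigma>\<bar>) \<le> (2 / h) ^ d / fact d" .
qed

text \<open>The vector \<open>y - x0\<close> may have norm 2, whereas the derivative bounds are for
  norm at most 1. So the direction is halved and the parameters are doubled, which leaves the
  Lagrange products unchanged.\<close>

lemma ray_interpolation_nodes: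
  fixes E :: "(real ^ 'n::finite) set"
    and d :: nat
  assumes E: "compact E" "E \<subseteq> cball 0 1" and x0: "x0 \<in> cball 0 1" and d: "d \<ge> 1"
    and \<rho>: "0 < \<rho>" "\<rho> * (CARD('n) * unit_ball_vol CARD('n)) < measure lebesgue E"
  shows "\<exists>u T. norm u \<le> 1 \<and> finite T \<and> card T = d + 1 \<and> (\<forall>\<tau>\<in>T. \<bar>\<tau>\<bar> \<le> 2 \<and> x0 + \<tau> *\<^sub>R u \<in> E) \<and>
    (\<Sum>\<tau>\<in>T. \<Prod>\<sigma>\<in>T - {\<tau>}. \<bar>\<sigma>\<bar> / \<bar>\<tau> - \<sigma>\<bar>) \<le> (2 * d / \<rho>) ^ d / fact d"
proof -
  from bexE[OF ray_nodes[OF E x0 d \<rho>]] obtain y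
    where y: "y \<in> cball 0 1" and y': "\<exists>r. (\<forall>j\<le>d. 0 < r j \<and> r j \<le> 1 \<and> x0 + r j *\<^sub>R (y - x0) \<in> E) \<and> (\<forall>j<d. r (Suc j) \<le> r j - \<rho> / d)"
    by metis
  from exE[OF y'] obtain r where r': "(\<forall>j\<le>d. 0 < r j \<and> r j \<le> 1 \<and> x0 + r j *\<^sub>R (y - x0) \<in> E) \<and> (\<forall>j<d. r (Suc j) \<le> r j - \<rho> / d)"
    by metis
  have r: "0 < r j \<and> r j \<le> 1 \<and> x0 + r j *\<^sub>R (y - x0) \<in> E" if "j \<le> d" for j using r' that by blast
  have r2: "r (Suc j) \<le> r j - \<rho> / d" if "j < d" for j using r' that by blast
  have h: "\<rho> / d > 0" using \<rho>(1) d by simp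
  have r1: "0 < r j \<and> r j \<le> 1" if "j \<le> d" for j using r[OF that] by blast
  note sp = spaced_nodes_sum[where r = r and d = d and h = "\<rho> / d", OF r1 r2 h]
  define X where "X = r ` {..d}"
  define u where "u = (1 / 2) *\<^sub>R (y - x0)"
  have "norm (y - x0) \<le> 2" using y x0 norm_triangle_ineq4[of y x0] by simp
  then have "norm u \<le> 1" by (simp add: u_def)
  have X: "finite X" "card X = d + 1" unfolding X_def using sp(1) by (simp_all add: card_image)
  have inj: "inj_on (\<lambda>x. 2 * x :: real) A" for A by (auto simp: inj_on_def)
  define T where "T = (\<lambda>x. 2 * x) ` X"
  have "(\<Sum>\<tau>\<in>T. \<Prod>\<sigma>\<in>T - {\<tau>}. \<bar>\<sigma>\<bar> / \<bar>\<tau> - \<sigma>\<bar>) = (\<Sum>x\<in>X. \<Prod>y\<in>X - {x}. \<bar>y\<bar> / \<bar>x - y\<bar>)"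
    unfolding T_def
  proof (subst sum.reindex[OF inj], rule sum.cong[OF refl])
    fix x assume "x \<in> X"
    have "(\<lambda>x. 2 * x) ` X - {2 * x} = (\<lambda>x. 2 * x) ` (X - {x})" by auto
    then have "(\<Prod>\<sigma>\<in>(\<lambda>x. 2 * x) ` X - {2 * x}. \<bar>\<sigma>\<bar> / \<bar>2 * x - \<sigma>\<bar>) = (\<Prod>y\<in>X - {x}. \<bar>2 * y\<bar> / \<bar>2 * x - 2 * y\<bar>)"
      by (simp add: prod.reindex[OF inj])
    also have "\<dots> = (\<Prod>y\<in>X - {x}. \<bar>y\<bar> / \<bar>x - y\<bar>)"
    proof (rule prod.cong[OF refl])
      fix y
      have "\<bar>2 * x - 2 * y\<bar> = 2 * \<bar>x - y\<bar>" by (simp add: abs_if)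
      then show "\<bar>2 * y\<bar> / \<bar>2 * x - 2 * y\<bar> = \<bar>y\<bar> / \<bar>x - y\<bar>" by (simp add: abs_mult)
    qed
    finally show "((\<lambda>\<tau>. \<Prod>\<sigma>\<in>(\<lambda>x. 2 * x) ` X - {\<tau>}. \<bar>\<sigma>\<bar> / \<bar>\<tau> - \<sigma>\<bar>) \<circ> (\<lambda>x. 2 * x)) x = (\<Prod>y\<in>X - {x}. \<bar>y\<bar> / \<bar>x - y\<bar>)" by simp
  qed
  also have "\<dots> \<le> (2 / (\<rho> / d)) ^ d / fact d" unfolding X_def by (rule sp(2))
  finally have sum: "(\<Sum>\<tau>\<in>T. \<Prod>\<sigma>\<in>T - {\<tau>}. \<bar>\<sigma>\<bar> / \<bar>\<tau> - \<sigma>\<bar>) \<le> (2 * d / \<rho>) ^ d / fact d" by simp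
  have "\<bar>\<tau>\<bar> \<le> 2 \<and> x0 + \<tau> *\<^sub>R u \<in> E" if "\<tau> \<in> T" for \<tau>
  proof -
    obtain j where j: "j \<le> d" "\<tau> = 2 * r j" using \<open>\<tau> \<in> T\<close> by (auto simp: T_def X_def)
    then show ?thesis using r[OF j(1)] j(2) by (simp add: u_def)
  qed
  moreover have "finite T" "card T = d + 1" unfolding T_def using X by (simp_all add: card_image[OF inj])
  ultimately show ?thesis using \<open>norm u \<le> 1\<close> sum by (intro exI[of _ u] exI[of _ T]) auto
qed

section \<open>Numerical estimates\<close>

text \<open>Machin's formula with partial sums of the arctangent series; comparing derivatives
  amounts to \<open>1 + y ^ 6 \<ge> 1\<close> for the upper and \<open>1 - y ^ 4 \<le> 1\<close> for
  the lower bound.\<close>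

lemma pi_bound: "pi \<le> 63 / 20"
proof -
  have upper: "arctan x \<le> x - x ^ 3 / 3 + x ^ 5 / 5" if "x \<ge> 0" for x
  proof -
    have "(\<lambda>x. x - x ^ 3 / 3 + x ^ 5 / 5 - arctan x) 0 \<le> (\<lambda>x. x - x ^ 3 / 3 + x ^ 5 / 5 - arctan x) x"
    proof (rule DERIV_nonneg_imp_nondecreasing[OF that])
      fix y :: real
      have "((\<lambda>x. x - x ^ 3 / 3 + x ^ 5 / 5 - arctan x) has_real_derivative 1 - y\<^sup>2 + y ^ 4 - inverse (1 + y\<^sup>2)) (at y)"
        by (auto intro!: derivative_eq_intros)
      moreover have "0 \<le> 1 - y\<^sup>2 + y ^ 4 - inverse (1 + y\<^sup>2)"
      proof -
        have pos: "1 + y\<^sup>2 > 0" by (simp add: add_pos_nonneg)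
        have "(1 - y\<^sup>2 + y ^ 4) * (1 + y\<^sup>2) = 1 + y ^ 6" by (simp add: algebra_simps eval_nat_numeral)
        then have "(1 - y\<^sup>2 + y ^ 4) * (1 + y\<^sup>2) \<ge> 1" by simp
        then show ?thesis using pos by (simp add: field_simps)
      qed
      ultimately show "\<exists>z. ((\<lambda>x. x - x ^ 3 / 3 + x ^ 5 / 5 - arctan x) has_real_derivative z) (at y) \<and> 0 \<le> z" by blast
    qed
    then show ?thesis by simp
  qed
  have lower: "x - x ^ 3 / 3 \<le> arctan x" if "x \<ge> 0" for x
  proof -
    have "(\<lambda>x. arctan x - (x - x ^ 3 / 3)) 0 \<le> (\<lambda>x. arctan x - (x - x ^ 3 / 3)) x"
    proof (rule DERIV_nonneg_imp_nondecreasing[OF that])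
      fix y :: real
      have "((\<lambda>x. arctan x - (x - x ^ 3 / 3)) has_real_derivative inverse (1 + y\<^sup>2) - (1 - y\<^sup>2)) (at y)"
        by (auto intro!: derivative_eq_intros)
      moreover have "0 \<le> inverse (1 + y\<^sup>2) - (1 - y\<^sup>2)"
      proof -
        have pos: "1 + y\<^sup>2 > 0" by (simp add: add_pos_nonneg)
        have "(1 - y\<^sup>2) * (1 + y\<^sup>2) = 1 - y ^ 4" by (simp add: algebra_simps eval_nat_numeral)
        then have "(1 - y\<^sup>2) * (1 + y\<^sup>2) \<le> 1" by simp
        then show ?thesis using pos by (simp add: field_simps)
      qed
      ultimately show "\<exists>z. ((\<lambda>x. arctan x - (x - x ^ 3 / 3)) has_real_derivative z) (at y) \<and> 0 \<le> z" by blast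
    qed
    then show ?thesis by simp
  qed
  have "pi = 16 * arctan (1 / 5) - 4 * arctan (1 / 239)" using machin by simp
  also have "\<dots> \<le> 16 * (1 / 5 - (1 / 5) ^ 3 / 3 + (1 / 5) ^ 5 / 5) - 4 * (1 / 239 - (1 / 239) ^ 3 / 3)"
    by (intro diff_mono mult_left_mono upper lower) auto
  also have "\<dots> \<le> 63 / 20" by (simp add: eval_nat_numeral)
  finally show ?thesis .
qed

lemma unit_ball_vol_rec: "unit_ball_vol (real (n + 2)) = 2 * pi / real (n + 2) * unit_ball_vol (real n)"
proof -
  have g: "Gamma (real n / 2 + 1 + 1) = (real n / 2 + 1) * Gamma (real n / 2 + 1)"
  proof (rule Gamma_plus1)
    have "real n / 2 + 1 > 0" by (simp add: add_nonneg_pos)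
    then show "real n / 2 + 1 \<notin> \<int>\<^sub>\<le>\<^sub>0" by (metis nonpos_Ints_nonpos not_less)
  qed
  have p: "pi powr (real n / 2 + 1) = pi powr (real n / 2) * pi" by (simp add: powr_add)
  have e1: "real (n + 2) / 2 = real n / 2 + 1" and e2: "2 * pi / real (n + 2) = pi / (real n / 2 + 1)"
    by (simp_all add: field_simps)
  show ?thesis unfolding unit_ball_vol_def e1 e2 g p by simp
qed

text \<open>The largest volume is \<open>8 * pi ^ 2 / 15\<close>, about 5.26, in dimension 5. From
  dimension 7 on, the factor \<open>2 * pi / n\<close> of the recursion is below 1, so that only the
  dimensions up to 6 have to be computed.\<close>

lemma unit_ball_vol_small:
  "unit_ball_vol (real 2) \<le> 63 / 20" "unit_ball_vol (real 3) \<le> 21 / 5" "unit_ball_vol (real n) \<le> 53 / 10"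
proof -
  have r: "unit_ball_vol (real (Suc (Suc k))) = 2 * pi / real (k + 2) * unit_ball_vol (real k)" for k
    using unit_ball_vol_rec[of k] by simp
  have two: "unit_ball_vol (real (Suc (Suc 0))) = pi" using r[of 0] by simp
  have three: "unit_ball_vol (real (Suc (Suc (Suc 0)))) = 4 * pi / 3" using r[of 1] by simp
  have four: "unit_ball_vol (real (Suc (Suc (Suc (Suc 0))))) = pi * pi / 2" using r[of 2] two by (simp add: numeral_2_eq_2)
  have five: "unit_ball_vol (real (Suc (Suc (Suc (Suc (Suc 0)))))) = 8 * (pi * pi) / 15" using r[of "Suc (Suc (Suc 0))"] unfolding three by simp
  have six: "unit_ball_vol (real (Suc (Suc (Suc (Suc (Suc (Suc 0))))))) = pi * pi * pi / 6" using r[of "Suc (Suc (Suc (Suc 0)))"] unfolding four by simp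
  have pp: "pi * pi \<le> 63 / 20 * (63 / 20)" using pi_bound by (intro mult_mono) auto
  then have ppp: "pi * pi * pi \<le> 63 / 20 * (63 / 20) * (63 / 20)" using pi_bound by (intro mult_mono[of "pi * pi"]) auto
  show "unit_ball_vol (real 2) \<le> 63 / 20" using two pi_bound by (simp add: numeral_2_eq_2)
  show "unit_ball_vol (real 3) \<le> 21 / 5" using three pi_bound by (simp add: numeral_3_eq_3)
  show "unit_ball_vol (real n) \<le> 53 / 10"
  proof (induction n rule: less_induct)
    case (less n)
    show ?case
    proof (cases "n \<le> 6")
      case True
      then consider "n = 0" | "n = Suc 0" | "n = Suc (Suc 0)" | "n = Suc (Suc (Suc 0))" | "n = Suc (Suc (Suc (Suc 0)))"
        | "n = Suc (Suc (Suc (Suc (Suc 0))))" | "n = Suc (Suc (Suc (Suc (Suc (Suc 0)))))" by linarith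
      then show ?thesis
        using two three four five six pi_bound pp ppp by cases (simp_all only: of_nat_0 of_nat_1 unit_ball_vol_0, simp_all)
    next
      case False
      define k where "k = n - 2"
      have k: "n = k + 2" "k \<ge> 5" using False by (auto simp: k_def)
      have "2 * pi / real (k + 2) \<le> 1" using k pi_bound by simp
      then have "2 * pi / real (k + 2) * unit_ball_vol (real k) \<le> 1 * unit_ball_vol (real k)"
        by (intro mult_right_mono) auto
      also have "\<dots> \<le> 53 / 10" using less[of k] k by simp
      finally show ?thesis unfolding k(1) unit_ball_vol_rec .
    qed
  qed
qed

text \<open>The maximum is at \<open>a = k / (k + 1)\<close>. Relative to it, both factors are
  bounded by \<open>1 + x \<le> exp x\<close>, with exponents that cancel.\<close>

lemma power_times_one_minus:
  fixes a :: real
  assumes "0 \<le> a" "a \<le> 1" "k \<ge> 1"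
  shows "a ^ k * (1 - a) \<le> real k ^ k / real (k + 1) ^ (k + 1)"
proof -
  define K where "K = real k"
  have K: "K > 0" using assms by (simp add: K_def)
  define x y where "x = a * (K + 1) / K - 1" and "y = (K + 1) * (1 - a) - 1"
  have xy: "K * x + y = 0" using K by (simp add: x_def y_def field_simps)
  have 1: "a \<le> K / (K + 1) * exp x" "0 \<le> a"
  proof -
    have "a = K / (K + 1) * (1 + x)" using K by (simp add: x_def)
    also have "\<dots> \<le> K / (K + 1) * exp x" using K by (intro mult_left_mono exp_ge_add_one_self) auto
    finally show "a \<le> K / (K + 1) * exp x" .
  qed (fact assms)
  have 2: "1 - a \<le> 1 / (K + 1) * exp y"
  proof -
    have "1 - a = 1 / (K + 1) * (1 + y)" using K by (simp add: y_def)
    also have "\<dots> \<le> 1 / (K + 1) * exp y" using K by (intro mult_left_mono exp_ge_add_one_self) auto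
    finally show ?thesis .
  qed
  have "a ^ k * (1 - a) \<le> (K / (K + 1) * exp x) ^ k * (1 / (K + 1) * exp y)"
    using 1 2 assms K by (intro mult_mono power_mono) auto
  also have "\<dots> = K ^ k / (K + 1) ^ (k + 1) * (exp x ^ k * exp y)"
    by (simp add: power_mult_distrib power_divide mult_ac)
  also have "exp x ^ k * exp y = 1"
    using xy by (simp add: exp_of_nat_mult[symmetric] exp_add[symmetric] K_def)
  finally have "a ^ k * (1 - a) \<le> K ^ k / (K + 1) ^ (k + 1)" by simp
  moreover have "real (k + 1) = K + 1" by (simp add: K_def)
  ultimately show ?thesis by (simp only: K_def)
qed

text \<open>The function \<open>t ^ n / n - t ^ (n + 1) / (n + 1)\<close> increases on the unit
  interval, having derivative \<open>t ^ (n - 1) * (1 - t)\<close>. This reduces all dimensions from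
  3 on to dimension 3.\<close>

lemma power_difference_quotient_mono:
  fixes s1 s2 :: real
  assumes "0 \<le> s1" "s1 \<le> s2" "s2 \<le> 1" "1 \<le> k" "k \<le> n"
  shows "(s2 ^ n - s1 ^ n) / n \<le> (s2 ^ k - s1 ^ k) / k"
  using assms(5)
proof (induction n rule: dec_induct)
  case (step n)
  have n: "n \<ge> 1" using step assms by simp
  have "(\<lambda>t. t ^ n / n - t ^ Suc n / Suc n) s1 \<le> (\<lambda>t. t ^ n / n - t ^ Suc n / Suc n) s2"
  proof (rule DERIV_nonneg_imp_nondecreasing[OF assms(2)])
    fix t assume t: "s1 \<le> t" "t \<le> s2"
    have "((\<lambda>t. t ^ n / n - t ^ Suc n / Suc n) has_real_derivative real n * t ^ (n - 1) / n - real (Suc n) * t ^ n / Suc n) (at t)"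
      by (auto intro!: derivative_eq_intros simp del: power_Suc)
    moreover have "real n * t ^ (n - 1) / n - real (Suc n) * t ^ n / Suc n = t ^ (n - 1) * (1 - t)"
      using n by (cases n) (auto simp: algebra_simps simp del: of_nat_Suc)
    moreover have "0 \<le> t ^ (n - 1) * (1 - t)" using t assms by simp
    ultimately show "\<exists>z. ((\<lambda>t. t ^ n / n - t ^ Suc n / Suc n) has_real_derivative z) (at t) \<and> 0 \<le> z" by force
  qed
  then show ?case using step.IH by (simp add: diff_divide_distrib)
qed simp

text \<open>The bracket is the interpolation constant for zeros at \<open>s1\<close>,
  \<open>s2\<close> and a value of order \<open>8 * (1 - a)\<close> at their midpoint. It blows up
  as the gap closes, but the power difference contains the factor \<open>h\<close> and compensates.
  The constants \<open>33 / 50\<close> and \<open>23 / 50\<close> round up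
  \<open>8 * 4 ^ 4 / 5 ^ 5\<close> and \<open>8 * 6 ^ 6 / 7 ^ 7\<close>.\<close>

lemma quadratic_case_estimate:
  fixes s1 s2 :: real
  assumes s: "0 < s1" "s1 < s2" "s2 \<le> 1" and n: "n \<ge> 2"
  defines "a \<equiv> (s1 + s2) / 2" and "h \<equiv> (s2 - s1) / 2"
  shows "(s2 ^ n - s1 ^ n)\<^sup>2 * (8 * (1 - a) * (s1 * s2) / h\<^sup>2 + 8 * (s1 * a * s2))
    \<le> 4 * (real n)\<^sup>2 * (if n = 2 then 33 / 50 else 23 / 50) + 8"
proof -
  define V where "V = s2 ^ n - s1 ^ n"
  define p where "p = s1 * s2"
  have h: "h > 0" using s by (simp add: h_def)
  have a: "0 < a" "a \<le> 1" using s by (simp_all add: a_def)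
  have p: "0 < p" "p = a\<^sup>2 - h\<^sup>2" using s by (simp_all add: p_def a_def h_def power2_eq_square field_simps)
  have pa: "p \<le> a\<^sup>2" using p by simp
  have V: "0 \<le> V" "V \<le> 1"
  proof -
    show "0 \<le> V" using s by (simp add: V_def power_mono)
    have "s2 ^ n \<le> 1" "0 \<le> s1 ^ n" using s by (simp_all add: power_le_one)
    then show "V \<le> 1" by (simp add: V_def)
  qed
  have V2: "V\<^sup>2 \<le> 1" using V by (simp add: power_le_one)
  have "s1 * a * s2 \<le> 1 * 1 * 1" using s a by (intro mult_mono) auto
  then have second: "V\<^sup>2 * (8 * (s1 * a * s2)) \<le> 1 * 8" using V2 s a by (intro mult_mono) auto
  have first: "V\<^sup>2 * (8 * (1 - a) * p / h\<^sup>2) \<le> 4 * (real n)\<^sup>2 * (if n = 2 then 33 / 50 else 23 / 50)"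
  proof (cases "n = 2")
    case True
    have "V = 4 * a * h" by (simp add: V_def True a_def h_def power2_eq_square field_simps)
    then have "V\<^sup>2 * (8 * (1 - a) * p / h\<^sup>2) = 128 * a\<^sup>2 * (1 - a) * p" using h by (simp add: power2_eq_square)
    also have "\<dots> \<le> 128 * a\<^sup>2 * (1 - a) * a\<^sup>2" using pa a by (intro mult_left_mono) auto
    also have "\<dots> = 128 * (a ^ 4 * (1 - a))" by (simp add: eval_nat_numeral)
    also have "\<dots> \<le> 128 * (4 ^ 4 / 5 ^ 5)" using power_times_one_minus[of a 4] a by (intro mult_left_mono) auto
    also have "\<dots> \<le> 4 * (real n)\<^sup>2 * (33 / 50)" by (simp add: True)
    finally show ?thesis by (simp add: True)
  next
    case False
    have "V / n \<le> (s2 ^ 3 - s1 ^ 3) / 3"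
      unfolding V_def using power_difference_quotient_mono[of s1 s2 3 n] s n False by simp
    also have "s2 ^ 3 - s1 ^ 3 = 2 * h * (4 * a\<^sup>2 - p)"
      by (simp add: a_def h_def p_def field_simps power2_eq_square power3_eq_cube)
    finally have "V \<le> n * (2 * h * (4 * a\<^sup>2 - p) / 3)" using n by (simp add: field_simps)
    then have "V\<^sup>2 \<le> (n * (2 * h * (4 * a\<^sup>2 - p) / 3))\<^sup>2" using V by (intro power_mono) auto
    also have "\<dots> = (real n)\<^sup>2 * 4 * h\<^sup>2 * (4 * a\<^sup>2 - p)\<^sup>2 / 9" by (simp add: power2_eq_square)
    finally have "V\<^sup>2 * (8 * (1 - a) * p / h\<^sup>2) \<le> ((real n)\<^sup>2 * 4 * h\<^sup>2 * (4 * a\<^sup>2 - p)\<^sup>2 / 9) * (8 * (1 - a) * p / h\<^sup>2)"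
      using a p by (intro mult_right_mono) auto
    also have "\<dots> = 32 / 9 * (real n)\<^sup>2 * (1 - a) * ((4 * a\<^sup>2 - p)\<^sup>2 * p)" using h by simp
    also have "\<dots> \<le> 32 / 9 * (real n)\<^sup>2 * (1 - a) * (9 * a ^ 6)"
    proof (intro mult_left_mono)
      \<comment> \<open>The expression \<open>(4 * a\<^sup>2 - p)\<^sup>2 * p\<close> attains
        \<open>9 * a ^ 6\<close> at \<open>p = a\<^sup>2\<close>; this is the cofactor of
        \<open>a\<^sup>2 - p\<close> in the difference.\<close>
      have "9 * (a\<^sup>2)\<^sup>2 - 7 * a\<^sup>2 * p + p\<^sup>2 \<ge> 0"
      proof -
        have "a\<^sup>2 * p \<le> a\<^sup>2 * a\<^sup>2" using pa by (intro mult_left_mono) auto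
        then have "a\<^sup>2 * p \<le> (a\<^sup>2)\<^sup>2" by (simp only: power2_eq_square[of "a\<^sup>2"])
        then show ?thesis using zero_le_power2[of p] zero_le_power2[of "a\<^sup>2"] by linarith
      qed
      then have "0 \<le> (a\<^sup>2 - p) * (9 * (a\<^sup>2)\<^sup>2 - 7 * a\<^sup>2 * p + p\<^sup>2)" using pa by simp
      also have "\<dots> = 9 * a ^ 6 - (4 * a\<^sup>2 - p)\<^sup>2 * p" by (simp add: eval_nat_numeral algebra_simps)
      finally show "(4 * a\<^sup>2 - p)\<^sup>2 * p \<le> 9 * a ^ 6" by simp
    qed (use a in auto)
    also have "\<dots> = 32 * (real n)\<^sup>2 * (a ^ 6 * (1 - a))" by simp
    also have "\<dots> \<le> 32 * (real n)\<^sup>2 * (6 ^ 6 / 7 ^ 7)" using power_times_one_minus[of a 6] a by (intro mult_left_mono) auto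
    also have "\<dots> \<le> 4 * (real n)\<^sup>2 * (23 / 50)" by simp
    finally show ?thesis using False by simp
  qed
  have "V\<^sup>2 * (8 * (1 - a) * (s1 * s2) / h\<^sup>2 + 8 * (s1 * a * s2)) = V\<^sup>2 * (8 * (1 - a) * p / h\<^sup>2) + V\<^sup>2 * (8 * (s1 * a * s2))"
    by (simp add: p_def distrib_left)
  with first second show ?thesis unfolding V_def[symmetric] by linarith
qed

text \<open>The quotient \<open>d ^ d / d!\<close> is a single term of the series for
  \<open>exp d\<close>.\<close>

lemma power_le_fact_exp: "real d ^ d \<le> 3 ^ d * fact d"
proof -
  have "real d ^ d / fact d \<le> exp (real d)"
  proof -
    have "(\<lambda>k. real d ^ k /\<^sub>R fact k) sums exp (real d)" by (rule exp_converges)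
    then have "(\<Sum>k\<in>{d}. real d ^ k /\<^sub>R fact k) \<le> exp (real d)"
      by (intro sum_le_suminf[of "\<lambda>k. real d ^ k /\<^sub>R fact k", THEN order_trans]) (auto simp: sums_iff)
    then show ?thesis by (simp add: divide_inverse mult.commute)
  qed
  also have "exp (real d) = exp 1 ^ d" by (simp add: exp_of_nat_mult[symmetric])
  also have "\<dots> \<le> 3 ^ d" using exp_le by (intro power_mono) auto
  finally show ?thesis by (simp add: field_simps)
qed

section \<open>Functions vanishing on the boundaries of disjoint pieces\<close>

lemma exit_point:
  fixes U :: "(real ^ 'n::finite) set"
  assumes U: "U \<subseteq> cball 0 1" and p: "x + s *\<^sub>R v \<in> interior U" and v: "norm v = 1"
  shows "\<exists>\<tau>>s. x + \<tau> *\<^sub>R v \<in> frontier U"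
proof -
  \<comment> \<open>Length 3 exceeds the diameter of the ball, so the far end of this segment is
    outside \<open>U\<close>.\<close>
  define S where "S = (\<lambda>t. x + t *\<^sub>R v) ` {s..s + 3}"
  have S: "connected S" unfolding S_def
    by (intro connected_continuous_image continuous_intros connected_Icc)
  have "x + s *\<^sub>R v \<in> S \<inter> U" using p interior_subset[of U] by (force simp: S_def)
  moreover have "x + (s + 3) *\<^sub>R v \<notin> U"
  proof
    assume "x + (s + 3) *\<^sub>R v \<in> U"
    then have "norm (x + (s + 3) *\<^sub>R v) \<le> 1" "norm (x + s *\<^sub>R v) \<le> 1"
      using U p interior_subset[of U] by (auto simp: subset_iff)
    moreover have "(x + (s + 3) *\<^sub>R v) - (x + s *\<^sub>R v) = 3 *\<^sub>R v" by (simp add: algebra_simps)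
    ultimately show False
      using norm_triangle_ineq4[of "x + (s + 3) *\<^sub>R v" "x + s *\<^sub>R v"] v by simp
  qed
  then have "x + (s + 3) *\<^sub>R v \<in> S - U" by (auto simp: S_def)
  ultimately have "S \<inter> frontier U \<noteq> {}" by (intro connected_Int_frontier[OF S]) blast+
  then obtain \<tau> where \<tau>: "\<tau> \<ge> s" "x + \<tau> *\<^sub>R v \<in> frontier U" by (auto simp: S_def)
  moreover have "\<tau> \<noteq> s" using \<tau> p by (auto simp: frontier_def)
  ultimately show ?thesis by (intro exI[of _ \<tau>]) auto
qed

lemma frontier_pair:
  fixes U :: "(real ^ 'n::finite) set"
  assumes U: "U \<subseteq> cball 0 1" and p: "x + s *\<^sub>R v \<in> interior U" and v: "norm v = 1"
  shows "\<exists>\<alpha> \<beta>. \<alpha> < s \<and> s < \<beta> \<and> x + \<alpha> *\<^sub>R v \<in> frontier U \<and> x + \<beta> *\<^sub>R v \<in> frontier U"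
proof -
  from exE[OF exit_point[OF U p v]] obtain \<beta> where "\<beta> > s" "x + \<beta> *\<^sub>R v \<in> frontier U" by blast
  moreover have "x + (- s) *\<^sub>R (- v) \<in> interior U" "norm (- v) = 1" using p v by simp_all
  from exE[OF exit_point[OF U this]] obtain \<alpha> where "\<alpha> > - s" "x + \<alpha> *\<^sub>R (- v) \<in> frontier U" by blast
  ultimately show ?thesis by (intro exI[of _ "- \<alpha>"] exI[of _ \<beta>]) auto
qed

text \<open>The power of the point \<open>x\<close> with respect to the unit sphere. Weighting the
  two norm inequalities by \<open>\<beta>\<close> and \<open>\<alpha>\<close> eliminates
  \<open>x \<bullet> u\<close>.\<close>

lemma chord_product:
  fixes x u :: "'a::real_inner"
  assumes "norm u = 1" "0 < \<alpha>" "0 < \<beta>" "norm (x - \<alpha> *\<^sub>R u) \<le> 1" "norm (x + \<beta> *\<^sub>R u) \<le> 1"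
  shows "\<alpha> * \<beta> \<le> 1 - (norm x)\<^sup>2"
proof -
  have uu: "u \<bullet> u = 1" using assms(1) by (simp add: dot_square_norm)
  have "(norm (x - \<alpha> *\<^sub>R u))\<^sup>2 = x \<bullet> x - 2 * \<alpha> * (x \<bullet> u) + \<alpha>\<^sup>2" "(norm (x + \<beta> *\<^sub>R u))\<^sup>2 = x \<bullet> x + 2 * \<beta> * (x \<bullet> u) + \<beta>\<^sup>2"
    unfolding power2_norm_eq_inner using uu by (simp_all add: inner_diff inner_add inner_commute power2_eq_square)
  moreover have "(norm (x - \<alpha> *\<^sub>R u))\<^sup>2 \<le> 1" "(norm (x + \<beta> *\<^sub>R u))\<^sup>2 \<le> 1"
    using assms(4,5) by (simp_all add: power_le_one)
  ultimately have "x \<bullet> x - 2 * \<alpha> * (x \<bullet> u) + \<alpha>\<^sup>2 \<le> 1" "x \<bullet> x + 2 * \<beta> * (x \<bullet> u) + \<beta>\<^sup>2 \<le> 1" by simp_all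
  then have "\<beta> * (x \<bullet> x - 2 * \<alpha> * (x \<bullet> u) + \<alpha>\<^sup>2) + \<alpha> * (x \<bullet> x + 2 * \<beta> * (x \<bullet> u) + \<beta>\<^sup>2) \<le> \<beta> * 1 + \<alpha> * 1"
    using assms by (intro add_mono mult_left_mono) auto
  then have "(\<alpha> + \<beta>) * (x \<bullet> x + \<alpha> * \<beta>) \<le> (\<alpha> + \<beta>) * 1" by (simp add: algebra_simps power2_eq_square)
  then have "x \<bullet> x + \<alpha> * \<beta> \<le> 1" using assms by (subst (asm) mult_le_cancel_left_pos) auto
  then show ?thesis by (simp add: power2_norm_eq_inner)
qed

text \<open>The passage from a measure to nodes, shared by the degree 3 and the high degree case:
  \<open>c\<close> bounds a function on \<open>E\<close> and \<open>b\<close> is a remainder. Nodes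
  exist for each \<open>\<rho>\<close> strictly below the critical ratio; the conclusion is the
  limit.\<close>

lemma node_bound:
  fixes x0 :: "real ^ 'n::finite" and d :: nat and a b c :: real
  assumes E: "compact E" "E \<subseteq> cball 0 1" and x0: "x0 \<in> cball 0 1" and d: "d \<ge> 1" and c: "c \<ge> 0"
    and pos: "0 < measure lebesgue E"
    and nodes: "\<And>u T. norm u \<le> 1 \<Longrightarrow> finite T \<Longrightarrow> card T = d + 1 \<Longrightarrow> (\<And>\<tau>. \<tau> \<in> T \<Longrightarrow> \<bar>\<tau>\<bar> \<le> 2 \<and> x0 + \<tau> *\<^sub>R u \<in> E) \<Longrightarrow>
      a \<le> c * (\<Sum>\<tau>\<in>T. \<Prod>\<sigma>\<in>T - {\<tau>}. \<bar>\<sigma>\<bar> / \<bar>\<tau> - \<sigma>\<bar>) + b"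
  shows "a \<le> c * ((2 * d * (CARD('n) * unit_ball_vol CARD('n)) / measure lebesgue E) ^ d / fact d) + b"
proof -
  define w where "w = CARD('n) * unit_ball_vol CARD('n)"
  define \<rho>0 where "\<rho>0 = measure lebesgue E / w"
  have w: "w > 0" by (simp add: w_def)
  have \<rho>0: "\<rho>0 > 0" using pos w by (simp add: \<rho>0_def)
  have le: "a \<le> c * ((2 * d / \<rho>) ^ d / fact d) + b" if \<rho>: "0 < \<rho>" "\<rho> < \<rho>0" for \<rho>
  proof -
    have "\<rho> * w < measure lebesgue E" using \<rho> w by (simp add: \<rho>0_def field_simps)
    from ray_interpolation_nodes[OF E x0 d \<rho>(1) this[unfolded w_def]] obtain u T
      where u: "norm u \<le> 1" "finite T" "card T = d + 1" "\<forall>\<tau>\<in>T. \<bar>\<tau>\<bar> \<le> 2 \<and> x0 + \<tau> *\<^sub>R u \<in> E"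
        "(\<Sum>\<tau>\<in>T. \<Prod>\<sigma>\<in>T - {\<tau>}. \<bar>\<sigma>\<bar> / \<bar>\<tau> - \<sigma>\<bar>) \<le> (2 * d / \<rho>) ^ d / fact d" by (elim exE conjE) (rule that)
    have "a \<le> c * (\<Sum>\<tau>\<in>T. \<Prod>\<sigma>\<in>T - {\<tau>}. \<bar>\<sigma>\<bar> / \<bar>\<tau> - \<sigma>\<bar>) + b" using u by (intro nodes) auto
    also have "\<dots> \<le> c * ((2 * d / \<rho>) ^ d / fact d) + b" using u(5) c by (intro add_right_mono mult_left_mono) auto
    finally show ?thesis .
  qed
  have "((\<lambda>\<rho>. c * ((2 * d / \<rho>) ^ d / fact d) + b) \<longlongrightarrow> c * ((2 * d / \<rho>0) ^ d / fact d) + b) (at_left \<rho>0)"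
    using \<rho>0 by (intro tendsto_intros) auto
  moreover have "eventually (\<lambda>\<rho>. a \<le> c * ((2 * d / \<rho>) ^ d / fact d) + b) (at_left \<rho>0)"
    using eventually_at_left_real[OF \<rho>0] by eventually_elim (use le in auto)
  ultimately have "a \<le> c * ((2 * d / \<rho>0) ^ d / fact d) + b"
    by (rule tendsto_lowerbound) simp
  then show ?thesis using w by (simp add: \<rho>0_def w_def)
qed

text \<open>One function, one degree and the pieces used for it. The number of pieces is left open,
  since each case states it in the form it works with, from a single piece for \<open>d = 1\<close>
  to \<open>(d - 1) ^ n + 1\<close>.\<close>

locale vanishing_pieces =
  fixes U :: "'i \<Rightarrow> (real ^ 'n::finite) set" and I :: "'i set" and f :: "real ^ 'n \<Rightarrow> real"
    and d :: nat and m0 :: real and x0 :: "real ^ 'n"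
  assumes finite_I: "finite I"
    and compact_piece: "\<And>i. i \<in> I \<Longrightarrow> compact (U i)"
    and interior_piece: "\<And>i. i \<in> I \<Longrightarrow> interior (U i) \<noteq> {}"
    and piece_subset: "\<And>i. i \<in> I \<Longrightarrow> U i \<subseteq> cball 0 1"
    and disjoint_pieces: "disjoint_family_on U I"
    and m0: "0 < m0" "\<And>i. i \<in> I \<Longrightarrow> m0 \<le> measure lebesgue (U i)"
    and d: "1 \<le> d"
    and smooth: "Ck_on (d + 1) B1 f"
    and zero: "\<And>i z. i \<in> I \<Longrightarrow> z \<in> frontier (U i) \<Longrightarrow> f z = 0"
    and x0: "x0 \<in> cball 0 1" "\<bar>f x0\<bar> = 1"
begin

lemma M_nonneg: "0 \<le> M (d + 1) f"
proof -
  have "0 \<le> deriv_norm (d + 1) f 0" by (simp add: deriv_norm_def sum_nonneg)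
  also have "\<dots> \<le> M (d + 1) f" by (rule deriv_norm_le_M[OF smooth]) simp
  finally show ?thesis .
qed

text \<open>The common end of all cases: \<open>A\<close> collects what an interpolation yields, and
  it remains to compare a number with 2.\<close>

lemma M_bound:
  assumes "\<kappa> \<ge> 0" "1 \<le> \<kappa> * M (d + 1) f / fact (d + 1) * A" "\<kappa> * (m0 / (4 * CARD('n))) ^ d * A \<le> 2"
  shows "fact (d + 1) / 2 * (m0 / (4 * CARD('n))) ^ d \<le> M (d + 1) f"
proof -
  define X where "X = (m0 / (4 * CARD('n))) ^ d"
  define F where "F = (fact (d + 1) :: real)"
  have X: "X \<ge> 0" and F: "F > 0" using m0 by (simp_all add: X_def F_def del: fact_Suc)
  have "F / 2 * X * 1 \<le> F / 2 * X * (\<kappa> * M (d + 1) f / F * A)"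
    using X F assms(2) by (intro mult_left_mono) (auto simp: F_def)
  also have "\<dots> = M (d + 1) f / 2 * (\<kappa> * X * A)" using F by simp
  also have "\<dots> \<le> M (d + 1) f / 2 * 2" using assms(3) M_nonneg by (intro mult_left_mono) (auto simp: X_def)
  finally show ?thesis by (simp add: X_def F_def)
qed

lemma frontier_piece: "i \<in> I \<Longrightarrow> z \<in> frontier (U i) \<Longrightarrow> z \<in> U i"
  using compact_imp_closed[OF compact_piece] frontier_subset_closed by blast

lemma pieces_apart: "i \<in> I \<Longrightarrow> j \<in> I \<Longrightarrow> z \<in> U i \<Longrightarrow> z \<in> U j \<Longrightarrow> i = j"
  using disjoint_pieces unfolding disjoint_family_on_def by blast

lemma compact_union: "J \<subseteq> I \<Longrightarrow> compact (\<Union>i\<in>J. U i)"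
  using finite_subset[OF _ finite_I] compact_piece by (intro compact_UN) auto

lemma union_subset: "J \<subseteq> I \<Longrightarrow> (\<Union>i\<in>J. U i) \<subseteq> cball 0 1"
  using piece_subset by blast

lemma measure_union:
  assumes "J \<subseteq> I"
  shows "card J * m0 \<le> measure lebesgue (\<Union>i\<in>J. U i)"
proof -
  have "card J * m0 = (\<Sum>i\<in>J. m0)" by simp
  also have "\<dots> \<le> (\<Sum>i\<in>J. measure lebesgue (U i))" using assms m0 by (intro sum_mono) auto
  also have "\<dots> = measure lebesgue (\<Union>i\<in>J. U i)"
  proof (rule measure_finite_Union[symmetric])
    show "finite J" by (rule finite_subset[OF assms finite_I])
    have lm: "U i \<in> lmeasurable" if "i \<in> J" for i using lmeasurable_compact compact_piece assms that by blast
    then show "U ` J \<subseteq> sets lebesgue" by (auto intro: fmeasurableD)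
    show "emeasure lebesgue (U i) \<noteq> \<infinity>" if "i \<in> J" for i
      using fmeasurableD2[OF lm[OF that]] unfolding infinity_ennreal_def .
    show "disjoint_family_on U J" using disjoint_pieces assms by (auto simp: disjoint_family_on_def)
  qed
  finally show ?thesis .
qed

text \<open>Disjoint pieces share the volume of the ball. This controls \<open>m0\<close> in the
  terms where it does not cancel.\<close>

lemma card_m0_le: "card I * m0 \<le> unit_ball_vol CARD('n)"
proof -
  have "card I * m0 \<le> measure lebesgue (\<Union>i\<in>I. U i)" by (rule measure_union) simp
  also have "\<dots> \<le> measure lebesgue (cball (0 :: real ^ 'n) 1)"
    using union_subset[of I] lmeasurable_compact[OF compact_union[of I]] lmeasurable_cball[of "0 :: real ^ 'n" 1]
    by (intro measure_mono_fmeasurable) auto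
  also have "\<dots> = unit_ball_vol CARD('n)" by (simp add: content_cball)
  finally show ?thesis .
qed

lemma interior_point_ne: "i \<in> I \<Longrightarrow> \<exists>p\<in>interior (U i). p \<noteq> x"
  using interior_piece[of i] open_interior[of "U i"] not_open_singleton[of x] by (metis subset_singletonD subsetI singletonI)

lemma line_through:
  assumes "p \<noteq> (x :: real ^ 'n)"
  shows "norm (sgn (p - x)) = 1" "x + norm (p - x) *\<^sub>R sgn (p - x) = p"
  using assms by (simp_all add: norm_sgn sgn_div_norm)

text \<open>Each piece whose interior is met contributes a boundary point on either side, and
  disjointness of the pieces keeps the points of different pieces apart.\<close>

lemma line_zeros:
  assumes J: "J \<subseteq> I" and u: "norm u = 1" and meets: "\<And>i. i \<in> J \<Longrightarrow> \<exists>s. x + s *\<^sub>R u \<in> interior (U i)"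
  shows "\<exists>T. finite T \<and> card T = 2 * card J \<and> (\<forall>\<tau>\<in>T. x + \<tau> *\<^sub>R u \<in> cball 0 1 \<and> f (x + \<tau> *\<^sub>R u) = 0)"
proof -
  have fin: "finite J" by (rule finite_subset[OF J finite_I])
  have "\<forall>i\<in>J. \<exists>p :: real \<times> real. fst p < snd p \<and> x + fst p *\<^sub>R u \<in> frontier (U i) \<and> x + snd p *\<^sub>R u \<in> frontier (U i)"
  proof
    fix i assume i: "i \<in> J"
    then obtain s where "x + s *\<^sub>R u \<in> interior (U i)" using meets by blast
    from frontier_pair[OF _ this u] piece_subset J i obtain \<alpha> \<beta>
      where "\<alpha> < s" "s < \<beta>" "x + \<alpha> *\<^sub>R u \<in> frontier (U i)" "x + \<beta> *\<^sub>R u \<in> frontier (U i)" by blast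
    then show "\<exists>p :: real \<times> real. fst p < snd p \<and> x + fst p *\<^sub>R u \<in> frontier (U i) \<and> x + snd p *\<^sub>R u \<in> frontier (U i)"
      by (intro exI[of _ "(\<alpha>, \<beta>)"]) auto
  qed
  from bchoice[OF this] obtain g :: "'i \<Rightarrow> real \<times> real"
    where g: "\<forall>i\<in>J. fst (g i) < snd (g i) \<and> x + fst (g i) *\<^sub>R u \<in> frontier (U i) \<and> x + snd (g i) *\<^sub>R u \<in> frontier (U i)" ..
  define h where "h p = (if snd p then fst (g (fst p)) else snd (g (fst p)))" for p :: "'i \<times> bool"
  have h: "x + h p *\<^sub>R u \<in> frontier (U (fst p))" if "p \<in> J \<times> UNIV" for p using g that by (auto simp: h_def)
  have "inj_on h (J \<times> UNIV)"
  proof (rule inj_onI)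
    fix p q assume pq: "p \<in> J \<times> UNIV" "q \<in> J \<times> UNIV" "h p = h q"
    have I: "fst p \<in> I" "fst q \<in> I" using pq J by auto
    have "x + h p *\<^sub>R u \<in> U (fst p)" "x + h p *\<^sub>R u \<in> U (fst q)"
      using frontier_piece[OF I(1) h[OF pq(1)]] frontier_piece[OF I(2) h[OF pq(2)]] pq(3) by auto
    then have "fst p = fst q" using pieces_apart I by blast
    moreover have "snd p = snd q" using g pq \<open>fst p = fst q\<close> by (auto simp: h_def split: if_splits)
    ultimately show "p = q" by (simp add: prod_eq_iff)
  qed
  then have "card (h ` (J \<times> UNIV)) = 2 * card J" by (simp add: card_image card_cartesian_product)
  moreover have "\<forall>\<tau>\<in>h ` (J \<times> UNIV). x + \<tau> *\<^sub>R u \<in> cball 0 1 \<and> f (x + \<tau> *\<^sub>R u) = 0"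
  proof
    fix \<tau> assume "\<tau> \<in> h ` (J \<times> UNIV)"
    then obtain p where p: "p \<in> J \<times> UNIV" "\<tau> = h p" by blast
    then have I: "fst p \<in> I" using J by auto
    show "x + \<tau> *\<^sub>R u \<in> cball 0 1 \<and> f (x + \<tau> *\<^sub>R u) = 0"
      using zero[OF I h[OF p(1)]] frontier_piece[OF I h[OF p(1)]] piece_subset[OF I] p(2) by blast
  qed
  ultimately show ?thesis using fin by (intro exI[of _ "h ` (J \<times> UNIV)"]) auto
qed

text \<open>With zeros of \<open>f\<close> as nodes only the remainder is left; points of the ball
  have distance at most 2, whence \<open>2 ^ (d + 1)\<close>.\<close>

lemma many_zeros_bound:
  assumes \<kappa>: "\<kappa> \<ge> 0" "weight_bound TYPE('n) (d + 1) \<kappa>" and u: "norm u = 1"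
    and T: "finite T" "d + 1 \<le> card T" "\<forall>\<tau>\<in>T. x0 + \<tau> *\<^sub>R u \<in> cball 0 1 \<and> f (x0 + \<tau> *\<^sub>R u) = 0"
  shows "1 \<le> \<kappa> * M (d + 1) f / fact (d + 1) * 2 ^ (d + 1)"
proof -
  obtain S where S: "S \<subseteq> T" "card S = d + 1" "finite S" using obtain_subset_with_card_n[OF T(2)] by blast
  have "\<bar>\<tau>\<bar> \<le> 2" if "\<tau> \<in> S" for \<tau>
  proof -
    have "\<bar>\<tau>\<bar> = norm ((x0 + \<tau> *\<^sub>R u) - x0)" using u by simp
    also have "\<dots> \<le> norm (x0 + \<tau> *\<^sub>R u) + norm x0" by (rule norm_triangle_ineq4)
    also have "\<dots> \<le> 1 + 1" using T(3) S(1) that x0 by (intro add_mono) auto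
    finally show ?thesis by simp
  qed
  then have prod: "(\<Prod>\<tau>\<in>S. \<bar>\<tau>\<bar>) \<le> (\<Prod>\<tau>\<in>S. 2)" by (intro prod_mono) auto
  have "\<bar>f x0\<bar> \<le> (\<Sum>\<tau>\<in>S. \<bar>f (x0 + \<tau> *\<^sub>R u)\<bar> * (\<Prod>\<sigma>\<in>S - {\<tau>}. \<bar>\<sigma>\<bar> / \<bar>\<tau> - \<sigma>\<bar>))
    + \<kappa> * M (d + 1) f / fact (d + 1) * (\<Prod>\<tau>\<in>S. \<bar>\<tau>\<bar>)"
    by (rule ball_interpolation[OF smooth \<kappa>(2)]) (use x0 u S T(3) in auto)
  also have "(\<Sum>\<tau>\<in>S. \<bar>f (x0 + \<tau> *\<^sub>R u)\<bar> * (\<Prod>\<sigma>\<in>S - {\<tau>}. \<bar>\<sigma>\<bar> / \<bar>\<tau> - \<sigma>\<bar>)) = 0"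
    using T(3) S(1) by (intro sum.neutral) auto
  also have "0 + \<kappa> * M (d + 1) f / fact (d + 1) * (\<Prod>\<tau>\<in>S. \<bar>\<tau>\<bar>) \<le> \<kappa> * M (d + 1) f / fact (d + 1) * 2 ^ (d + 1)"
    unfolding add_0 using prod \<kappa> M_nonneg S(2) by (intro mult_left_mono) (auto simp del: fact_Suc power_Suc)
  finally show ?thesis using x0(2) by simp
qed

text \<open>On the line from a point of one piece to another piece \<open>f\<close> has four zeros, two of which
  lie on a chord through the point.\<close>

lemma piece_value_bound:
  assumes \<kappa>: "\<kappa> \<ge> 0" "weight_bound TYPE('n) (d + 1) \<kappa>" and ij: "i \<in> I" "j \<in> I" "i \<noteq> j" and x: "x \<in> U i"
    and d23: "d = 2 \<or> d = 3"
  shows "\<bar>f x\<bar> \<le> \<kappa> * M (d + 1) f / fact (d + 1) * ((1 - (norm x)\<^sup>2) * (1 + norm x) ^ (d - 1))"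
proof (cases "x \<in> frontier (U i)")
  case True
  have "norm x \<le> 1" using piece_subset ij x by force
  then show ?thesis using zero[OF ij(1) True] \<kappa> M_nonneg by (simp add: power_le_one)
next
  case False
  have n: "norm x \<le> 1" using piece_subset ij x by force
  have x_int: "x \<in> interior (U i)" using False x compact_imp_closed[OF compact_piece[OF ij(1)]] by (auto simp: frontier_def)
  obtain p where p: "p \<in> interior (U j)" "p \<noteq> x" using interior_point_ne[OF ij(2)] by blast
  define u where "u = sgn (p - x)"
  have u: "norm u = 1" "x + norm (p - x) *\<^sub>R u = p" using line_through[OF p(2)] by (simp_all add: u_def)
  have "x + 0 *\<^sub>R u \<in> interior (U i)" using x_int by simp
  from frontier_pair[OF piece_subset[OF ij(1)] this u(1)] obtain \<alpha> \<beta> where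
    ab: "\<alpha> < 0" "0 < \<beta>" "x + \<alpha> *\<^sub>R u \<in> frontier (U i)" "x + \<beta> *\<^sub>R u \<in> frontier (U i)" by blast
  have "x + norm (p - x) *\<^sub>R u \<in> interior (U j)" using u p by simp
  from frontier_pair[OF piece_subset[OF ij(2)] this u(1)] obtain \<gamma> \<gamma>' where
    cc: "\<gamma> < \<gamma>'" "x + \<gamma> *\<^sub>R u \<in> frontier (U j)" "x + \<gamma>' *\<^sub>R u \<in> frontier (U j)"
    by (meson less_trans)
  have distinct: "\<alpha> \<noteq> \<beta>" "\<gamma> \<noteq> \<gamma>'" "\<alpha> \<noteq> \<gamma>" "\<alpha> \<noteq> \<gamma>'" "\<beta> \<noteq> \<gamma>" "\<beta> \<noteq> \<gamma>'"
    using ab cc pieces_apart[OF ij(1,2)] frontier_piece[OF ij(1)] frontier_piece[OF ij(2)] ij(3) by auto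
  have fr: "x + \<tau> *\<^sub>R u \<in> cball 0 1 \<and> f (x + \<tau> *\<^sub>R u) = 0" if "\<tau> \<in> {\<alpha>, \<beta>, \<gamma>, \<gamma>'}" for \<tau>
  proof -
    have "x + \<tau> *\<^sub>R u \<in> frontier (U i) \<or> x + \<tau> *\<^sub>R u \<in> frontier (U j)" using that ab(3,4) cc(2,3) by blast
    then show ?thesis using zero frontier_piece piece_subset ij(1,2) by (meson subsetD)
  qed
  have size: "\<bar>\<tau>\<bar> \<le> 1 + norm x" if "\<tau> \<in> {\<alpha>, \<beta>, \<gamma>, \<gamma>'}" for \<tau>
  proof -
    have "\<bar>\<tau>\<bar> = norm ((x + \<tau> *\<^sub>R u) - x)" using u by simp
    also have "\<dots> \<le> norm (x + \<tau> *\<^sub>R u) + norm x" by (rule norm_triangle_ineq4)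
    finally show ?thesis using fr[OF that] by simp
  qed
  \<comment> \<open>The two zeros on the piece of \<open>x\<close> lie on opposite sides of
    \<open>x\<close>, which makes their product small near the sphere; the zeros on the other piece
    are only known to be within \<open>1 + norm x\<close>.\<close>
  have ch: "\<bar>\<alpha>\<bar> * \<bar>\<beta>\<bar> \<le> 1 - (norm x)\<^sup>2"
    using chord_product[OF u(1), of "- \<alpha>" \<beta> x] ab fr[of \<alpha>] fr[of \<beta>] by simp
  have ch0: "0 \<le> 1 - (norm x)\<^sup>2" using n by (simp add: power_le_one)
  define T where "T = (if d = 2 then {\<alpha>, \<beta>, \<gamma>} else {\<alpha>, \<beta>, \<gamma>, \<gamma>'})"
  have T: "finite T" "card T = d + 1" "T \<subseteq> {\<alpha>, \<beta>, \<gamma>, \<gamma>'}" using distinct d23 by (auto simp: T_def)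
  have "(\<Prod>\<tau>\<in>T. \<bar>\<tau>\<bar>) = (\<bar>\<alpha>\<bar> * \<bar>\<beta>\<bar>) * (if d = 2 then \<bar>\<gamma>\<bar> else \<bar>\<gamma>\<bar> * \<bar>\<gamma>'\<bar>)"
    using distinct by (simp add: T_def)
  also have "\<dots> \<le> (1 - (norm x)\<^sup>2) * (1 + norm x) ^ (d - 1)"
  proof (rule mult_mono[OF ch _ ch0])
    have "\<bar>\<gamma>\<bar> * \<bar>\<gamma>'\<bar> \<le> (1 + norm x) * (1 + norm x)" using size by (intro mult_mono) auto
    then show "(if d = 2 then \<bar>\<gamma>\<bar> else \<bar>\<gamma>\<bar> * \<bar>\<gamma>'\<bar>) \<le> (1 + norm x) ^ (d - 1)"
      using d23 size[of \<gamma>] by (auto simp: power2_eq_square)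
  qed auto
  finally have prod: "(\<Prod>\<tau>\<in>T. \<bar>\<tau>\<bar>) \<le> (1 - (norm x)\<^sup>2) * (1 + norm x) ^ (d - 1)" .
  have "\<bar>f x\<bar> \<le> (\<Sum>\<tau>\<in>T. \<bar>f (x + \<tau> *\<^sub>R u)\<bar> * (\<Prod>\<sigma>\<in>T - {\<tau>}. \<bar>\<sigma>\<bar> / \<bar>\<tau> - \<sigma>\<bar>))
    + \<kappa> * M (d + 1) f / fact (d + 1) * (\<Prod>\<tau>\<in>T. \<bar>\<tau>\<bar>)"
    by (rule ball_interpolation[OF smooth \<kappa>(2)]) (use n u T fr in \<open>auto simp: subset_iff\<close>)
  also have "(\<Sum>\<tau>\<in>T. \<bar>f (x + \<tau> *\<^sub>R u)\<bar> * (\<Prod>\<sigma>\<in>T - {\<tau>}. \<bar>\<sigma>\<bar> / \<bar>\<tau> - \<sigma>\<bar>)) = 0"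
    using T(3) fr by (intro sum.neutral) (auto simp: subset_iff)
  also have "0 + \<kappa> * M (d + 1) f / fact (d + 1) * (\<Prod>\<tau>\<in>T. \<bar>\<tau>\<bar>)
    \<le> \<kappa> * M (d + 1) f / fact (d + 1) * ((1 - (norm x)\<^sup>2) * (1 + norm x) ^ (d - 1))"
    unfolding add_0 using prod \<kappa> M_nonneg by (intro mult_left_mono) (auto simp del: fact_Suc)
  finally show ?thesis .
qed

text \<open>All pieces lie on one line and give \<open>2 * d \<ge> d + 1\<close> zeros
  there.\<close>

lemma case_n1:
  assumes n: "CARD('n) = 1" and I: "card I = d"
  shows "fact (d + 1) / 2 * (m0 / (4 * CARD('n))) ^ d \<le> M (d + 1) f"
proof -
  obtain k :: 'n where k: "UNIV = {k}" using n card_1_singletonE by blast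
  have \<kappa>: "weight_bound TYPE('n) (d + 1) 1" using weight_bound_general[where 'n = 'n, of "d - 1"] d n by simp
  define u :: "real ^ 'n" where "u = axis k 1"
  have u: "norm u = 1" by (simp add: u_def)
  have line: "x0 + ((p - x0) $ k) *\<^sub>R u = p" for p
  proof (subst vec_eq_iff, rule allI)
    fix i
    have "i = k" using k by blast
    then show "(x0 + ((p - x0) $ k) *\<^sub>R u) $ i = p $ i" by (simp add: u_def)
  qed
  have "\<exists>s. x0 + s *\<^sub>R u \<in> interior (U i)" if "i \<in> I" for i
    using interior_point_ne[OF that, of 0] line by metis
  then have "\<exists>T. finite T \<and> card T = 2 * card I \<and> (\<forall>\<tau>\<in>T. x0 + \<tau> *\<^sub>R u \<in> cball 0 1 \<and> f (x0 + \<tau> *\<^sub>R u) = 0)"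
    by (intro line_zeros u subset_refl)
  then obtain T where T: "finite T" "card T = 2 * card I"
    "\<forall>\<tau>\<in>T. x0 + \<tau> *\<^sub>R u \<in> cball 0 1 \<and> f (x0 + \<tau> *\<^sub>R u) = 0" by (elim exE conjE) (rule that)
  have card: "d + 1 \<le> card T" using T(2) I d by simp
  note b = many_zeros_bound[OF _ \<kappa> u T(1) card T(3)]
  have m: "m0 \<le> 2"
  proof -
    have "1 * m0 \<le> card I * m0" using I d m0 by (intro mult_right_mono) auto
    also have "\<dots> \<le> 2" using card_m0_le n by simp
    finally show ?thesis by simp
  qed
  have "(m0 / (4 * CARD('n))) ^ d * 2 ^ (d + 1) = 2 * (m0 / 4 * 2) ^ d"
    unfolding power_mult_distrib using n by simp
  also have "m0 / 4 * 2 = m0 / 2" by simp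
  also have "2 * (m0 / 2) ^ d \<le> 2" using m m0 by (simp add: power_le_one)
  finally show ?thesis by (intro M_bound[of 1 "2 ^ (d + 1)"]) (use b in \<open>auto simp del: fact_Suc power_Suc\<close>)
qed

section \<open>Degrees one and three in dimension at least two\<close>

lemma unit_ball_vol_le:
  assumes "CARD('n) \<ge> 2"
  shows "unit_ball_vol CARD('n) \<le> 53 / 10" "CARD('n) = 2 \<Longrightarrow> unit_ball_vol CARD('n) \<le> 63 / 20"
    "CARD('n) = 3 \<Longrightarrow> unit_ball_vol CARD('n) \<le> 21 / 5"
  using unit_ball_vol_small by metis+

text \<open>A line from \<open>x0\<close> through one piece already carries the two zeros that
  linear interpolation takes.\<close>

lemma case_d1:
  assumes n: "CARD('n) \<ge> 2" and I: "I \<noteq> {}" and d1: "d = 1"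
  shows "fact (d + 1) / 2 * (m0 / (4 * CARD('n))) ^ d \<le> M (d + 1) f"
proof -
  obtain i where i: "i \<in> I" using I by blast
  obtain p where p: "p \<in> interior (U i)" "p \<noteq> x0" using interior_point_ne[OF i] by blast
  note u = line_through[OF p(2)]
  have \<kappa>: "weight_bound TYPE('n) (d + 1) 1" using weight_bound_2[where 'n = 'n] d1 by (simp add: numeral_2_eq_2)
  have "\<exists>s. x0 + s *\<^sub>R sgn (p - x0) \<in> interior (U j)" if "j \<in> {i}" for j using that u p by (intro exI[of _ "norm (p - x0)"]) simp
  moreover have "{i} \<subseteq> I" using i by simp
  ultimately have "\<exists>T. finite T \<and> card T = 2 * card {i} \<and> (\<forall>\<tau>\<in>T. x0 + \<tau> *\<^sub>R sgn (p - x0) \<in> cball 0 1 \<and> f (x0 + \<tau> *\<^sub>R sgn (p - x0)) = 0)"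
    by (intro line_zeros u(1))
  then obtain T where T: "finite T" "card T = 2 * card {i}"
    "\<forall>\<tau>\<in>T. x0 + \<tau> *\<^sub>R sgn (p - x0) \<in> cball 0 1 \<and> f (x0 + \<tau> *\<^sub>R sgn (p - x0)) = 0" by (elim exE conjE) (rule that)
  have card: "d + 1 \<le> card T" using T(2) d1 by simp
  note b = many_zeros_bound[OF _ \<kappa> u(1) T(1) card T(3)]
  have "1 \<le> card I" using i finite_I by (metis Suc_leI card_gt_0_iff empty_iff One_nat_def)
  then have "1 * m0 \<le> card I * m0" using m0 by (intro mult_right_mono) auto
  then have "m0 \<le> 2 * CARD('n)" using card_m0_le unit_ball_vol_le[OF n] n by (cases "CARD('n) = 2") auto
  then show ?thesis by (intro M_bound[of 1 "2 ^ (d + 1)"]) (use b d1 n in \<open>auto simp: field_simps\<close>)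
qed

text \<open>All \<open>2 ^ n + 1\<close> pieces form \<open>E\<close>. On it \<open>f\<close> is
  bounded by \<open>27 / 16 * K\<close> through the lines between pieces, and a ray from
  \<open>x0\<close> through \<open>E\<close> transfers this to \<open>x0\<close>.\<close>

lemma case_d3:
  assumes n: "CARD('n) \<ge> 2" and I: "card I = 2 ^ CARD('n) + 1" and d3: "d = 3"
  shows "fact (d + 1) / 2 * (m0 / (4 * CARD('n))) ^ d \<le> M (d + 1) f"
proof -
  define \<kappa> n' \<omega> where "\<kappa> = real CARD('n)" and "n' = real CARD('n)" and "\<omega> = unit_ball_vol n'"
  define K where "K = \<kappa> * M (d + 1) f / fact (d + 1)"
  define E where "E = (\<Union>i\<in>I. U i)"
  define J where "J = real (card I)"
  have \<kappa>: "\<kappa> \<ge> 0" "weight_bound TYPE('n) (d + 1) \<kappa>"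
    using weight_bound_general[where 'n = 'n, of 2] d3 by (simp_all add: \<kappa>_def)
  have K: "K \<ge> 0" unfolding K_def using \<kappa> M_nonneg by (simp del: fact_Suc)
  have n': "n' \<ge> 2" using n by (simp add: n'_def)
  have J: "J = 2 ^ CARD('n) + 1" using I by (simp add: J_def)
  have J0: "J > 0" unfolding J by (simp add: add_pos_pos)
  have val: "\<bar>f x\<bar> \<le> K * (27 / 16)" if xE: "x \<in> E" for x
  proof -
    obtain i where i: "i \<in> I" "x \<in> U i" using xE by (auto simp: E_def)
    have "card (I - {i}) > 0" using I i finite_I by (simp add: card_Diff_singleton)
    then obtain j where j: "j \<in> I" "i \<noteq> j" by (metis Diff_iff card_gt_0_iff ex_in_conv insertI1)
    have "\<bar>f x\<bar> \<le> K * ((1 - (norm x)\<^sup>2) * (1 + norm x) ^ 2)"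
      using piece_value_bound[OF \<kappa> i(1) j(1,2) i(2)] d3 unfolding K_def by (simp del: fact_Suc)
    also have "\<dots> \<le> K * (27 / 16)"
    proof (intro mult_left_mono K)
      \<comment> \<open>The maximum of \<open>(1 - t) * (1 + t) ^ 3\<close> is at
        \<open>t = 1 / 2\<close>, the double zero split off in the factorization.\<close>
      define t where "t = norm x"
      have "27 / 16 - (1 - t\<^sup>2) * (1 + t) ^ 2 = (t - 1 / 2)\<^sup>2 * (t\<^sup>2 + 3 * t + 11 / 4) + (1 - (1 :: real))"
        by (simp add: power2_eq_square algebra_simps)
      moreover have "0 \<le> (t - 1 / 2)\<^sup>2 * (t\<^sup>2 + 3 * t + 11 / 4)" by (simp add: t_def)
      ultimately show "(1 - (norm x)\<^sup>2) * (1 + norm x) ^ 2 \<le> 27 / 16" unfolding t_def by linarith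
    qed
    finally show ?thesis .
  qed
  have E: "compact E" "E \<subseteq> cball 0 1" "J * m0 \<le> measure lebesgue E"
    unfolding E_def J_def using compact_union[of I] union_subset[of I] measure_union[of I] by simp_all
  have mE: "0 < measure lebesgue E" using E(3) J0 m0(1) by (metis less_le_trans mult_pos_pos)
  have "1 \<le> K * (27 / 16) * ((2 * d * (CARD('n) * unit_ball_vol CARD('n)) / measure lebesgue E) ^ d / fact d) + K * 2 ^ (d + 1)"
  proof (rule node_bound[OF E(1,2) x0(1) d _ mE])
    fix u T assume u: "norm u \<le> 1" and T: "finite T" "card T = d + 1" "\<And>\<tau>. \<tau> \<in> T \<Longrightarrow> \<bar>\<tau>\<bar> \<le> 2 \<and> x0 + \<tau> *\<^sub>R u \<in> E"
    have "\<bar>f x0\<bar> \<le> (\<Sum>\<tau>\<in>T. \<bar>f (x0 + \<tau> *\<^sub>R u)\<bar> * (\<Prod>\<sigma>\<in>T - {\<tau>}. \<bar>\<sigma>\<bar> / \<bar>\<tau> - \<sigma>\<bar>)) + K * (\<Prod>\<tau>\<in>T. \<bar>\<tau>\<bar>)"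
      unfolding K_def by (rule ball_interpolation[OF smooth \<kappa>(2) x0(1) u T(1,2)]) (use T(3) E(2) in blast)
    also have "\<dots> \<le> (\<Sum>\<tau>\<in>T. K * (27 / 16) * (\<Prod>\<sigma>\<in>T - {\<tau>}. \<bar>\<sigma>\<bar> / \<bar>\<tau> - \<sigma>\<bar>)) + K * (\<Prod>\<tau>\<in>T. 2)"
    proof (rule add_mono)
      show "(\<Sum>\<tau>\<in>T. \<bar>f (x0 + \<tau> *\<^sub>R u)\<bar> * (\<Prod>\<sigma>\<in>T - {\<tau>}. \<bar>\<sigma>\<bar> / \<bar>\<tau> - \<sigma>\<bar>)) \<le> (\<Sum>\<tau>\<in>T. K * (27 / 16) * (\<Prod>\<sigma>\<in>T - {\<tau>}. \<bar>\<sigma>\<bar> / \<bar>\<tau> - \<sigma>\<bar>))"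
        using T(3) val by (intro sum_mono mult_right_mono prod_nonneg) auto
      have "(\<Prod>\<tau>\<in>T. \<bar>\<tau>\<bar>) \<le> (\<Prod>\<tau>\<in>T. 2)" using T(3) by (intro prod_mono) auto
      then show "K * (\<Prod>\<tau>\<in>T. \<bar>\<tau>\<bar>) \<le> K * (\<Prod>\<tau>\<in>T. 2)" using K by (rule mult_left_mono)
    qed
    finally show "1 \<le> K * (27 / 16) * (\<Sum>\<tau>\<in>T. \<Prod>\<sigma>\<in>T - {\<tau>}. \<bar>\<sigma>\<bar> / \<bar>\<tau> - \<sigma>\<bar>) + K * 2 ^ (d + 1)"
      using x0(2) T(2) by (simp add: sum_distrib_left)
  qed (use K in simp)
  also have "\<dots> \<le> K * (27 / 16) * ((6 * (n' * \<omega>) / (J * m0)) ^ 3 / 6) + K * 16"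
  proof -
    have "6 * (n' * \<omega>) / measure lebesgue E \<le> 6 * (n' * \<omega>) / (J * m0)"
      using E(3) mE J0 m0(1) n' by (intro divide_left_mono) (auto simp: \<omega>_def)
    moreover have "0 \<le> 6 * (n' * \<omega>) / measure lebesgue E" using mE n' by (simp add: \<omega>_def)
    ultimately have "(6 * (n' * \<omega>) / measure lebesgue E) ^ 3 \<le> (6 * (n' * \<omega>) / (J * m0)) ^ 3" by (rule power_mono)
    then have "K * (27 / 16) * ((6 * (n' * \<omega>) / measure lebesgue E) ^ 3 / 6) \<le> K * (27 / 16) * ((6 * (n' * \<omega>) / (J * m0)) ^ 3 / 6)"
      using K by (intro mult_left_mono divide_right_mono) auto
    then show ?thesis using d3 by (simp add: n'_def \<omega>_def fact_numeral)
  qed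
  finally have main: "1 \<le> K * (27 / 16 * ((6 * (n' * \<omega>) / (J * m0)) ^ 3 / 6) + 16)" by (simp add: algebra_simps)
  \<comment> \<open>The volume available per piece. In the interpolation term \<open>m0\<close>
    cancels and \<open>n * w ^ 3\<close> times a constant remains; \<open>m0 \<le> w\<close> serves
    for the remainder term.\<close>
  define w where "w = \<omega> / J"
  have w0: "w > 0" using J0 n' by (simp add: w_def \<omega>_def)
  have mw: "m0 \<le> w" using card_m0_le J0 by (simp add: w_def \<omega>_def n'_def J_def field_simps)
  have w: "w \<le> 63 / 100" "n' * w \<le> 9 / 5"
  proof -
    have "w \<le> 63 / 100 \<and> n' * w \<le> 9 / 5"
    proof (cases "CARD('n) = 2")
      case True
      have "w \<le> (63 / 20) / 5" unfolding w_def using J True unit_ball_vol_le(2)[OF n True] by (simp add: \<omega>_def n'_def)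
      then show ?thesis using True by (simp add: n'_def)
    next
      case False
      then have n3: "CARD('n) \<ge> 3" using n by simp
      have "3 * k \<le> 2 ^ k + 1" if "3 \<le> k" for k :: nat
        using that by (induction k rule: nat_induct_at_least) simp_all
      from this[OF n3] have "3 * CARD('n) \<le> 2 ^ CARD('n) + 1" .
      then have "real (3 * CARD('n)) \<le> real (2 ^ CARD('n) + 1)" by (rule of_nat_mono)
      then have J3: "3 * n' \<le> J" using J by (simp add: n'_def)
      then have J9: "9 \<le> J" using n3 by (simp add: n'_def)
      have \<omega>: "\<omega> \<le> 53 / 10" "0 \<le> \<omega>" using unit_ball_vol_le(1)[OF n] by (simp_all add: \<omega>_def n'_def)
      have "w \<le> (53 / 10) / 9" unfolding w_def using \<omega> J9 by (intro frac_le) auto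
      moreover have "n' * w \<le> 53 / 30"
      proof -
        have "n' * \<omega> \<le> J / 3 * (53 / 10)" using J3 \<omega> n' by (intro mult_mono) auto
        then show ?thesis using J0 by (simp add: w_def field_simps)
      qed
      ultimately show ?thesis by simp
    qed
    then show "w \<le> 63 / 100" "n' * w \<le> 9 / 5" by blast+
  qed
  have "\<kappa> * (m0 / (4 * n')) ^ 3 * (27 / 16 * ((6 * (n' * \<omega>) / (J * m0)) ^ 3 / 6) + 16)
    = n' * w * w\<^sup>2 * (243 / 256) + 16 * (n' * (m0 / (4 * n')) ^ 3)"
    using m0(1) J0 n' unfolding w_def by (simp add: \<kappa>_def n'_def[symmetric] field_simps eval_nat_numeral)
  also have "\<dots> \<le> 9 / 5 * (63 / 100)\<^sup>2 * (243 / 256) + 16 * (1 / 64)"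
  proof (intro add_mono mult_mono power_mono w mult_left_mono)
    have "m0 / (4 * n') \<le> 1 / (4 * n')" using mw w n' by (intro divide_right_mono) auto
    then have "n' * (m0 / (4 * n')) ^ 3 \<le> n' * (1 / (4 * n')) ^ 3" using n' m0 by (intro mult_left_mono power_mono) auto
    also have "\<dots> = 1 / 64 * (1 / n'\<^sup>2)" using n' by (simp add: eval_nat_numeral)
    also have "\<dots> \<le> 1 / 64 * 1" using n' by (intro mult_left_mono) (auto simp: field_simps)
    finally show "n' * (m0 / (4 * n')) ^ 3 \<le> 1 / 64" by simp
  qed (use w0 n' m0 in auto)
  also have "\<dots> \<le> 2" by (simp add: power2_eq_square)
  finally have "\<kappa> * (m0 / (4 * n')) ^ 3 * (27 / 16 * ((6 * (n' * \<omega>) / (J * m0)) ^ 3 / 6) + 16) \<le> 2" .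
  then show ?thesis
    by (intro M_bound[of \<kappa> "27 / 16 * ((6 * (n' * \<omega>) / (J * m0)) ^ 3 / 6) + 16"])
      (use main \<kappa> d3 in \<open>simp_all add: K_def n'_def del: fact_Suc\<close>)
qed

end

section \<open>The quadratic case\<close>

text \<open>The extreme points of \<open>E\<close> on the line are boundary points, and a gap between them would give
  a third one unless the line meets \<open>E\<close> in these two points only.\<close>

lemma quadratic_ray:
  fixes E :: "(real ^ 'n::finite) set"
  assumes E: "compact E" "E \<subseteq> cball 0 1" and x0: "x0 \<in> cball 0 1" "x0 \<notin> E"
    and three: "\<forall>w T. finite T \<longrightarrow> card T = 3 \<longrightarrow> w \<noteq> 0 \<longrightarrow> (\<exists>\<tau>\<in>T. x0 + \<tau> *\<^sub>R w \<notin> frontier E)"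
    and q: "0 < q" "q < 1"
    and \<theta>: "0 < \<theta>" "\<theta> * unit_ball_vol CARD('n) < measure lebesgue E" "2 * (1 - q ^ CARD('n)) \<le> \<theta>"
  shows "\<exists>w r1 r2. norm w \<le> 2 \<and> 0 < r1 \<and> r1 < r2 \<and> r2 < 1 / q \<and> (\<forall>r\<in>{r1..r2}. x0 + r *\<^sub>R w \<in> E) \<and>
    x0 + r1 *\<^sub>R w \<in> frontier E \<and> x0 + r2 *\<^sub>R w \<in> frontier E \<and> norm (x0 + (1 / q) *\<^sub>R w) > 1 \<and>
    \<theta> \<le> r2 ^ CARD('n) - q ^ CARD('n) * r1 ^ CARD('n)"
proof -
  define n where "n = CARD('n)"
  have n: "n \<ge> 1" by (simp add: n_def Suc_leI)
  define J where "J i = {q ^ (n * Suc i)<..q ^ (n * i)}" for i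
  from shell_ray[OF E x0(1) q less_imp_le[OF \<theta>(1)] \<theta>(2)] obtain y where y: "y \<in> cball 0 1"
    "x0 + (1 / q) *\<^sub>R (y - x0) \<notin> cball 0 1"
    "ennreal \<theta> < emeasure lborel (\<Union>i\<in>{i. x0 + q ^ i *\<^sub>R (y - x0) \<in> E}. {q ^ (CARD('n) * Suc i)<..q ^ (CARD('n) * i)})"
    by (elim bexE conjE) (rule that)
  define w where "w = y - x0"
  define A where "A = {r. x0 + r *\<^sub>R w \<in> E}"
  define S where "S = {i. q ^ i \<in> A}"
  have S: "ennreal \<theta> < emeasure lborel (\<Union>i\<in>S. J i)" using y(3) unfolding S_def A_def w_def J_def n_def mem_Collect_eq .
  have out: "x0 + (1 / q) *\<^sub>R w \<notin> cball 0 1" using y(2) by (simp add: w_def)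
  have w0: "w \<noteq> 0" using out x0 by auto
  have w2: "norm w \<le> 2" using y(1) x0(1) norm_triangle_ineq4[of y x0] by (simp add: w_def)
  have cont: "continuous_on UNIV (\<lambda>r. x0 + r *\<^sub>R w)" by (intro continuous_intros)
  have "closed ((\<lambda>r. x0 + r *\<^sub>R w) -` E)" by (rule closed_vimage[OF compact_imp_closed[OF E(1)] cont])
  then have clA: "closed A" by (simp add: A_def vimage_def)
  have "bounded A"
  proof (rule boundedI)
    fix r assume "r \<in> A"
    then have "norm (x0 + r *\<^sub>R w) \<le> 1" using E(2) by (auto simp: A_def)
    then have "norm (r *\<^sub>R w) \<le> 2" using x0(1) norm_triangle_ineq4[of "x0 + r *\<^sub>R w" x0] by simp
    then show "norm r \<le> 2 / norm w" using w0 by (simp add: field_simps)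
  qed
  then have cA: "compact A" using clA by (simp add: compact_eq_bounded_closed)
  have "S \<noteq> {}" using S by auto
  then obtain i0 where i0: "q ^ i0 \<in> A" by (auto simp: S_def)
  then have ne: "A \<noteq> {}" by blast
  obtain r1 where r1: "r1 \<in> A" "\<And>r. r \<in> A \<Longrightarrow> r1 \<le> r" using compact_attains_inf[OF cA ne] by blast
  obtain r2 where r2: "r2 \<in> A" "\<And>r. r \<in> A \<Longrightarrow> r \<le> r2" using compact_attains_sup[OF cA ne] by blast
  have inner: "\<exists>\<epsilon>>0. ball r \<epsilon> \<subseteq> A" if "r \<in> A" "x0 + r *\<^sub>R w \<notin> frontier E" for r
  proof -
    have mem: "r \<in> (\<lambda>r. x0 + r *\<^sub>R w) -` interior E" using that closure_subset[of E] by (auto simp: A_def frontier_def)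
    have "open ((\<lambda>r. x0 + r *\<^sub>R w) -` interior E)" by (rule open_vimage[OF open_interior cont])
    from this mem obtain \<epsilon> where "\<epsilon> > 0" "ball r \<epsilon> \<subseteq> (\<lambda>r. x0 + r *\<^sub>R w) -` interior E"
      by (rule openE)
    then show ?thesis using interior_subset[of E] by (auto simp: A_def intro!: exI[of _ \<epsilon>])
  qed
  have f1: "x0 + r1 *\<^sub>R w \<in> frontier E"
  proof (rule ccontr)
    assume "x0 + r1 *\<^sub>R w \<notin> frontier E"
    from inner[OF r1(1) this] obtain \<epsilon> where "\<epsilon> > 0" "ball r1 \<epsilon> \<subseteq> A" by blast
    then have "r1 - \<epsilon> / 2 \<in> A" by (auto simp: subset_iff dist_real_def)
    then show False using r1(2) \<open>\<epsilon> > 0\<close> by force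
  qed
  have f2: "x0 + r2 *\<^sub>R w \<in> frontier E"
  proof (rule ccontr)
    assume "x0 + r2 *\<^sub>R w \<notin> frontier E"
    from inner[OF r2(1) this] obtain \<epsilon> where "\<epsilon> > 0" "ball r2 \<epsilon> \<subseteq> A" by blast
    then have "r2 + \<epsilon> / 2 \<in> A" by (auto simp: subset_iff dist_real_def)
    then show False using r2(2) \<open>\<epsilon> > 0\<close> by force
  qed
  have no: "x0 + \<tau> *\<^sub>R w \<notin> frontier E" if "r1 < \<tau>" "\<tau> < r2" for \<tau>
  proof
    assume "x0 + \<tau> *\<^sub>R w \<in> frontier E"
    moreover have "card {r1, \<tau>, r2} = 3" using that by simp
    ultimately show False using f1 f2 w0 three[rule_format, of "{r1, \<tau>, r2}" w] by auto
  qed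
  \<comment> \<open>If \<open>A\<close> consisted of its extreme parameters only, the ray would meet
    at most two layers, of total length at most
    \<open>2 * (1 - q ^ n) \<le> \<theta>\<close>.\<close>
  have "\<exists>r\<in>A. r1 < r \<and> r < r2"
  proof (rule ccontr)
    assume "\<not> ?thesis"
    then have A2: "A \<subseteq> {r1, r2}" using r1(2) r2(2) by force
    have "q ^ i = q ^ j \<Longrightarrow> i = j" for i j using q by (simp add: power_inject_exp')
    then have inj: "inj_on (\<lambda>i. q ^ i) S" by (auto simp: inj_on_def)
    have sub: "(\<lambda>i. q ^ i) ` S \<subseteq> {r1, r2}" using A2 by (auto simp: S_def)
    have finS: "finite S" by (rule finite_imageD[OF finite_subset[OF sub] inj]) simp
    have "card S \<le> card {r1, r2}" by (rule card_inj_on_le[OF inj sub]) simp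
    also have "\<dots> \<le> 2" by (simp add: card_insert_if)
    finally have cS: "card S \<le> 2" .
    have "q ^ n \<le> 1" using q by (simp add: power_le_one)
    have "emeasure lborel (\<Union>i\<in>S. J i) \<le> (\<Sum>i\<in>S. emeasure lborel (J i))"
      by (rule emeasure_subadditive_finite[OF finS]) (auto simp: J_def)
    also have "\<dots> \<le> (\<Sum>i\<in>S. ennreal (1 - q ^ n))"
    proof (rule sum_mono)
      fix i
      have le: "q ^ (n * Suc i) \<le> q ^ (n * i)" using q by (intro power_decreasing) auto
      have "q ^ (n * i) - q ^ (n * Suc i) = q ^ (n * i) * (1 - q ^ n)" by (simp add: algebra_simps power_add)
      also have "\<dots> \<le> 1 * (1 - q ^ n)" using q \<open>q ^ n \<le> 1\<close> by (intro mult_right_mono power_le_one) auto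
      finally show "emeasure lborel (J i) \<le> ennreal (1 - q ^ n)" unfolding J_def using le by (simp add: ennreal_leI)
    qed
    also have "\<dots> = ennreal (card S * (1 - q ^ n))" using \<open>q ^ n \<le> 1\<close> by (simp add: ennreal_mult ennreal_of_nat_eq_real_of_nat)
    also have "\<dots> \<le> ennreal (2 * (1 - q ^ n))" using cS \<open>q ^ n \<le> 1\<close> by (intro ennreal_leI mult_right_mono) auto
    also have "\<dots> \<le> ennreal \<theta>" using \<theta>(3) by (intro ennreal_leI) (simp add: n_def)
    finally show False using S by simp
  qed
  then obtain r0 where r0: "r0 \<in> A" "r1 < r0" "r0 < r2" by blast
  \<comment> \<open>Between \<open>r0\<close> and a parameter outside \<open>A\<close> the line
    would cross the boundary strictly between \<open>r1\<close> and \<open>r2\<close>, at a third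
    point.\<close>
  have seg: "x0 + r *\<^sub>R w \<in> E" if r: "r \<in> {r1..r2}" for r
  proof (rule ccontr)
    assume neg: "x0 + r *\<^sub>R w \<notin> E"
    then have "r \<noteq> r1" "r \<noteq> r2" using r1(1) r2(1) by (auto simp: A_def)
    then have r': "r1 < r" "r < r2" using r by auto
    define L where "L = (\<lambda>t. x0 + t *\<^sub>R w) ` {min r r0..max r r0}"
    have L: "connected L" unfolding L_def by (intro connected_continuous_image continuous_intros connected_Icc)
    have "x0 + r0 *\<^sub>R w \<in> L \<inter> E" "x0 + r *\<^sub>R w \<in> L - E" using r0(1) neg by (auto simp: L_def A_def)
    then have "L \<inter> frontier E \<noteq> {}" by (intro connected_Int_frontier[OF L]) blast+
    then obtain \<tau> where "\<tau> \<in> {min r r0..max r r0}" "x0 + \<tau> *\<^sub>R w \<in> frontier E" unfolding L_def by blast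
    moreover have "r1 < min r r0" "max r r0 < r2" using r' r0 by simp_all
    ultimately show False using no[of \<tau>] by (meson atLeastAtMost_iff less_le_trans le_less_trans)
  qed
  have pos: "r1 > 0"
  proof (rule ccontr)
    assume "\<not> r1 > 0"
    moreover have "0 < q ^ i0" "q ^ i0 \<le> r2" using q r2(2)[OF i0] by auto
    ultimately have "0 \<in> {r1..r2}" by auto
    from seg[OF this] show False using x0(2) by simp
  qed
  \<comment> \<open>The ray has left the ball at the parameter \<open>1 / q\<close>, and by
    convexity it does not return.\<close>
  have r2q: "r2 < 1 / q"
  proof (rule ccontr)
    assume "\<not> r2 < 1 / q"
    then have q': "0 \<le> 1 / q / r2" "1 / q / r2 \<le> 1" "r2 > 0" using pos r0 q by (auto simp: field_simps)
    have "(1 - 1 / q / r2) *\<^sub>R x0 + (1 / q / r2) *\<^sub>R (x0 + r2 *\<^sub>R w) \<in> cball 0 1"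
      using E(2) r2(1) x0(1) q' by (intro convexD_alt[OF convex_cball]) (auto simp: A_def)
    also have "(1 - 1 / q / r2) *\<^sub>R x0 + (1 / q / r2) *\<^sub>R (x0 + r2 *\<^sub>R w) = x0 + (1 / q) *\<^sub>R w"
      using q'(3) by (simp add: scaleR_add_right scaleR_left_diff_distrib)
    finally show False using out by simp
  qed
  have "\<theta> \<le> r2 ^ n - q ^ n * r1 ^ n"
  proof -
    have "(\<Union>i\<in>S. J i) \<subseteq> {q ^ n * r1 ^ n<..r2 ^ n}"
    proof
      fix v assume "v \<in> (\<Union>i\<in>S. J i)"
      then obtain i where i: "q ^ i \<in> A" "q ^ (n * Suc i) < v" "v \<le> q ^ (n * i)" by (auto simp: S_def J_def)
      have "r1 ^ n \<le> (q ^ i) ^ n" "(q ^ i) ^ n \<le> r2 ^ n"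
        using r1(2)[OF i(1)] r2(2)[OF i(1)] pos q by (auto intro!: power_mono)
      moreover have "(q ^ i) ^ n = q ^ (n * i)" by (simp add: power_mult[symmetric] mult.commute)
      ultimately have le: "r1 ^ n \<le> q ^ (n * i)" "q ^ (n * i) \<le> r2 ^ n" by simp_all
      have "q ^ n * r1 ^ n \<le> q ^ n * q ^ (n * i)" using le(1) q by (intro mult_left_mono) auto
      also have "\<dots> = q ^ (n * Suc i)" by (simp add: power_add)
      finally show "v \<in> {q ^ n * r1 ^ n<..r2 ^ n}" using i le by simp
    qed
    then have "emeasure lborel (\<Union>i\<in>S. J i) \<le> emeasure lborel {q ^ n * r1 ^ n<..r2 ^ n}" by (rule emeasure_mono) simp
    also have "q ^ n * r1 ^ n \<le> 1 * r2 ^ n" using q pos r0 by (intro mult_mono power_le_one power_mono) auto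
    then have "emeasure lborel {q ^ n * r1 ^ n<..r2 ^ n} = ennreal (r2 ^ n - q ^ n * r1 ^ n)" by simp
    finally have "ennreal \<theta> < ennreal (r2 ^ n - q ^ n * r1 ^ n)" using S by (rule less_le_trans[rotated])
    then show ?thesis using \<theta>(1) by (simp add: ennreal_less_iff)
  qed
  then show ?thesis using w2 pos r0 r2q seg f1 f2 out unfolding n_def
    by (intro exI[of _ w] exI[of _ r1] exI[of _ r2]) (auto simp: not_le)
qed

text \<open>A point at the fraction \<open>t\<close> of the way from a point of the ball to a point
  outside has norm at least \<open>2 * t - 1\<close>, by the triangle inequality.\<close>

lemma near_sphere:
  fixes x z :: "'a::real_normed_vector"
  assumes "norm x \<le> 1" "norm z > 1" "0 < t" "t < 1"
  shows "1 - (norm ((1 - t) *\<^sub>R x + t *\<^sub>R z))\<^sup>2 \<le> 4 * (1 - t)"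
proof -
  define p where "p = (1 - t) *\<^sub>R x + t *\<^sub>R z"
  have "t * norm z = norm (p - (1 - t) *\<^sub>R x)" using assms by (simp add: p_def)
  also have "\<dots> \<le> norm p + (1 - t) * norm x" using norm_triangle_ineq4[of p "(1 - t) *\<^sub>R x"] assms by simp
  also have "\<dots> \<le> norm p + (1 - t) * 1" using assms by (intro add_left_mono mult_left_mono) auto
  finally have "t * norm z \<le> norm p + (1 - t)" by simp
  moreover have "t * 1 \<le> t * norm z" using assms by (intro mult_left_mono) auto
  ultimately have p: "2 * t - 1 \<le> norm p" by linarith
  have "1 - (norm p)\<^sup>2 \<le> 4 * (1 - t)"
  proof (cases "2 * t - 1 \<ge> 0")
    case True
    have "(2 * t - 1)\<^sup>2 \<le> (norm p)\<^sup>2" using p True by (rule power_mono)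
    moreover have "4 * (1 - t) - (1 - (2 * t - 1)\<^sup>2) = 4 * (1 - t)\<^sup>2" by (simp add: power2_eq_square algebra_simps)
    moreover have "0 \<le> (1 - t)\<^sup>2" by simp
    ultimately show ?thesis by linarith
  next
    case False
    then have "1 \<le> 4 * (1 - t)" by simp
    moreover have "1 - (norm p)\<^sup>2 \<le> 1" by simp
    ultimately show ?thesis by (rule order_trans[rotated])
  qed
  then show ?thesis by (simp add: p_def)
qed

context vanishing_pieces
begin

text \<open>The nodes are the ends of the segment cut out of \<open>E\<close>, where
  \<open>f\<close> vanishes, and its midpoint. There \<open>f\<close> is bounded through the
  distance to the sphere, which shrinks with the remaining part of the ray. The parameter
  \<open>e\<close> is the inverse homothety ratio, to be sent to 1.\<close>

lemma quadratic_step: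
  fixes K C e \<theta> \<kappa> :: real
  assumes n: "CARD('n) \<ge> 2" and d2: "d = 2" and \<kappa>: "\<kappa> \<ge> 0" "weight_bound TYPE('n) (d + 1) \<kappa>"
    and E: "compact E" "E \<subseteq> cball 0 1" "x0 \<notin> E" "\<And>z. z \<in> frontier E \<Longrightarrow> f z = 0"
    and three: "\<forall>w T. finite T \<longrightarrow> card T = 3 \<longrightarrow> w \<noteq> 0 \<longrightarrow> (\<exists>\<tau>\<in>T. x0 + \<tau> *\<^sub>R w \<notin> frontier E)"
    and val: "\<And>x. x \<in> E \<Longrightarrow> \<bar>f x\<bar> \<le> K * (2 * (1 - (norm x)\<^sup>2))"
    and e: "1 < e" and \<theta>: "0 < \<theta>" "\<theta> * unit_ball_vol CARD('n) < measure lebesgue E" "2 * (1 - (1 / e) ^ CARD('n)) \<le> \<theta>"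
    and K_def: "K = \<kappa> * M (d + 1) f / fact (d + 1)"
    and C_def: "C = 4 * (real CARD('n))\<^sup>2 * (if CARD('n) = 2 then 33 / 50 else 23 / 50) + 8"
  shows "\<theta> \<le> e ^ CARD('n) * sqrt (K * C * e ^ 3) + (e ^ CARD('n) - 1)"
proof -
  define n where "n = CARD('n)"
  define q where "q = 1 / e"
  have q: "0 < q" "q < 1" "1 / q = e" using e by (simp_all add: q_def)
  have K: "K \<ge> 0" unfolding K_def using \<kappa> M_nonneg by (simp del: fact_Suc)
  from quadratic_ray[OF E(1,2) x0(1) E(3) three q(1,2) \<theta>(1,2) \<theta>(3)[folded q_def]] obtain w r1 r2 where
    w: "norm w \<le> 2" and r: "0 < r1" "r1 < r2" "r2 < e" and seg: "\<forall>r\<in>{r1..r2}. x0 + r *\<^sub>R w \<in> E"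
    and fr: "x0 + r1 *\<^sub>R w \<in> frontier E" "x0 + r2 *\<^sub>R w \<in> frontier E"
    and out: "norm (x0 + e *\<^sub>R w) > 1" and meas: "\<theta> \<le> r2 ^ CARD('n) - q ^ CARD('n) * r1 ^ CARD('n)"
    unfolding q(3) by (elim exE conjE) (rule that)
  \<comment> \<open>Scaling by \<open>q\<close> brings the parameters into the unit interval, where
    \<open>quadratic_case_estimate\<close> applies; powers of \<open>e\<close> record the
    loss.\<close>
  define s1 s2 where "s1 = q * r1" and "s2 = q * r2"
  have s: "0 < s1" "s1 < s2" "s2 \<le> 1" using r q e by (simp_all add: s1_def s2_def q_def field_simps)
  define a where "a = (r1 + r2) / 2"
  define h where "h = (r2 - r1) / 2"
  have ra: "r1 < a" "a < r2" "a - r1 = h" "r2 - a = h" "h > 0" "a > 0" using r by (simp_all add: a_def h_def field_simps)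
  define X where "X = 8 * (1 - (s1 + s2) / 2) * (s1 * s2) / ((s2 - s1) / 2)\<^sup>2 + 8 * (s1 * ((s1 + s2) / 2) * s2)"
  define V where "V = s2 ^ n - s1 ^ n"
  have V: "V \<ge> 0" using s by (simp add: V_def power_mono)
  have VX: "V\<^sup>2 * X \<le> C" unfolding V_def X_def C_def n_def by (rule quadratic_case_estimate[OF s n])
  have mid: "1 - (norm (x0 + a *\<^sub>R w))\<^sup>2 \<le> 4 * (1 - q * a)"
  proof -
    have "x0 + a *\<^sub>R w = (1 - q * a) *\<^sub>R x0 + (q * a) *\<^sub>R (x0 + e *\<^sub>R w)"
      using e by (simp add: q_def algebra_simps)
    moreover have "0 < q * a" "q * a < 1" using ra q r e by (simp_all add: q_def field_simps)
    ultimately show ?thesis using near_sphere[of x0 "x0 + e *\<^sub>R w" "q * a"] x0(1) out by simp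
  qed
  have fa: "\<bar>f (x0 + a *\<^sub>R w)\<bar> \<le> K * (8 * (1 - q * a))"
  proof -
    have "\<bar>f (x0 + a *\<^sub>R w)\<bar> \<le> K * (2 * (1 - (norm (x0 + a *\<^sub>R w))\<^sup>2))" using seg ra by (intro val) auto
    also have "\<dots> \<le> K * (8 * (1 - q * a))" using mid K by (intro mult_left_mono) auto
    finally show ?thesis .
  qed
  have "1 \<le> K * (8 * (1 - q * a)) * (r1 * r2 / h\<^sup>2) + K * (8 * (r1 * a * r2))"
  proof -
    define T where "T = {2 * r1, 2 * a, 2 * r2}"
    have T: "finite T" "card T = d + 1" using ra d2 by (simp_all add: T_def)
    have pts: "x0 + \<tau> *\<^sub>R ((1 / 2) *\<^sub>R w) \<in> E" if "\<tau> \<in> T" for \<tau>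
      using that seg ra by (auto simp: T_def)
    define g where "g \<tau> = \<bar>f (x0 + \<tau> *\<^sub>R ((1 / 2) *\<^sub>R w))\<bar> * (\<Prod>\<sigma>\<in>T - {\<tau>}. \<bar>\<sigma>\<bar> / \<bar>\<tau> - \<sigma>\<bar>)" for \<tau>
    have pts': "x0 + \<tau> *\<^sub>R ((1 / 2) *\<^sub>R w) \<in> B1" if "\<tau> \<in> T" for \<tau> using pts[OF that] E(2) by blast
    have w': "norm ((1 / 2) *\<^sub>R w) \<le> 1" using w by simp
    have "\<bar>f x0\<bar> \<le> (\<Sum>\<tau>\<in>T. g \<tau>) + K * (\<Prod>\<tau>\<in>T. \<bar>\<tau>\<bar>)"
      unfolding K_def g_def by (rule ball_interpolation[OF smooth \<kappa>(2) x0(1) w' T pts'])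
    also have "(\<Sum>\<tau>\<in>T. g \<tau>) = g (2 * r1) + g (2 * a) + g (2 * r2)" using ra by (simp add: T_def)
    also have "g (2 * r1) = 0" using fr E(4) by (simp add: g_def)
    also have "g (2 * r2) = 0" using fr E(4) by (simp add: g_def)
    also have "g (2 * a) = \<bar>f (x0 + a *\<^sub>R w)\<bar> * (r1 * r2 / h\<^sup>2)"
    proof -
      have "T - {2 * a} = {2 * r1, 2 * r2}" using ra by (auto simp: T_def)
      moreover have "\<bar>2 * r1\<bar> / \<bar>2 * a - 2 * r1\<bar> = r1 / h" "\<bar>2 * r2\<bar> / \<bar>2 * a - 2 * r2\<bar> = r2 / h"
        using ra r by (simp_all add: abs_if field_simps)
      ultimately show ?thesis using ra by (simp add: g_def power2_eq_square)
    qed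
    also have "(\<Prod>\<tau>\<in>T. \<bar>\<tau>\<bar>) = 8 * (r1 * a * r2)" using ra r by (simp add: T_def)
    finally have "1 \<le> \<bar>f (x0 + a *\<^sub>R w)\<bar> * (r1 * r2 / h\<^sup>2) + K * (8 * (r1 * a * r2))" using x0(2) by simp
    moreover have "\<bar>f (x0 + a *\<^sub>R w)\<bar> * (r1 * r2 / h\<^sup>2) \<le> K * (8 * (1 - q * a)) * (r1 * r2 / h\<^sup>2)"
      using fa r by (intro mult_right_mono) auto
    ultimately show ?thesis by linarith
  qed
  also have "\<dots> = K * (8 * (1 - (s1 + s2) / 2) * (s1 * s2) / ((s2 - s1) / 2)\<^sup>2 + e ^ 3 * (8 * (s1 * ((s1 + s2) / 2) * s2)))"
  proof -
    have e1: "r1 * r2 / h\<^sup>2 = s1 * s2 / ((s2 - s1) / 2)\<^sup>2"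
    proof -
      have "(s2 - s1) / 2 = q * h" by (simp add: s1_def s2_def h_def algebra_simps)
      then show ?thesis using q(1) by (simp add: s1_def s2_def power2_eq_square)
    qed
    have e2: "q * a = (s1 + s2) / 2" by (simp add: s1_def s2_def a_def algebra_simps)
    have e3: "r1 * a * r2 = e ^ 3 * (s1 * ((s1 + s2) / 2) * s2)"
      using e by (simp add: s1_def s2_def a_def q_def field_simps power3_eq_cube)
    have alg: "K * (8 * x) * (p / D) + K * (8 * (c * z)) = K * (8 * x * p / D + c * (8 * z))" for x p D c z :: real
      by (simp add: distrib_left)
    show ?thesis unfolding e1 e2 e3 by (rule alg)
  qed
  also have "\<dots> \<le> K * (e ^ 3 * X)"
  proof -
    have "1 * (8 * (1 - (s1 + s2) / 2) * (s1 * s2) / ((s2 - s1) / 2)\<^sup>2) \<le> e ^ 3 * (8 * (1 - (s1 + s2) / 2) * (s1 * s2) / ((s2 - s1) / 2)\<^sup>2)"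
      using s e by (intro mult_right_mono) auto
    then show ?thesis using K unfolding X_def by (intro mult_left_mono) (auto simp: distrib_left)
  qed
  finally have "1 \<le> K * e ^ 3 * X" by simp
  then have "V\<^sup>2 * 1 \<le> V\<^sup>2 * (K * e ^ 3 * X)" by (intro mult_left_mono) auto
  also have "\<dots> = K * e ^ 3 * (V\<^sup>2 * X)" by simp
  also have "\<dots> \<le> K * e ^ 3 * C" using K e VX by (intro mult_left_mono) auto
  finally have "V\<^sup>2 \<le> K * C * e ^ 3" by (simp add: mult_ac)
  then have Vle: "V \<le> sqrt (K * C * e ^ 3)" by (rule real_le_rsqrt)
  have "r2 ^ n - q ^ n * r1 ^ n = e ^ n * V + (e ^ n - 1) * s1 ^ n"
    using e by (simp add: V_def s1_def s2_def q_def power_divide power_mult_distrib field_simps)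
  also have "\<dots> \<le> e ^ n * sqrt (K * C * e ^ 3) + (e ^ n - 1) * 1"
    using Vle e s by (intro add_mono mult_left_mono power_le_one) auto
  finally show ?thesis using meas unfolding n_def by (simp only: mult_1_right)
qed

text \<open>If a line through \<open>x0\<close> carries three zeros in the ball, the remainder alone
  decides. Otherwise every line through \<open>x0\<close> meets the boundary of \<open>E\<close> in
  at most two points, \<open>x0\<close> is outside \<open>E\<close>, and
  \<open>quadratic_step\<close> applies.\<close>

lemma case_d2:
  assumes n: "CARD('n) \<ge> 2" and I: "card I = 2" and d2: "d = 2"
  shows "fact (d + 1) / 2 * (m0 / (4 * CARD('n))) ^ d \<le> M (d + 1) f"
proof -
  define \<kappa> where "\<kappa> = sqrt 3"
  define K where "K = \<kappa> * M (d + 1) f / fact (d + 1)"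
  define n' where "n' = real CARD('n)"
  define \<omega> where "\<omega> = unit_ball_vol n'"
  define C where "C = 4 * n'\<^sup>2 * (if CARD('n) = 2 then 33 / 50 else 23 / 50) + 8"
  have \<kappa>: "\<kappa> \<ge> 0" "weight_bound TYPE('n) (d + 1) \<kappa>" "\<kappa> \<le> 1733 / 1000"
  proof -
    show "\<kappa> \<ge> 0" by (simp add: \<kappa>_def)
    show "weight_bound TYPE('n) (d + 1) \<kappa>" using weight_bound_3[where 'n = 'n] d2 by (simp add: \<kappa>_def)
    show "\<kappa> \<le> 1733 / 1000" unfolding \<kappa>_def by (rule real_le_lsqrt) (simp_all add: power2_eq_square)
  qed
  have K: "K \<ge> 0" unfolding K_def using \<kappa> M_nonneg by (simp del: fact_Suc)
  have n': "n' \<ge> 2" using n by (simp add: n'_def)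
  have \<omega>0: "\<omega> > 0" using n' by (simp add: \<omega>_def)
  have \<omega>: "\<omega> \<le> 53 / 10" "CARD('n) = 2 \<Longrightarrow> \<omega> \<le> 63 / 20" "CARD('n) = 3 \<Longrightarrow> \<omega> \<le> 21 / 5"
    using unit_ball_vol_le[OF n] by (simp_all add: \<omega>_def n'_def)
  have m\<omega>: "2 * m0 \<le> \<omega>" using card_m0_le I by (simp add: \<omega>_def n'_def)
  obtain i j where ij: "I = {i, j}" "i \<noteq> j" using I by (meson card_2_iff)
  define E where "E = (\<Union>k\<in>I. U k)"
  have E: "compact E" "E \<subseteq> cball 0 1" "2 * m0 \<le> measure lebesgue E"
    unfolding E_def using compact_union[of I] union_subset[of I] measure_union[of I] I by simp_all
  have frE: "\<exists>k\<in>I. z \<in> frontier (U k)" if "z \<in> frontier E" for z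
    using that frontier_Un_subset[of "U i" "U j"] unfolding E_def ij(1) by auto
  have zE: "f z = 0" if "z \<in> frontier E" for z using frE[OF that] zero by blast
  have many: ?thesis if "norm u = 1" "finite T" "3 \<le> card T" "\<forall>\<tau>\<in>T. x0 + \<tau> *\<^sub>R u \<in> cball 0 1 \<and> f (x0 + \<tau> *\<^sub>R u) = 0" for u T
  proof -
    have c: "d + 1 \<le> card T" using that(3) d2 by simp
    note b = many_zeros_bound[OF \<kappa>(1,2) that(1,2) c that(4)]
    have "m0 / (4 * n') \<le> 1 / 4"
    proof (cases "CARD('n) = 2")
      case True
      then show ?thesis using m\<omega> \<omega>(2) by (simp add: n'_def)
    next
      case False
      then have "n' \<ge> 3" using n by (simp add: n'_def)
      then show ?thesis using m\<omega> \<omega>(1) by (simp add: field_simps)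
    qed
    then have "(m0 / (4 * n'))\<^sup>2 \<le> (1 / 4)\<^sup>2" using m0(1) n' by (intro power_mono) auto
    then have "\<kappa> * (m0 / (4 * n'))\<^sup>2 \<le> 1733 / 1000 * (1 / 4)\<^sup>2" using \<kappa> by (intro mult_mono) auto
    then have "\<kappa> * (m0 / (4 * n')) ^ d * 2 ^ (d + 1) \<le> 2" using d2 by (simp add: power2_eq_square)
    then show ?thesis by (intro M_bound[OF \<kappa>(1) b]) (simp add: n'_def)
  qed
  show ?thesis
  proof (cases "\<exists>u T. norm u = 1 \<and> finite T \<and> 3 \<le> card T \<and> (\<forall>\<tau>\<in>T. x0 + \<tau> *\<^sub>R u \<in> cball 0 1 \<and> f (x0 + \<tau> *\<^sub>R u) = 0)")
    case True
    then show ?thesis by (elim exE conjE) (rule many)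
  next
    case False
    have few: False if "norm u = 1" "finite T" "3 \<le> card T" "\<And>\<tau>. \<tau> \<in> T \<Longrightarrow> x0 + \<tau> *\<^sub>R u \<in> cball 0 1 \<and> f (x0 + \<tau> *\<^sub>R u) = 0" for u T
      by (rule notE[OF False], rule exI[of _ u], rule exI[of _ T]) (use that in simp)
    have three: "\<exists>\<tau>\<in>T. x0 + \<tau> *\<^sub>R w \<notin> frontier E" if w: "finite T" "card T = 3" "w \<noteq> 0" for w T
    proof (rule ccontr)
      assume "\<not> ?thesis"
      then have fr: "x0 + \<tau> *\<^sub>R w \<in> frontier E" if "\<tau> \<in> T" for \<tau> using that by blast
      show False
      proof (rule few[of "sgn w" "(\<lambda>\<tau>. \<tau> * norm w) ` T"])
      show "norm (sgn w) = 1" using w(3) by (simp add: norm_sgn)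
      have "inj_on (\<lambda>\<tau>. \<tau> * norm w) T" using w(3) by (simp add: inj_on_def)
      then show "3 \<le> card ((\<lambda>\<tau>. \<tau> * norm w) ` T)" using w(2) by (simp add: card_image)
      fix \<sigma> assume "\<sigma> \<in> (\<lambda>\<tau>. \<tau> * norm w) ` T"
      then obtain \<tau> where \<tau>: "\<tau> \<in> T" "\<sigma> = \<tau> * norm w" by blast
      have "\<sigma> *\<^sub>R sgn w = \<tau> *\<^sub>R w" using w(3) \<tau>(2) by (simp add: sgn_div_norm)
      moreover have "x0 + \<tau> *\<^sub>R w \<in> E" using fr[OF \<tau>(1)] frontier_subset_closed[OF compact_imp_closed[OF E(1)]] by blast
      ultimately show "x0 + \<sigma> *\<^sub>R sgn w \<in> cball 0 1 \<and> f (x0 + \<sigma> *\<^sub>R sgn w) = 0"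
        using zE[OF fr[OF \<tau>(1)]] E(2) by auto
      qed (use w in auto)
    qed
    have x0E: "x0 \<notin> E"
    proof
      assume "x0 \<in> E"
      then obtain k where k: "k \<in> I" "x0 \<in> U k" by (auto simp: E_def)
      have "x0 \<notin> frontier (U k)" using zero[OF k(1)] x0(2) by force
      then have k_int: "x0 \<in> interior (U k)" using k(2) closure_subset[of "U k"] by (auto simp: frontier_def)
      obtain l where l: "l \<in> I" "l \<noteq> k" using ij k by blast
      obtain p where p: "p \<in> interior (U l)" "p \<noteq> x0" using interior_point_ne[OF l(1)] by blast
      note u = line_through[OF p(2)]
      have "\<exists>s. x0 + s *\<^sub>R sgn (p - x0) \<in> interior (U m)" if "m \<in> {k, l}" for m
      proof (cases "m = k")
        case True
        then show ?thesis using k_int by (intro exI[of _ 0]) simp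
      next
        case False
        then show ?thesis using that u(2) p(1) by (intro exI[of _ "norm (p - x0)"]) simp
      qed
      moreover have "{k, l} \<subseteq> I" using k l by simp
      ultimately have "\<exists>T. finite T \<and> card T = 2 * card {k, l} \<and> (\<forall>\<tau>\<in>T. x0 + \<tau> *\<^sub>R sgn (p - x0) \<in> cball 0 1 \<and> f (x0 + \<tau> *\<^sub>R sgn (p - x0)) = 0)"
        by (intro line_zeros u(1))
      then obtain T where T: "finite T" "card T = 2 * card {k, l}"
        "\<forall>\<tau>\<in>T. x0 + \<tau> *\<^sub>R sgn (p - x0) \<in> cball 0 1 \<and> f (x0 + \<tau> *\<^sub>R sgn (p - x0)) = 0" by (elim exE conjE) (rule that)
      show False by (rule few[OF u(1) T(1)]) (use T(2,3) l(2) in auto)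
    qed
    have val: "\<bar>f x\<bar> \<le> K * (2 * (1 - (norm x)\<^sup>2))" if xE: "x \<in> E" for x
    proof -
      obtain k where k: "k \<in> I" "x \<in> U k" using xE by (auto simp: E_def)
      obtain l where l: "l \<in> I" "k \<noteq> l" using ij k by blast
      have nx: "norm x \<le> 1" using xE E(2) by force
      have "\<bar>f x\<bar> \<le> K * ((1 - (norm x)\<^sup>2) * (1 + norm x))"
        using piece_value_bound[OF \<kappa>(1,2) k(1) l k(2)] d2 unfolding K_def by (simp del: fact_Suc)
      also have "\<dots> \<le> K * ((1 - (norm x)\<^sup>2) * 2)" using K nx by (intro mult_left_mono) (auto simp: power_le_one)
      finally show ?thesis by (simp add: mult_ac)
    qed
    have three': "\<forall>w T. finite T \<longrightarrow> card T = 3 \<longrightarrow> w \<noteq> 0 \<longrightarrow> (\<exists>\<tau>\<in>T. x0 + \<tau> *\<^sub>R w \<notin> frontier E)"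
      using three by simp
    define D where "D = K * C"
    \<comment> \<open>The shells are refined, \<open>e\<close> tending to 1 from above, for fixed
      \<open>\<theta>\<close>; afterwards \<open>\<theta>\<close> may approach the share of the ball
      taken by \<open>E\<close>.\<close>
    have le: "\<theta> \<le> sqrt D" if \<theta>: "0 < \<theta>" "\<theta> < measure lebesgue E / \<omega>" for \<theta>
    proof (rule tendsto_lowerbound)
      show "((\<lambda>e. e ^ CARD('n) * sqrt (D * e ^ 3) + (e ^ CARD('n) - 1)) \<longlongrightarrow> sqrt D) (at_right 1)"
      proof -
        have "((\<lambda>e. e ^ CARD('n) * sqrt (D * e ^ 3) + (e ^ CARD('n) - 1)) \<longlongrightarrow> 1 ^ CARD('n) * sqrt (D * 1 ^ 3) + (1 ^ CARD('n) - 1)) (at_right 1)"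
          by (intro tendsto_intros)
        then show ?thesis by simp
      qed
      have "((\<lambda>e. 2 * (1 - (1 / e) ^ CARD('n))) \<longlongrightarrow> 2 * (1 - (1 / 1) ^ CARD('n))) (at_right (1 :: real))"
        by (intro tendsto_intros) simp
      then have "((\<lambda>e. 2 * (1 - (1 / e) ^ CARD('n))) \<longlongrightarrow> 0) (at_right (1 :: real))" by simp
      from order_tendstoD(2)[OF this \<theta>(1)]
      have "\<forall>\<^sub>F e in at_right (1 :: real). 2 * (1 - (1 / e) ^ CARD('n)) < \<theta>" .
      moreover have "\<forall>\<^sub>F e in at_right (1 :: real). e > 1" by (simp add: eventually_at_right_less)
      ultimately show "\<forall>\<^sub>F e in at_right 1. \<theta> \<le> e ^ CARD('n) * sqrt (D * e ^ 3) + (e ^ CARD('n) - 1)"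
      proof eventually_elim
        case (elim e)
        have "\<theta> * \<omega> < measure lebesgue E" using \<theta>(2) \<omega>0 by (simp add: field_simps)
        then have \<theta>': "\<theta> * unit_ball_vol CARD('n) < measure lebesgue E" by (simp add: \<omega>_def n'_def)
        show ?case unfolding D_def
          by (rule quadratic_step[OF n d2 \<kappa>(1,2) E(1,2) x0E zE three' val elim(2) \<theta>(1) \<theta>' less_imp_le[OF elim(1)] K_def C_def[unfolded n'_def]])
      qed
    qed simp
    have mE: "0 < measure lebesgue E / \<omega>" using E(3) m0(1) \<omega>0 by simp
    have "measure lebesgue E / \<omega> \<le> sqrt D"
    proof (rule dense_le_bounded[OF mE])
      fix \<theta> assume "0 < \<theta>" "\<theta> < measure lebesgue E / \<omega>"
      then show "\<theta> \<le> sqrt D" by (rule le)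
    qed
    moreover have "2 * m0 / \<omega> \<le> measure lebesgue E / \<omega>" using E(3) \<omega>0 by (intro divide_right_mono) auto
    ultimately have "2 * m0 / \<omega> \<le> sqrt D" by linarith
    then have "(2 * m0 / \<omega>)\<^sup>2 \<le> (sqrt D)\<^sup>2" using m0(1) \<omega>0 by (intro power_mono) auto
    also have "(sqrt D)\<^sup>2 = K * C" using K by (simp add: D_def C_def)
    finally have "1 \<le> K * (C * (\<omega> / (2 * m0))\<^sup>2)" using m0(1) \<omega>0 by (simp add: field_simps power2_eq_square)
    moreover have "\<kappa> * (m0 / (4 * n')) ^ d * (C * (\<omega> / (2 * m0))\<^sup>2) \<le> 2"
    proof -
      have "\<kappa> * (m0 / (4 * n')) ^ d * (C * (\<omega> / (2 * m0))\<^sup>2) = \<kappa> * (C * \<omega>\<^sup>2 / (64 * n'\<^sup>2))"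
        using m0(1) d2 n' by (simp add: field_simps power2_eq_square)
      \<comment> \<open>The product is just below 2. From dimension 4 on, the additive 8 in
        \<open>C\<close> is absorbed by \<open>n ^ 2 / 2\<close>; dimensions 2 and 3 use their own
        volume bounds.\<close>
      also have "\<dots> \<le> 1733 / 1000 * (100 / 87)"
      proof (rule mult_mono)
        show "C * \<omega>\<^sup>2 / (64 * n'\<^sup>2) \<le> 100 / 87"
        proof -
          consider "CARD('n) = 2" | "CARD('n) = 3" | "CARD('n) \<ge> 4" using n by linarith
          then show ?thesis
          proof cases
            case 1
            have "\<omega>\<^sup>2 \<le> (63 / 20)\<^sup>2" using \<omega>(2)[OF 1] \<omega>0 by (intro power_mono) auto
            then show ?thesis using 1 by (simp add: C_def n'_def power2_eq_square)
          next
            case 2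
            have "\<omega>\<^sup>2 \<le> (21 / 5)\<^sup>2" using \<omega>(3)[OF 2] \<omega>0 by (intro power_mono) auto
            then show ?thesis using 2 by (simp add: C_def n'_def power2_eq_square)
          next
            case 3
            have w2: "\<omega>\<^sup>2 \<le> (53 / 10)\<^sup>2" using \<omega>(1) \<omega>0 by (intro power_mono) auto
            have "n' \<ge> 4" using 3 by (simp add: n'_def)
            then have "4 * 4 \<le> n' * n'" by (intro mult_mono) auto
            then have n2: "16 \<le> n'\<^sup>2" by (simp add: power2_eq_square)
            then have "C \<le> (4 * (23 / 50) + 1 / 2) * n'\<^sup>2" using 3 by (simp add: C_def)
            then have "C * \<omega>\<^sup>2 \<le> ((4 * (23 / 50) + 1 / 2) * n'\<^sup>2) * (53 / 10)\<^sup>2" using w2 by (intro mult_mono) auto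
            then show ?thesis using n2 by (simp add: field_simps power2_eq_square)
          qed
        qed
      qed (use \<kappa> in \<open>auto simp: C_def\<close>)
      finally show ?thesis by simp
    qed
    ultimately show ?thesis by (intro M_bound[OF \<kappa>(1), of "C * (\<omega> / (2 * m0))\<^sup>2"]) (simp_all add: K_def n'_def del: fact_Suc)
  qed
qed

end

section \<open>The case of high degree\<close>

text \<open>Pascal's rule: a multiset either avoids \<open>a\<close> or loses one copy of it and
  decreases in size.\<close>

lemma card_multisets_upto:
  fixes S :: "'a set"
  assumes "finite S"
  shows "finite {A. set_mset A \<subseteq> S \<and> size A \<le> r} \<and> card {A. set_mset A \<subseteq> S \<and> size A \<le> r} = (card S + r) choose r"
  using assms
proof (induction S arbitrary: r rule: finite_induct)
  case empty
  have "{A :: 'a multiset. set_mset A \<subseteq> {} \<and> size A \<le> r} = {{#}}" by auto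
  then show ?case unfolding card.empty by (simp only:) simp
next
  case (insert a S)
  show ?case
  proof (induction r)
    case 0
    have "{A. set_mset A \<subseteq> insert a S \<and> size A \<le> 0} = {{#}}" by auto
    then show ?case by simp
  next
    case (Suc r)
    define X where "X = {A. set_mset A \<subseteq> S \<and> size A \<le> Suc r}"
    define Y where "Y = {A. set_mset A \<subseteq> insert a S \<and> size A \<le> r}"
    have split: "{A. set_mset A \<subseteq> insert a S \<and> size A \<le> Suc r} = X \<union> add_mset a ` Y"
    proof (rule Set.equalityI; rule subsetI)
      fix A assume A: "A \<in> {A. set_mset A \<subseteq> insert a S \<and> size A \<le> Suc r}"
      show "A \<in> X \<union> add_mset a ` Y"
      proof (cases "a \<in># A")
        case True
        then obtain B where B: "A = add_mset a B" by (metis insert_DiffM)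
        then have "B \<in> Y" using A by (auto simp: Y_def)
        then show ?thesis using B by blast
      next
        case False
        then show ?thesis using A by (auto simp: X_def)
      qed
    qed (auto simp: X_def Y_def)
    have "X \<inter> add_mset a ` Y = {}" using insert.hyps(2) by (auto simp: X_def)
    moreover have "finite X" "card X = (card S + Suc r) choose Suc r" using insert.IH[of "Suc r"] by (auto simp: X_def)
    moreover have "finite Y" "card Y = (card (insert a S) + r) choose r" using Suc.IH by (auto simp: Y_def)
    moreover have "card (add_mset a ` Y) = card Y" by (intro card_image) (simp add: inj_on_def)
    ultimately show ?case unfolding split using insert.hyps by (simp add: card_Un_disjoint)
  qed
qed

lemma card_multisets_small:
  "card {A :: 'n::finite multiset. size A \<le> 1} = CARD('n) + 1"
  "2 * card {A :: 'n::finite multiset. size A \<le> 2} = (CARD('n) + 1) * (CARD('n) + 2)"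
proof -
  have c: "card {A :: 'n multiset. size A \<le> r} = (CARD('n) + r) choose r" for r
    using card_multisets_upto[of "UNIV :: 'n set" r] by simp
  show "card {A :: 'n multiset. size A \<le> 1} = CARD('n) + 1" using c[of 1] by simp
  have "2 * ((CARD('n) + 2) choose 2) = (CARD('n) + 1) * (CARD('n) + 2)"
    by (induction "CARD('n)") (simp_all add: choose_two)
  then show "2 * card {A :: 'n multiset. size A \<le> 2} = (CARD('n) + 1) * (CARD('n) + 2)" using c[of 2] by simp
qed

lemma Pol_line:
  assumes "P \<in> Pol d"
  shows "\<exists>p. degree p \<le> d \<and> (\<forall>\<tau>. P (x + \<tau> *\<^sub>R u) = poly p \<tau>)"
  using assms
proof (induction P rule: Pol_induct)
  case (mon A)
  have "\<exists>p. degree p \<le> size A \<and> (\<forall>\<tau>. mon A (x + \<tau> *\<^sub>R u) = poly p \<tau>)" for A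
  proof (induction A)
    case empty
    show ?case by (intro exI[of _ 1]) simp
  next
    case (add i A)
    then obtain p where p: "degree p \<le> size A" "\<forall>\<tau>. mon A (x + \<tau> *\<^sub>R u) = poly p \<tau>" by (elim exE conjE) (rule that)
    have "degree ([:x $ i, u $ i:] * p) \<le> degree [:x $ i, u $ i:] + degree p" by (rule degree_mult_le)
    also have "\<dots> \<le> 1 + size A" using p(1) by (intro add_mono) auto
    finally show ?case using p(2) by (intro exI[of _ "[:x $ i, u $ i:] * p"]) (simp add: algebra_simps)
  qed
  from this[of A] mon show ?case by (meson order_trans)
next
  case (add f g)
  then obtain p q where "degree p \<le> d" "\<forall>\<tau>. f (x + \<tau> *\<^sub>R u) = poly p \<tau>" "degree q \<le> d" "\<forall>\<tau>. g (x + \<tau> *\<^sub>R u) = poly q \<tau>"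
    by (elim exE conjE) (rule that)
  then show ?case by (intro exI[of _ "p + q"]) (simp add: degree_add_le)
next
  case (cmult c f)
  then obtain p where "degree p \<le> d" "\<forall>\<tau>. f (x + \<tau> *\<^sub>R u) = poly p \<tau>" by (elim exE conjE) (rule that)
  then show ?case by (intro exI[of _ "smult c p"]) (simp add: order_trans[OF degree_smult_le])
qed

text \<open>The remainder vanishes for a polynomial of degree at most \<open>d\<close>, so neither
  the nodes nor \<open>x\<close> need to lie in the ball.\<close>

lemma Pol_interpolation:
  assumes P: "P \<in> Pol d" and T: "finite T" "card T = d + 1"
  shows "\<bar>P x\<bar> \<le> (\<Sum>\<tau>\<in>T. \<bar>P (x + \<tau> *\<^sub>R u)\<bar> * (\<Prod>\<sigma>\<in>T - {\<tau>}. \<bar>\<sigma>\<bar> / \<bar>\<tau> - \<sigma>\<bar>))"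
proof -
  from Pol_line[where x = x and u = u, OF P] obtain p where p: "degree p \<le> d" "\<forall>\<tau>. P (x + \<tau> *\<^sub>R u) = poly p \<tau>" by (elim exE conjE) (rule that)
  define \<alpha> \<beta> where "\<alpha> = Min (insert 0 T)" and "\<beta> = Max (insert 0 T)"
  define \<phi> where "\<phi> j = poly ((pderiv ^^ j) p)" for j
  have "\<bar>\<phi> 0 0\<bar> \<le> (\<Sum>\<tau>\<in>T. \<bar>\<phi> 0 \<tau>\<bar> * (\<Prod>\<sigma>\<in>T - {\<tau>}. \<bar>0 - \<sigma>\<bar> / \<bar>\<tau> - \<sigma>\<bar>)) + 0 / fact (Suc d) * (\<Prod>\<tau>\<in>T. \<bar>0 - \<tau>\<bar>)"
  proof (rule interpolation_bound)
    show "(\<phi> j has_real_derivative \<phi> (Suc j) \<tau>) (at \<tau> within {\<alpha>..\<beta>})" for j \<tau>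
      unfolding \<phi>_def by (simp add: has_field_derivative_at_within)
    show "\<bar>\<phi> (Suc d) \<tau>\<bar> \<le> 0" for \<tau> using higher_pderiv_small_degree[of p "Suc d"] p(1) by (simp add: \<phi>_def del: funpow.simps)
    show "T \<subseteq> {\<alpha>..\<beta>}" "0 \<in> {\<alpha>..\<beta>}" using T(1) by (auto simp: \<alpha>_def \<beta>_def)
  qed (use T in auto)
  moreover have "P x = poly p 0" using p(2)[rule_format, of 0] by simp
  ultimately show ?thesis using p(2) by (simp add: \<phi>_def)
qed

context vanishing_pieces
begin

text \<open>Applied with \<open>m = d - 1\<close>. On the boundaries \<open>f = 0\<close>, hence
  \<open>\<bar>P\<bar> \<le> \<delta>\<close>, and \<open>bad_pieces_bound\<close> limits the pieces
  where \<open>P\<close> gets larger; one piece more than \<open>m ^ n\<close> accounts for the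
  summand 1.\<close>

lemma many_good_pieces:
  fixes P :: "real ^ 'n \<Rightarrow> real"
  assumes P: "P \<in> Pol d" "\<forall>z\<in>cball 0 1. \<bar>f z - P z\<bar> \<le> \<delta>" and I: "card I = (d - 1) ^ CARD('n) + 1"
    and r: "1 \<le> r" "r \<le> d - 2" "2 * r + (if even CARD('n) then 0 else d - 1) < CARD('n) * (d - 2)"
  shows "\<exists>G\<subseteq>I. 1 + card {A :: 'n multiset. size A \<le> r} \<le> card G \<and> (\<forall>x\<in>(\<Union>i\<in>G. U i). \<bar>P x\<bar> \<le> \<delta>)"
proof -
  define Bd where "Bd = {i \<in> I. \<exists>x\<in>U i. \<bar>P x\<bar> > \<delta>}"
  define a where "a = (if even CARD('n) then 0 else d - 1)"
  have d1: "d - 1 + 1 = d" "d - 1 - 1 = d - 2" "d - 1 \<ge> 2" using r by auto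
  have "0 \<le> \<bar>f 0 - P 0\<bar>" by simp
  also have "\<dots> \<le> \<delta>" by (rule P(2)[rule_format]) simp
  finally have \<delta>: "\<delta> \<ge> 0" .
  have fin: "finite Bd" "Bd \<subseteq> I" using finite_I by (auto simp: Bd_def)
  have "card Bd + card {A :: 'n multiset. size A \<le> r} \<le> (d - 1) ^ CARD('n)"
  proof (rule bad_pieces_bound[where P = P and U = U and \<delta> = \<delta> and a = a])
    show "P \<in> Pol (d - 1 + 1)" using P(1) d1 by simp
    show "disjoint_family_on U Bd" using disjoint_pieces fin(2) by (auto simp: disjoint_family_on_def)
    show "\<bar>P x\<bar> \<le> \<delta>" if "j \<in> Bd" "x \<in> frontier (U j)" for j x
    proof -
      have j: "j \<in> I" using that fin(2) by blast
      have "x \<in> cball 0 1" using frontier_piece[OF j that(2)] piece_subset[OF j] by blast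
      then show ?thesis using bspec[OF P(2), of x] zero[OF j that(2)] by simp
    qed
    show "2 * r + a < CARD('n) * (d - 1 - 1)" using r(3) d1 by (simp add: a_def)
  qed (use fin compact_piece piece_subset \<delta> r d1 in \<open>auto simp: Bd_def a_def\<close>)
  moreover have "card (I - Bd) = card I - card Bd" using fin by (simp add: card_Diff_subset)
  ultimately have "1 + card {A :: 'n multiset. size A \<le> r} \<le> card (I - Bd)" using I by simp
  moreover have "\<forall>x\<in>(\<Union>i\<in>I - Bd. U i). \<bar>P x\<bar> \<le> \<delta>" by (auto simp: Bd_def not_less)
  ultimately show ?thesis by (intro exI[of _ "I - Bd"]) auto
qed

text \<open>The Taylor polynomial is interpolated rather than \<open>f\<close>, so that the
  approximation error enters additively only once at \<open>x0\<close>. The total 2 required by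
  \<open>M_bound\<close> is split into \<open>1 / 5\<close> for this error and \<open>9 / 5\<close>
  for the interpolation.\<close>

lemma high_degree_bound:
  assumes I: "card I = (d - 1) ^ CARD('n) + 1"
    and r: "1 \<le> r" "r \<le> d - 2" "2 * r + (if even CARD('n) then 0 else d - 1) < CARD('n) * (d - 2)"
    and \<kappa>: "\<kappa> \<ge> 0" "weight_bound TYPE('n) (d + 1) \<kappa>"
    and g: "g = 1 + real (card {A :: 'n multiset. size A \<le> r})"
    and small: "\<kappa> * (m0 / (4 * CARD('n))) ^ d \<le> 1 / 5"
    and main: "\<kappa> * ((d * unit_ball_vol CARD('n) / (2 * g)) ^ d / fact d) \<le> 9 / 5"
  shows "fact (d + 1) / 2 * (m0 / (4 * CARD('n))) ^ d \<le> M (d + 1) f"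
proof -
  define n' where "n' = real CARD('n)"
  define \<omega> where "\<omega> = unit_ball_vol n'"
  define \<delta> where "\<delta> = \<kappa> * M (d + 1) f / fact (d + 1)"
  have n': "n' > 0" by (simp add: n'_def)
  have \<omega>: "\<omega> > 0" by (simp add: \<omega>_def n'_def)
  have g0: "g > 0" by (simp add: g add_pos_nonneg)
  have \<delta>: "\<delta> \<ge> 0" unfolding \<delta>_def using \<kappa> M_nonneg by (simp del: fact_Suc)
  from taylor_ball[OF smooth \<kappa>(2)] obtain P where P: "P \<in> Pol d" and P1: "\<forall>z\<in>B1. \<bar>f z - P z\<bar> \<le> \<kappa> * M (d + 1) f / fact (d + 1)"
    by (elim bexE) (rule that)
  from P1 have P2: "\<forall>z\<in>B1. \<bar>f z - P z\<bar> \<le> \<delta>" unfolding \<delta>_def .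
  from many_good_pieces[OF P P2 I r] obtain G where G: "G \<subseteq> I" "1 + card {A :: 'n multiset. size A \<le> r} \<le> card G"
    and GP: "\<forall>x\<in>(\<Union>i\<in>G. U i). \<bar>P x\<bar> \<le> \<delta>" by (elim exE conjE) (rule that)
  define E where "E = (\<Union>i\<in>G. U i)"
  have E: "compact E" "E \<subseteq> cball 0 1" unfolding E_def using compact_union[OF G(1)] union_subset[OF G(1)] by simp_all
  have "g \<le> card G" using G(2) by (simp add: g del: of_nat_Suc)
  then have "g * m0 \<le> card G * m0" using m0(1) by (intro mult_right_mono) auto
  also have "\<dots> \<le> measure lebesgue E" unfolding E_def by (rule measure_union[OF G(1)])
  finally have gE: "g * m0 \<le> measure lebesgue E" .
  have gm: "0 < g * m0" using g0 m0(1) by simp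
  have mE: "0 < measure lebesgue E" using gE gm by linarith
  have "\<bar>P x0\<bar> \<le> \<delta> * ((2 * d * (CARD('n) * unit_ball_vol CARD('n)) / measure lebesgue E) ^ d / fact d) + 0"
  proof (rule node_bound[OF E x0(1) d \<delta> mE])
    fix u T assume T: "finite T" "card T = d + 1" "\<And>\<tau>. \<tau> \<in> T \<Longrightarrow> \<bar>\<tau>\<bar> \<le> 2 \<and> x0 + \<tau> *\<^sub>R u \<in> E"
    have "\<bar>P x0\<bar> \<le> (\<Sum>\<tau>\<in>T. \<bar>P (x0 + \<tau> *\<^sub>R u)\<bar> * (\<Prod>\<sigma>\<in>T - {\<tau>}. \<bar>\<sigma>\<bar> / \<bar>\<tau> - \<sigma>\<bar>))"
      by (rule Pol_interpolation[OF P T(1,2)])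
    also have "\<dots> \<le> (\<Sum>\<tau>\<in>T. \<delta> * (\<Prod>\<sigma>\<in>T - {\<tau>}. \<bar>\<sigma>\<bar> / \<bar>\<tau> - \<sigma>\<bar>))"
      using T(3) GP by (intro sum_mono mult_right_mono prod_nonneg) (auto simp: E_def)
    finally show "\<bar>P x0\<bar> \<le> \<delta> * (\<Sum>\<tau>\<in>T. \<Prod>\<sigma>\<in>T - {\<tau>}. \<bar>\<sigma>\<bar> / \<bar>\<tau> - \<sigma>\<bar>) + 0" by (simp add: sum_distrib_left)
  qed
  also have "\<dots> \<le> \<delta> * ((2 * d * (n' * \<omega>) / (g * m0)) ^ d / fact d)"
  proof -
    have "2 * d * (n' * \<omega>) / measure lebesgue E \<le> 2 * d * (n' * \<omega>) / (g * m0)"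
      using gE gm mE n' \<omega> by (intro divide_left_mono) auto
    moreover have "0 \<le> 2 * d * (n' * \<omega>) / measure lebesgue E" using mE n' \<omega> by simp
    ultimately have "(2 * d * (n' * \<omega>) / measure lebesgue E) ^ d \<le> (2 * d * (n' * \<omega>) / (g * m0)) ^ d" by (rule power_mono)
    then have "\<delta> * ((2 * d * (n' * \<omega>) / measure lebesgue E) ^ d / fact d) \<le> \<delta> * ((2 * d * (n' * \<omega>) / (g * m0)) ^ d / fact d)"
      using \<delta> by (intro mult_left_mono divide_right_mono) auto
    then show ?thesis by (simp add: n'_def \<omega>_def)
  qed
  finally have "\<bar>P x0\<bar> \<le> \<delta> * ((2 * d * (n' * \<omega>) / (g * m0)) ^ d / fact d)" .
  moreover have "\<bar>f x0 - P x0\<bar> \<le> \<delta>" using P2 x0(1) by blast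
  ultimately have one: "1 \<le> \<delta> * (1 + (2 * d * (n' * \<omega>) / (g * m0)) ^ d / fact d)" using x0(2) unfolding distrib_left by linarith
  have "\<kappa> * (m0 / (4 * n')) ^ d * (1 + (2 * d * (n' * \<omega>) / (g * m0)) ^ d / fact d)
    = \<kappa> * (m0 / (4 * n')) ^ d + \<kappa> * ((m0 / (4 * n') * (2 * d * (n' * \<omega>) / (g * m0))) ^ d / fact d)"
    unfolding power_mult_distrib by (simp add: distrib_left)
  also have "m0 / (4 * n') * (2 * d * (n' * \<omega>) / (g * m0)) = d * \<omega> / (2 * g)"
    using m0(1) n' g0 by (simp add: field_simps)
  also have "\<kappa> * (m0 / (4 * n')) ^ d + \<kappa> * ((d * \<omega> / (2 * g)) ^ d / fact d) \<le> 2"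
    using small main unfolding n'_def \<omega>_def of_nat_mult of_nat_numeral by linarith
  finally show ?thesis using one by (intro M_bound[OF \<kappa>(1)]) (simp_all add: \<delta>_def n'_def del: fact_Suc)
qed

text \<open>The choice is \<open>r = 2\<close>, except for \<open>d = 4\<close> in dimensions 2 and
  3, where the condition on \<open>2 * r + a\<close> admits only \<open>r = 1\<close>; there
  \<open>g\<close> is 4 or 5 and the numbers are computed directly.\<close>

lemma case_d4:
  assumes n: "CARD('n) \<ge> 2" and I: "card I = (d - 1) ^ CARD('n) + 1" and d4: "d \<ge> 4"
  shows "fact (d + 1) / 2 * (m0 / (4 * CARD('n))) ^ d \<le> M (d + 1) f"
proof -
  define n' where "n' = real CARD('n)"
  define \<omega> where "\<omega> = unit_ball_vol n'"
  define \<kappa> where "\<kappa> = sqrt n' ^ (d - 1)"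
  have n': "n' \<ge> 2" using n by (simp add: n'_def)
  have \<omega>0: "\<omega> > 0" using n' by (simp add: \<omega>_def)
  have \<omega>: "\<omega> \<le> 53 / 10" "CARD('n) = 2 \<Longrightarrow> \<omega> \<le> 63 / 20" "CARD('n) = 3 \<Longrightarrow> \<omega> \<le> 21 / 5"
    using unit_ball_vol_le[OF n] by (simp_all add: \<omega>_def n'_def)
  have s: "sqrt n' \<ge> 1" using n' by simp
  have ss: "sqrt n' * sqrt n' = n'" using n' by simp
  have \<kappa>: "\<kappa> \<ge> 0" "weight_bound TYPE('n) (d + 1) \<kappa>"
    using weight_bound_general[where 'n = 'n, of "d - 1"] d4 n' by (simp_all add: \<kappa>_def n'_def)
  \<comment> \<open>Spending one more factor \<open>sqrt n'\<close> turns the weight into a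
    \<open>d\<close>-th power, which merges with the rest.\<close>
  have kp: "\<kappa> * x ^ d \<le> (sqrt n' * x) ^ d" if "x \<ge> 0" for x
  proof -
    have "\<kappa> \<le> sqrt n' ^ d" unfolding \<kappa>_def using s by (intro power_increasing) auto
    then show ?thesis using that by (simp add: power_mult_distrib mult_right_mono)
  qed
  have small: "\<kappa> * (m0 / (4 * n')) ^ d \<le> 1 / 5"
  proof -
    have "(2 :: nat) ^ 2 \<le> (d - 1) ^ 2" using d4 by (intro power_mono) auto
    also have "\<dots> \<le> (d - 1) ^ CARD('n)" using d4 n by (intro power_increasing) auto
    finally have "5 \<le> card I" using I by simp
    then have J: "5 \<le> real (card I)" by simp
    have "5 * m0 \<le> card I * m0" using J m0(1) by (intro mult_right_mono) auto
    also have "\<dots> \<le> \<omega>" using card_m0_le by (simp add: \<omega>_def n'_def)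
    finally have "5 * m0 \<le> \<omega>" .
    then have m: "m0 \<le> 11 / 10" using \<omega>(1) by simp
    have "(sqrt n' * (m0 / (4 * n'))) = m0 / (4 * sqrt n')" using ss s by (simp add: field_simps)
    also have "\<dots> \<le> (11 / 10) / (4 * 1)" using m m0(1) s by (intro frac_le) auto
    finally have b: "sqrt n' * (m0 / (4 * n')) \<le> 11 / 40" by simp
    have "\<kappa> * (m0 / (4 * n')) ^ d \<le> (sqrt n' * (m0 / (4 * n'))) ^ d" using m0(1) n' by (intro kp) simp
    also have "\<dots> \<le> (11 / 40) ^ d" using b m0(1) n' by (intro power_mono) auto
    also have "\<dots> \<le> (11 / 40) ^ 2" using d4 by (intro power_decreasing) auto
    finally show ?thesis by (simp add: power2_eq_square)
  qed
  \<comment> \<open>By \<open>d ^ d / d! \<le> 3 ^ d\<close> the quantity is at most a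
    \<open>d\<close>-th power, so it suffices that its base is at most 1, uniformly in
    \<open>d\<close>.\<close>
  have main: "\<kappa> * ((d * \<omega> / (2 * g)) ^ d / fact d) \<le> 9 / 5" if "g > 0" "sqrt n' * (3 * \<omega> / (2 * g)) \<le> 1" for g
  proof -
    have "\<kappa> * ((d * \<omega> / (2 * g)) ^ d / fact d) = \<kappa> * (\<omega> / (2 * g)) ^ d * (real d ^ d / fact d)"
      by (simp add: power_mult_distrib power_divide)
    also have "\<dots> \<le> \<kappa> * (\<omega> / (2 * g)) ^ d * 3 ^ d"
      using power_le_fact_exp[of d] \<kappa>(1) \<omega>0 that(1) by (intro mult_left_mono) (auto simp: field_simps)
    also have "\<dots> = \<kappa> * (3 * \<omega> / (2 * g)) ^ d" by (simp add: power_mult_distrib power_divide)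
    also have "\<dots> \<le> (sqrt n' * (3 * \<omega> / (2 * g))) ^ d" using \<omega>0 that(1) by (intro kp) simp
    also have "\<dots> \<le> 1" using that \<omega>0 n' by (intro power_le_one) auto
    finally show ?thesis by (rule order_trans) simp
  qed
  have s2: "sqrt n' \<le> 142 / 100" if "CARD('n) = 2" unfolding n'_def that by (rule real_le_lsqrt) (simp_all add: power2_eq_square)
  have s3: "sqrt n' \<le> 174 / 100" if "CARD('n) = 3" unfolding n'_def that by (rule real_le_lsqrt) (simp_all add: power2_eq_square)
  show ?thesis
  proof (cases "d = 4 \<and> CARD('n) \<le> 3")
    case True
    have pw: "x ^ 3 = x * x * x" "x ^ 4 = x * x * x * x" for x :: real by (simp_all add: eval_nat_numeral)
    have card1: "card {A :: 'n multiset. size A \<le> Suc 0} = CARD('n) + 1" using card_multisets_small(1) by simp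
    consider "CARD('n) = 2" | "CARD('n) = 3" using True n by linarith
    then show ?thesis
    proof cases
      case 1
      have "\<kappa> * ((d * \<omega> / (2 * 4)) ^ d / fact d) \<le> (142 / 100) ^ 3 * ((63 / 40) ^ 4 / 24)"
        unfolding \<kappa>_def using True s2[OF 1] \<omega>(2)[OF 1] \<omega>0 n' by (intro mult_mono power_mono divide_mono) (auto simp: fact_numeral)
      also have "\<dots> \<le> 9 / 5" by (simp add: pw)
      finally have "\<kappa> * ((d * \<omega> / (2 * 4)) ^ d / fact d) \<le> 9 / 5" .
      then show ?thesis using True 1 small
        by (intro high_degree_bound[OF I _ _ _ \<kappa>, of 1 4]) (simp_all add: card1 \<omega>_def n'_def)
    next
      case 2
      have "\<kappa> * ((d * \<omega> / (2 * 5)) ^ d / fact d) \<le> (174 / 100) ^ 3 * ((84 / 50) ^ 4 / 24)"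
        unfolding \<kappa>_def using True s3[OF 2] \<omega>(3)[OF 2] \<omega>0 n' by (intro mult_mono power_mono divide_mono) (auto simp: fact_numeral)
      also have "\<dots> \<le> 9 / 5" by (simp add: pw)
      finally have "\<kappa> * ((d * \<omega> / (2 * 5)) ^ d / fact d) \<le> 9 / 5" .
      then show ?thesis using True 2 small
        by (intro high_degree_bound[OF I _ _ _ \<kappa>, of 1 5]) (simp_all add: card1 \<omega>_def n'_def)
    qed
  next
    case False
    define D where "D = card {A :: 'n multiset. size A \<le> 2}"
    have "real (2 * D) = real ((CARD('n) + 1) * (CARD('n) + 2))"
      unfolding D_def by (rule arg_cong[OF card_multisets_small(2)])
    then have D: "2 * real D = (n' + 1) * (n' + 2)"
      unfolding n'_def of_nat_mult of_nat_add by simp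
    define g where "g = 1 + real D"
    have g: "2 * g = n' * n' + 3 * n' + 4" using D by (simp add: g_def algebra_simps)
    have g0: "g > 0" by (simp add: g_def add_pos_nonneg)
    have "2 * 2 + (if even CARD('n) then 0 else d - 1) < CARD('n) * (d - 2)"
    proof -
      obtain k where k: "d = k + 4" using d4 by (metis add.commute le_Suc_ex)
      consider "CARD('n) = 2" | "CARD('n) = 3" | "CARD('n) \<ge> 4" using n by linarith
      then show ?thesis
      proof cases
        case 3
        have "4 * (d - 2) \<le> CARD('n) * (d - 2)" using 3 by (rule mult_le_mono1)
        moreover have "CARD('n) \<ge> 5" if "odd CARD('n)" using 3 that by (cases "CARD('n) = 4") auto
        moreover have "5 * (d - 2) \<le> CARD('n) * (d - 2)" if "CARD('n) \<ge> 5" using that by (rule mult_le_mono1)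
        ultimately show ?thesis using k by (auto split: if_splits)
      qed (use False k in auto)
    qed
    moreover have "sqrt n' * (3 * \<omega> / (2 * g)) \<le> 1"
    proof -
      consider "CARD('n) = 2" | "CARD('n) = 3" | "CARD('n) \<ge> 4" using n by linarith
      then have "sqrt n' * (3 * \<omega>) \<le> 2 * g"
      proof cases
        case 1
        have "sqrt n' * (3 * \<omega>) \<le> 142 / 100 * (3 * (63 / 20))" using s2[OF 1] \<omega>(2)[OF 1] \<omega>0 n' by (intro mult_mono) auto
        also have "\<dots> \<le> 2 * g" using 1 by (simp add: g n'_def)
        finally show ?thesis .
      next
        case 2
        have "sqrt n' * (3 * \<omega>) \<le> 174 / 100 * (3 * (21 / 5))" using s3[OF 2] \<omega>(3)[OF 2] \<omega>0 n' by (intro mult_mono) auto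
        also have "\<dots> \<le> 2 * g" using 2 by (simp add: g n'_def)
        finally show ?thesis .
      next
        case 3
        have n4: "n' \<ge> 4" using 3 by (simp add: n'_def)
        \<comment> \<open>The tangent to the square root at 4, where this case begins, linearizes
          the comparison with the quadratic \<open>g\<close>.\<close>
        have "0 \<le> (sqrt n' - 2) * (sqrt n' - 2)" by simp
        also have "\<dots> = n' - 4 * sqrt n' + 4" using ss by (simp add: algebra_simps)
        finally have "sqrt n' \<le> (n' + 4) / 4" by simp
        then have "sqrt n' * (3 * \<omega>) \<le> (n' + 4) / 4 * (3 * (53 / 10))" using \<omega>(1) \<omega>0 n' by (intro mult_mono) auto
        also have "\<dots> \<le> 2 * g"
        proof -
          have "4 * n' \<le> n' * n'" using n4 by (intro mult_right_mono) auto
          then show ?thesis using n4 g by argo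
        qed
        finally show ?thesis .
      qed
      then show ?thesis using g0 by (simp add: field_simps)
    qed
    ultimately show ?thesis using d4 small main[OF g0]
      by (intro high_degree_bound[OF I _ _ _ \<kappa>, of 2 g]) (simp_all add: g_def D_def \<omega>_def n'_def)
  qed
qed

lemma pieces_bound:
  assumes I: "card I = (d - 1) ^ CARD('n) + 1"
  shows "fact (d + 1) / 2 * (m0 / (4 * CARD('n))) ^ d \<le> M (d + 1) f"
proof (cases "CARD('n) = 1")
  case True
  then show ?thesis using case_n1 I d by simp
next
  case False
  have "0 < CARD('n)" by simp
  then have n: "CARD('n) \<ge> 2" using False by linarith
  consider "d = 1" | "d = 2" | "d = 3" | "d \<ge> 4" using d by linarith
  then show ?thesis
  proof cases
    case 1
    have "I \<noteq> {}" using I by auto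
    then show ?thesis by (rule case_d1[OF n _ 1])
  next
    case 2
    then show ?thesis using I by (intro case_d2[OF n]) simp_all
  next
    case 3
    then show ?thesis using I by (intro case_d3[OF n]) simp_all
  next
    case 4
    show ?thesis by (rule case_d4[OF n I 4])
  qed
qed

end

theorem theorem6p3:
  fixes U :: "nat \<Rightarrow> (real ^ 'n) set"
    and \<mu> :: "nat \<Rightarrow> real"
    and N dbar :: nat
  assumes "N \<ge> 1"
    and "\<And>j. j \<in> {1..N} \<Longrightarrow>
      compact (U j) \<and> connected (U j) \<and> interior (U j) \<noteq> {} \<and> U j \<subseteq> cball 0 1"
    and "disjoint_family_on U {1..N}"
    and "\<And>j. j \<in> {1..N} \<Longrightarrow> \<mu> j = measure lebesgue (U j)"
    and "\<And>i j. 1 \<le> i \<Longrightarrow> i \<le> j \<Longrightarrow> j \<le> N \<Longrightarrow> \<mu> i \<ge> \<mu> j"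
    and "dbar \<ge> 1"
    and "(dbar - 1) ^ CARD('n) + 1 \<le> N"
    and "N < dbar ^ CARD('n) + 1"
  shows "\<forall>d\<in>{1..dbar}.
    RG d (\<Union>j\<in>{1..N}. frontier (U j)) \<ge>
      ereal (fact (d + 1) / 2 * (\<mu> ((d - 1) ^ CARD('n) + 1) / (4 * real CARD('n))) ^ d)"
proof
  fix d assume d: "d \<in> {1..dbar}"
  \<comment> \<open>The argument works with the first \<open>J\<close> pieces; by monotonicity each
    has measure at least \<open>\<mu> J\<close>, and their number is exactly what
    \<open>pieces_bound\<close> asks for.\<close>
  define J where "J = (d - 1) ^ CARD('n) + 1"
  define I where "I = {1..J}"
  have "(d - 1) ^ CARD('n) \<le> (dbar - 1) ^ CARD('n)" using d by (intro power_mono) auto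
  then have JN: "J \<le> N" using assms(7) unfolding J_def by linarith
  then have IN: "I \<subseteq> {1..N}" by (auto simp: I_def)
  have "ereal (fact (d + 1) / 2 * (\<mu> J / (4 * real CARD('n))) ^ d) \<le> ereal (M (d + 1) f)"
    if f: "f \<in> W d (\<Union>j\<in>{1..N}. frontier (U j))" for f
  proof (cases "\<mu> J > 0")
    case True
    have smooth: "Ck_on (d + 1) B1 f" and zero: "\<And>j z. j \<in> I \<Longrightarrow> z \<in> frontier (U j) \<Longrightarrow> f z = 0"
      using f IN by (auto simp: W_def)
    from W_attained[OF f] obtain x0 where x0: "x0 \<in> B1" "\<bar>f x0\<bar> = 1" by (elim bexE) (rule that)
    interpret vanishing_pieces U I f d "\<mu> J" x0
    proof
      fix i assume i: "i \<in> I"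
      then have iN: "i \<in> {1..N}" using IN by blast
      show "compact (U i)" "interior (U i) \<noteq> {}" "U i \<subseteq> cball 0 1" using assms(2)[OF iN] by auto
      have "\<mu> J \<le> \<mu> i" using i JN by (intro assms(5)) (auto simp: I_def)
      then show "\<mu> J \<le> measure lebesgue (U i)" using assms(4)[OF iN] by simp
    next
      show "disjoint_family_on U I" using assms(3) IN by (auto simp: disjoint_family_on_def)
    qed (use True d smooth zero x0 in \<open>auto simp: I_def\<close>)
    have "card I = (d - 1) ^ CARD('n) + 1" by (simp add: I_def J_def)
    from pieces_bound[OF this] show ?thesis by simp
  next
    case False
    have "J \<in> {1..N}" using JN by (simp add: J_def)
    from assms(4)[OF this] have "\<mu> J \<ge> 0" by simp
    then have "\<mu> J = 0" using False by simp
    moreover have "0 \<le> M (d + 1) f"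
    proof -
      have "0 \<le> deriv_norm (d + 1) f 0" by (simp add: deriv_norm_def sum_nonneg)
      also have "\<dots> \<le> M (d + 1) f" using f by (intro deriv_norm_le_M) (auto simp: W_def)
      finally show ?thesis .
    qed
    ultimately show ?thesis using d by (simp add: zero_power)
  qed
  then show "RG d (\<Union>j\<in>{1..N}. frontier (U j)) \<ge>
      ereal (fact (d + 1) / 2 * (\<mu> ((d - 1) ^ CARD('n) + 1) / (4 * real CARD('n))) ^ d)"
    unfolding RG_def J_def by (intro INF_greatest)
qed

end
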